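(* Assume that either (H0)$_1$ or (H0)$_2$ holds, where: (H0)$_1$: the structural bounds on $f,l$ in the standing assumptions hold with $L_R$, $M_R$ and the modulus $\omega(\cdot)=\omega(\cdot,R)$ independent of $R$, $|f(x,a)|\le M(1+|a|^p)$ for all $x\in\mathbb{R}^n$, $a\in A$, and $\int_0^1\frac{\omega(s)}{s}\,ds<+\infty$; (H0)$_2$: for every $x\in\mathbb{R}^n$ with $V^r(x)<+\infty$ there exist an optimal relaxed control $\mu$ for $V^r(x)$ and some $\bar R>0$ such that $|\xi^r_x(s,\mu)|\le\bar R$ for all $s\ge0$ if $A$ is unbounded (respectively $|y^r_x(t,\mu)|\le\bar R$ for all $t\ge0$ if $A$ is compact), and moreover $\int_0^1\frac{\omega(s,\bar R+3)}{s}\,ds<+\infty$, where $\omega$ is the modulus of $l$ in the standing assumptions. Then: (i) if either $A$ is compact or $q>p$, then $\mathcal{V}_*(x)=V^r(x)$ for any $x\in\mathbb{R}^n$; (ii) if $A$ is unbounded and $q=p$, then $V_*(x)=V^r(x)$ for any $x\in\mathbb{R}^n$. Moreover, if the following conditions (H2) and (H3) hold for the same closed set $\mathcal{T}\subset\mathbb{R}^n$, then also $\mathcal{V}_*(x)=V^r(x)$ for any $x\in\mathbb{R}^n$: (H2) $\mathcal{T}$ is nonempty and closed with compact boundary, $\mathcal{V}(x)=0$ for all $x\in\mathcal{T}$, and $\lim_{x\to\bar x}\mathcal{V}(x)=0$ for all $\bar x\in\partial\mathcal{T}$; (H3) for any $x$ with $V(x)<+\infty$ there is $\varepsilon>0$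 such that $\liminf_{s\to+\infty}\mathbf{d}(\xi_x(s,w_0,w))=0$ for every $(w_0,w)\in\Gamma$ with $J(+\infty,x,w_0,w)\le V(x)+\varepsilon$.
   Context: Notation. $\mathbb{R}_+=[0,+\infty)$; $\overline{B(0,1)}$ is the closed unit ball of $\mathbb{R}^m$; $\mathbf{d}(x)$ is the distance of $x$ from $\mathcal{T}$; $u_*$ denotes the lower semicontinuous envelope of $u$. A modulus is a function $\omega:\mathbb{R}_+\times\mathbb{R}_+\to\mathbb{R}_+$ such that $\omega(\cdot,R)$ is increasing in a neighborhood of $0$, continuous at $0$, with $\omega(0,R)=0$ for every $R>0$, and $\omega(r,\cdot)$ is increasing for every $r$. Data (standing assumptions). $A\subset\mathbb{R}^m$ is either compact or an (unbounded) convex, closed, nontrivial cone containing the origin. $f:\mathbb{R}^n\times A\to\mathbb{R}^n$ and $l:\mathbb{R}^n\times A\to\mathbb{R}$ are continuous; there are integers $q\ge p\ge 1$, $M>0$ and, for every $R>0$, constants $L_R,M_R>0$ and a modulus $\omega(\cdot,R)$ such that, for all $a\in A$ and all $|x|,|x_1|,|x_2|\le R$, $|f(x_1,a)-f(x_2,a)|\le L_R(1+|a|^p)|x_1-x_2|$, $|l(x_1,a)-l(x_2,a)|\le(1+|a|^q)\omega(|x_1-x_2|,R)$, $0\le l(x,a)\le M_R(1+|a|^q)$; and $|f(x,a)|\le M(1+|a|^p)(1+|x|)$ for all $(x,a)$. If $A$ is unbounded, moreover: there are $C_1\ge0$, $C_2>0$ with $l(x,a)\ge C_2|a|^q-C_1$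 for all $(x,a)\in\mathbb{R}^n\times A$ (same $q$), and for $\Phi\in\{f,l\}$ there is a continuous function $\Phi^\infty$ with $\lim_{\rho\to0^+}\rho^q\Phi(x,\rho^{-1}a)=\Phi^\infty(x,a)$ uniformly on compact subsets of $\mathbb{R}^n\times A$. Original problem. $\mathcal{A}$ is the set of Borel measurable $\alpha:\mathbb{R}_+\to A$ belonging to $L^q_{loc}(\mathbb{R}_+,A)$ (all Borel $\alpha$ if $A$ is compact); $y_x(\cdot,\alpha)$ is the solution of $\dot y=f(y,\alpha)$, $y(0)=x$; $\mathcal{V}(x)=\inf_{\alpha\in\mathcal{A}}\int_0^{+\infty} l(y_x(\tau,\alpha),\alpha(\tau))\,d\tau\in[0,+\infty]$. Extended problem ($A$ unbounded). For $\Phi\in\{f,l\}$, $\overline{\Phi}(x,w_0,w)=w_0^q\Phi(x,w_0^{-1}w)$ if $w_0\ne0$ and $\overline\Phi(x,0,w)=\Phi^\infty(x,w)$, for $(x,w_0,w)\in\mathbb{R}^n\times\mathbb{R}_+\times A$. $S(A)=\{(w_0,w)\in\mathbb{R}_+\times A:\ w_0^q+|w|^q=1\}$; $\Gamma$ is the set of Borel measurable functions $(w_0,w):\mathbb{R}_+\to S(A)$. For $(w_0,w)\in\Gamma$, $\xi_x(\cdot,w_0,w)$ is the solution of $\xi'=\overline f(\xi,w_0,w)$, $\xi(0)=x$; $J(+\infty,x,w_0,w)=\int_0^{+\infty}\overline l(\xi_x(s,w_0,w),w_0(s),w(s))\,ds$ and $V(x)=\inf_{(w_0,w)\in\Gamma}J(+\infty,x,w_0,w)\in[0,+\infty]$.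 Relaxed problem, $A$ compact. $A^r=\mathcal{P}(A)$ is the set of Radon probability measures on $A$ with the weak$^*$ topology, $\mathcal{A}^r=L^\infty(\mathbb{R}_+,\mathcal{P}(A))$ is the set of relaxed controls; $f^r(x,\mu)=\int_A f(x,a)\,d\mu$, $l^r(x,\mu)=\int_A l(x,a)\,d\mu$; $y^r_x(\cdot,\mu)$ solves $\dot y^r=f^r(y^r,\mu)$, $y^r(0)=x$; $V^r(x)=\inf_{\mu\in\mathcal{A}^r}\int_0^{+\infty} l^r(y^r_x(\tau,\mu),\mu(\tau))\,d\tau$. Relaxed problem, $A$ unbounded. $A^r=\mathcal{P}(\overline{B(0,1)}\cap A)$ is the set of Radon probability measures on $\overline{B(0,1)}\cap A$ with the weak$^*$ topology, $\Gamma^r=L^\infty(\mathbb{R}_+,A^r)$ is the set of relaxed controls; for $\psi\in\{\overline f,\overline l\}$, $\psi^r(x,\mu)=\int_{\overline{B(0,1)}\cap A}\psi(x,(1-|w|^q)^{1/q},w)\,d\mu$; $\xi^r_x(\cdot,\mu)$ solves $\dot\xi^r=\overline f^r(\xi^r,\mu)$, $\xi^r(0)=x$; $V^r(x)=\inf_{\mu\in\Gamma^r}\int_0^{+\infty}\overline l^r(\xi^r_x(s,\mu),\mu(s))\,ds$. An optimal relaxed control is one attaining the infimum defining $V^r(x)$. *)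

theory Defs
  imports "HOL-Probability.Probability"
begin

section \<open>Semicontinuous envelopes and moduli\<close>

text \<open>The filter \<open>nhds x\<close> contains the point \<open>x\<close> itself (unlike \<open>at x\<close>), so this is the largest
  lower semicontinuous function below \<open>u\<close>.\<close>

definition lsc_envelope :: "('a::topological_space \<Rightarrow> 'b::complete_lattice) \<Rightarrow> 'a \<Rightarrow> 'b" where
  "lsc_envelope u x = Liminf (nhds x) u"

text \<open>A modulus lives on \<open>[0,\<infinity>) \<times> [0,\<infinity>)\<close>. ``Increasing'' is meant in the weak sense, so that moduli
  not depending on the second argument are allowed.\<close>

definition modulus :: "(real \<Rightarrow> real \<Rightarrow> real) \<Rightarrow> bool" where
  "modulus \<omega> \<longleftrightarrow>
     (\<forall>r\<ge>0. \<forall>R\<ge>0. \<omega> r R \<ge> 0) \<and>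
     (\<forall>R>0. (\<exists>\<delta>>0. mono_on {0..<\<delta>} (\<lambda>r. \<omega> r R)) \<and>
            continuous (at 0 within {0..}) (\<lambda>r. \<omega> r R) \<and> \<omega> 0 R = 0) \<and>
     (\<forall>r\<ge>0. mono_on {0..} (\<lambda>R. \<omega> r R))"

definition dini :: "(real \<Rightarrow> real) \<Rightarrow> bool" where
  "dini \<omega> \<longleftrightarrow> (\<integral>\<^sup>+s\<in>{0<..1}. ennreal (\<omega> s / s) \<partial>lborel) < \<infinity>"

section \<open>Standing assumptions\<close>

definition control_set :: "(real^'m) set \<Rightarrow> bool" where
  "control_set A \<longleftrightarrow>
     compact A \<or> (\<not> bounded A \<and> convex A \<and> closed A \<and> cone A \<and> 0 \<in> A \<and> A \<noteq> {0})"

definition structural_bounds ::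
  "(real^'m) set \<Rightarrow> (real^'n \<Rightarrow> real^'m \<Rightarrow> real^'n) \<Rightarrow> (real^'n \<Rightarrow> real^'m \<Rightarrow> real) \<Rightarrow>
   nat \<Rightarrow> nat \<Rightarrow> real \<Rightarrow> (real \<Rightarrow> real) \<Rightarrow> (real \<Rightarrow> real) \<Rightarrow> (real \<Rightarrow> real \<Rightarrow> real) \<Rightarrow> bool" where
  "structural_bounds A f l p q M L N \<omega> \<longleftrightarrow>
     1 \<le> p \<and> p \<le> q \<and> M > 0 \<and> modulus \<omega> \<and>
     (\<forall>R>0. L R > 0 \<and> N R > 0 \<and>
       (\<forall>a\<in>A. \<forall>x1\<in>cball 0 R. \<forall>x2\<in>cball 0 R.
          norm (f x1 a - f x2 a) \<le> L R * (1 + norm a ^ p) * norm (x1 - x2) \<and>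
          \<bar>l x1 a - l x2 a\<bar> \<le> (1 + norm a ^ q) * \<omega> (norm (x1 - x2)) R) \<and>
       (\<forall>a\<in>A. \<forall>x\<in>cball 0 R. 0 \<le> l x a \<and> l x a \<le> N R * (1 + norm a ^ q))) \<and>
     (\<forall>x. \<forall>a\<in>A. norm (f x a) \<le> M * (1 + norm a ^ p) * (1 + norm x))"

definition coercive ::
  "(real^'m) set \<Rightarrow> (real^'n \<Rightarrow> real^'m \<Rightarrow> real) \<Rightarrow> nat \<Rightarrow> bool" where
  "coercive A l q \<longleftrightarrow> (\<exists>C1\<ge>0. \<exists>C2>0. \<forall>x. \<forall>a\<in>A. l x a \<ge> C2 * norm a ^ q - C1)"

definition recession ::
  "(real^'m) set \<Rightarrow> nat \<Rightarrow> (real^'n \<Rightarrow> real^'m \<Rightarrow> 'b::real_normed_vector) \<Rightarrow>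
   (real^'n \<Rightarrow> real^'m \<Rightarrow> 'b) \<Rightarrow> bool" where
  "recession A q \<Phi> \<Phi>inf \<longleftrightarrow>
     continuous_on (UNIV \<times> A) (\<lambda>(x, a). \<Phi>inf x a) \<and>
     (\<forall>K. compact K \<and> K \<subseteq> UNIV \<times> A \<longrightarrow>
        uniform_limit K (\<lambda>\<rho> (x, a). \<rho> ^ q *\<^sub>R \<Phi> x (inverse \<rho> *\<^sub>R a)) (\<lambda>(x, a). \<Phi>inf x a) (at_right 0))"

definition standing_assumptions ::
  "(real^'m) set \<Rightarrow> (real^'n \<Rightarrow> real^'m \<Rightarrow> real^'n) \<Rightarrow> (real^'n \<Rightarrow> real^'m \<Rightarrow> real) \<Rightarrow>
   (real^'n \<Rightarrow> real^'m \<Rightarrow> real^'n) \<Rightarrow> (real^'n \<Rightarrow> real^'m \<Rightarrow> real) \<Rightarrow>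
   nat \<Rightarrow> nat \<Rightarrow> real \<Rightarrow> (real \<Rightarrow> real) \<Rightarrow> (real \<Rightarrow> real) \<Rightarrow> (real \<Rightarrow> real \<Rightarrow> real) \<Rightarrow> bool" where
  "standing_assumptions A f l finf linf p q M L N \<omega> \<longleftrightarrow>
     control_set A \<and>
     continuous_on (UNIV \<times> A) (\<lambda>(x, a). f x a) \<and>
     continuous_on (UNIV \<times> A) (\<lambda>(x, a). l x a) \<and>
     structural_bounds A f l p q M L N \<omega> \<and>
     (\<not> bounded A \<longrightarrow> coercive A l q \<and> recession A q f finf \<and> recession A q l linf)"

section \<open>Infinite horizon control problems\<close>

text \<open>Controls and trajectories are functions on \<open>\<real>\<close> of which only the restriction to \<open>[0,\<infinity>)\<close> is ever
  used. Solutions are Caratheodory solutions, written in integral form.\<close>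

definition is_solution ::
  "('x::euclidean_space \<Rightarrow> 'c \<Rightarrow> 'x) \<Rightarrow> 'x \<Rightarrow> (real \<Rightarrow> 'c) \<Rightarrow> (real \<Rightarrow> 'x) \<Rightarrow> bool" where
  "is_solution g x u y \<longleftrightarrow>
     (\<forall>t\<ge>0. set_integrable lborel {0..t} (\<lambda>s. g (y s) (u s)) \<and>
            y t = x + (LINT s:{0..t}|lborel. g (y s) (u s)))"

text \<open>Under the standing assumptions each control considered below has a solution, and it is unique
  on \<open>[0,\<infinity>)\<close>; the choice operator only leaves its (irrelevant) values at negative times open.\<close>

definition trajectory ::
  "('x::euclidean_space \<Rightarrow> 'c \<Rightarrow> 'x) \<Rightarrow> 'x \<Rightarrow> (real \<Rightarrow> 'c) \<Rightarrow> real \<Rightarrow> 'x" where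
  "trajectory g x u = (SOME y. is_solution g x u y)"

definition total_cost ::
  "('x::euclidean_space \<Rightarrow> 'c \<Rightarrow> 'x) \<Rightarrow> ('x \<Rightarrow> 'c \<Rightarrow> real) \<Rightarrow> 'x \<Rightarrow> (real \<Rightarrow> 'c) \<Rightarrow> ennreal" where
  "total_cost g h x u = (\<integral>\<^sup>+t\<in>{0..}. ennreal (h (trajectory g x u t) (u t)) \<partial>lborel)"

definition value_function ::
  "(real \<Rightarrow> 'c) set \<Rightarrow> ('x::euclidean_space \<Rightarrow> 'c \<Rightarrow> 'x) \<Rightarrow> ('x \<Rightarrow> 'c \<Rightarrow> real) \<Rightarrow> 'x \<Rightarrow> ennreal" where
  "value_function U g h x = (INF u\<in>U. total_cost g h x u)"

section \<open>Original problem\<close>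

definition controls :: "(real^'m) set \<Rightarrow> nat \<Rightarrow> (real \<Rightarrow> real^'m) set" where
  "controls A q =
     {\<alpha>. \<alpha> \<in> borel_measurable (restrict_space borel {0..}) \<and> (\<forall>t\<ge>0. \<alpha> t \<in> A) \<and>
         (\<not> bounded A \<longrightarrow> (\<forall>T\<ge>0. set_integrable lborel {0..T} (\<lambda>t. norm (\<alpha> t) ^ q)))}"

definition V_orig ::
  "(real^'m) set \<Rightarrow> nat \<Rightarrow> (real^'n \<Rightarrow> real^'m \<Rightarrow> real^'n) \<Rightarrow> (real^'n \<Rightarrow> real^'m \<Rightarrow> real) \<Rightarrow>
   real^'n \<Rightarrow> ennreal" where
  "V_orig A q f l = value_function (controls A q) f l"

section \<open>Extended problem\<close>

text \<open>The pair \<open>v = (w0, w)\<close> is the extended control value.\<close>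

definition extension ::
  "nat \<Rightarrow> (real^'n \<Rightarrow> real^'m \<Rightarrow> 'b::real_vector) \<Rightarrow> (real^'n \<Rightarrow> real^'m \<Rightarrow> 'b) \<Rightarrow>
   real^'n \<Rightarrow> real \<times> (real^'m) \<Rightarrow> 'b" where
  "extension q \<Phi> \<Phi>inf x v =
     (if fst v \<noteq> 0 then fst v ^ q *\<^sub>R \<Phi> x (inverse (fst v) *\<^sub>R snd v) else \<Phi>inf x (snd v))"

definition extended_set :: "(real^'m) set \<Rightarrow> nat \<Rightarrow> (real \<times> (real^'m)) set" where
  "extended_set A q = {(w0, w). w0 \<ge> 0 \<and> w \<in> A \<and> w0 ^ q + norm w ^ q = 1}"

definition extended_controls :: "(real^'m) set \<Rightarrow> nat \<Rightarrow> (real \<Rightarrow> real \<times> (real^'m)) set" where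
  "extended_controls A q =
     {v. v \<in> borel_measurable (restrict_space borel {0..}) \<and> (\<forall>s\<ge>0. v s \<in> extended_set A q)}"

definition V_ext ::
  "(real^'m) set \<Rightarrow> nat \<Rightarrow> (real^'n \<Rightarrow> real^'m \<Rightarrow> real^'n) \<Rightarrow> (real^'n \<Rightarrow> real^'m \<Rightarrow> real^'n) \<Rightarrow>
   (real^'n \<Rightarrow> real^'m \<Rightarrow> real) \<Rightarrow> (real^'n \<Rightarrow> real^'m \<Rightarrow> real) \<Rightarrow> real^'n \<Rightarrow> ennreal" where
  "V_ext A q f finf l linf =
     value_function (extended_controls A q) (extension q f finf) (extension q l linf)"

section \<open>Relaxed problem\<close>

text \<open>All sets \<open>K\<close> used below are compact subsets of a Euclidean space, where every Borel probability
  measure is Radon.\<close>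

definition radon_prob :: "'a::euclidean_space set \<Rightarrow> 'a measure set" where
  "radon_prob K = {\<mu>. sets \<mu> = sets (restrict_space borel K) \<and> prob_space \<mu>}"

definition weak_star :: "'a::euclidean_space set \<Rightarrow> 'a measure topology" where
  "weak_star K = topology_generated_by
     {{\<mu> \<in> radon_prob K. (\<integral>a. \<phi> a \<partial>\<mu>) \<in> U} | (\<phi> :: 'a \<Rightarrow> real) U. continuous_on K \<phi> \<and> open U}"

text \<open>Elements of \<open>L\<^sup>\<infinity>(\<real>\<^sub>+, P(K))\<close> are represented by functions that are measurable with respect to the
  Borel sets of the weak* topology. Since \<open>P(K)\<close> is compact and metrizable, every class of Lebesgue
  measurable functions has such a Borel representative, and neither trajectories nor costs depend
  on the representative; boundedness is automatic.\<close>

definition relaxed_controls_on :: "'a::euclidean_space set \<Rightarrow> (real \<Rightarrow> 'a measure) set" where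
  "relaxed_controls_on K =
     measurable (restrict_space borel {0..}) (sigma (radon_prob K) {U. openin (weak_star K) U})"

text \<open>The relaxed problem is built on \<open>A\<close> with the data \<open>f, l\<close> if \<open>A\<close> is compact, and on the intersection
  of \<open>A\<close> with the closed unit ball, with the extended data restricted to the points \<open>(w0, w)\<close> with
  \<open>w0 = root q (1 - |w| ^ q)\<close>, otherwise.\<close>

definition relaxed_base :: "(real^'m) set \<Rightarrow> (real^'m) set" where
  "relaxed_base A = (if compact A then A else cball 0 1 \<inter> A)"

definition relaxed_controls :: "(real^'m) set \<Rightarrow> (real \<Rightarrow> (real^'m) measure) set" where
  "relaxed_controls A = relaxed_controls_on (relaxed_base A)"

definition relaxation ::
  "(real^'m) set \<Rightarrow> nat \<Rightarrow> (real^'n \<Rightarrow> real^'m \<Rightarrow> 'b::euclidean_space) \<Rightarrow>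
   (real^'n \<Rightarrow> real^'m \<Rightarrow> 'b) \<Rightarrow> real^'n \<Rightarrow> (real^'m) measure \<Rightarrow> 'b" where
  "relaxation A q \<Phi> \<Phi>inf x \<mu> =
     (if compact A then \<integral>a. \<Phi> x a \<partial>\<mu>
      else \<integral>w. extension q \<Phi> \<Phi>inf x (root q (1 - norm w ^ q), w) \<partial>\<mu>)"

definition V_rel ::
  "(real^'m) set \<Rightarrow> nat \<Rightarrow> (real^'n \<Rightarrow> real^'m \<Rightarrow> real^'n) \<Rightarrow> (real^'n \<Rightarrow> real^'m \<Rightarrow> real^'n) \<Rightarrow>
   (real^'n \<Rightarrow> real^'m \<Rightarrow> real) \<Rightarrow> (real^'n \<Rightarrow> real^'m \<Rightarrow> real) \<Rightarrow> real^'n \<Rightarrow> ennreal" where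
  "V_rel A q f finf l linf =
     value_function (relaxed_controls A) (relaxation A q f finf) (relaxation A q l linf)"

section \<open>The hypotheses (H0), (H2), (H3)\<close>

text \<open>\<open>L\<close>, \<open>N\<close> and \<open>\<omega>\<close> are the families of constants (with \<open>N R\<close> the bound \<open>M\<^sub>R\<close> on \<open>l\<close>) and the modulus
  of the standing assumptions.\<close>

definition H0_1 ::
  "(real^'m) set \<Rightarrow> (real^'n \<Rightarrow> real^'m \<Rightarrow> real^'n) \<Rightarrow> nat \<Rightarrow> real \<Rightarrow> (real \<Rightarrow> real) \<Rightarrow>
   (real \<Rightarrow> real) \<Rightarrow> (real \<Rightarrow> real \<Rightarrow> real) \<Rightarrow> bool" where
  "H0_1 A f p M L N \<omega> \<longleftrightarrow>
     (\<forall>R>0. \<forall>R'>0. L R = L R' \<and> N R = N R' \<and> (\<forall>s\<ge>0. \<omega> s R = \<omega> s R')) \<and>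
     (\<forall>x. \<forall>a\<in>A. norm (f x a) \<le> M * (1 + norm a ^ p)) \<and>
     dini (\<lambda>s. \<omega> s 1)"

definition H0_2 ::
  "(real^'m) set \<Rightarrow> nat \<Rightarrow> (real^'n \<Rightarrow> real^'m \<Rightarrow> real^'n) \<Rightarrow> (real^'n \<Rightarrow> real^'m \<Rightarrow> real^'n) \<Rightarrow>
   (real^'n \<Rightarrow> real^'m \<Rightarrow> real) \<Rightarrow> (real^'n \<Rightarrow> real^'m \<Rightarrow> real) \<Rightarrow> (real \<Rightarrow> real \<Rightarrow> real) \<Rightarrow> bool" where
  "H0_2 A q f finf l linf \<omega> \<longleftrightarrow>
     (\<forall>x. V_rel A q f finf l linf x < \<infinity> \<longrightarrow>
       (\<exists>\<mu>\<in>relaxed_controls A. \<exists>R>0.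
          total_cost (relaxation A q f finf) (relaxation A q l linf) x \<mu> = V_rel A q f finf l linf x \<and>
          (\<forall>s\<ge>0. norm (trajectory (relaxation A q f finf) x \<mu> s) \<le> R) \<and>
          dini (\<lambda>s. \<omega> s (R + 3))))"

definition H2 ::
  "(real^'m) set \<Rightarrow> nat \<Rightarrow> (real^'n \<Rightarrow> real^'m \<Rightarrow> real^'n) \<Rightarrow> (real^'n \<Rightarrow> real^'m \<Rightarrow> real) \<Rightarrow>
   (real^'n) set \<Rightarrow> bool" where
  "H2 A q f l T \<longleftrightarrow>
     T \<noteq> {} \<and> closed T \<and> compact (frontier T) \<and>
     (\<forall>x\<in>T. V_orig A q f l x = 0) \<and>
     (\<forall>z\<in>frontier T. (V_orig A q f l \<longlongrightarrow> 0) (at z))"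

definition H3 ::
  "(real^'m) set \<Rightarrow> nat \<Rightarrow> (real^'n \<Rightarrow> real^'m \<Rightarrow> real^'n) \<Rightarrow> (real^'n \<Rightarrow> real^'m \<Rightarrow> real^'n) \<Rightarrow>
   (real^'n \<Rightarrow> real^'m \<Rightarrow> real) \<Rightarrow> (real^'n \<Rightarrow> real^'m \<Rightarrow> real) \<Rightarrow> (real^'n) set \<Rightarrow> bool" where
  "H3 A q f finf l linf T \<longleftrightarrow>
     (\<forall>x. V_ext A q f finf l linf x < \<infinity> \<longrightarrow>
       (\<exists>\<epsilon>>0. \<forall>v\<in>extended_controls A q.
          total_cost (extension q f finf) (extension q l linf) x v
            \<le> V_ext A q f finf l linf x + ennreal \<epsilon> \<longrightarrow>
          Liminf at_top (\<lambda>s. ereal (infdist (trajectory (extension q f finf) x v s) T)) = 0))"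

end

theory Submission
  imports Defs "HOL-Complex_Analysis.Great_Picard"
begin

text \<open>If \<open>A\<close> is unbounded, points of its intersection with the unit ball parametrise the extended controls,
  so that ordinary, extended and relaxed problem all live on one compact control set \<open>K\<close>.

  The relaxed value is lower semicontinuous below the ordinary one: along a sequence of trajectories with
  controls in \<open>K\<close>, suitable convex combinations of the Dirac masses of the controls converge weakly-* at
  almost every time, and the limit is a relaxed control generating the limit trajectory, with no larger
  cost by Fatou's lemma.

  Conversely, on an infinite horizon a relaxed trajectory \<open>y\<close> can in general be followed by ordinary ones
  only if the initial point may move, which the lower semicontinuous envelope allows. A chattering control makes the
  drift error decay exponentially, and a contraction argument solves backward from infinity for a trajectory
  of this control whose distance from \<open>y\<close> decays like \<open>\<epsilon> exp (- 2 \<Lambda> t)\<close>; the Dini condition is what makes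
  the accumulated cost difference small. The chattering control can be chosen in any dense subset of \<open>K\<close>, in
  particular with \<open>w\<^sub>0 > 0\<close>, and coercivity forces the original time of such a control to be infinite
  whenever its cost is finite, hence it is a time-changed original control.\<close>

section \<open>Caratheodory differential equations\<close>

text \<open>If an ordinary trajectory is started at the initial point of the relaxed one, an
  averaging error made early is amplified like exp (\<Lambda> t) later on, however small the later
  errors are. Integrating from infinity turns the same Lipschitz bound into a contraction, since the
  integral of \<Lambda> exp (- 2 \<Lambda> s) over [t, \<infinity>) is exp (- 2 \<Lambda> t) / 2.
  The substitution r = \<epsilon> exp (- 2 \<Lambda> s) then turns the excess cost into an integral
  of \<omega>(r) / r, which is where the Dini condition comes from.

  The other obstacle is measurability in time of a limit with values in a space of measures. Convex
  combinations, unlike the controls themselves, can be made to converge at almost every fixed time,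
  and dynamics and cost are linear in the measure. The limit is chosen through its moments on
  [0, 1]: the choice is arbitrary, but the resulting measure on \<open>K\<close> depends
  continuously on the moment sequence, hence it is Borel in time.

  The original and the extended value both lie between the value over \<open>K\<close> and the value
  over a dense subset of \<open>K\<close>, and these two have the same envelope, so one sandwich
  settles both problems.\<close>

lemma convergent_geometric_steps:
  fixes X :: "nat \<Rightarrow> 'a::banach"
  assumes "\<And>n. norm (X (Suc n) - X n) \<le> C * (1/2) ^ n"
  shows "convergent X"
proof -
  have "summable (\<lambda>n. X (Suc n) - X n)"
    by (rule summable_comparison_test'[of "\<lambda>n. C * (1/2) ^ n" 0]) (use assms in \<open>auto intro!: summable_mult summable_geometric\<close>)
  then have "convergent (\<lambda>n. X n - X 0)"
    by (simp only: summable_iff_convergent sum_lessThan_telescope[of X])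
  then show ?thesis using convergent_add_const_right_iff[of X "- X 0"] by simp
qed

lemma exp_uminus_le_half: "\<kappa> \<ge> 1 \<Longrightarrow> exp (- \<kappa>) \<le> (1 / 2 :: real)"
proof -
  assume "\<kappa> \<ge> 1"
  then have "2 \<le> exp \<kappa>" using exp_ge_add_one_self[of \<kappa>] by linarith
  then show ?thesis by (simp add: exp_minus field_simps)
qed

text \<open>\<open>y\<close> is a pointwise limit of simple functions. For a simple function the
  composition is glued from finitely many of the measurable \<open>\<lambda>t. F t x\<close>, and
  continuity in the second argument passes to the limit.\<close>

lemma measurable_caratheodory:
  fixes F :: "'a \<Rightarrow> 'b::{metric_space, second_countable_topology} \<Rightarrow> 'c::metric_space"
  assumes meas: "\<And>x. (\<lambda>t. F t x) \<in> borel_measurable N"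
    and cont: "\<And>t. t \<in> space N \<Longrightarrow> continuous_on UNIV (F t)"
    and y: "y \<in> borel_measurable N"
  shows "(\<lambda>t. F t (y t)) \<in> borel_measurable N"
proof -
  \<comment> \<open>An arbitrary point of the space, needed as the centre for the approximation by
    simple functions.\<close>
  obtain z :: 'b where True by simp
  obtain s where s: "\<And>i. simple_function N (s i)"
    and lim: "\<And>t. t \<in> space N \<Longrightarrow> (\<lambda>i. s i t) \<longlonglongrightarrow> y t"
    using borel_measurable_implies_sequence_metric[OF y, of z] by blast
  show ?thesis
  proof (rule borel_measurable_LIMSEQ_metric)
    fix i
    have fin: "finite (s i ` space N)" using s by (rule simple_functionD)
    have g: "s i \<in> measurable N (count_space (s i ` space N))"
      using s[of i] fin by (auto simp: measurable_count_space_eq2 simple_functionD)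
    show "(\<lambda>t. F t (s i t)) \<in> borel_measurable N"
      by (rule measurable_compose_countable'[OF meas g countable_finite[OF fin]])
  next
    fix t assume t: "t \<in> space N"
    show "(\<lambda>i. F t (s i t)) \<longlonglongrightarrow> F t (y t)"
      using continuous_on_tendsto_compose[OF cont[OF t] lim[OF t]] by simp
  qed
qed

section \<open>Integrals over intervals and Gronwall's inequality\<close>

lemma set_integrable_bounded_Icc:
  fixes f :: "real \<Rightarrow> 'a::{banach, second_countable_topology}"
  assumes "f \<in> borel_measurable borel" and "\<And>s. a \<le> s \<Longrightarrow> s \<le> b \<Longrightarrow> norm (f s) \<le> B"
  shows "set_integrable lborel {a..b} f"
  unfolding set_integrable_def
proof (rule integrableI_bounded_set_indicator)
  show "AE x in lborel. x \<in> {a..b} \<longrightarrow> norm (f x) \<le> B" using assms(2) by auto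
qed (use assms in \<open>auto simp: emeasure_lborel_Icc_eq\<close>)

lemma norm_set_integral_le:
  fixes f :: "real \<Rightarrow> 'a::{banach, second_countable_topology}"
  assumes f: "set_integrable lborel S f" and g: "set_integrable lborel S g"
    and le: "\<And>s. s \<in> S \<Longrightarrow> norm (f s) \<le> g s" and S: "S \<in> sets lborel"
  shows "norm (LINT s:S|lborel. f s) \<le> (LINT s:S|lborel. g s)"
proof -
  have "norm (LINT s:S|lborel. f s) \<le> (LINT s:S|lborel. norm (f s))"
    by (rule set_integral_norm_bound[OF f])
  also have "\<dots> \<le> (LINT s:S|lborel. g s)"
    by (rule set_integral_mono[OF set_integrable_norm[OF f] g le])
  finally show ?thesis .
qed

lemma set_integral_exp_Icc:
  fixes k :: real
  assumes "0 \<le> t" "k > 0"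
  shows "(LINT s:{0..t}|lborel. exp (k * s)) = (exp (k * t) - 1) / k"
proof -
  have "((\<lambda>s. exp (k * s)) has_integral (exp (k * t) / k - exp (k * 0) / k)) {0..t}"
    using assms by (intro fundamental_theorem_of_calculus)
      (auto intro!: derivative_eq_intros simp: has_real_derivative_iff_has_vector_derivative[symmetric])
  moreover have "set_integrable lborel {0..t} (\<lambda>s. exp (k * s))"
    by (intro borel_integrable_atLeastAtMost' continuous_intros)
  ultimately show ?thesis
    by (simp add: set_borel_integral_eq_integral integral_unique diff_divide_distrib)
qed

lemma continuous_on_atLeastI:
  fixes f :: "real \<Rightarrow> 'a::topological_space"
  assumes "\<And>T. T > 0 \<Longrightarrow> continuous_on {0..T} f"
  shows "continuous_on {0..} f"
  unfolding continuous_on_eq_continuous_within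
proof
  fix t :: real assume t: "t \<in> {0..}"
  have "continuous (at t within {0..t+1}) f"
    using assms[of "t+1"] t by (simp add: continuous_on_eq_continuous_within)
  moreover have "at t within {0..t+1} = at t within {0..}"
    by (rule at_within_nhd[of t "{..<t+1}"]) auto
  ultimately show "continuous (at t within {0..}) f" by simp
qed

lemma continuous_on_set_integral_Icc:
  fixes f :: "real \<Rightarrow> 'a::euclidean_space"
  assumes "\<And>t. t \<ge> 0 \<Longrightarrow> set_integrable lborel {0..t} f"
  shows "continuous_on {0..} (\<lambda>t. LINT s:{0..t}|lborel. f s)"
proof (rule continuous_on_atLeastI)
  fix T :: real assume "T > 0"
  then have "continuous_on {0..T} (\<lambda>x. integral {0..x} f)"
    using assms[of T] by (intro indefinite_integral_continuous_1 set_borel_integral_eq_integral) auto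
  then show "continuous_on {0..T} (\<lambda>t. LINT s:{0..t}|lborel. f s)"
    using assms by (subst continuous_on_cong[OF refl]) (auto simp: set_borel_integral_eq_integral)
qed

lemma gronwall:
  fixes \<phi> :: "real \<Rightarrow> real"
  assumes cont: "continuous_on {0..T} \<phi>" and L: "L \<ge> 0"
    and le: "\<And>t. t \<in> {0..T} \<Longrightarrow> \<phi> t \<le> a + L * (LINT s:{0..t}|lborel. \<phi> s)"
    and t: "t \<in> {0..T}"
  shows "\<phi> t \<le> a * exp (L * t)"
proof -
  \<comment> \<open>Integrating factor: the derivative of \<open>w\<close> is
    \<open>exp (- L * r)\<close> times
    \<open>L * (\<phi> r - (a + L * integral {0..r} \<phi>))\<close>, which is nonpositive by
    hypothesis.\<close>
  define w where "w t = (a + L * integral {0..t} \<phi>) * exp (- L * t)" for t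
  have int_eq: "(LINT s:{0..r}|lborel. \<phi> s) = integral {0..r} \<phi>" if "r \<in> {0..T}" for r
    using that by (intro set_borel_integral_eq_integral borel_integrable_atLeastAtMost'
        continuous_on_subset[OF cont]) auto
  have intd: "((\<lambda>x. integral {0..x} \<phi>) has_real_derivative \<phi> r) (at r within {0..T})"
    if "r \<in> {0..T}" for r
    using integral_has_real_derivative[OF cont that] .
  have contI: "continuous_on {0..T} (\<lambda>x. integral {0..x} \<phi>)"
    by (rule DERIV_continuous_on[OF intd])
  have "w t \<le> w 0"
  proof (rule DERIV_nonpos_imp_decreasing_open[of 0 t w])
    show "0 \<le> t" using t by simp
    show "continuous_on {0..t} w"
      unfolding w_def by (intro continuous_intros continuous_on_subset[OF contI]) (use t in auto)
    fix r assume r: "0 < r" "r < t"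
    have d: "((\<lambda>x. integral {0..x} \<phi>) has_real_derivative \<phi> r) (at r)"
      using intd[of r] r t at_within_interior[of r "{0..T}"] by auto
    have "(w has_real_derivative ((L * \<phi> r) * exp (- L * r)
        + (a + L * integral {0..r} \<phi>) * (exp (- L * r) * (- L)))) (at r)"
      unfolding w_def by (rule derivative_eq_intros d refl | simp)+
    moreover have "(L * \<phi> r) * exp (- L * r)
        + (a + L * integral {0..r} \<phi>) * (exp (- L * r) * (- L)) \<le> 0"
    proof -
      have "\<phi> r \<le> a + L * integral {0..r} \<phi>" using le[of r] int_eq[of r] r t by auto
      then have "L * (\<phi> r - (a + L * integral {0..r} \<phi>)) \<le> 0"
        using L by (simp add: mult_nonneg_nonpos)
      then have "exp (- L * r) * (L * (\<phi> r - (a + L * integral {0..r} \<phi>))) \<le> 0"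
        by (simp add: mult_nonneg_nonpos)
      then show ?thesis by (simp add: algebra_simps)
    qed
    ultimately show "\<exists>y. (w has_real_derivative y) (at r) \<and> y \<le> 0" by blast
  qed
  then have "(a + L * integral {0..t} \<phi>) * exp (- L * t) \<le> a" by (simp add: w_def)
  then have "a + L * integral {0..t} \<phi> \<le> a * exp (L * t)"
    by (simp add: exp_minus field_simps)
  then show ?thesis using le[OF t] int_eq[OF t] by simp
qed

text \<open>The control is absorbed into the time dependence of \<open>F\<close>, so that ordinary
  and relaxed controls give two instances of one and the same equation.\<close>

definition caratheodory_solution ::
  "(real \<Rightarrow> 'x::euclidean_space \<Rightarrow> 'x) \<Rightarrow> 'x \<Rightarrow> (real \<Rightarrow> 'x) \<Rightarrow> bool" where
  "caratheodory_solution F x y \<longleftrightarrow>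
     (\<forall>t\<ge>0. set_integrable lborel {0..t} (\<lambda>s. F s (y s)) \<and>
            y t = x + (LINT s:{0..t}|lborel. F s (y s)))"

lemma is_solution_eq_caratheodory:
  "is_solution g x u y = caratheodory_solution (\<lambda>s z. g z (u s)) x y"
  by (simp add: is_solution_def caratheodory_solution_def)

text \<open>Only times \<open>s \<ge> 0\<close> enter the equation; this allows a control or a
  trajectory to be replaced by an extension to the whole line.\<close>

lemma caratheodory_solution_cong:
  assumes "\<And>s z. s \<ge> 0 \<Longrightarrow> F s z = G s z" and "\<And>s. s \<ge> 0 \<Longrightarrow> y s = y' s"
  shows "caratheodory_solution F x y = caratheodory_solution G x y'"
proof -
  have "set_integrable lborel {0..t} (\<lambda>s. F s (y s)) = set_integrable lborel {0..t} (\<lambda>s. G s (y' s))"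
    "(LINT s:{0..t}|lborel. F s (y s)) = (LINT s:{0..t}|lborel. G s (y' s))" for t
    using assms by (intro set_integrable_cong set_lebesgue_integral_cong; simp)+
  then show ?thesis using assms by (simp add: caratheodory_solution_def)
qed

lemma caratheodory_solutionD:
  assumes "caratheodory_solution F x y" "t \<ge> 0"
  shows "set_integrable lborel {0..t} (\<lambda>s. F s (y s))"
    and "y t = x + (LINT s:{0..t}|lborel. F s (y s))"
  using assms by (auto simp: caratheodory_solution_def)

lemma caratheodory_solution_continuous:
  assumes "caratheodory_solution F x y"
  shows "continuous_on {0..} y"
proof -
  have "continuous_on {0..} (\<lambda>t. x + (LINT s:{0..t}|lborel. F s (y s)))"
    using assms by (intro continuous_intros continuous_on_set_integral_Icc)
      (auto simp: caratheodory_solution_def)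
  then show ?thesis
    by (rule continuous_on_eq) (use assms in \<open>auto simp: caratheodory_solution_def\<close>)
qed

lemma caratheodory_solution_0:
  assumes "caratheodory_solution F x y"
  shows "y 0 = x"
proof -
  have "AE s in lborel. indicat_real {0..0} s *\<^sub>R F s (y s) = 0"
    using AE_lborel_singleton[of "0::real"] by eventually_elim (auto simp: indicator_def)
  then have "(LINT s:{0..0}|lborel. F s (y s)) = 0"
    unfolding set_lebesgue_integral_def by (rule integral_eq_zero_AE)
  then show ?thesis using assms by (simp add: caratheodory_solution_def)
qed

text \<open>The hypotheses are imposed at all real times, so a control given on [0, \<infinity>) has
  to be extended before it enters here. Linear growth confines solutions to a ball on every bounded
  interval, hence the Lipschitz constant may depend on the radius.\<close>

locale caratheodory_field =
  fixes F :: "real \<Rightarrow> 'x::euclidean_space \<Rightarrow> 'x" and M :: real and L :: "real \<Rightarrow> real"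
  assumes meas: "\<And>x. (\<lambda>t. F t x) \<in> borel_measurable borel"
    and M_pos: "M > 0"
    and growth: "\<And>t x. norm (F t x) \<le> M * (1 + norm x)"
    and L_pos: "\<And>R. R > 0 \<Longrightarrow> L R > 0"
    and lip: "\<And>R t x y. R > 0 \<Longrightarrow> norm x \<le> R \<Longrightarrow> norm y \<le> R \<Longrightarrow>
                norm (F t x - F t y) \<le> L R * norm (x - y)"
begin

lemma continuous_field: "continuous_on UNIV (F t)"
proof (rule continuous_at_imp_continuous_on, rule ballI)
  fix x :: 'x
  define R where "R = norm x + 1"
  have R: "R > 0" by (simp add: R_def add_nonneg_pos)
  have "lipschitz_on (L R) (ball x 1) (F t)"
  proof (rule lipschitz_onI)
    fix a b assume "a \<in> ball x 1" "b \<in> ball x 1"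
    then have "norm a \<le> R" "norm b \<le> R"
      using norm_triangle_sub[of a x] norm_triangle_sub[of b x]
      by (auto simp: R_def dist_norm norm_minus_commute)
    then show "dist (F t a) (F t b) \<le> L R * dist a b" using lip[OF R] by (simp add: dist_norm)
  qed (use L_pos[OF R] in simp)
  then have "continuous_on (ball x 1) (F t)" by (rule lipschitz_on_continuous_on)
  then show "isCont (F t) x" by (simp add: continuous_on_eq_continuous_at)
qed

lemma measurable_comp [measurable]:
  "y \<in> borel_measurable borel \<Longrightarrow> (\<lambda>s. F s (y s)) \<in> borel_measurable borel"
  by (rule measurable_caratheodory[OF meas continuous_field])

lemma set_integrable_comp:
  assumes y: "y \<in> borel_measurable borel" and bd: "\<And>s. 0 \<le> s \<Longrightarrow> s \<le> t \<Longrightarrow> norm (y s) \<le> R"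
  shows "set_integrable lborel {0..t} (\<lambda>s. F s (y s))"
proof (rule set_integrable_bounded_Icc)
  show "norm (F s (y s)) \<le> M * (1 + R)" if "0 \<le> s" "s \<le> t" for s
    using growth[of s "y s"] bd[OF that] M_pos
    by (meson add_left_mono mult_left_mono less_imp_le order_trans)
qed (use y in measurable)

text \<open>Gronwall is applied to \<open>1 + norm (y s)\<close>, for which the growth condition
  becomes linear.\<close>

lemma solution_bound:
  assumes y: "caratheodory_solution F x y" and t: "t \<ge> 0"
  shows "norm (y t) \<le> (1 + norm x) * exp (M * t) - 1"
proof -
  have cont: "continuous_on {0..t} y"
    using caratheodory_solution_continuous[OF y] by (rule continuous_on_subset) auto
  have cn: "continuous_on {0..t} (\<lambda>s. 1 + norm (y s))"
    by (intro continuous_intros cont)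
  have "1 + norm (y t) \<le> (1 + norm x) * exp (M * t)"
  proof (rule gronwall[OF cn])
    fix r assume r: "r \<in> {0..t}"
    have int: "set_integrable lborel {0..r} (\<lambda>s. 1 + norm (y s))"
      by (rule borel_integrable_atLeastAtMost'[OF continuous_on_subset[OF cn]]) (use r in auto)
    have "norm (y r) \<le> norm x + norm (LINT s:{0..r}|lborel. F s (y s))"
      using y r by (simp add: caratheodory_solution_def norm_triangle_ineq)
    also have "norm (LINT s:{0..r}|lborel. F s (y s)) \<le> (LINT s:{0..r}|lborel. M * (1 + norm (y s)))"
      by (rule norm_set_integral_le) (use y r int growth in \<open>auto simp: caratheodory_solution_def\<close>)
    also have "\<dots> = M * (LINT s:{0..r}|lborel. 1 + norm (y s))" by simp
    finally show "1 + norm (y r) \<le> 1 + norm x + M * (LINT s:{0..r}|lborel. 1 + norm (y s))" by simp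
  qed (use M_pos t in auto)
  then show ?thesis by simp
qed

text \<open>Up to time \<open>t\<close> both solutions stay in the ball of radius \<open>R\<close>,
  so a single Lipschitz constant serves, and Gronwall applies with initial error 0.\<close>

lemma solution_unique:
  assumes y: "caratheodory_solution F x y" and z: "caratheodory_solution F x z" and t: "t \<ge> 0"
  shows "y t = z t"
proof -
  define R where "R = (1 + norm x) * exp (M * t)"
  have R: "R > 0" by (simp add: R_def add_pos_nonneg)
  have bd: "norm (y s) \<le> R" "norm (z s) \<le> R" if "0 \<le> s" "s \<le> t" for s
  proof -
    have "(1 + norm x) * exp (M * s) - 1 \<le> R"
      using that M_pos mult_left_mono[of "exp (M * s)" "exp (M * t)" "1 + norm x"]
      by (simp add: R_def)
    then show "norm (y s) \<le> R" "norm (z s) \<le> R"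
      using solution_bound[OF y, of s] solution_bound[OF z, of s] that by auto
  qed
  have cont: "continuous_on {0..t} (\<lambda>s. norm (y s - z s))"
    by (intro continuous_intros continuous_on_subset[OF caratheodory_solution_continuous[OF y]]
      continuous_on_subset[OF caratheodory_solution_continuous[OF z]]) auto
  have "norm (y t - z t) \<le> 0 * exp (L R * t)"
  proof (rule gronwall[OF cont])
    fix r assume r: "r \<in> {0..t}"
    have int: "set_integrable lborel {0..r} (\<lambda>s. norm (y s - z s))"
      by (rule borel_integrable_atLeastAtMost'[OF continuous_on_subset[OF cont]]) (use r in auto)
    have "y r - z r = (LINT s:{0..r}|lborel. F s (y s)) - (LINT s:{0..r}|lborel. F s (z s))"
      using y z r by (simp add: caratheodory_solution_def)
    also have "\<dots> = (LINT s:{0..r}|lborel. F s (y s) - F s (z s))"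
      by (rule set_integral_diff(2)[symmetric]) (use y z r in \<open>auto simp: caratheodory_solution_def\<close>)
    finally have "norm (y r - z r) = norm (LINT s:{0..r}|lborel. F s (y s) - F s (z s))" by simp
    also have "\<dots> \<le> (LINT s:{0..r}|lborel. L R * norm (y s - z s))"
    proof (rule norm_set_integral_le)
      show "set_integrable lborel {0..r} (\<lambda>s. F s (y s) - F s (z s))"
        by (rule set_integral_diff(1)) (use y z r in \<open>auto intro: caratheodory_solutionD\<close>)
    qed (use int bd lip[OF R] r in auto)
    finally show "norm (y r - z r) \<le> 0 + L R * (LINT s:{0..r}|lborel. norm (y s - z s))" by simp
  qed (use L_pos[OF R] t in auto)
  then show ?thesis by simp
qed

text \<open>\<open>max 0 t\<close> freezes the iterates at \<open>x\<close> for negative times,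
  which keeps them continuous on the whole line and therefore Borel.\<close>

primrec picard :: "'x \<Rightarrow> nat \<Rightarrow> real \<Rightarrow> 'x" where
  "picard x 0 = (\<lambda>_. x)"
| "picard x (Suc n) = (\<lambda>t. x + (LINT s:{0..max 0 t}|lborel. F s (picard x n s)))"

text \<open>The a priori bound is invariant under the Picard map: the integral of
  \<open>M * (1 + norm x) * exp (M * s)\<close> over [0, t] is
  \<open>(1 + norm x) * (exp (M * t) - 1)\<close>. All iterates thus share one ball on each bounded
  interval.\<close>

lemma picard_bound:
  "continuous_on UNIV (picard x n) \<and> (\<forall>t\<ge>0. norm (picard x n t) \<le> (1 + norm x) * exp (M * t) - 1)"
proof (induction n)
  case 0
  have "norm x \<le> (1 + norm x) * exp (M * t) - 1" if "t \<ge> 0" for t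
    using mult_left_mono[of 1 "exp (M * t)" "1 + norm x"] that M_pos by simp
  then show ?case by simp
next
  case (Suc n)
  have meas: "picard x n \<in> borel_measurable borel"
    using Suc by (simp add: borel_measurable_continuous_onI)
  have bd: "norm (picard x n s) \<le> (1 + norm x) * exp (M * t)" if "0 \<le> s" "s \<le> t" for s t
  proof -
    have "(1 + norm x) * exp (M * s) - 1 \<le> (1 + norm x) * exp (M * t)"
      using that M_pos mult_left_mono[of "exp (M * s)" "exp (M * t)" "1 + norm x"] by simp
    then show ?thesis using Suc that by fastforce
  qed
  have int: "set_integrable lborel {0..t} (\<lambda>s. F s (picard x n s))" for t
    by (rule set_integrable_comp[OF meas bd])
  have "continuous_on {0..} (\<lambda>t. LINT s:{0..t}|lborel. F s (picard x n s))"
    by (rule continuous_on_set_integral_Icc[OF int])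
  then have "continuous_on UNIV (\<lambda>t. LINT s:{0..max 0 t}|lborel. F s (picard x n s))"
    by (rule continuous_on_compose2) (auto intro!: continuous_intros)
  then have "continuous_on UNIV (picard x (Suc n))" by (simp add: continuous_intros)
  moreover have "norm (picard x (Suc n) t) \<le> (1 + norm x) * exp (M * t) - 1" if t: "t \<ge> 0" for t
  proof -
    have "norm (picard x (Suc n) t) \<le> norm x + norm (LINT s:{0..t}|lborel. F s (picard x n s))"
      using t by (simp add: norm_triangle_ineq)
    also have "norm (LINT s:{0..t}|lborel. F s (picard x n s)) \<le>
        (LINT s:{0..t}|lborel. M * (1 + norm x) * exp (M * s))"
    proof (rule norm_set_integral_le[OF int])
      show "set_integrable lborel {0..t} (\<lambda>s. M * (1 + norm x) * exp (M * s))"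
        by (intro borel_integrable_atLeastAtMost' continuous_intros)
      fix s assume s: "s \<in> {0..t}"
      have "norm (F s (picard x n s)) \<le> M * (1 + norm (picard x n s))" by (rule growth)
      also have "\<dots> \<le> M * ((1 + norm x) * exp (M * s))"
        using Suc s M_pos by (intro mult_left_mono) auto
      finally show "norm (F s (picard x n s)) \<le> M * (1 + norm x) * exp (M * s)" by (simp add: mult.assoc)
    qed auto
    also have "\<dots> = (1 + norm x) * (exp (M * t) - 1)"
      using set_integral_exp_Icc[OF t M_pos] M_pos by simp
    finally show ?thesis by (simp add: algebra_simps)
  qed
  ultimately show ?case by blast
qed

text \<open>Bielecki's weight: integrating \<open>L R * exp (2 * L R * s)\<close> over [0, t] gives
  at most half of \<open>exp (2 * L R * t)\<close>, so each step gains a factor 1/2 on all of [0, T]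
  at once. The initial \<open>2 * R\<close> bounds the distance of two points in the ball of radius
  \<open>R\<close>.\<close>

lemma picard_diff:
  fixes x :: 'x
  assumes T: "T \<ge> 0"
  defines "R \<equiv> (1 + norm x) * exp (M * T)"
  shows "\<forall>t\<in>{0..T}. norm (picard x (Suc n) t - picard x n t) \<le> 2 * R * (1/2) ^ n * exp (2 * L R * t)"
proof -
  have R: "R > 0" by (simp add: R_def add_pos_nonneg)
  have bd: "norm (picard x n s) \<le> R" if "0 \<le> s" "s \<le> T" for s n
  proof -
    have "(1 + norm x) * exp (M * s) - 1 \<le> R"
      using that M_pos mult_left_mono[of "exp (M * s)" "exp (M * T)" "1 + norm x"] by (simp add: R_def)
    then show ?thesis using picard_bound[of x n] that by fastforce
  qed
  have cont: "continuous_on S (picard x n)" for n S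
    using picard_bound[of x n] continuous_on_subset by blast
  have int: "set_integrable lborel {0..t} (\<lambda>s. F s (picard x n s))" if "t \<le> T" for t n
  proof (rule set_integrable_comp[where R=R])
    show "norm (picard x n s) \<le> R" if "0 \<le> s" "s \<le> t" for s
      using bd[of s n] that \<open>t \<le> T\<close> by linarith
  qed (rule borel_measurable_continuous_onI[OF cont])
  show ?thesis
  proof (induction n)
    case 0
    show ?case
    proof
      fix t assume t: "t \<in> {0..T}"
      have "norm (picard x (Suc 0) t - picard x 0 t) \<le> R + R"
        using bd[of t "Suc 0"] bd[of t 0] t norm_triangle_ineq4[of "picard x (Suc 0) t" "picard x 0 t"] by auto
      also have "\<dots> \<le> 2 * R * exp (2 * L R * t)"
        using R L_pos[OF R] t mult_left_mono[of 1 "exp (2 * L R * t)" "2 * R"] by simp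
      finally show "norm (picard x (Suc 0) t - picard x 0 t) \<le> 2 * R * (1/2) ^ 0 * exp (2 * L R * t)" by simp
    qed
  next
    case (Suc n)
    show ?case
    proof
      fix t assume t: "t \<in> {0..T}"
      have "picard x (Suc (Suc n)) t - picard x (Suc n) t =
          (LINT s:{0..t}|lborel. F s (picard x (Suc n) s)) - (LINT s:{0..t}|lborel. F s (picard x n s))"
        using t by (simp only: picard.simps) simp
      also have "\<dots> = (LINT s:{0..t}|lborel. F s (picard x (Suc n) s) - F s (picard x n s))"
        by (rule set_integral_diff(2)[symmetric]) (use t in \<open>auto intro!: int simp del: picard.simps\<close>)
      finally have "norm (picard x (Suc (Suc n)) t - picard x (Suc n) t) =
          norm (LINT s:{0..t}|lborel. F s (picard x (Suc n) s) - F s (picard x n s))" by simp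
      also have "\<dots> \<le> (LINT s:{0..t}|lborel. L R * (2 * R * (1/2) ^ n) * exp (2 * L R * s))"
      proof (rule norm_set_integral_le)
        show "set_integrable lborel {0..t} (\<lambda>s. F s (picard x (Suc n) s) - F s (picard x n s))"
          by (rule set_integral_diff(1)) (use t in \<open>auto intro!: int simp del: picard.simps\<close>)
        show "set_integrable lborel {0..t} (\<lambda>s. L R * (2 * R * (1/2) ^ n) * exp (2 * L R * s))"
          by (intro borel_integrable_atLeastAtMost' continuous_intros)
        fix s assume s: "s \<in> {0..t}"
        have "norm (F s (picard x (Suc n) s) - F s (picard x n s))
            \<le> L R * norm (picard x (Suc n) s - picard x n s)"
          using bd s t by (intro lip[OF R]) (auto simp del: picard.simps)
        also have "\<dots> \<le> L R * (2 * R * (1/2) ^ n * exp (2 * L R * s))"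
          using Suc s t L_pos[OF R] by (intro mult_left_mono) auto
        finally show "norm (F s (picard x (Suc n) s) - F s (picard x n s))
            \<le> L R * (2 * R * (1/2) ^ n) * exp (2 * L R * s)" by (simp add: mult.assoc)
      qed auto
      also have "\<dots> = L R * (2 * R * (1/2) ^ n) * ((exp (2 * L R * t) - 1) / (2 * L R))"
        using set_integral_exp_Icc[of t "2 * L R"] L_pos[OF R] t by (simp del: times_divide_eq_right)
      also have "\<dots> = 2 * R * (1/2) ^ Suc n * (exp (2 * L R * t) - 1)"
        using L_pos[OF R] by (simp add: field_simps)
      also have "\<dots> \<le> 2 * R * (1/2) ^ Suc n * exp (2 * L R * t)"
        using R by (intro mult_left_mono) auto
      finally show "norm (picard x (Suc (Suc n)) t - picard x (Suc n) t)
          \<le> 2 * R * (1/2) ^ Suc n * exp (2 * L R * t)" .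
    qed
  qed
qed

text \<open>The weighted differences form a geometric series, so the iterates converge at each time;
  the integral equation passes to the limit by dominated convergence with the constant bound
  \<open>M * (1 + R)\<close>.\<close>

lemma solution_exists: "\<exists>y. caratheodory_solution F x y"
proof -
  define y where "y t = lim (\<lambda>n. picard x n t)" for t
  have lim: "(\<lambda>n. picard x n t) \<longlonglongrightarrow> y t" if t: "t \<ge> 0" for t
  proof -
    define R where "R = (1 + norm x) * exp (M * t)"
    have "norm (picard x (Suc n) t - picard x n t) \<le> 2 * R * exp (2 * L R * t) * (1/2) ^ n" for n
      using picard_diff[OF t, of x n] t unfolding R_def by (auto simp: mult_ac simp del: picard.simps)
    then have "convergent (\<lambda>n. picard x n t)" by (rule convergent_geometric_steps)
    then show ?thesis by (simp add: y_def convergent_LIMSEQ_iff)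
  qed
  have cont: "continuous_on S (picard x n)" for n S
    using picard_bound[of x n] continuous_on_subset by blast
  show ?thesis
  proof (intro exI[of _ y], unfold caratheodory_solution_def, intro allI impI)
    fix t :: real assume t: "t \<ge> 0"
    define R where "R = (1 + norm x) * exp (M * t)"
    have bd: "norm (picard x n s) \<le> R" if "0 \<le> s" "s \<le> t" for s n
    proof -
      have "(1 + norm x) * exp (M * s) - 1 \<le> R"
        using that M_pos mult_left_mono[of "exp (M * s)" "exp (M * t)" "1 + norm x"] by (simp add: R_def)
      then show ?thesis using picard_bound[of x n] that by fastforce
    qed
    have R0: "R \<ge> 0" by (simp add: R_def)
    have [measurable]: "picard x n \<in> borel_measurable borel" for n
      by (rule borel_measurable_continuous_onI[OF cont])
    let ?f = "\<lambda>n s. indicat_real {0..t} s *\<^sub>R F s (picard x n s)"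
    let ?g = "\<lambda>s. indicat_real {0..t} s *\<^sub>R F s (y s)"
    let ?w = "\<lambda>s. indicat_real {0..t} s *\<^sub>R (M * (1 + R))"
    have m1: "\<And>n. ?f n \<in> borel_measurable lborel" by measurable
    have conv: "(\<lambda>n. ?f n s) \<longlonglongrightarrow> ?g s" for s
    proof (cases "s \<in> {0..t}")
      case True
      then have "(\<lambda>n. F s (picard x n s)) \<longlonglongrightarrow> F s (y s)"
        using continuous_on_tendsto_compose[OF continuous_field lim] by auto
      then show ?thesis using True by simp
    qed simp
    \<comment> \<open>Convergence is known at times \<open>t \<ge> 0\<close> only, so measurability
      is derived for the truncated integrand, which is a limit everywhere.\<close>
    have m2: "?g \<in> borel_measurable lborel"
      by (rule borel_measurable_LIMSEQ_metric[OF m1 conv])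
    have w: "integrable lborel ?w"
      by (intro integrable_scaleR_left integrable_real_indicator) (auto simp: emeasure_lborel_Icc_eq)
    have dom: "AE s in lborel. norm (?f n s) \<le> ?w s" for n
    proof (rule AE_I2)
      fix s
      have "norm (F s (picard x n s)) \<le> M * (1 + R)" if "s \<in> {0..t}"
      proof -
        have "norm (F s (picard x n s)) \<le> M * (1 + norm (picard x n s))" by (rule growth)
        also have "\<dots> \<le> M * (1 + R)" using bd[of s n] that M_pos by (intro mult_left_mono) auto
        finally show ?thesis .
      qed
      then show "norm (?f n s) \<le> ?w s" by (cases "s \<in> {0..t}") auto
    qed
    have AEc: "AE s in lborel. (\<lambda>n. ?f n s) \<longlonglongrightarrow> ?g s" using conv by simp
    have I: "integrable lborel ?g" and C: "(\<lambda>n. integral\<^sup>L lborel (?f n)) \<longlonglongrightarrow> integral\<^sup>L lborel ?g"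
      using integral_dominated_convergence[OF m2 m1 w AEc dom]
            integrable_dominated_convergence[OF m2 m1 w AEc dom] by auto
    have "(\<lambda>n. picard x (Suc n) t) \<longlonglongrightarrow> x + integral\<^sup>L lborel ?g"
      using tendsto_add[OF tendsto_const[of x] C] t by (simp add: set_lebesgue_integral_def)
    moreover have "(\<lambda>n. picard x (Suc n) t) \<longlonglongrightarrow> y t"
      using lim[OF t] by (rule LIMSEQ_Suc)
    ultimately have "y t = x + integral\<^sup>L lborel ?g" by (rule LIMSEQ_unique[symmetric])
    then show "set_integrable lborel {0..t} (\<lambda>s. F s (y s)) \<and>
        y t = x + (LINT s:{0..t}|lborel. F s (y s))"
      using I by (simp add: set_integrable_def set_lebesgue_integral_def)
  qed
qed

end

section \<open>Convex combinations converging almost everywhere\<close>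

text \<open>A fair coin decides which of the two laws is sampled. The result represents the midpoint
  of two convex combinations, as the parallelogram law requires.\<close>

lemma pmf_midpoint:
  fixes p p' :: "'a pmf"
  assumes "finite (set_pmf p)" "finite (set_pmf p')"
  obtains m where "finite (set_pmf m)" "set_pmf m \<subseteq> set_pmf p \<union> set_pmf p'"
    "\<And>f :: 'a \<Rightarrow> real. measure_pmf.expectation m f =
        (measure_pmf.expectation p f + measure_pmf.expectation p' f) / 2"
proof -
  define m where "m = bind_pmf (bernoulli_pmf (1/2)) (\<lambda>b. if b then p else p')"
  let ?A = "set_pmf p \<union> set_pmf p'"
  have sub: "set_pmf m \<subseteq> ?A" by (auto simp: m_def split: if_splits)
  have fin: "finite ?A" using assms by simp
  have pm: "pmf m a = (pmf p a + pmf p' a) / 2" for a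
    by (simp add: m_def pmf_bind field_simps)
  have "measure_pmf.expectation m f =
        (measure_pmf.expectation p f + measure_pmf.expectation p' f) / 2" for f :: "'a \<Rightarrow> real"
  proof -
    have "measure_pmf.expectation m f = (\<Sum>a\<in>?A. pmf m a *\<^sub>R f a)"
      by (rule integral_measure_pmf[OF fin]) (use sub in auto)
    moreover have "measure_pmf.expectation p f = (\<Sum>a\<in>?A. pmf p a *\<^sub>R f a)"
      by (rule integral_measure_pmf[OF fin]) auto
    moreover have "measure_pmf.expectation p' f = (\<Sum>a\<in>?A. pmf p' a *\<^sub>R f a)"
      by (rule integral_measure_pmf[OF fin]) auto
    ultimately show ?thesis
      by (simp add: pm sum.distrib[symmetric] sum_divide_distrib algebra_simps add_divide_distrib)
  qed
  then show thesis using that[of m] sub fin finite_subset by blast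
qed

lemma norm_expectation_le:
  fixes f :: "'a \<Rightarrow> 'b::{banach, second_countable_topology}"
  assumes "finite (set_pmf p)" "\<And>n. n \<in> set_pmf p \<Longrightarrow> norm (f n) \<le> B"
  shows "norm (measure_pmf.expectation p f) \<le> B"
proof -
  have "norm (measure_pmf.expectation p f) \<le> measure_pmf.expectation p (\<lambda>n. norm (f n))"
    by (rule integral_norm_bound)
  also have "\<dots> \<le> B"
    using assms by (intro measure_pmf.integral_le_const integrable_measure_pmf_finite)
      (auto simp: AE_measure_pmf_iff)
  finally show ?thesis .
qed

text \<open>Elements of almost minimal \<open>L\<^sup>2\<close> norm in the convex hulls of the tails form a Cauchy sequence, by
  the parallelogram law.\<close>

lemma convex_combinations_converge_AE:
  fixes X :: "nat \<Rightarrow> 'a \<Rightarrow> real"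
  assumes "finite_measure N" and meas [measurable]: "\<And>n. X n \<in> borel_measurable N"
    and bd: "\<And>n x. \<bar>X n x\<bar> \<le> B"
  obtains p :: "nat \<Rightarrow> nat pmf" where "\<And>k. finite (set_pmf (p k))" "\<And>k. set_pmf (p k) \<subseteq> {k..}"
    "AE x in N. Cauchy (\<lambda>k. measure_pmf.expectation (p k) (\<lambda>n. X n x))"
proof -
  interpret finite_measure N by fact
  define Y where "Y p x = measure_pmf.expectation p (\<lambda>n. X n x)" for p x
  \<comment> \<open>Convex combinations of the tail from \<open>k\<close> on, encoded as finitely
    supported laws on the indices.\<close>
  define P where "P k = {p :: nat pmf. finite (set_pmf p) \<and> set_pmf p \<subseteq> {k..}}" for k
  define Q where "Q p = (LINT x|N. (Y p x)\<^sup>2)" for p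
  define d where "d k = (INF p\<in>P k. Q p)" for k
  have Pmono: "P j \<subseteq> P i" if "i \<le> j" for i j using that by (force simp: P_def)
  have Pne: "return_pmf k \<in> P k" for k by (simp add: P_def)
  have Ymeas [measurable]: "Y p \<in> borel_measurable N" if "p \<in> P k" for p k
  proof -
    have "Y p = (\<lambda>x. \<Sum>a\<in>set_pmf p. pmf p a *\<^sub>R X a x)"
      using that by (auto simp: Y_def P_def integral_measure_pmf[of "set_pmf p"])
    then show ?thesis by simp
  qed
  have Ybd: "\<bar>Y p x\<bar> \<le> B" if "p \<in> P k" for p k x
    unfolding Y_def using that bd norm_expectation_le[of p "\<lambda>n. X n x" B] by (simp add: P_def)
  have B0: "B \<ge> 0" using bd[of 0 undefined] by linarith
  have int: "integrable N (Y p)" if "p \<in> P k" for p k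
    using Ybd[OF that] Ymeas[OF that] by (intro integrable_const_bound[of _ B]) auto
  have int2: "integrable N (\<lambda>x. (Y p x)\<^sup>2)" if "p \<in> P k" for p k
  proof (rule integrable_const_bound[of _ "B\<^sup>2"])
    show "AE x in N. norm ((Y p x)\<^sup>2) \<le> B\<^sup>2"
      using Ybd[OF that] B0 by (auto simp: abs_le_square_iff[symmetric])
  qed (use Ymeas[OF that] in measurable)
  have int_prod: "integrable N (\<lambda>x. Y p x * Y p' x)" if "p \<in> P k" "p' \<in> P k'" for p p' k k'
  proof (rule integrable_const_bound[of _ "B*B"])
    show "AE x in N. norm (Y p x * Y p' x) \<le> B*B"
      using Ybd[OF that(1)] Ybd[OF that(2)] B0 by (auto simp: abs_mult intro!: mult_mono)
  qed (use Ymeas[OF that(1)] Ymeas[OF that(2)] in measurable)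
  have Q0: "Q p \<ge> 0" for p unfolding Q_def by simp
  have bdd: "bdd_below (Q ` P k)" for k using Q0 by (auto intro!: bdd_belowI)
  have d_le: "d k \<le> Q p" if "p \<in> P k" for k p
    unfolding d_def by (rule cINF_lower[OF bdd that])
  have dmono: "incseq d"
    unfolding incseq_def d_def using Pmono Pne by (auto intro!: cINF_superset_mono bdd) (metis empty_iff)
  have Qub: "Q (return_pmf k) \<le> B\<^sup>2 * measure N (space N)" for k
  proof -
    have "Q (return_pmf k) \<le> (LINT x|N. B\<^sup>2)"
      unfolding Q_def using Ybd[OF Pne] B0
      by (intro integral_mono int2[OF Pne]) (auto simp: abs_le_square_iff[symmetric])
    then show ?thesis by (simp add: mult.commute)
  qed
  have dub: "d k \<le> B\<^sup>2 * measure N (space N)" for k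
    using d_le[OF Pne] Qub order_trans by blast
  obtain D where D: "d \<longlonglongrightarrow> D" "\<And>k. d k \<le> D"
    using incseq_convergent[OF dmono] dub by metis
  have "\<exists>p\<in>P k. Q p < d k + 1 / (real k + 1)" for k
    using cINF_less_iff[of "P k" Q "d k + 1 / (real k + 1)"] Pne bdd
    unfolding d_def by auto
  then obtain v where v: "\<And>k. v k \<in> P k" "\<And>k. Q (v k) < d k + 1 / (real k + 1)" by metis
  \<comment> \<open>The midpoint of \<open>v i\<close> and \<open>v j\<close> still belongs to
    \<open>P n\<close>, so its squared norm is at least \<open>d n\<close>, while those of
    \<open>v i\<close> and \<open>v j\<close> exceed \<open>D\<close> by at most
    \<open>1 / (real n + 1)\<close>. The parallelogram law leaves four times the gap.\<close>
  have dist2: "(LINT x|N. (Y (v i) x - Y (v j) x)\<^sup>2) \<le> 4 * (D - d n) + 4 / (real n + 1)"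
    if "i \<ge> n" "j \<ge> n" for i j n
  proof -
    obtain m where m: "finite (set_pmf m)" "set_pmf m \<subseteq> set_pmf (v i) \<union> set_pmf (v j)"
      "\<And>f. measure_pmf.expectation m f =
        (measure_pmf.expectation (v i) f + measure_pmf.expectation (v j) f) / (2::real)"
      using pmf_midpoint[of "v i" "v j"] v(1) unfolding P_def by blast
    have mP: "m \<in> P n"
      using m(1,2) v(1)[of i] v(1)[of j] that unfolding P_def by fastforce
    have Ym: "Y m x = (Y (v i) x + Y (v j) x) / 2" for x
      unfolding Y_def by (rule m(3))
    have eq: "(Y (v i) x - Y (v j) x)\<^sup>2 = 2 * (Y (v i) x)\<^sup>2 + 2 * (Y (v j) x)\<^sup>2 - 4 * (Y m x)\<^sup>2" for x
      unfolding Ym by (simp add: power2_eq_square algebra_simps)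
    have "(LINT x|N. (Y (v i) x - Y (v j) x)\<^sup>2) = 2 * Q (v i) + 2 * Q (v j) - 4 * Q m"
      unfolding eq Q_def using int2[OF v(1)] int2[OF mP] by simp
    also have "\<dots> \<le> 2 * (D + 1 / (real n + 1)) + 2 * (D + 1 / (real n + 1)) - 4 * d n"
    proof -
      have "1 / (real i + 1) \<le> 1 / (real n + 1)" "1 / (real j + 1) \<le> 1 / (real n + 1)"
        using that by (auto intro!: divide_left_mono)
      then have "Q (v i) \<le> D + 1 / (real n + 1)" "Q (v j) \<le> D + 1 / (real n + 1)"
        using v(2)[of i] v(2)[of j] D(2)[of i] D(2)[of j] by linarith+
      then have "2 * Q (v i) \<le> 2 * (D + 1 / (real n + 1))" "2 * Q (v j) \<le> 2 * (D + 1 / (real n + 1))"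
        by auto
      then show ?thesis using d_le[OF mP] by linarith
    qed
    finally show ?thesis by (simp add: algebra_simps)
  qed
  have L1: "\<exists>n. \<forall>i\<ge>n. \<forall>j\<ge>n. (LINT x|N. norm (Y (v i) x - Y (v j) x)) < e" if e: "e > 0" for e
  proof -
    \<comment> \<open>From L2 to L1 by |f| \<le> \<eta> + f^2 / \<eta>. With this \<eta> the
      constant term integrates to at most e / 2, and the summand 1 keeps the denominator positive
      for a null measure.\<close>
    define \<eta> where "\<eta> = e / (2 * (measure N (space N) + 1))"
    have \<eta>: "\<eta> > 0" using e by (simp add: \<eta>_def add_nonneg_pos)
    have "(\<lambda>n. 4 * (D - d n) + 4 / (real n + 1)) \<longlonglongrightarrow> 4 * (D - D) + 0"
    proof (intro tendsto_intros D)
      have "(\<lambda>n. 4 * (1 / (real n + 1))) \<longlonglongrightarrow> 4 * 0"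
        using LIMSEQ_inverse_real_of_nat by (intro tendsto_intros) (simp add: inverse_eq_divide add.commute)
      then show "(\<lambda>n. 4 / (real n + 1)) \<longlonglongrightarrow> 0" by simp
    qed
    then have "\<forall>\<^sub>F n in sequentially. 4 * (D - d n) + 4 / (real n + 1) < \<eta> * (e / 2)"
      using \<eta> e by (intro order_tendstoD(2)) auto
    then obtain n where n: "4 * (D - d n) + 4 / (real n + 1) < \<eta> * (e / 2)"
      using eventually_happens trivial_limit_sequentially by blast
    show ?thesis
    proof (intro exI[of _ n] allI impI)
      fix i j assume ij: "i \<ge> n" "j \<ge> n"
      let ?f = "\<lambda>x. Y (v i) x - Y (v j) x"
      have i2: "integrable N (\<lambda>x. (?f x)\<^sup>2)"
        unfolding power2_diff using int2[OF v(1)] int_prod[OF v(1) v(1)]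
        by (intro Bochner_Integration.integrable_diff Bochner_Integration.integrable_add) (auto simp: mult.assoc)
      have "(LINT x|N. norm (?f x)) \<le> (LINT x|N. \<eta> + (?f x)\<^sup>2 / \<eta>)"
      proof (rule integral_mono)
        show "integrable N (\<lambda>x. norm (?f x))" using int[OF v(1)] by (intro integrable_norm) auto
        show "integrable N (\<lambda>x. \<eta> + (?f x)\<^sup>2 / \<eta>)" using i2 by auto
        fix x
        show "norm (?f x) \<le> \<eta> + (?f x)\<^sup>2 / \<eta>"
        proof (cases "\<bar>?f x\<bar> \<le> \<eta>")
          case True
          then show ?thesis using \<eta> by (simp add: add_increasing2)
        next
          case False
          then have "\<bar>?f x\<bar> * \<eta> \<le> \<bar>?f x\<bar> * \<bar>?f x\<bar>" by (intro mult_left_mono) auto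
          then have "\<bar>?f x\<bar> \<le> (?f x)\<^sup>2 / \<eta>"
            using \<eta> by (simp add: field_simps power2_eq_square)
          then show ?thesis using \<eta> by simp
        qed
      qed
      also have "\<dots> = \<eta> * measure N (space N) + (LINT x|N. (?f x)\<^sup>2) / \<eta>"
        using i2 by (simp add: mult.commute)
      also have "\<dots> < e / 2 + e / 2"
      proof (rule add_le_less_mono)
        show "\<eta> * measure N (space N) \<le> e / 2"
        proof -
          have "\<eta> * measure N (space N) \<le> \<eta> * (measure N (space N) + 1)"
            using \<eta> by (intro mult_left_mono) auto
          also have "\<dots> = e / 2"
          proof -
            have *: "e / (2 * c) * c = e / 2" if "c > 0" for c :: real using that by simp
            show ?thesis unfolding \<eta>_def by (rule *) (simp add: add_nonneg_pos)
          qed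
          finally show ?thesis .
        qed
        show "(LINT x|N. (?f x)\<^sup>2) / \<eta> < e / 2"
        proof -
          have "(LINT x|N. (?f x)\<^sup>2) < \<eta> * (e / 2)" using dist2[OF ij] n by linarith
          then show ?thesis using \<eta> by (simp add: pos_divide_less_eq mult.commute)
        qed
      qed
      finally show "(LINT x|N. norm (?f x)) < e" by simp
    qed
  qed
  \<comment> \<open>An L1-Cauchy sequence has an almost everywhere Cauchy subsequence; since
    \<open>k \<le> r k\<close>, the supports still lie in \<open>{k..}\<close>.\<close>
  obtain r where r: "strict_mono r" "AE x in N. Cauchy (\<lambda>i. Y (v (r i)) x)"
    using cauchy_L1_AE_cauchy_subseq[of N "\<lambda>i. Y (v i)"] int[OF v(1)] L1 by metis
  show thesis
  proof (rule that[of "\<lambda>k. v (r k)"])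
    show "finite (set_pmf (v (r k)))" for k using v(1)[of "r k"] by (simp add: P_def)
    show "set_pmf (v (r k)) \<subseteq> {k..}" for k
      using v(1)[of "r k"] seq_suble[OF r(1), of k] by (auto simp: P_def)
    show "AE x in N. Cauchy (\<lambda>k. measure_pmf.expectation (v (r k)) (\<lambda>n. X n x))"
      using r(2) by (simp add: Y_def)
  qed
qed

section \<open>A space-filling curve with a Borel section\<close>

text \<open>Schoenberg's curve. It transports Borel measures on a compact subset of a Euclidean space to
  the unit interval, where Helly's theorem and moments are available. The wave has period \<open>2\<close> and
  reads off the first ternary digit of a point of the Cantor set.\<close>

definition schoenberg_wave :: "real \<Rightarrow> real" where
  "schoenberg_wave x = max 0 (min 1 (3 * arccos (cos (pi * x)) / pi - 1))"

lemma continuous_schoenberg_wave: "continuous_on UNIV schoenberg_wave"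
  unfolding schoenberg_wave_def
  by (intro continuous_intros) auto

lemma schoenberg_wave_bound: "0 \<le> schoenberg_wave x" "schoenberg_wave x \<le> 1"
  by (auto simp: schoenberg_wave_def)

lemma schoenberg_wave_periodic: "schoenberg_wave (2 * real_of_int k + x) = schoenberg_wave x"
proof -
  have "pi * (2 * real_of_int k + x) = pi * x + 2 * pi * of_int k" by (simp add: algebra_simps)
  then have "cos (pi * (2 * real_of_int k + x)) = cos (pi * x)"
    by (simp add: cos_add cos_int_2pin sin_int_2pin)
  then show ?thesis by (simp add: schoenberg_wave_def)
qed

text \<open>On [0, 1] the angle \<open>arccos (cos (pi * x))\<close> is \<open>pi * x\<close>, so
  there the wave is 3 x - 1 clamped to [0, 1].\<close>

lemma schoenberg_wave_low: "0 \<le> x \<Longrightarrow> x \<le> 1/3 \<Longrightarrow> schoenberg_wave x = 0"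
  using arccos_cos[of "pi * x"] mult_left_le[of x pi] by (simp add: schoenberg_wave_def)

lemma schoenberg_wave_high: "2/3 \<le> x \<Longrightarrow> x \<le> 1 \<Longrightarrow> schoenberg_wave x = 1"
  using arccos_cos[of "pi * x"] mult_left_le[of x pi] by (simp add: schoenberg_wave_def)

text \<open>For 0-1 sequences \<open>b\<close>, the point of the Cantor set with ternary digits 2
  b(0), 2 b(1), and so on.\<close>

definition ternary :: "(nat \<Rightarrow> int) \<Rightarrow> real" where
  "ternary b = (\<Sum>j. 2 * real_of_int (b j) * (1/3) ^ Suc j)"

lemma ternary_summable:
  assumes "\<And>j. b j \<in> {0, 1}"
  shows "summable (\<lambda>j. 2 * real_of_int (b j) * (1/3) ^ Suc j)"
proof (rule summable_comparison_test')
  show "summable (\<lambda>j. 2 * (1/3::real) ^ Suc j)"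
    by (intro summable_mult) (auto simp: summable_geometric)
  show "norm (2 * real_of_int (b j) * (1/3) ^ Suc j) \<le> 2 * (1/3) ^ Suc j" if "j \<ge> 0" for j
    using assms[of j] by auto
qed

lemma ternary_bound:
  assumes "\<And>j. b j \<in> {0, 1}"
  shows "0 \<le> ternary b" "ternary b \<le> 1"
proof -
  have *: "0 \<le> real_of_int (b j)" "real_of_int (b j) \<le> 1" for j using assms[of j] by auto
  show "0 \<le> ternary b" unfolding ternary_def
    by (intro suminf_nonneg ternary_summable assms) (use * in auto)
  have g: "(\<lambda>j. 2/3 * (1/3::real) ^ j) sums (2/3 * (1 / (1 - 1/3)))"
    by (intro sums_mult geometric_sums) auto
  have "ternary b \<le> (\<Sum>j. 2/3 * (1/3::real) ^ j)" unfolding ternary_def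
    by (intro suminf_le ternary_summable assms sums_summable[OF g]) (use * in \<open>auto simp: field_simps\<close>)
  then show "ternary b \<le> 1" using sums_unique[OF g] by simp
qed

lemma ternary_shift:
  assumes "\<And>j. b j \<in> {0, 1}"
  shows "3 * ternary b = 2 * real_of_int (b 0) + ternary (\<lambda>j. b (Suc j))"
proof -
  have "ternary b = (\<Sum>j. 2 * real_of_int (b (Suc j)) * (1/3) ^ Suc (Suc j)) + 2 * real_of_int (b 0) * (1/3)"
    unfolding ternary_def using suminf_split_head[OF ternary_summable[of b, OF assms]] by simp
  also have "(\<Sum>j. 2 * real_of_int (b (Suc j)) * (1/3) ^ Suc (Suc j)) =
      (\<Sum>j. (1/3) * (2 * real_of_int (b (Suc j)) * (1/3) ^ Suc j))"
    by (simp add: algebra_simps)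
  also have "\<dots> = (1/3) * ternary (\<lambda>j. b (Suc j))"
    unfolding ternary_def by (rule suminf_mult[OF ternary_summable]) (use assms in auto)
  finally show ?thesis by simp
qed

lemma schoenberg_wave_ternary_0:
  assumes "\<And>j. b j \<in> {0, 1}"
  shows "schoenberg_wave (ternary b) = real_of_int (b 0)"
  using ternary_shift[of b, OF assms] ternary_bound[of "\<lambda>j. b (Suc j)", OF assms] assms[of 0]
    schoenberg_wave_low[of "ternary b"] schoenberg_wave_high[of "ternary b"]
  by auto

text \<open>Multiplication by \<open>3 ^ n\<close> turns the digits before the \<open>n\<close>-th
  into an even integer, which the wave of period 2 does not see; the digit \<open>b n\<close>
  becomes the leading one.\<close>

lemma schoenberg_wave_ternary:
  assumes "\<And>j. b j \<in> {0, 1}"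
  shows "schoenberg_wave (3 ^ n * ternary b) = real_of_int (b n)"
proof -
  have "\<exists>k::int. 3 ^ n * ternary b = 2 * real_of_int k + ternary (\<lambda>j. b (n + j))"
  proof (induction n)
    case 0
    show ?case by (intro exI[of _ 0]) simp
  next
    case (Suc n)
    then obtain k :: int where k: "3 ^ n * ternary b = 2 * real_of_int k + ternary (\<lambda>j. b (n + j))" by blast
    have "3 ^ Suc n * ternary b = 3 * (2 * real_of_int k + ternary (\<lambda>j. b (n + j)))"
      using k by simp
    also have "\<dots> = 2 * real_of_int (3 * k + b n) + ternary (\<lambda>j. b (Suc n + j))"
      using ternary_shift[of "\<lambda>j. b (n + j)", OF assms] by (simp add: algebra_simps)
    finally show ?case by blast
  qed
  then show ?thesis
    using schoenberg_wave_ternary_0[of "\<lambda>j. b (n + j)", OF assms] by (auto simp: schoenberg_wave_periodic)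
qed

definition binary_digit :: "real \<Rightarrow> nat \<Rightarrow> int" where
  "binary_digit a k = \<lfloor>2 ^ Suc k * a\<rfloor> mod 2"

lemma binary_digit_range: "binary_digit a k \<in> {0, 1}"
  by (auto simp: binary_digit_def)

text \<open>The partial sums are the dyadic truncations of \<open>a\<close> from below;
  \<open>a < 1\<close> makes the integer part vanish.\<close>

lemma binary_digit_sums:
  assumes "0 \<le> a" "a < 1"
  shows "(\<lambda>k. real_of_int (binary_digit a k) * (1/2) ^ Suc k) sums a"
proof -
  have partial: "(\<Sum>k<n. real_of_int (binary_digit a k) * (1/2) ^ Suc k) = real_of_int \<lfloor>2 ^ n * a\<rfloor> * (1/2) ^ n" for n
  proof (induction n)
    case 0
    have "\<lfloor>a\<rfloor> = 0" using assms by (simp add: floor_eq_iff)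
    then show ?case by simp
  next
    case (Suc n)
    have "\<lfloor>2 ^ Suc n * a\<rfloor> div 2 = \<lfloor>2 ^ n * a\<rfloor>"
      using floor_divide_real_eq_div[of 2 "2 ^ Suc n * a"] by simp
    then have "\<lfloor>2 ^ Suc n * a\<rfloor> = 2 * \<lfloor>2 ^ n * a\<rfloor> + binary_digit a n"
      unfolding binary_digit_def by (metis mult_div_mod_eq)
    then have "real_of_int \<lfloor>2 ^ Suc n * a\<rfloor> = 2 * real_of_int \<lfloor>2 ^ n * a\<rfloor> + real_of_int (binary_digit a n)" by simp
    then show ?case using Suc by (simp add: algebra_simps)
  qed
  have "(\<lambda>n. real_of_int \<lfloor>2 ^ n * a\<rfloor> * (1/2) ^ n) \<longlonglongrightarrow> a"
  proof (rule real_tendsto_sandwich)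
    show "\<forall>\<^sub>F n in sequentially. a - (1/2) ^ n \<le> real_of_int \<lfloor>2 ^ n * a\<rfloor> * (1/2) ^ n"
    proof (rule always_eventually, rule allI)
      fix n
      have "(2 ^ n * a - 1) * (1/2) ^ n \<le> real_of_int \<lfloor>2 ^ n * a\<rfloor> * (1/2) ^ n"
        by (intro mult_right_mono) (linarith | simp)+
      then show "a - (1/2) ^ n \<le> real_of_int \<lfloor>2 ^ n * a\<rfloor> * (1/2) ^ n"
        by (simp add: field_simps)
    qed
    show "\<forall>\<^sub>F n in sequentially. real_of_int \<lfloor>2 ^ n * a\<rfloor> * (1/2) ^ n \<le> a"
    proof (rule always_eventually, rule allI)
      fix n
      have "real_of_int \<lfloor>2 ^ n * a\<rfloor> * (1/2) ^ n \<le> (2 ^ n * a) * (1/2) ^ n"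
        by (intro mult_right_mono) (linarith | simp)+
      then show "real_of_int \<lfloor>2 ^ n * a\<rfloor> * (1/2) ^ n \<le> a" by (simp add: field_simps)
    qed
    have "(\<lambda>n. a - (1/2) ^ n) \<longlonglongrightarrow> a - 0"
      by (intro tendsto_intros LIMSEQ_power_zero) auto
    then show "(\<lambda>n. a - (1/2) ^ n) \<longlonglongrightarrow> a" by simp
  qed auto
  then show ?thesis unfolding sums_def partial .
qed

text \<open>\<open>\<sigma>\<close> interleaves the binary digits of the rescaled coordinates into
  one point of the Cantor set, and \<open>\<pi>\<close> reads them back. Digits are floors, so
  \<open>\<sigma>\<close> is Borel; \<open>\<pi>\<close> is a uniformly convergent series of waves,
  so it is continuous. Away from the points \<open>\<sigma> a\<close> with \<open>a \<in> K\<close>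
  the curve may leave \<open>K\<close>.\<close>

lemma space_filling_curve:
  fixes K :: "'c::euclidean_space set"
  assumes "bounded K"
  obtains \<pi> :: "real \<Rightarrow> 'c" and \<sigma> :: "'c \<Rightarrow> real" where
    "continuous_on UNIV \<pi>" "\<sigma> \<in> borel_measurable borel"
    "\<And>a. a \<in> K \<Longrightarrow> \<pi> (\<sigma> a) = a" "\<And>a. 0 \<le> \<sigma> a \<and> \<sigma> a \<le> 1"
proof -
  obtain B where B: "B > 0" "\<And>a. a \<in> K \<Longrightarrow> norm a < B"
    using assms by (metis bounded_pos_less)
  define m where "m = DIM('c)"
  have m: "m > 0" by (simp add: m_def)
  obtain e where e: "bij_betw e {..<m} (Basis :: 'c set)"
    using ex_bij_betw_nat_finite[OF finite_Basis] unfolding m_def atLeast0LessThan by blast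
  \<comment> \<open>The strict bound on the norm puts the rescaled coordinates of points of
    \<open>K\<close> into [0, 1), where the binary expansion applies.\<close>
  define c where "c a i = (a \<bullet> e i + B) / (2 * B)" for a :: 'c and i
  \<comment> \<open>Digit \<open>j\<close> belongs to coordinate \<open>j mod m\<close>, so
    coordinate \<open>i\<close> occupies the positions \<open>i + m * k\<close>, which are those
    read by \<open>\<pi>c i\<close>.\<close>
  define dg where "dg a j = binary_digit (c a (j mod m)) (j div m)" for a j
  define \<sigma> where "\<sigma> a = ternary (dg a)" for a
  define \<pi>c where "\<pi>c i x = (\<Sum>k. schoenberg_wave (3 ^ (i + m * k) * x) * (1/2) ^ Suc k)" for i x
  define \<pi> where "\<pi> x = (\<Sum>i<m. (2 * B * \<pi>c i x - B) *\<^sub>R e i)" for x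
  have range: "dg a j \<in> {0, 1}" for a j unfolding dg_def by (rule binary_digit_range)
  have "continuous_on UNIV (\<pi>c i)" for i
  proof -
    have "uniform_limit UNIV (\<lambda>n x. \<Sum>k<n. schoenberg_wave (3 ^ (i + m * k) * x) * (1/2) ^ Suc k) (\<pi>c i) sequentially"
      unfolding \<pi>c_def
    proof (rule Weierstrass_m_test)
      show "norm (schoenberg_wave (3 ^ (i + m * k) * x) * (1/2) ^ Suc k) \<le> (1/2) ^ Suc k" for k x
        using schoenberg_wave_bound[of "3 ^ (i + m * k) * x"] by (simp add: abs_mult mult_left_le_one_le)
      show "summable (\<lambda>k. (1/2::real) ^ Suc k)" by (auto simp: summable_geometric)
    qed
    moreover have "continuous_on UNIV (\<lambda>x. schoenberg_wave (3 ^ (i + m * k) * x))" for k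
      by (rule continuous_on_compose2[OF continuous_schoenberg_wave]) (auto intro!: continuous_intros)
    then have "\<forall>\<^sub>F n in sequentially. continuous_on UNIV (\<lambda>x. \<Sum>k<n. schoenberg_wave (3 ^ (i + m * k) * x) * (1/2) ^ Suc k)"
      by (intro always_eventually allI continuous_intros)
    ultimately show ?thesis by (intro uniform_limit_theorem[OF _ _ trivial_limit_sequentially])
  qed
  then have cont: "continuous_on UNIV \<pi>" unfolding \<pi>_def by (intro continuous_intros)
  have "(\<lambda>a. 2 * real_of_int (dg a j) * (1/3) ^ Suc j) \<in> borel_measurable borel" for j
    unfolding dg_def binary_digit_def c_def by measurable
  then have meas: "\<sigma> \<in> borel_measurable borel"
    unfolding \<sigma>_def ternary_def by measurable
  show thesis
  proof (rule that[OF cont meas])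
    show "0 \<le> \<sigma> a \<and> \<sigma> a \<le> 1" for a
      unfolding \<sigma>_def using ternary_bound[of "dg a", OF range] by blast
    fix a assume a: "a \<in> K"
    have "\<pi>c i (\<sigma> a) = c a i" if i: "i < m" for i
    proof -
      have "\<bar>a \<bullet> e i\<bar> \<le> norm a"
        using e i by (intro Basis_le_norm) (auto simp: bij_betw_def)
      then have "- B < a \<bullet> e i" "a \<bullet> e i < B" using B(2)[OF a] by linarith+
      then have "0 \<le> c a i" "c a i < 1" using B(1) by (simp_all add: c_def)
      then have "(\<lambda>k. real_of_int (binary_digit (c a i) k) * (1/2) ^ Suc k) sums c a i"
        by (rule binary_digit_sums)
      moreover have "schoenberg_wave (3 ^ (i + m * k) * \<sigma> a) = real_of_int (binary_digit (c a i) k)" for k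
        unfolding \<sigma>_def schoenberg_wave_ternary[of "dg a", OF range] using i by (simp add: dg_def)
      ultimately show ?thesis unfolding \<pi>c_def by (simp add: sums_iff)
    qed
    then have "\<pi> (\<sigma> a) = (\<Sum>i<m. (2 * B * c a i - B) *\<^sub>R e i)" by (simp add: \<pi>_def)
    also have "\<dots> = (\<Sum>i<m. (a \<bullet> e i) *\<^sub>R e i)" using B(1) by (simp add: c_def)
    also have "\<dots> = (\<Sum>b\<in>Basis. (a \<bullet> b) *\<^sub>R b)"
      by (rule sum.reindex_bij_betw[OF e])
    finally show "\<pi> (\<sigma> a) = a" by (simp add: euclidean_representation)
  qed
qed

section \<open>Limits of relaxed controls\<close>

definition unit_clamp :: "real \<Rightarrow> real" where
  "unit_clamp x = max 0 (min 1 x)"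

lemma unit_clamp_range: "0 \<le> unit_clamp x" "unit_clamp x \<le> 1"
  by (auto simp: unit_clamp_def)

lemma unit_clamp_id: "0 \<le> x \<Longrightarrow> x \<le> 1 \<Longrightarrow> unit_clamp x = x"
  by (auto simp: unit_clamp_def)

lemma continuous_unit_clamp [continuous_intros]: "continuous_on S unit_clamp"
  unfolding unit_clamp_def[abs_def] by (intro continuous_intros)

lemma measurable_unit_clamp [measurable]: "unit_clamp \<in> borel_measurable borel"
  by (rule borel_measurable_continuous_onI[OF continuous_unit_clamp])

text \<open>The generators are the weak-* open sets, so this is the Borel structure used for relaxed
  controls.\<close>

abbreviation relaxed_space :: "'c::euclidean_space set \<Rightarrow> 'c measure measure" where
  "relaxed_space K \<equiv> sigma (radon_prob K) {U. openin (weak_star K) U}"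

lemma integral_radon_cong:
  fixes K :: "'c::euclidean_space set"
  assumes "\<mu> \<in> radon_prob K" "\<And>a. a \<in> K \<Longrightarrow> f a = g a"
  shows "(LINT a|\<mu>. f a) = (LINT a|\<mu>. g a)"
proof -
  have "space \<mu> = K" using assms(1) sets_eq_imp_space_eq[of \<mu> "restrict_space borel K"]
    by (simp add: radon_prob_def space_restrict_space)
  then show ?thesis using assms(2) by (intro Bochner_Integration.integral_cong) auto
qed

text \<open>The preimage of an open set under integration of \<open>\<phi>\<close> is a subbasic
  open set of the weak-* topology.\<close>

lemma measurable_relaxed_integral:
  fixes \<phi> :: "'c::euclidean_space \<Rightarrow> real"
  assumes \<mu>: "\<mu> \<in> measurable N (relaxed_space K)"
    and \<phi>: "continuous_on K \<phi>"
  shows "(\<lambda>t. LINT a|\<mu> t. \<phi> a) \<in> borel_measurable N"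
proof (rule borel_measurableI)
  fix U :: "real set" assume U: "open U"
  have tops: "topspace (weak_star K) \<subseteq> radon_prob K"
    unfolding weak_star_def topology_generated_by_topspace by auto
  then have sub: "{U. openin (weak_star K) U} \<subseteq> Pow (radon_prob K)"
    using openin_subset by blast
  have sp: "\<mu> t \<in> radon_prob K" if "t \<in> space N" for t
    using measurable_space[OF \<mu> that] sub by (simp add: space_measure_of)
  have "openin (weak_star K) {\<nu> \<in> radon_prob K. (\<integral>a. \<phi> a \<partial>\<nu>) \<in> U}"
    unfolding weak_star_def by (rule topology_generated_by_Basis) (use U \<phi> in blast)
  then have "{\<nu> \<in> radon_prob K. (\<integral>a. \<phi> a \<partial>\<nu>) \<in> U} \<in> sets (relaxed_space K)"
    using sub by (simp add: in_measure_of)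
  from measurable_sets[OF \<mu> this]
  have "\<mu> -` {\<nu> \<in> radon_prob K. (\<integral>a. \<phi> a \<partial>\<nu>) \<in> U} \<inter> space N \<in> sets N" .
  moreover have "\<mu> -` {\<nu> \<in> radon_prob K. (\<integral>a. \<phi> a \<partial>\<nu>) \<in> U} \<inter> space N
      = (\<lambda>t. LINT a|\<mu> t. \<phi> a) -` U \<inter> space N"
    using sp by auto
  ultimately show "(\<lambda>t. LINT a|\<mu> t. \<phi> a) -` U \<inter> space N \<in> sets N" by simp
qed

section \<open>Measures on K, described by measures on the unit interval and their moments\<close>

locale parametrised_compact =
  fixes K :: "'c::euclidean_space set" and \<pi> :: "real \<Rightarrow> 'c" and \<sigma> :: "'c \<Rightarrow> real"
  assumes compact_K: "compact K" and K_ne: "K \<noteq> {}"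
    and curve_cont: "continuous_on UNIV \<pi>"
    and \<sigma>_meas [measurable]: "\<sigma> \<in> borel_measurable borel"
    and curve_inv: "\<And>a. a \<in> K \<Longrightarrow> \<pi> (\<sigma> a) = a"
    and \<sigma>_range: "\<And>a. 0 \<le> \<sigma> a \<and> \<sigma> a \<le> 1"
begin

text \<open>Clamping makes continuous functions of the parameter bounded on the whole line, as weak
  convergence of measures on the line requires.\<close>

definition param :: "real \<Rightarrow> 'c" where "param x = \<pi> (unit_clamp x)"

definition admissible :: "real measure \<Rightarrow> bool" where
  "admissible \<nu> \<longleftrightarrow> real_distribution \<nu> \<and> (AE x in \<nu>. param x \<in> K)"

definition base :: 'c where "base = (SOME a. a \<in> K)"

text \<open>\<open>base\<close> catches the parameters that miss \<open>K\<close>, a null set if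
  \<open>\<nu>\<close> is admissible, so that the map takes values in \<open>K\<close> everywhere
  and is measurable into the restricted space.\<close>

definition push :: "real measure \<Rightarrow> 'c measure" where
  "push \<nu> = distr \<nu> (restrict_space borel K) (\<lambda>x. if param x \<in> K then param x else base)"

definition moment :: "real measure \<Rightarrow> nat \<Rightarrow> real" where
  "moment \<nu> k = (LINT x|\<nu>. unit_clamp x ^ k)"

lemma base_in: "base \<in> K" unfolding base_def using K_ne by (auto intro: someI)

lemma param_cont: "continuous_on S param"
  unfolding param_def by (rule continuous_on_compose2[OF curve_cont]) (auto intro: continuous_intros)

lemma param_meas [measurable]: "param \<in> borel_measurable borel"
  by (rule borel_measurable_continuous_onI[OF param_cont])

lemma param_\<sigma>: "a \<in> K \<Longrightarrow> param (\<sigma> a) = a"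
  using \<sigma>_range[of a] by (simp add: param_def unit_clamp_id curve_inv)

lemma K_borel [measurable]: "K \<in> sets borel"
  using compact_K by (simp add: borel_compact)

lemma push_map_measurable:
  assumes "real_distribution \<nu>"
  shows "(\<lambda>x. if param x \<in> K then param x else base) \<in> measurable \<nu> (restrict_space borel K)"
proof -
  interpret real_distribution \<nu> by fact
  have "(\<lambda>x. if param x \<in> K then param x else base) \<in> borel_measurable \<nu>"
    unfolding measurable_cong_sets[OF events_eq_borel refl] by measurable
  then show ?thesis using base_in by (intro measurable_restrict_space2) auto
qed

lemma push_radon:
  assumes "admissible \<nu>"
  shows "push \<nu> \<in> radon_prob K"
proof -
  interpret real_distribution \<nu> using assms by (simp add: admissible_def)
  show ?thesis
    unfolding radon_prob_def push_def
    by (auto intro!: prob_space_distr push_map_measurable real_distribution_axioms)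
qed

text \<open>\<open>\<Phi>\<close> is continuous on the whole space so that
  \<open>\<Phi> (param x)\<close> is measurable also where \<open>param x\<close> misses
  \<open>K\<close>; a function on \<open>K\<close> is first extended by Tietze's theorem.\<close>

lemma push_integral:
  fixes \<Phi> :: "'c \<Rightarrow> real"
  assumes \<nu>: "admissible \<nu>" and \<Phi>: "continuous_on UNIV \<Phi>"
  shows "(LINT a|push \<nu>. \<Phi> a) = (LINT x|\<nu>. \<Phi> (param x))"
proof -
  interpret real_distribution \<nu> using \<nu> by (simp add: admissible_def)
  have m [measurable]: "\<Phi> \<in> borel_measurable borel" by (rule borel_measurable_continuous_onI[OF \<Phi>])
  have "(LINT a|push \<nu>. \<Phi> a) = (LINT x|\<nu>. \<Phi> (if param x \<in> K then param x else base))"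
    unfolding push_def by (rule integral_distr)
      (auto intro!: push_map_measurable real_distribution_axioms measurable_restrict_space1)
  also have "\<dots> = (LINT x|\<nu>. \<Phi> (param x))"
  proof (rule integral_cong_AE)
    show "AE x in \<nu>. \<Phi> (if param x \<in> K then param x else base) = \<Phi> (param x)"
      using \<nu> unfolding admissible_def by auto
  qed (unfold measurable_cong_sets[OF events_eq_borel refl], measurable)
  finally show ?thesis .
qed

lemma tietze_K:
  fixes \<phi> :: "'c \<Rightarrow> real"
  assumes "continuous_on K \<phi>"
  obtains \<Phi> where "continuous_on UNIV \<Phi>" "\<And>a. a \<in> K \<Longrightarrow> \<Phi> a = \<phi> a"
proof (rule Tietze_unbounded[OF assms, of UNIV])
  show "closedin (top_of_set UNIV) K" using compact_K by (simp add: compact_imp_closed)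
qed (use that in blast)

text \<open>By the Weierstrass theorem \<open>\<Phi> (\<pi> x)\<close> is uniformly close to a
  polynomial on [0, 1]. The coefficients do not depend on the measure, and this uniformity gives
  both convergence of integrals and their continuity in the moments.\<close>

lemma moment_approx:
  fixes \<phi> :: "'c \<Rightarrow> real"
  assumes \<phi>: "continuous_on K \<phi>" and e: "e > 0"
  obtains c n where "\<And>\<nu>. admissible \<nu> \<Longrightarrow> \<bar>(LINT a|push \<nu>. \<phi> a) - (\<Sum>i\<le>n. c i * moment \<nu> i)\<bar> \<le> e"
proof -
  obtain \<Phi> where \<Phi>: "continuous_on UNIV \<Phi>" "\<And>a. a \<in> K \<Longrightarrow> \<Phi> a = \<phi> a"
    using tietze_K[OF \<phi>] by blast
  have c1: "continuous_on {0..1} (\<lambda>x. \<Phi> (\<pi> x))"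
    by (rule continuous_on_compose2[OF \<Phi>(1)]) (auto intro: continuous_on_subset[OF curve_cont])
  obtain g where g: "real_polynomial_function g" "\<And>x. x \<in> {0..1} \<Longrightarrow> \<bar>\<Phi> (\<pi> x) - g x\<bar> < e"
    using Stone_Weierstrass_real_polynomial_function[OF compact_Icc c1 e] by blast
  obtain c n where cn: "g = (\<lambda>x. \<Sum>i\<le>n. c i * x ^ i)"
    using g(1) real_polynomial_function_iff_sum by blast
  show thesis
  proof (rule that[of c n])
    fix \<nu> assume \<nu>: "admissible \<nu>"
    interpret real_distribution \<nu> using \<nu> by (simp add: admissible_def)
    have [measurable_cong]: "sets \<nu> = sets borel" by simp
    have m [measurable]: "\<Phi> \<in> borel_measurable borel" by (rule borel_measurable_continuous_onI[OF \<Phi>(1)])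
    have ip: "integrable \<nu> (\<lambda>x. unit_clamp x ^ i)" for i
      by (rule integrable_const_bound[of _ 1]) (auto simp: unit_clamp_range power_le_one)
    have "compact (\<Phi> ` \<pi> ` {0..1})"
      by (intro compact_continuous_image compact_Icc continuous_on_subset[OF \<Phi>(1)] continuous_on_subset[OF curve_cont]) auto
    then obtain B where B: "\<And>x. x \<in> {0..1} \<Longrightarrow> \<bar>\<Phi> (\<pi> x)\<bar> \<le> B"
      unfolding image_image by (force dest!: compact_imp_bounded simp: bounded_iff)
    have i\<Phi>: "integrable \<nu> (\<lambda>x. \<Phi> (param x))"
    proof (rule integrable_const_bound[of _ B])
      show "AE x in \<nu>. norm (\<Phi> (param x)) \<le> B" by (auto simp: param_def B unit_clamp_range)
    qed measurable
    have "(LINT a|push \<nu>. \<phi> a) = (LINT a|push \<nu>. \<Phi> a)"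
      by (rule integral_radon_cong[OF push_radon[OF \<nu>]]) (simp add: \<Phi>(2))
    also have "\<dots> = (LINT x|\<nu>. \<Phi> (param x))" by (rule push_integral[OF \<nu> \<Phi>(1)])
    finally have "(LINT a|push \<nu>. \<phi> a) - (\<Sum>i\<le>n. c i * moment \<nu> i)
        = (LINT x|\<nu>. \<Phi> (param x) - (\<Sum>i\<le>n. c i * unit_clamp x ^ i))"
      using ip i\<Phi> by (simp add: moment_def)
    also have "\<bar>\<dots>\<bar> \<le> (LINT x|\<nu>. \<bar>\<Phi> (param x) - (\<Sum>i\<le>n. c i * unit_clamp x ^ i)\<bar>)"
      by (rule integral_abs_bound)
    also have "\<dots> \<le> e"
    proof (rule integral_le_const)
      show "integrable \<nu> (\<lambda>x. \<bar>\<Phi> (param x) - (\<Sum>i\<le>n. c i * unit_clamp x ^ i)\<bar>)"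
        using ip i\<Phi> by auto
      show "AE x in \<nu>. \<bar>\<Phi> (param x) - (\<Sum>i\<le>n. c i * unit_clamp x ^ i)\<bar> \<le> e"
        using g(2) unit_clamp_range unfolding cn param_def by (auto intro!: less_imp_le)
    qed
    finally show "\<bar>(LINT a|push \<nu>. \<phi> a) - (\<Sum>i\<le>n. c i * moment \<nu> i)\<bar> \<le> e" .
  qed
qed

text \<open>The polynomial approximation is equally good for all the measures, so convergence of
  finitely many moments suffices for each accuracy.\<close>

lemma push_converges:
  fixes \<phi> :: "'c \<Rightarrow> real"
  assumes \<phi>: "continuous_on K \<phi>" and \<nu>: "\<And>k. admissible (\<nu> k)" and \<nu>': "admissible \<nu>'"
    and lim: "\<And>i. (\<lambda>k. moment (\<nu> k) i) \<longlonglongrightarrow> moment \<nu>' i"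
  shows "(\<lambda>k. LINT a|push (\<nu> k). \<phi> a) \<longlonglongrightarrow> (LINT a|push \<nu>'. \<phi> a)"
proof (rule LIMSEQ_I)
  fix e :: real assume "e > 0"
  then have e: "e / 4 > 0" by simp
  obtain c n where cn: "\<And>\<nu>. admissible \<nu> \<Longrightarrow> \<bar>(LINT a|push \<nu>. \<phi> a) - (\<Sum>i\<le>n. c i * moment \<nu> i)\<bar> \<le> e / 4"
    using moment_approx[OF \<phi> e] by blast
  have "(\<lambda>k. \<Sum>i\<le>n. c i * moment (\<nu> k) i) \<longlonglongrightarrow> (\<Sum>i\<le>n. c i * moment \<nu>' i)"
    by (intro tendsto_intros lim)
  from LIMSEQ_D[OF this e, unfolded real_norm_def] obtain N where N: "\<And>k. k \<ge> N \<Longrightarrow> \<bar>(\<Sum>i\<le>n. c i * moment (\<nu> k) i) - (\<Sum>i\<le>n. c i * moment \<nu>' i)\<bar> < e / 4"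
    by blast
  show "\<exists>N. \<forall>k\<ge>N. norm ((LINT a|push (\<nu> k). \<phi> a) - (LINT a|push \<nu>'. \<phi> a)) < e"
  proof (intro exI[of _ N] allI impI)
    fix k assume "k \<ge> N"
    then show "norm ((LINT a|push (\<nu> k). \<phi> a) - (LINT a|push \<nu>'. \<phi> a)) < e"
      using N[of k] cn[OF \<nu>[of k]] cn[OF \<nu>'] \<open>e > 0\<close> unfolding real_norm_def abs_less_iff abs_le_iff
      by linarith
  qed
qed

text \<open>Mass 1 on [0, 1] gives tightness, so a subsequence converges weakly by Helly's theorem.
  Powers of the clamp are bounded and continuous, hence the limit measure has the limit
  moments.\<close>

lemma moment_limit:
  assumes \<nu>: "\<And>k. admissible (\<nu> k)" and supp: "\<And>k. measure (\<nu> k) {0..1} = 1"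
    and lim: "\<And>i. (\<lambda>k. moment (\<nu> k) i) \<longlonglongrightarrow> m i"
  shows "\<exists>\<nu>'. admissible \<nu>' \<and> (\<forall>i. moment \<nu>' i = m i)"
proof -
  have rd: "real_distribution (\<nu> k)" for k using \<nu>[of k] by (simp add: admissible_def)
  have "tight \<nu>"
    unfolding tight_def
  proof (intro conjI allI impI rd)
    fix e :: real assume e: "e > 0"
    show "\<exists>a b. a < b \<and> (\<forall>n. 1 - e < measure (\<nu> n) {a<..b})"
    proof (rule exI[of _ "-1"], rule exI[of _ 1], intro conjI allI)
      fix n
      interpret real_distribution "\<nu> n" by (rule rd)
      have "measure (\<nu> n) {0..1} \<le> measure (\<nu> n) {-1<..1}"
        by (rule finite_measure_mono) auto
      then show "1 - e < measure (\<nu> n) {-1<..1}" using supp[of n] e by simp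
    qed simp
  qed
  then obtain r \<nu>' where r: "strict_mono r" and \<nu>': "real_distribution \<nu>'"
    and wc: "weak_conv_m (\<nu> \<circ> id \<circ> r) \<nu>'"
    using tight_imp_convergent_subsubsequence[of \<nu> id] strict_mono_id by blast
  interpret \<nu>': real_distribution \<nu>' by fact
  have conv: "(\<lambda>n. LINT x|\<nu> (r n). f x) \<longlonglongrightarrow> (LINT x|\<nu>'. f x)"
    if f: "continuous_on UNIV f" and B: "\<And>x. norm (f x) \<le> B" for f :: "real \<Rightarrow> real" and B
  proof -
    have "(\<lambda>n. integral\<^sup>L ((\<nu> \<circ> id \<circ> r) n) f) \<longlonglongrightarrow> integral\<^sup>L \<nu>' f"
      by (rule weak_conv_imp_integral_bdd_continuous_conv[OF _ \<nu>' wc, of f B])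
        (use rd f B in \<open>auto simp: continuous_on_eq_continuous_at\<close>)
    then show ?thesis by simp
  qed
  have "moment \<nu>' i = m i" for i
  proof -
    have "(\<lambda>n. moment (\<nu> (r n)) i) \<longlonglongrightarrow> moment \<nu>' i"
      unfolding moment_def
      by (rule conv[of _ 1]) (auto intro!: continuous_intros simp: unit_clamp_range power_le_one)
    moreover have "(\<lambda>n. moment (\<nu> (r n)) i) \<longlonglongrightarrow> m i"
      using LIMSEQ_subseq_LIMSEQ[OF lim r] by (simp add: o_def)
    ultimately show ?thesis by (rule LIMSEQ_unique)
  qed
  moreover have "AE x in \<nu>'. param x \<in> K"
  proof -
    \<comment> \<open>A bounded continuous function vanishing exactly where \<open>param x\<close>
      lies in the closed set \<open>K\<close>; its integral is zero along the sequence and hence in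
      the limit.\<close>
    define f where "f x = min 1 (infdist (param x) K)" for x
    have fc: "continuous_on UNIV f"
      unfolding f_def by (intro continuous_intros param_cont)
    have f0: "f x \<ge> 0" "f x \<le> 1" for x by (auto simp: f_def infdist_nonneg)
    have fm [measurable]: "f \<in> borel_measurable borel" by (rule borel_measurable_continuous_onI[OF fc])
    have "(LINT x|\<nu> (r n). f x) = 0" for n
    proof -
      have "AE x in \<nu> (r n). f x = 0"
        using \<nu>[of "r n"] unfolding admissible_def by (auto simp: f_def elim!: eventually_mono)
      then show ?thesis by (rule integral_eq_zero_AE)
    qed
    moreover have "(\<lambda>n. LINT x|\<nu> (r n). f x) \<longlonglongrightarrow> (LINT x|\<nu>'. f x)"
      by (rule conv[OF fc, of 1]) (use f0 in auto)
    ultimately have z: "(LINT x|\<nu>'. f x) = 0" by (simp add: LIMSEQ_const_iff)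
    have [measurable_cong]: "sets \<nu>' = sets borel" by simp
    have "integrable \<nu>' f" by (rule \<nu>'.integrable_const_bound[of _ 1]) (use f0 in auto)
    then have "AE x in \<nu>'. f x = 0"
      using z f0 by (subst (asm) integral_nonneg_eq_0_iff_AE) auto
    moreover have "param x \<in> K" if "f x = 0" for x
      using that in_closed_iff_infdist_zero[OF compact_imp_closed[OF compact_K] K_ne, of "param x"]
      by (auto simp: f_def min_def split: if_splits)
    ultimately show ?thesis by auto
  qed
  ultimately show ?thesis using \<nu>' unfolding admissible_def by blast
qed

section \<open>Borel dependence of the measure on its moments\<close>

definition moment_sequences :: "(nat \<Rightarrow> real) set" where
  "moment_sequences = {m. \<exists>\<nu>. admissible \<nu> \<and> (\<forall>i. moment \<nu> i = m i)}"

text \<open>Several measures may share the moments, but by \<open>moment_approx\<close> they give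
  the same integrals of continuous functions on \<open>K\<close> after pushing forward; the
  arbitrary choice therefore does no harm to continuity.\<close>

definition measure_of_moments :: "(nat \<Rightarrow> real) \<Rightarrow> real measure" where
  "measure_of_moments m = (SOME \<nu>. admissible \<nu> \<and> (\<forall>i. moment \<nu> i = m i))"

lemma measure_of_moments:
  assumes "m \<in> moment_sequences"
  shows "admissible (measure_of_moments m)" "moment (measure_of_moments m) i = m i"
proof -
  have "admissible (measure_of_moments m) \<and> (\<forall>i. moment (measure_of_moments m) i = m i)"
    unfolding measure_of_moments_def by (rule someI_ex) (use assms in \<open>simp add: moment_sequences_def\<close>)
  then show "admissible (measure_of_moments m)" "moment (measure_of_moments m) i = m i" by auto
qed

text \<open>By continuity on generators it suffices to treat one integral. It is a uniform limit, on
  all moment sequences, of finite linear combinations of coordinates, and these are continuous for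
  the product topology.\<close>

lemma continuous_push_moments:
  "continuous_map (top_of_set moment_sequences) (weak_star K) (\<lambda>m. push (measure_of_moments m))"
  unfolding weak_star_def
proof (rule continuous_on_generated_topo)
  let ?\<Psi> = "\<lambda>m. push (measure_of_moments m)"
  have radon: "?\<Psi> m \<in> radon_prob K" if "m \<in> moment_sequences" for m
    by (rule push_radon[OF measure_of_moments(1)[OF that]])
  show "?\<Psi> ` topspace (top_of_set moment_sequences) \<subseteq>
      \<Union> {{\<mu> \<in> radon_prob K. (\<integral>a. \<phi> a \<partial>\<mu>) \<in> U} | (\<phi> :: 'c \<Rightarrow> real) U. continuous_on K \<phi> \<and> open U}"
  proof
    fix \<mu> assume "\<mu> \<in> ?\<Psi> ` topspace (top_of_set moment_sequences)"
    then have "\<mu> \<in> {\<mu> \<in> radon_prob K. (\<integral>a. (\<lambda>_. 0::real) a \<partial>\<mu>) \<in> UNIV}" using radon by auto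
    then show "\<mu> \<in> \<Union> {{\<mu> \<in> radon_prob K. (\<integral>a. \<phi> a \<partial>\<mu>) \<in> U} | (\<phi> :: 'c \<Rightarrow> real) U. continuous_on K \<phi> \<and> open U}"
      by (intro UnionI[of "{\<mu> \<in> radon_prob K. (\<integral>a. (\<lambda>_. 0::real) a \<partial>\<mu>) \<in> UNIV}"])
        (auto intro!: exI[of _ "\<lambda>_. 0::real"] exI[of _ UNIV])
  qed
  fix U assume "U \<in> {{\<mu> \<in> radon_prob K. (\<integral>a. \<phi> a \<partial>\<mu>) \<in> U} | (\<phi> :: 'c \<Rightarrow> real) U. continuous_on K \<phi> \<and> open U}"
  then obtain \<phi> :: "'c \<Rightarrow> real" and W where U: "U = {\<mu> \<in> radon_prob K. (\<integral>a. \<phi> a \<partial>\<mu>) \<in> W}"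
    and \<phi>: "continuous_on K \<phi>" and W: "open W" by blast
  define G where "G m = (LINT a|?\<Psi> m. \<phi> a)" for m
  have "\<exists>c n. \<forall>m\<in>moment_sequences. \<bar>G m - (\<Sum>i\<le>n. c i * m i)\<bar> \<le> inverse (real (Suc k))" for k :: nat
  proof -
    have "inverse (real (Suc k)) > 0" by simp
    from moment_approx[OF \<phi> this] obtain c n where
      cn: "\<And>\<nu>. admissible \<nu> \<Longrightarrow> \<bar>(LINT a|push \<nu>. \<phi> a) - (\<Sum>i\<le>n. c i * moment \<nu> i)\<bar> \<le> inverse (real (Suc k))"
      by blast
    show ?thesis
    proof (intro exI ballI)
      fix m assume m: "m \<in> moment_sequences"
      show "\<bar>G m - (\<Sum>i\<le>n. c i * m i)\<bar> \<le> inverse (real (Suc k))"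
        using cn[OF measure_of_moments(1)[OF m]] by (simp add: G_def measure_of_moments(2)[OF m])
    qed
  qed
  then obtain c n where cn: "\<And>k m. m \<in> moment_sequences \<Longrightarrow>
      \<bar>G m - (\<Sum>i\<le>n k. c k i * m i)\<bar> \<le> inverse (real (Suc k))" by metis
  have "uniform_limit moment_sequences (\<lambda>k m. \<Sum>i\<le>n k. c k i * m i) G sequentially"
  proof (rule uniform_limitI)
    fix e :: real assume "e > 0"
    then have "\<forall>\<^sub>F k in sequentially. inverse (real (Suc k)) < e"
      using LIMSEQ_inverse_real_of_nat by (intro order_tendstoD(2)) auto
    then show "\<forall>\<^sub>F k in sequentially. \<forall>m\<in>moment_sequences. dist (\<Sum>i\<le>n k. c k i * m i) (G m) < e"
    proof eventually_elim
      case (elim k)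
      show ?case
      proof
        fix m assume "m \<in> moment_sequences"
        from cn[OF this, of k] elim show "dist (\<Sum>i\<le>n k. c k i * m i) (G m) < e"
          by (simp add: dist_real_def abs_minus_commute)
      qed
    qed
  qed
  moreover have "\<forall>\<^sub>F k in sequentially. continuous_on moment_sequences (\<lambda>m. \<Sum>i\<le>n k. c k i * m i)"
    by (intro always_eventually allI continuous_intros continuous_on_subset[OF continuous_on_product_coordinates]) auto
  ultimately have "continuous_on moment_sequences G"
    by (intro uniform_limit_theorem[OF _ _ trivial_limit_sequentially])
  then have "openin (top_of_set moment_sequences) (moment_sequences \<inter> G -` W)"
    by (rule continuous_openin_preimage_gen[OF _ W])
  moreover have "?\<Psi> -` U \<inter> topspace (top_of_set moment_sequences) = moment_sequences \<inter> G -` W"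
    using radon by (auto simp: U G_def)
  ultimately show "openin (top_of_set moment_sequences) (?\<Psi> -` U \<inter> topspace (top_of_set moment_sequences))"
    by simp
qed

text \<open>A sequence-valued map with measurable coordinates is Borel for the product topology;
  composition with the continuous map from moments to measures gives a weak-* Borel map.\<close>

lemma measurable_push_moments:
  assumes m: "\<And>i. (\<lambda>t. m t i) \<in> borel_measurable N" and ms: "\<And>t. t \<in> space N \<Longrightarrow> m t \<in> moment_sequences"
  shows "(\<lambda>t. push (measure_of_moments (m t))) \<in>
    measurable N (relaxed_space K)"
proof (rule measurable_measure_of)
  have tops: "topspace (weak_star K) \<subseteq> radon_prob K"
    unfolding weak_star_def topology_generated_by_topspace by auto
  show "{U. openin (weak_star K) U} \<subseteq> Pow (radon_prob K)"
    using tops openin_subset by blast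
  show "(\<lambda>t. push (measure_of_moments (m t))) \<in> space N \<rightarrow> radon_prob K"
    using push_radon measure_of_moments(1) ms by blast
  fix U assume "U \<in> {U. openin (weak_star K) U}"
  then have "openin (top_of_set moment_sequences)
      {m \<in> topspace (top_of_set moment_sequences). push (measure_of_moments m) \<in> U}"
    by (intro openin_continuous_map_preimage[OF continuous_push_moments]) auto
  then obtain W where W: "open W" "{m \<in> moment_sequences. push (measure_of_moments m) \<in> U} = moment_sequences \<inter> W"
    by (auto simp: openin_open)
  have "m \<in> borel_measurable N"
    using measurable_coordinatewise_then_product[of m N] m by simp
  then have "m -` W \<inter> space N \<in> sets N"
    using W(1) by (intro measurable_sets) auto
  moreover have "(\<lambda>t. push (measure_of_moments (m t))) -` U \<inter> space N = m -` W \<inter> space N"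
    using W(2) ms by blast
  ultimately show "(\<lambda>t. push (measure_of_moments (m t))) -` U \<inter> space N \<in> sets N" by simp
qed

section \<open>Limits of averaged Dirac masses\<close>

definition empirical :: "nat pmf \<Rightarrow> (nat \<Rightarrow> 'c) \<Rightarrow> real measure" where
  "empirical p u = distr (measure_pmf p) borel (\<lambda>n. \<sigma> (u n))"

text \<open>Since \<open>param\<close> inverts \<open>\<sigma>\<close> on \<open>K\<close>, pushing
  forward gives back the convex combination of the Dirac masses at the points
  \<open>u n\<close>.\<close>

lemma empirical:
  fixes \<phi> :: "'c \<Rightarrow> real"
  assumes u: "\<And>n. u n \<in> K"
  shows "admissible (empirical p u)" "measure (empirical p u) {0..1} = 1"
    and "moment (empirical p u) i = measure_pmf.expectation p (\<lambda>n. \<sigma> (u n) ^ i)"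
    and "continuous_on K \<phi> \<Longrightarrow> (LINT a|push (empirical p u). \<phi> a) = measure_pmf.expectation p (\<lambda>n. \<phi> (u n))"
proof -
  have rd: "real_distribution (empirical p u)"
    unfolding empirical_def by (rule prob_space.real_distribution_distr[OF measure_pmf.prob_space_axioms]) auto
  show adm: "admissible (empirical p u)"
    unfolding admissible_def
  proof
    show "AE x in empirical p u. param x \<in> K"
      unfolding empirical_def by (subst AE_distr_iff) (auto simp: param_\<sigma> u)
  qed (rule rd)
  show "measure (empirical p u) {0..1} = 1"
    unfolding empirical_def by (subst measure_distr) (use \<sigma>_range in \<open>auto simp: vimage_def\<close>)
  show "moment (empirical p u) i = measure_pmf.expectation p (\<lambda>n. \<sigma> (u n) ^ i)"
    unfolding moment_def empirical_def by (subst integral_distr) (use \<sigma>_range in \<open>auto simp: unit_clamp_id\<close>)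
  assume \<phi>: "continuous_on K \<phi>"
  obtain \<Phi> where \<Phi>: "continuous_on UNIV \<Phi>" "\<And>a. a \<in> K \<Longrightarrow> \<Phi> a = \<phi> a"
    using tietze_K[OF \<phi>] by blast
  have [measurable]: "\<Phi> \<in> borel_measurable borel" by (rule borel_measurable_continuous_onI[OF \<Phi>(1)])
  have "(LINT a|push (empirical p u). \<phi> a) = (LINT a|push (empirical p u). \<Phi> a)"
    by (rule integral_radon_cong[OF push_radon[OF adm]]) (simp add: \<Phi>(2))
  also have "\<dots> = (LINT x|empirical p u. \<Phi> (param x))" by (rule push_integral[OF adm \<Phi>(1)])
  also have "\<dots> = measure_pmf.expectation p (\<lambda>n. \<Phi> (param (\<sigma> (u n))))"
    unfolding empirical_def by (rule integral_distr) auto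
  also have "\<dots> = measure_pmf.expectation p (\<lambda>n. \<phi> (u n))" by (simp add: param_\<sigma> u \<Phi>(2))
  finally show "(LINT a|push (empirical p u). \<phi> a) = measure_pmf.expectation p (\<lambda>n. \<phi> (u n))" .
qed

text \<open>The weights are chosen so that at almost every time all moments converge. At such a time
  the limits are again moments of a measure carried by \<open>K\<close>, and convergence of moments
  implies convergence of all integrals of continuous functions.\<close>

lemma relaxed_limit:
  fixes u :: "nat \<Rightarrow> real \<Rightarrow> 'c"
  assumes u [measurable]: "\<And>n. u n \<in> borel_measurable borel" and uK: "\<And>n t. u n t \<in> K"
  obtains p :: "nat \<Rightarrow> nat pmf" and \<mu> :: "real \<Rightarrow> 'c measure" where
    "\<And>k. finite (set_pmf (p k))" "\<And>k. set_pmf (p k) \<subseteq> {k..}"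
    "\<mu> \<in> measurable borel (relaxed_space K)"
    "AE t in lborel. \<forall>\<phi> :: 'c \<Rightarrow> real. continuous_on K \<phi> \<longrightarrow>
       (\<lambda>k. measure_pmf.expectation (p k) (\<lambda>n. \<phi> (u n t))) \<longlonglongrightarrow> (LINT a|\<mu> t. \<phi> a)"
proof -
  \<comment> \<open>The Hilbert space argument needs a finite measure, and one sequence of weights
    has to serve all moments. The normal law replaces Lebesgue measure, and a geometric law on the
    index of the moment makes the index a second variable; each index has positive mass, so almost
    everywhere on the product means for almost every time and every index.\<close>
  interpret R: prob_space "density lborel std_normal_density" by (rule prob_space_normal_density) simp
  interpret PS: pair_prob_space "density lborel std_normal_density" "measure_pmf (geometric_pmf (1/2))" ..
  let ?\<Omega> = "density lborel std_normal_density \<Otimes>\<^sub>M measure_pmf (geometric_pmf (1/2))"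
  define X where "X n \<omega> = \<sigma> (u n (fst \<omega>)) ^ snd \<omega>" for n and \<omega> :: "real \<times> nat"
  have Xm: "X n \<in> borel_measurable ?\<Omega>" for n
  proof -
    have "(\<lambda>t. \<sigma> (u n t)) \<in> borel_measurable (density lborel std_normal_density)"
      using u[of n] \<sigma>_meas by simp
    then have "(\<lambda>\<omega>. \<sigma> (u n (fst \<omega>))) \<in> borel_measurable ?\<Omega>"
      by (rule measurable_compose[OF measurable_fst])
    then have *: "(\<lambda>\<omega>. \<sigma> (u n (fst \<omega>)) ^ i) \<in> borel_measurable ?\<Omega>" for i
      by (rule borel_measurable_power)
    have "snd \<in> measurable ?\<Omega> (count_space UNIV)"
      by (rule measurable_compose[OF measurable_snd, of "\<lambda>i. i", simplified]) simp
    then show ?thesis unfolding X_def by (rule measurable_compose_countable[OF *])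
  qed
  have Xb: "\<bar>X n \<omega>\<bar> \<le> 1" for n \<omega>
    using \<sigma>_range[of "u n (fst \<omega>)"] by (simp add: X_def power_abs power_le_one)
  obtain p where p: "\<And>k. finite (set_pmf (p k))" "\<And>k. set_pmf (p k) \<subseteq> {k..}"
    and pX: "AE x in ?\<Omega>. Cauchy (\<lambda>k. measure_pmf.expectation (p k) (\<lambda>n. X n x))"
    by (rule convex_combinations_converge_AE[OF PS.P.finite_measure_axioms, of X 1, OF Xm Xb]) blast
  define mk where "mk k t i = measure_pmf.expectation (p k) (\<lambda>n. \<sigma> (u n t) ^ i)" for k t i
  have "AE t in density lborel std_normal_density. AE i in measure_pmf (geometric_pmf (1/2)).
      Cauchy (\<lambda>k. measure_pmf.expectation (p k) (\<lambda>n. X n (t, i)))"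
    using PS.AE_pair[OF pX] .
  then have "AE t in density lborel std_normal_density. \<forall>i. convergent (\<lambda>k. mk k t i)"
    by (simp add: AE_measure_pmf_iff set_pmf_geometric X_def mk_def Cauchy_convergent_iff)
  \<comment> \<open>The density is positive, so its null sets are Lebesgue null.\<close>
  then have good: "AE t in lborel. \<forall>i. convergent (\<lambda>k. mk k t i)"
    by (simp add: AE_density normal_density_pos)
  have mk_meas [measurable]: "(\<lambda>t. mk k t i) \<in> borel_measurable borel" for k i
  proof -
    have "mk k t i = (\<Sum>a\<in>set_pmf (p k). pmf (p k) a *\<^sub>R \<sigma> (u a t) ^ i)" for t
      unfolding mk_def by (rule integral_measure_pmf[OF p(1)])
    then show ?thesis by simp
  qed
  define G where "G = {t. \<forall>i. convergent (\<lambda>k. mk k t i)}"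
  have G [measurable]: "G \<in> sets borel"
  proof -
    have "Measurable.pred borel (\<lambda>t. \<forall>i. Cauchy (\<lambda>k. mk k t i))" by measurable
    then show ?thesis unfolding G_def Cauchy_convergent_iff[symmetric] by simp
  qed
  \<comment> \<open>Off the set of convergence the moments of the Dirac mass at \<open>base\<close>
    are inserted, so that \<open>m t\<close> is a moment sequence at every time.\<close>
  define m where "m t i = (if t \<in> G then lim (\<lambda>k. mk k t i) else \<sigma> base ^ i)" for t i
  have m_meas: "(\<lambda>t. m t i) \<in> borel_measurable borel" for i
    unfolding m_def by measurable
  have emp_mk: "moment (empirical (p k) (\<lambda>n. u n t)) i = mk k t i" for k t i
    unfolding mk_def by (rule empirical(3)) (rule uK)
  have m_lim: "(\<lambda>k. moment (empirical (p k) (\<lambda>n. u n t)) i) \<longlonglongrightarrow> m t i" if "t \<in> G" for t i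
    using that unfolding emp_mk m_def by (simp add: G_def convergent_LIMSEQ_iff)
  have m_in: "m t \<in> moment_sequences" for t
  proof (cases "t \<in> G")
    case True
    have "\<exists>\<nu>'. admissible \<nu>' \<and> (\<forall>i. moment \<nu>' i = m t i)"
      by (rule moment_limit[of "\<lambda>k. empirical (p k) (\<lambda>n. u n t)"]) (auto intro!: empirical uK m_lim True)
    then show ?thesis by (simp add: moment_sequences_def)
  next
    case False
    then have "moment (empirical (return_pmf 0) (\<lambda>_. base)) i = m t i" for i
      by (simp add: empirical(3)[OF base_in] m_def)
    then show ?thesis using empirical(1)[OF base_in] unfolding moment_sequences_def by blast
  qed
  show thesis
  proof (rule that[OF p])
    show "(\<lambda>t. push (measure_of_moments (m t))) \<in> measurable borel (relaxed_space K)"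
      by (rule measurable_push_moments[OF m_meas m_in])
    have "AE t in lborel. t \<in> G" using good by (simp add: G_def)
    then show "AE t in lborel. \<forall>\<phi> :: 'c \<Rightarrow> real. continuous_on K \<phi> \<longrightarrow>
       (\<lambda>k. measure_pmf.expectation (p k) (\<lambda>n. \<phi> (u n t))) \<longlonglongrightarrow> (LINT a|push (measure_of_moments (m t)). \<phi> a)"
    proof eventually_elim
      case (elim t)
      show ?case
      proof (intro allI impI)
        fix \<phi> :: "'c \<Rightarrow> real" assume \<phi>: "continuous_on K \<phi>"
        have "(\<lambda>k. LINT a|push (empirical (p k) (\<lambda>n. u n t)). \<phi> a) \<longlonglongrightarrow> (LINT a|push (measure_of_moments (m t)). \<phi> a)"
          by (rule push_converges[OF \<phi>])
            (auto intro!: empirical uK measure_of_moments m_in m_lim elim simp: measure_of_moments(2)[OF m_in])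
        then show "(\<lambda>k. measure_pmf.expectation (p k) (\<lambda>n. \<phi> (u n t))) \<longlonglongrightarrow> (LINT a|push (measure_of_moments (m t)). \<phi> a)"
          by (simp add: empirical(4)[OF uK \<phi>])
      qed
    qed
  qed
qed

end

lemma relaxed_space_space:
  assumes "\<mu> \<in> measurable N (relaxed_space K)" "t \<in> space N"
  shows "\<mu> t \<in> radon_prob K"
proof -
  have tops: "topspace (weak_star K) \<subseteq> radon_prob K"
    unfolding weak_star_def topology_generated_by_topspace by auto
  then have sub: "{U. openin (weak_star K) U} \<subseteq> Pow (radon_prob K)"
    using openin_subset by blast
  show ?thesis using measurable_space[OF assms] sub by (simp add: space_measure_of)
qed

theorem relaxed_limit_compact:
  fixes u :: "nat \<Rightarrow> real \<Rightarrow> 'c::euclidean_space"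
  assumes K: "compact K" "K \<noteq> {}"
    and u: "\<And>n. u n \<in> borel_measurable borel" and uK: "\<And>n t. u n t \<in> K"
  obtains p :: "nat \<Rightarrow> nat pmf" and \<mu> :: "real \<Rightarrow> 'c measure" where
    "\<And>k. finite (set_pmf (p k))" "\<And>k. set_pmf (p k) \<subseteq> {k..}"
    "\<mu> \<in> measurable borel (relaxed_space K)"
    "AE t in lborel. \<forall>\<phi> :: 'c \<Rightarrow> real. continuous_on K \<phi> \<longrightarrow>
       (\<lambda>k. measure_pmf.expectation (p k) (\<lambda>n. \<phi> (u n t))) \<longlonglongrightarrow> (LINT a|\<mu> t. \<phi> a)"
proof -
  have "\<exists>\<pi> \<sigma>. parametrised_compact K \<pi> \<sigma>"
    by (rule space_filling_curve[OF compact_imp_bounded[OF K(1)]])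
      (auto simp: parametrised_compact_def K)
  then obtain \<pi> \<sigma> where "parametrised_compact K \<pi> \<sigma>" by blast
  then interpret parametrised_compact K \<pi> \<sigma> .
  show thesis by (rule relaxed_limit[of u, OF u uK]) (rule that)
qed

section \<open>Relaxed vector fields\<close>

lemma set_integral_Icc_combine:
  fixes f :: "real \<Rightarrow> 'a::euclidean_space"
  assumes "a \<le> c" "c \<le> b" "set_integrable lborel {a..b} f"
  shows "(LINT s:{a..c}|lborel. f s) + (LINT s:{c..b}|lborel. f s) = (LINT s:{a..b}|lborel. f s)"
proof -
  have "set_integrable lborel {a..c} f" "set_integrable lborel {c..b} f"
    by (rule set_integrable_subset[OF assms(3)]; use assms in auto)+
  then show ?thesis
    using assms Henstock_Kurzweil_Integration.integral_combine[of a c b f]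
    by (simp add: set_borel_integral_eq_integral)
qed

lemma norm_set_integral_Icc_le:
  fixes f :: "real \<Rightarrow> 'a::euclidean_space"
  assumes "a \<le> b" "set_integrable lborel {a..b} f" "\<And>s. a \<le> s \<Longrightarrow> s \<le> b \<Longrightarrow> norm (f s) \<le> B"
  shows "norm (LINT s:{a..b}|lborel. f s) \<le> B * (b - a)"
proof -
  have "norm (LINT s:{a..b}|lborel. f s) \<le> (LINT s:{a..b}|lborel. B)"
    by (rule norm_set_integral_le) (use assms in \<open>auto intro!: borel_integrable_atLeastAtMost'\<close>)
  also have "\<dots> = B * (b - a)" using assms(1) by (simp add: set_lebesgue_integral_def)
  finally show ?thesis .
qed

lemma caratheodory_solution_diff:
  assumes "caratheodory_solution F x y" "0 \<le> s" "s \<le> t"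
  shows "y t - y s = (LINT r:{s..t}|lborel. F r (y r))"
proof -
  have "y t - y s = (LINT r:{0..t}|lborel. F r (y r)) - (LINT r:{0..s}|lborel. F r (y r))"
    using caratheodory_solutionD(2)[OF assms(1), of s] caratheodory_solutionD(2)[OF assms(1), of t] assms
    by simp
  also have "\<dots> = (LINT r:{s..t}|lborel. F r (y r))"
    using set_integral_Icc_combine[OF assms(2,3) caratheodory_solutionD(1)[OF assms(1)]] assms
    by (simp add: diff_eq_eq add.commute)
  finally show ?thesis .
qed

lemma measurable_continuous_on_comp:
  assumes "continuous_on K \<phi>" "K \<in> sets borel" "u \<in> borel_measurable N" "\<And>t. t \<in> space N \<Longrightarrow> u t \<in> K"
  shows "(\<lambda>t. \<phi> (u t)) \<in> borel_measurable N"
proof -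
  have "u \<in> measurable N (restrict_space borel K)"
    using assms by (intro measurable_restrict_space2) auto
  then show ?thesis
    by (rule measurable_compose[OF _ borel_measurable_continuous_on_restrict[OF assms(1)]])
qed

text \<open>Uniform continuity on the compact set \<open>cball z0 1 \<times> K\<close>, which
  eventually contains all \<open>(z n, a)\<close>.\<close>

lemma uniform_in_control:
  fixes \<Phi> :: "'x::euclidean_space \<Rightarrow> 'c::euclidean_space \<Rightarrow> 'e::real_normed_vector"
  assumes K: "compact K" and \<Phi>: "continuous_on (UNIV \<times> K) (\<lambda>(x, a). \<Phi> x a)"
    and z: "z \<longlonglongrightarrow> z0" and e: "e > 0"
  shows "\<forall>\<^sub>F n in sequentially. \<forall>a\<in>K. norm (\<Phi> (z n) a - \<Phi> z0 a) < e"
proof -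
  have "uniformly_continuous_on (cball z0 1 \<times> K) (\<lambda>(x, a). \<Phi> x a)"
    by (intro compact_uniformly_continuous continuous_on_subset[OF \<Phi>] compact_Times compact_cball K) auto
  then obtain d where d: "d > 0" "\<And>v w. v \<in> cball z0 1 \<times> K \<Longrightarrow> w \<in> cball z0 1 \<times> K \<Longrightarrow>
      dist w v < d \<Longrightarrow> dist (case w of (x, a) \<Rightarrow> \<Phi> x a) (case v of (x, a) \<Rightarrow> \<Phi> x a) < e"
    using e unfolding uniformly_continuous_on_def by metis
  have "\<forall>\<^sub>F n in sequentially. dist (z n) z0 < min d 1"
    using z d(1) by (intro tendstoD) auto
  then show ?thesis
  proof eventually_elim
    case (elim n)
    show ?case
    proof
      fix a assume "a \<in> K"
      then show "norm (\<Phi> (z n) a - \<Phi> z0 a) < e"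
        using d(2)[of "(z0, a)" "(z n, a)"] elim by (auto simp: dist_Pair_Pair dist_norm norm_minus_commute)
    qed
  qed
qed

lemma continuous_on_slice:
  assumes "continuous_on (UNIV \<times> K) (\<lambda>(x, a). \<Phi> x a)"
  shows "continuous_on K (\<Phi> x)" "a \<in> K \<Longrightarrow> continuous_on UNIV (\<lambda>x. \<Phi> x a)"
proof -
  show "continuous_on K (\<Phi> x)"
    using continuous_on_compose2[OF assms, of K "\<lambda>a. (x, a)"]
    by (simp add: continuous_on_Pair image_subset_iff)
  show "continuous_on UNIV (\<lambda>x. \<Phi> x a)" if "a \<in> K"
    using continuous_on_compose2[OF assms, of UNIV "\<lambda>x. (x, a)"] that
    by (simp add: continuous_on_Pair image_subset_iff)
qed

lemma radon_prob_integrable: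
  fixes \<phi> :: "'c::euclidean_space \<Rightarrow> 'e::{banach, second_countable_topology}"
  assumes \<mu>: "\<mu> \<in> radon_prob K" and K: "compact K" and \<phi>: "continuous_on K \<phi>"
  shows "integrable \<mu> \<phi>"
proof -
  interpret prob_space \<mu> using \<mu> by (simp add: radon_prob_def)
  have sets: "sets \<mu> = sets (restrict_space borel K)" using \<mu> by (simp add: radon_prob_def)
  have sp: "space \<mu> = K" using sets_eq_imp_space_eq[OF sets] by (simp add: space_restrict_space)
  obtain B where B: "\<And>a. a \<in> K \<Longrightarrow> norm (\<phi> a) \<le> B"
    using compact_imp_bounded[OF compact_continuous_image[OF \<phi> K]] by (auto simp: bounded_iff)
  show ?thesis
  proof (rule integrable_const_bound)
    show "AE a in \<mu>. norm (\<phi> a) \<le> B" using B sp by auto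
    show "\<phi> \<in> borel_measurable \<mu>"
      unfolding measurable_cong_sets[OF sets refl] by (rule borel_measurable_continuous_on_restrict[OF \<phi>])
  qed
qed

lemma radon_prob_norm_integral_le:
  fixes \<phi> :: "'c::euclidean_space \<Rightarrow> 'e::{banach, second_countable_topology}"
  assumes \<mu>: "\<mu> \<in> radon_prob K" and K: "compact K" and \<phi>: "continuous_on K \<phi>"
    and B: "\<And>a. a \<in> K \<Longrightarrow> norm (\<phi> a) \<le> B"
  shows "norm (LINT a|\<mu>. \<phi> a) \<le> B"
proof -
  interpret prob_space \<mu> using \<mu> by (simp add: radon_prob_def)
  have sets: "sets \<mu> = sets (restrict_space borel K)" using \<mu> by (simp add: radon_prob_def)
  have sp: "space \<mu> = K" using sets_eq_imp_space_eq[OF sets] by (simp add: space_restrict_space)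
  have "norm (LINT a|\<mu>. \<phi> a) \<le> (LINT a|\<mu>. norm (\<phi> a))" by (rule integral_norm_bound)
  also have "\<dots> \<le> B"
    by (rule integral_le_const) (use radon_prob_integrable[OF \<mu> K \<phi>] B sp in auto)
  finally show ?thesis .
qed

lemma measurable_relaxed_integral_vec:
  fixes \<phi> :: "'c::euclidean_space \<Rightarrow> 'e::euclidean_space"
  assumes \<mu>: "\<mu> \<in> measurable N (relaxed_space K)" and K: "compact K" and \<phi>: "continuous_on K \<phi>"
  shows "(\<lambda>t. LINT a|\<mu> t. \<phi> a) \<in> borel_measurable N"
proof (subst borel_measurable_euclidean_space, rule ballI)
  fix b :: 'e assume "b \<in> Basis"
  have "(\<lambda>t. LINT a|\<mu> t. \<phi> a \<bullet> b) \<in> borel_measurable N"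
    by (intro measurable_relaxed_integral[OF \<mu>] continuous_intros \<phi>)
  moreover have "(LINT a|\<mu> t. \<phi> a) \<bullet> b = (LINT a|\<mu> t. \<phi> a \<bullet> b)" if "t \<in> space N" for t
    using radon_prob_integrable[OF relaxed_space_space[OF \<mu> that] K \<phi>] by simp
  ultimately show "(\<lambda>t. (LINT a|\<mu> t. \<phi> a) \<bullet> b) \<in> borel_measurable N"
    by (subst measurable_cong) auto
qed

lemma measurable_ordinary_comp:
  fixes \<Phi> :: "'x::euclidean_space \<Rightarrow> 'c::euclidean_space \<Rightarrow> 'e::euclidean_space"
  assumes K: "compact K" and \<Phi>: "continuous_on (UNIV \<times> K) (\<lambda>(x, a). \<Phi> x a)"
    and u: "u \<in> borel_measurable borel" "\<And>t. u t \<in> K" and y: "y \<in> borel_measurable borel"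
  shows "(\<lambda>t. \<Phi> (y t) (u t)) \<in> borel_measurable borel"
proof (rule measurable_caratheodory[OF _ _ y])
  show "(\<lambda>t. \<Phi> x (u t)) \<in> borel_measurable borel" for x
    by (rule measurable_continuous_on_comp[OF continuous_on_slice(1)[OF \<Phi>] _ u(1)])
      (use K u(2) in \<open>auto simp: borel_compact\<close>)
  show "continuous_on UNIV (\<lambda>x. \<Phi> x (u t))" for t
    by (rule continuous_on_slice(2)[OF \<Phi> u(2)])
qed

text \<open>The supports move to infinity, so from some index on all averaged terms are close to the
  limit.\<close>

lemma expectation_tail_converges:
  fixes z :: "nat \<Rightarrow> 'e::{banach, second_countable_topology}"
  assumes p: "\<And>k. finite (set_pmf (p k))" "\<And>k. set_pmf (p k) \<subseteq> {k..}" and z: "z \<longlonglongrightarrow> z0"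
  shows "(\<lambda>k. measure_pmf.expectation (p k) z) \<longlonglongrightarrow> z0"
proof (rule LIMSEQ_I)
  fix e :: real assume e: "e > 0"
  obtain N where N: "\<And>n. n \<ge> N \<Longrightarrow> norm (z n - z0) < e / 2"
    using LIMSEQ_D[OF z, of "e/2"] e by auto
  show "\<exists>N. \<forall>k\<ge>N. norm (measure_pmf.expectation (p k) z - z0) < e"
  proof (intro exI[of _ N] allI impI)
    fix k assume k: "k \<ge> N"
    have "measure_pmf.expectation (p k) z - z0 = measure_pmf.expectation (p k) (\<lambda>n. z n - z0)"
      by (subst Bochner_Integration.integral_diff) (auto intro!: integrable_measure_pmf_finite p)
    also have "norm \<dots> \<le> e / 2"
      by (rule norm_expectation_le[OF p(1)]) (use p(2)[of k] k N in \<open>force intro: less_imp_le\<close>)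
    finally show "norm (measure_pmf.expectation (p k) z - z0) < e" using e by simp
  qed
qed

text \<open>The states \<open>z n\<close> vary with the averaged index, while weak-* convergence
  tests a fixed function. Replacing \<open>z n\<close> by \<open>z0\<close> costs little, uniformly
  in the control, and what remains is tested component by component.\<close>

lemma expectation_relaxed_converges:
  fixes \<Phi> :: "'x::euclidean_space \<Rightarrow> 'c::euclidean_space \<Rightarrow> 'e::euclidean_space"
  assumes K: "compact K" and \<Phi>: "continuous_on (UNIV \<times> K) (\<lambda>(x, a). \<Phi> x a)"
    and p: "\<And>k. finite (set_pmf (p k))" "\<And>k. set_pmf (p k) \<subseteq> {k..}"
    and \<mu>: "\<mu> \<in> radon_prob K"
    and conv: "\<forall>\<phi> :: 'c \<Rightarrow> real. continuous_on K \<phi> \<longrightarrow>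
       (\<lambda>k. measure_pmf.expectation (p k) (\<lambda>n. \<phi> (u n))) \<longlonglongrightarrow> (LINT a|\<mu>. \<phi> a)"
    and u: "\<And>n. u n \<in> K" and z: "z \<longlonglongrightarrow> z0"
  shows "(\<lambda>k. measure_pmf.expectation (p k) (\<lambda>n. \<Phi> (z n) (u n))) \<longlonglongrightarrow> (LINT a|\<mu>. \<Phi> z0 a)"
proof -
  note int = integrable_measure_pmf_finite[OF p(1)]
  have "(\<lambda>n. \<Phi> (z n) (u n) - \<Phi> z0 (u n)) \<longlonglongrightarrow> 0"
  proof (rule LIMSEQ_I)
    fix e :: real assume "e > 0"
    from uniform_in_control[OF K \<Phi> z this] u
    show "\<exists>N. \<forall>n\<ge>N. norm (\<Phi> (z n) (u n) - \<Phi> z0 (u n) - 0) < e"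
      unfolding eventually_sequentially by fastforce
  qed
  from expectation_tail_converges[OF p this]
  have 1: "(\<lambda>k. measure_pmf.expectation (p k) (\<lambda>n. \<Phi> (z n) (u n) - \<Phi> z0 (u n))) \<longlonglongrightarrow> 0" .
  have cont: "continuous_on K (\<Phi> z0)" by (rule continuous_on_slice[OF \<Phi>])
  have 2: "(\<lambda>k. measure_pmf.expectation (p k) (\<lambda>n. \<Phi> z0 (u n))) \<longlonglongrightarrow> (LINT a|\<mu>. \<Phi> z0 a)"
  proof (subst tendsto_componentwise_iff, rule ballI)
    fix b :: 'e assume "b \<in> Basis"
    have "(\<lambda>k. measure_pmf.expectation (p k) (\<lambda>n. \<Phi> z0 (u n) \<bullet> b)) \<longlonglongrightarrow> (LINT a|\<mu>. \<Phi> z0 a \<bullet> b)"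
      by (rule conv[rule_format]) (intro continuous_intros cont)
    then show "(\<lambda>k. measure_pmf.expectation (p k) (\<lambda>n. \<Phi> z0 (u n)) \<bullet> b) \<longlonglongrightarrow> (LINT a|\<mu>. \<Phi> z0 a) \<bullet> b"
      unfolding integral_inner_left[OF radon_prob_integrable[OF \<mu> K cont]]
        integral_inner_left[OF integrable_measure_pmf_finite[OF p(1)]] .
  qed
  from tendsto_add[OF 1 2] show ?thesis
    by (simp add: Bochner_Integration.integral_diff[OF int int])
qed

text \<open>The common frame of all three problems: \<open>K\<close> is either \<open>A\<close> or
  the part of \<open>A\<close> in the unit ball, and \<open>g\<close>, \<open>h\<close> are drift
  and running cost as functions on \<open>K\<close>. Coercivity is not visible here; it only enters
  the return to original time.\<close>

locale compact_control =
  fixes K :: "'c::euclidean_space set" and g :: "'x::euclidean_space \<Rightarrow> 'c \<Rightarrow> 'x"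
    and h :: "'x \<Rightarrow> 'c \<Rightarrow> real" and M :: real and L :: "real \<Rightarrow> real"
  assumes compact_K: "compact K" and K_ne: "K \<noteq> {}"
    and cont_g: "continuous_on (UNIV \<times> K) (\<lambda>(x, a). g x a)"
    and cont_h: "continuous_on (UNIV \<times> K) (\<lambda>(x, a). h x a)"
    and M_pos: "M > 0" and growth_g: "\<And>x a. a \<in> K \<Longrightarrow> norm (g x a) \<le> M * (1 + norm x)"
    and L_pos: "\<And>R. R > 0 \<Longrightarrow> L R > 0"
    and lip_g: "\<And>R a x y. R > 0 \<Longrightarrow> a \<in> K \<Longrightarrow> norm x \<le> R \<Longrightarrow> norm y \<le> R \<Longrightarrow>
                  norm (g x a - g y a) \<le> L R * norm (x - y)"
    and h_nonneg: "\<And>x a. a \<in> K \<Longrightarrow> 0 \<le> h x a"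
begin

lemma K_borel: "K \<in> sets borel" using compact_K by (simp add: borel_compact)

lemma field_ordinary:
  assumes u: "u \<in> borel_measurable borel" "\<And>t. u t \<in> K"
  shows "caratheodory_field (\<lambda>t x. g x (u t)) M L"
proof
  show "(\<lambda>t. g x (u t)) \<in> borel_measurable borel" for x
    by (rule measurable_continuous_on_comp[OF continuous_on_slice(1)[OF cont_g] K_borel u(1)]) (rule u(2))
qed (use M_pos L_pos growth_g lip_g u(2) in auto)

text \<open>Averaging over a probability measure preserves both the growth and the Lipschitz
  constants, so relaxed controls obey the same theory as ordinary ones.\<close>

lemma field_relaxed:
  assumes \<mu>: "\<mu> \<in> measurable borel (relaxed_space K)"
  shows "caratheodory_field (\<lambda>t x. LINT a|\<mu> t. g x a) M L"
proof
  have r: "\<mu> t \<in> radon_prob K" for t using relaxed_space_space[OF \<mu>] by simp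
  show "(\<lambda>t. LINT a|\<mu> t. g x a) \<in> borel_measurable borel" for x
    by (rule measurable_relaxed_integral_vec[OF \<mu> compact_K continuous_on_slice(1)[OF cont_g]])
  show "norm (LINT a|\<mu> t. g x a) \<le> M * (1 + norm x)" for t x
    by (rule radon_prob_norm_integral_le[OF r compact_K continuous_on_slice(1)[OF cont_g] growth_g])
  show "norm ((LINT a|\<mu> t. g x a) - (LINT a|\<mu> t. g y a)) \<le> L R * norm (x - y)"
    if R: "R > 0" "norm x \<le> R" "norm y \<le> R" for R t x y
  proof -
    have c: "continuous_on K (g z)" for z by (rule continuous_on_slice(1)[OF cont_g])
    have "(LINT a|\<mu> t. g x a) - (LINT a|\<mu> t. g y a) = (LINT a|\<mu> t. g x a - g y a)"
      using radon_prob_integrable[OF r compact_K c] by simp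
    also have "norm \<dots> \<le> L R * norm (x - y)"
      by (rule radon_prob_norm_integral_le[OF r compact_K]) (use c R lip_g in \<open>auto intro!: continuous_intros\<close>)
    finally show ?thesis .
  qed
qed (use M_pos L_pos in auto)

end

section \<open>Limits of ordinary trajectories are relaxed trajectories\<close>

context compact_control
begin

text \<open>Pointwise Arzela-Ascoli: a diagonal subsequence converges at all nonnegative rational
  times, and a Lipschitz constant common to all trajectories on bounded intervals carries this to
  every time.\<close>

lemma trajectories_subsequence:
  assumes x: "\<And>n. norm (x n) \<le> B" and u: "\<And>n. u n \<in> borel_measurable borel" "\<And>n t. u n t \<in> K"
    and y: "\<And>n. caratheodory_solution (\<lambda>s z. g z (u n s)) (x n) (y n)"
  obtains k where "strict_mono (k :: nat \<Rightarrow> nat)" "\<And>t. t \<ge> 0 \<Longrightarrow> convergent (\<lambda>n. y (k n) t)"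
proof -
  have B: "B \<ge> 0" using x[of 0] norm_ge_zero order_trans by blast
  define \<rho> where "\<rho> t = (1 + B) * exp (M * t)" for t
  have \<rho>_pos: "\<rho> t > 0" for t using B by (simp add: \<rho>_def add_pos_nonneg)
  have \<rho>_mono: "\<rho> s \<le> \<rho> t" if "s \<le> t" for s t
    using that B M_pos by (simp add: \<rho>_def)
  have bd: "norm (y n t) \<le> \<rho> t" if t: "t \<ge> 0" for n t
  proof -
    interpret caratheodory_field "\<lambda>t x. g x (u n t)" M L by (rule field_ordinary[OF u])
    have "norm (y n t) \<le> (1 + norm (x n)) * exp (M * t) - 1" by (rule solution_bound[OF y t])
    also have "\<dots> \<le> \<rho> t" using x[of n] by (simp add: \<rho>_def mult_right_mono le_diff_eq add_increasing2 diff_le_eq)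
    finally show ?thesis .
  qed
  have lips: "norm (y n t - y n s) \<le> M * (1 + \<rho> T) * (t - s)" if "0 \<le> s" "s \<le> t" "t \<le> T" for n s t T
  proof -
    have int: "set_integrable lborel {s..t} (\<lambda>r. g (y n r) (u n r))"
      by (rule set_integrable_subset[OF caratheodory_solutionD(1)[OF y, of t]]) (use that in auto)
    have "norm (g (y n r) (u n r)) \<le> M * (1 + \<rho> T)" if r: "s \<le> r" "r \<le> t" for r
    proof -
      have "norm (y n r) \<le> \<rho> T" using bd[of r n] \<rho>_mono[of r T] r \<open>0 \<le> s\<close> \<open>t \<le> T\<close> by linarith
      then have "M * (1 + norm (y n r)) \<le> M * (1 + \<rho> T)" using M_pos by simp
      then show ?thesis using growth_g[OF u(2), of "y n r" n r] by linarith
    qed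
    then show ?thesis
      unfolding caratheodory_solution_diff[OF y that(1,2)]
      by (intro norm_set_integral_Icc_le[OF that(2) int]) auto
  qed
  \<comment> \<open>Rescaled to norm at most 1, because the diagonal extraction asks for one bound
    at all times.\<close>
  define f where "f n t = y n t /\<^sub>R \<rho> t" for n t
  have "countable (\<rat> \<inter> {0..} :: real set)" by (simp add: countable_rat)
  moreover have "norm (f n t) \<le> 1" if "t \<in> \<rat> \<inter> {0..}" for n t
    using bd[of t n] that \<rho>_pos[of t] by (simp add: f_def field_simps)
  ultimately obtain k where k: "strict_mono (k :: nat \<Rightarrow> nat)"
    and fl: "\<And>t. t \<in> \<rat> \<inter> {0..} \<Longrightarrow> \<exists>l. (\<lambda>n. f (k n) t) \<longlonglongrightarrow> l"
    using function_convergent_subsequence[of "\<rat> \<inter> {0..}" f 1] by blast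
  have rat: "Cauchy (\<lambda>n. y (k n) t)" if t: "t \<in> \<rat> \<inter> {0..}" for t
  proof -
    obtain l where "(\<lambda>n. f (k n) t) \<longlonglongrightarrow> l" using fl[OF t] by blast
    then have "(\<lambda>n. \<rho> t *\<^sub>R f (k n) t) \<longlonglongrightarrow> \<rho> t *\<^sub>R l" by (intro tendsto_intros)
    then have "(\<lambda>n. y (k n) t) \<longlonglongrightarrow> \<rho> t *\<^sub>R l"
      using \<rho>_pos[of t] by (simp add: f_def)
    then show ?thesis by (rule LIMSEQ_imp_Cauchy)
  qed
  have "convergent (\<lambda>n. y (k n) t)" if t: "t \<ge> 0" for t
  proof -
    have "Cauchy (\<lambda>n. y (k n) t)"
    proof (rule metric_CauchyI)
      fix e :: real assume e: "e > 0"
      define c where "c = M * (1 + \<rho> (t + 1))"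
      have c: "c > 0" using M_pos \<rho>_pos[of "t+1"] by (simp add: c_def)
      \<comment> \<open>Within distance 1 the Lipschitz constant \<open>c\<close> for the horizon
        \<open>t + 1\<close> applies; within \<open>e / (3 * c)\<close> each trajectory moves by at
        most \<open>e / 3\<close>.\<close>
      obtain q where q: "q \<in> \<rat>" "t < q" "q < t + min 1 (e / (3 * c))"
        using Rats_dense_in_real[of t "t + min 1 (e / (3 * c))"] e c by auto
      have near: "norm (y n q - y n t) \<le> e / 3" for n
      proof -
        have "norm (y n q - y n t) \<le> c * (q - t)"
          unfolding c_def by (rule lips) (use t q in auto)
        also have "\<dots> \<le> c * (e / (3 * c))" using q c by (intro mult_left_mono) auto
        also have "\<dots> = e / 3" using c by simp
        finally show ?thesis .
      qed
      obtain N where N: "\<And>m n. m \<ge> N \<Longrightarrow> n \<ge> N \<Longrightarrow> dist (y (k m) q) (y (k n) q) < e / 3"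
        using metric_CauchyD[OF rat, of q "e/3"] q t e by auto
      show "\<exists>N. \<forall>m\<ge>N. \<forall>n\<ge>N. dist (y (k m) t) (y (k n) t) < e"
      proof (intro exI[of _ N] allI impI)
        fix m n assume mn: "m \<ge> N" "n \<ge> N"
        have "dist (y (k m) t) (y (k n) t) \<le> dist (y (k m) t) (y (k m) q)
            + (dist (y (k m) q) (y (k n) q) + dist (y (k n) q) (y (k n) t))"
          by (meson add_left_mono dist_triangle order_trans)
        also have "\<dots> < e"
          using near[of "k m"] near[of "k n"] N[OF mn] by (simp add: dist_norm norm_minus_commute)
        finally show "dist (y (k m) t) (y (k n) t) < e" .
      qed
    qed
    then show ?thesis by (simp add: Cauchy_convergent_iff)
  qed
  then show thesis using that k by blast
qed

text \<open>The integral equation is averaged over the same weights that make the Dirac masses of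
  the controls converge. The averages of the states converge to \<open>z\<close> because the states
  do, and those of the drifts converge to the relaxed drift along \<open>z\<close>.\<close>

theorem relaxed_trajectory_limit:
  assumes x: "x \<longlonglongrightarrow> x0" and u: "\<And>n. u n \<in> borel_measurable borel" "\<And>n t. u n t \<in> K"
    and y: "\<And>n. caratheodory_solution (\<lambda>s z. g z (u n s)) (x n) (y n)"
    and cost: "\<And>n. (\<integral>\<^sup>+t\<in>{0..}. ennreal (h (y n t) (u n t)) \<partial>lborel) \<le> C"
  obtains \<mu> z where "\<mu> \<in> measurable borel (relaxed_space K)"
    "caratheodory_solution (\<lambda>s z. LINT a|\<mu> s. g z a) x0 z"
    "(\<integral>\<^sup>+t\<in>{0..}. ennreal (LINT a|\<mu> t. h (z t) a) \<partial>lborel) \<le> C"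
proof -
  obtain B where B: "\<And>n. norm (x n) \<le> B"
    using convergent_imp_Bseq[of x] x by (auto simp: convergent_def Bseq_def)
  obtain k where k: "strict_mono (k :: nat \<Rightarrow> nat)" "\<And>t. t \<ge> 0 \<Longrightarrow> convergent (\<lambda>n. y (k n) t)"
    by (rule trajectories_subsequence[of x B u y, OF B u y]) blast
  define v where "v n = u (k n)" for n
  \<comment> \<open>Constant before time 0, which makes the trajectories Borel on the whole line and
    their limit exist there.\<close>
  define Y where "Y n t = y (k n) (max 0 t)" for n t
  define z where "z t = lim (\<lambda>n. Y n t)" for t
  have v: "v n \<in> borel_measurable borel" "v n t \<in> K" for n t using u by (auto simp: v_def)
  have Ysol: "caratheodory_solution (\<lambda>s z. g z (v n s)) (x (k n)) (Y n)" for n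
    using y[of "k n"] unfolding v_def
    by (subst caratheodory_solution_cong[of _ "\<lambda>s z. g z (u (k n) s)" _ "y (k n)"]) (auto simp: Y_def)
  have Yz: "(\<lambda>n. Y n t) \<longlonglongrightarrow> z t" for t
    using k(2)[of "max 0 t"] by (simp add: z_def Y_def convergent_LIMSEQ_iff)
  have Ym [measurable]: "Y n \<in> borel_measurable borel" for n
  proof (rule borel_measurable_continuous_onI)
    show "continuous_on UNIV (Y n)"
      unfolding Y_def
      by (rule continuous_on_compose2[OF caratheodory_solution_continuous[OF y]]) (auto intro!: continuous_intros)
  qed
  have zm [measurable]: "z \<in> borel_measurable borel" by (rule borel_measurable_LIMSEQ_metric[OF Ym Yz])
  obtain p \<mu> where p: "\<And>k. finite (set_pmf (p k))" "\<And>k. set_pmf (p k) \<subseteq> {k..}"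
    and \<mu>: "\<mu> \<in> measurable borel (relaxed_space K)"
    and conv: "AE t in lborel. \<forall>\<phi> :: 'c \<Rightarrow> real. continuous_on K \<phi> \<longrightarrow>
       (\<lambda>k. measure_pmf.expectation (p k) (\<lambda>n. \<phi> (v n t))) \<longlonglongrightarrow> (LINT a|\<mu> t. \<phi> a)"
    by (rule relaxed_limit_compact[of K v, OF compact_K K_ne v]) blast
  have r: "\<mu> t \<in> radon_prob K" for t using relaxed_space_space[OF \<mu>] by simp
  define A where "A k s = measure_pmf.expectation (p k) (\<lambda>n. g (Y n s) (v n s))" for k s
  define H where "H k s = measure_pmf.expectation (p k) (\<lambda>n. h (Y n s) (v n s))" for k s
  have A_conv: "AE s in lborel. (\<lambda>k. A k s) \<longlonglongrightarrow> (LINT a|\<mu> s. g (z s) a)"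
    using conv unfolding A_def
    by eventually_elim (rule expectation_relaxed_converges[OF compact_K cont_g p r _ v(2) Yz])
  have H_conv: "AE s in lborel. (\<lambda>k. H k s) \<longlonglongrightarrow> (LINT a|\<mu> s. h (z s) a)"
    using conv unfolding H_def
    by eventually_elim (rule expectation_relaxed_converges[OF compact_K cont_h p r _ v(2) Yz])
  interpret V: caratheodory_field "\<lambda>t x. g x (v n t)" M L for n by (rule field_ordinary[OF v])
  interpret R: caratheodory_field "\<lambda>t x. LINT a|\<mu> t. g x a" M L by (rule field_relaxed[OF \<mu>])
  have A_sum: "A k s = (\<Sum>n\<in>set_pmf (p k). pmf (p k) n *\<^sub>R g (Y n s) (v n s))" for k s
    unfolding A_def by (rule integral_measure_pmf[OF p(1)])
  have H_sum: "H k s = (\<Sum>n\<in>set_pmf (p k). pmf (p k) n * h (Y n s) (v n s))" for k s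
    unfolding H_def by (subst integral_measure_pmf[OF p(1)]) auto
  have Hm [measurable]: "(\<lambda>t. h (Y n t) (v n t)) \<in> borel_measurable borel" for n
    by (rule measurable_ordinary_comp[OF compact_K cont_h v Ym])
  have Am: "A k \<in> borel_measurable borel" for k
    unfolding A_sum using V.measurable_comp[OF Ym] by measurable
  have Hkm [measurable]: "H k \<in> borel_measurable borel" for k
    unfolding H_sum by measurable
  have sol: "caratheodory_solution (\<lambda>s z. LINT a|\<mu> s. g z a) x0 z"
    unfolding caratheodory_solution_def
  proof (intro allI impI)
    fix t :: real assume t: "t \<ge> 0"
    define R where "R = (1 + B) * exp (M * t)"
    have bd: "norm (Y n s) \<le> R" if s: "0 \<le> s" "s \<le> t" for n s
    proof -
      have "norm (Y n s) \<le> (1 + norm (x (k n))) * exp (M * s) - 1" by (rule V.solution_bound[OF Ysol s(1)])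
      also have "\<dots> \<le> (1 + norm (x (k n))) * exp (M * s)" by simp
      also have "\<dots> \<le> R" unfolding R_def
        using B[of "k n"] order_trans[OF norm_ge_zero B[of 0]] s M_pos by (intro mult_mono) auto
      finally show ?thesis .
    qed
    let ?f = "\<lambda>k s. indicat_real {0..t} s *\<^sub>R A k s"
    let ?g = "\<lambda>s. indicat_real {0..t} s *\<^sub>R (LINT a|\<mu> s. g (z s) a)"
    let ?w = "\<lambda>s. indicat_real {0..t} s *\<^sub>R (M * (1 + R))"
    have m1: "?f k \<in> borel_measurable lborel" for k using Am[of k] by measurable
    have m2: "?g \<in> borel_measurable lborel" using R.measurable_comp[OF zm] by measurable
    have c: "AE s in lborel. (\<lambda>k. ?f k s) \<longlonglongrightarrow> ?g s"
      using A_conv by eventually_elim (intro tendsto_intros)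
    have w: "integrable lborel ?w"
      by (intro integrable_scaleR_left integrable_real_indicator) (auto simp: emeasure_lborel_Icc_eq)
    have dom: "AE s in lborel. norm (?f k s) \<le> ?w s" for k
    proof (rule AE_I2)
      fix s
      have "norm (A k s) \<le> M * (1 + R)" if s: "s \<in> {0..t}"
        unfolding A_def
      proof (rule norm_expectation_le[OF p(1)])
        fix n
        have "norm (g (Y n s) (v n s)) \<le> M * (1 + norm (Y n s))" by (rule growth_g[OF v(2)])
        also have "\<dots> \<le> M * (1 + R)" using bd[of s n] s M_pos by simp
        finally show "norm (g (Y n s) (v n s)) \<le> M * (1 + R)" .
      qed
      then show "norm (?f k s) \<le> ?w s" by (cases "s \<in> {0..t}") auto
    qed
    have I: "integrable lborel ?g" and C: "(\<lambda>k. integral\<^sup>L lborel (?f k)) \<longlonglongrightarrow> integral\<^sup>L lborel ?g"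
      using integral_dominated_convergence[OF m2 m1 w c dom]
            integrable_dominated_convergence[OF m2 m1 w c dom] by auto
    \<comment> \<open>Finite averages commute with the time integral, so the averaged equation
      involves exactly the averaged drift \<open>A j\<close>.\<close>
    have EY: "measure_pmf.expectation (p j) (\<lambda>n. Y n t) =
        measure_pmf.expectation (p j) (\<lambda>n. x (k n)) + integral\<^sup>L lborel (?f j)" for j
    proof -
      have int: "integrable lborel (\<lambda>s. indicat_real {0..t} s *\<^sub>R g (Y n s) (v n s))" for n
        using caratheodory_solutionD(1)[OF Ysol t] by (simp add: set_integrable_def)
      have "integral\<^sup>L lborel (?f j) =
          (LINT s|lborel. (\<Sum>n\<in>set_pmf (p j). pmf (p j) n *\<^sub>R (indicat_real {0..t} s *\<^sub>R g (Y n s) (v n s))))"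
        unfolding A_sum by (simp add: scaleR_sum_right mult.commute)
      also have "\<dots> = (\<Sum>n\<in>set_pmf (p j). pmf (p j) n *\<^sub>R (LINT s:{0..t}|lborel. g (Y n s) (v n s)))"
        using int by (subst Bochner_Integration.integral_sum) (auto simp: set_lebesgue_integral_def simp del: scaleR_scaleR)
      also have "\<dots> = (\<Sum>n\<in>set_pmf (p j). pmf (p j) n *\<^sub>R (Y n t - x (k n)))"
        using caratheodory_solutionD(2)[OF Ysol t] by (simp add: algebra_simps)
      also have "\<dots> = (\<Sum>n\<in>set_pmf (p j). pmf (p j) n *\<^sub>R Y n t) - (\<Sum>n\<in>set_pmf (p j). pmf (p j) n *\<^sub>R x (k n))"
        by (simp add: algebra_simps sum_subtractf)
      also have "\<dots> = measure_pmf.expectation (p j) (\<lambda>n. Y n t) - measure_pmf.expectation (p j) (\<lambda>n. x (k n))"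
        by (simp add: integral_measure_pmf[OF p(1)])
      finally show ?thesis by simp
    qed
    have "(\<lambda>n. x (k n)) \<longlonglongrightarrow> x0" using LIMSEQ_subseq_LIMSEQ[OF x k(1)] by (simp add: o_def)
    then have "(\<lambda>j. measure_pmf.expectation (p j) (\<lambda>n. Y n t)) \<longlonglongrightarrow> x0 + integral\<^sup>L lborel ?g"
      unfolding EY by (intro tendsto_add expectation_tail_converges[OF p] C)
    moreover have "(\<lambda>j. measure_pmf.expectation (p j) (\<lambda>n. Y n t)) \<longlonglongrightarrow> z t"
      by (rule expectation_tail_converges[OF p Yz])
    ultimately have "z t = x0 + integral\<^sup>L lborel ?g" by (rule LIMSEQ_unique[symmetric])
    then show "set_integrable lborel {0..t} (\<lambda>s. LINT a|\<mu> s. g (z s) a) \<and>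
        z t = x0 + (LINT s:{0..t}|lborel. LINT a|\<mu> s. g (z s) a)"
      using I by (simp add: set_integrable_def set_lebesgue_integral_def)
  qed
  have costY: "(\<integral>\<^sup>+t\<in>{0..}. ennreal (h (Y n t) (v n t)) \<partial>lborel) \<le> C" for n
  proof -
    have "(\<integral>\<^sup>+t\<in>{0..}. ennreal (h (Y n t) (v n t)) \<partial>lborel) = (\<integral>\<^sup>+t\<in>{0..}. ennreal (h (y (k n) t) (u (k n) t)) \<partial>lborel)"
      by (intro nn_integral_cong) (auto simp: Y_def v_def indicator_def)
    then show ?thesis using cost[of "k n"] by simp
  qed
  \<comment> \<open>An average of costs that are all at most \<open>C\<close>; Fatou's lemma then
    yields the bound for the limit.\<close>
  have costH: "(\<integral>\<^sup>+t. ennreal (H j t) * indicator {0..} t \<partial>lborel) \<le> C" for j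
  proof -
    have "ennreal (H j t) * indicator {0..} t =
        (\<Sum>n\<in>set_pmf (p j). ennreal (pmf (p j) n) * (ennreal (h (Y n t) (v n t)) * indicator {0..} t))" for t
    proof -
      have "ennreal (H j t) = (\<Sum>n\<in>set_pmf (p j). ennreal (pmf (p j) n * h (Y n t) (v n t)))"
        unfolding H_sum by (rule sum_ennreal[symmetric]) (simp add: h_nonneg v(2))
      then show ?thesis
        by (simp add: sum_distrib_right ennreal_mult h_nonneg v(2) mult.assoc)
    qed
    then have "(\<integral>\<^sup>+t. ennreal (H j t) * indicator {0..} t \<partial>lborel) =
        (\<Sum>n\<in>set_pmf (p j). ennreal (pmf (p j) n) * (\<integral>\<^sup>+t\<in>{0..}. ennreal (h (Y n t) (v n t)) \<partial>lborel))"
      by (simp add: nn_integral_sum nn_integral_cmult)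
    also have "\<dots> \<le> (\<Sum>n\<in>set_pmf (p j). ennreal (pmf (p j) n) * C)"
      by (intro sum_mono mult_left_mono costY) auto
    also have "\<dots> = ennreal (\<Sum>n\<in>set_pmf (p j). pmf (p j) n) * C"
      by (simp add: sum_distrib_right[symmetric])
    also have "(\<Sum>n\<in>set_pmf (p j). pmf (p j) n) = 1" by (rule sum_pmf_eq_1[OF p(1)]) simp
    finally show ?thesis by simp
  qed
  have "(\<integral>\<^sup>+t\<in>{0..}. ennreal (LINT a|\<mu> t. h (z t) a) \<partial>lborel)
      = (\<integral>\<^sup>+t. liminf (\<lambda>j. ennreal (H j t) * indicator {0..} t) \<partial>lborel)"
  proof (rule nn_integral_cong_AE)
    show "AE t in lborel. ennreal (LINT a|\<mu> t. h (z t) a) * indicator {0..} t =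
        liminf (\<lambda>j. ennreal (H j t) * indicator {0..} t)"
      using H_conv
    proof eventually_elim
      case (elim t)
      then have "(\<lambda>j. ennreal (H j t)) \<longlonglongrightarrow> ennreal (LINT a|\<mu> t. h (z t) a)" by (rule tendsto_ennrealI)
      then have "(\<lambda>j. ennreal (H j t) * indicator {0..} t) \<longlonglongrightarrow> ennreal (LINT a|\<mu> t. h (z t) a) * indicator {0..} t"
        by (cases "t \<in> {0..}") auto
      then show ?case by (rule lim_imp_Liminf[OF trivial_limit_sequentially, symmetric])
    qed
  qed
  also have "\<dots> \<le> liminf (\<lambda>j. \<integral>\<^sup>+t. ennreal (H j t) * indicator {0..} t \<partial>lborel)"
    by (rule nn_integral_liminf) measurable
  also have "\<dots> \<le> liminf (\<lambda>j::nat. C)" by (intro Liminf_mono always_eventually allI costH)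
  also have "\<dots> = C" by (simp add: Liminf_const)
  finally show thesis by (rule that[OF \<mu> sol])
qed

end

section \<open>Chattering controls\<close>

text \<open>The endpoints are null, so it does not matter which of two adjacent pieces of a glued
  control governs a switching time.\<close>

lemma set_integral_Icc_cong_interior:
  fixes f f' :: "real \<Rightarrow> 'e::{banach, second_countable_topology}"
  assumes f: "f \<in> borel_measurable borel" and f': "f' \<in> borel_measurable borel"
    and eq: "\<And>s. a < s \<Longrightarrow> s < b \<Longrightarrow> f s = f' s"
  shows "(LINT s:{a..b}|lborel. f s) = (LINT s:{a..b}|lborel. f' s)"
  unfolding set_lebesgue_integral_def
proof (rule integral_cong_AE)
  show "AE s in lborel. indicat_real {a..b} s *\<^sub>R f s = indicat_real {a..b} s *\<^sub>R f' s"
    using AE_lborel_singleton[of a] AE_lborel_singleton[of b]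
    by eventually_elim (use eq in \<open>auto simp: indicator_def\<close>)
qed (use f f' in measurable)

lemma set_integral_Ioc_eq_Icc:
  fixes f :: "real \<Rightarrow> 'e::{banach, second_countable_topology}"
  assumes f: "f \<in> borel_measurable borel"
  shows "(LINT s:{a<..b}|lborel. f s) = (LINT s:{a..b}|lborel. f s)"
  unfolding set_lebesgue_integral_def
proof (rule integral_cong_AE)
  show "AE s in lborel. indicat_real {a<..b} s *\<^sub>R f s = indicat_real {a..b} s *\<^sub>R f s"
    using AE_lborel_singleton[of a] by eventually_elim (auto simp: indicator_def)
qed (use f in measurable)

text \<open>The points of \<open>J\<close> are visited one after the other, \<open>d\<close> for the
  time \<open>len d\<close>; half-open intervals make the pieces disjoint, and the induction appends
  the new point at the end.\<close>

lemma switching_control: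
  fixes D J :: "'c::euclidean_space set" and len :: "'c \<Rightarrow> real" and a :: real
  assumes J: "finite J" "J \<subseteq> D" and D: "D \<noteq> {}" and len: "\<And>d. len d \<ge> 0"
  shows "\<exists>u. u \<in> borel_measurable borel \<and> (\<forall>s. u s \<in> D) \<and>
    (\<forall>\<phi> :: 'c \<Rightarrow> 'e::{banach, second_countable_topology}.
       set_integrable lborel {a<..a + sum len J} (\<lambda>s. \<phi> (u s)) \<and>
       (LINT s:{a<..a + sum len J}|lborel. \<phi> (u s)) = (\<Sum>d\<in>J. len d *\<^sub>R \<phi> d))"
  using J
proof (induction J rule: finite_induct)
  case empty
  obtain d where "d \<in> D" using D by blast
  then show ?case by (intro exI[of _ "\<lambda>_. d"]) (simp add: set_lebesgue_integral_def)
next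
  case (insert d J)
  have "J \<subseteq> D" using insert.prems by simp
  from insert.IH[OF this] obtain u where U: "u \<in> borel_measurable borel \<and> (\<forall>s. u s \<in> D) \<and>
    (\<forall>\<phi> :: 'c \<Rightarrow> 'e. set_integrable lborel {a<..a + sum len J} (\<lambda>s. \<phi> (u s)) \<and>
       (LINT s:{a<..a + sum len J}|lborel. \<phi> (u s)) = (\<Sum>d\<in>J. len d *\<^sub>R \<phi> d))" ..
  have u [measurable]: "u \<in> borel_measurable borel" and uD: "\<And>s. u s \<in> D"
    using U by auto
  have int: "set_integrable lborel {a<..a + sum len J} (\<lambda>s. \<phi> (u s))"
    and val: "(LINT s:{a<..a + sum len J}|lborel. \<phi> (u s)) = (\<Sum>d\<in>J. len d *\<^sub>R \<phi> d)"
    for \<phi> :: "'c \<Rightarrow> 'e" using U by auto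
  define b where "b = a + sum len J"
  define b' where "b' = a + sum len (insert d J)"
  have b': "b' = b + len d" using insert by (simp add: b_def b'_def)
  have ab: "a \<le> b" "b \<le> b'" using len by (simp_all add: b_def b' sum_nonneg)
  define v where "v s = (if s \<le> b then u s else d)" for s
  have v: "v \<in> borel_measurable borel" unfolding v_def by measurable
  have split: "{a<..b'} = {a<..b} \<union> {b<..b'}" "{a<..b} \<inter> {b<..b'} = {}" using ab by auto
  have "set_integrable lborel {a<..b'} (\<lambda>s. \<phi> (v s)) \<and>
       (LINT s:{a<..b'}|lborel. \<phi> (v s)) = (\<Sum>d\<in>insert d J. len d *\<^sub>R \<phi> d)" for \<phi> :: "'c \<Rightarrow> 'e"
  proof -
    have i1: "set_integrable lborel {a<..b} (\<lambda>s. \<phi> (v s)) = set_integrable lborel {a<..b} (\<lambda>s. \<phi> (u s))"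
      by (rule set_integrable_cong) (auto simp: v_def)
    have l1: "(LINT s:{a<..b}|lborel. \<phi> (v s)) = (LINT s:{a<..b}|lborel. \<phi> (u s))"
      by (rule set_lebesgue_integral_cong) (auto simp: v_def)
    have i2: "set_integrable lborel {b<..b'} (\<lambda>s. \<phi> (v s)) = set_integrable lborel {b<..b'} (\<lambda>s. \<phi> d)"
      by (rule set_integrable_cong) (auto simp: v_def)
    have l2: "(LINT s:{b<..b'}|lborel. \<phi> (v s)) = (LINT s:{b<..b'}|lborel. \<phi> d)"
      by (rule set_lebesgue_integral_cong) (auto simp: v_def)
    have ic: "set_integrable lborel {b<..b'} (\<lambda>s. \<phi> d)"
      unfolding set_integrable_def by (intro integrable_scaleR_left integrable_real_indicator) (use ab in auto)
    have lc: "(LINT s:{b<..b'}|lborel. \<phi> d) = len d *\<^sub>R \<phi> d"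
      using ab by (simp add: set_lebesgue_integral_def b')
    have i1': "set_integrable lborel {a<..b} (\<lambda>s. \<phi> (v s))" using i1 int[of \<phi>] by (simp add: b_def)
    have i2': "set_integrable lborel {b<..b'} (\<lambda>s. \<phi> (v s))" using i2 ic by simp
    have "(LINT s:{a<..b'}|lborel. \<phi> (v s)) = (LINT s:{a<..b}|lborel. \<phi> (u s)) + len d *\<^sub>R \<phi> d"
      unfolding split(1) using set_integral_Un[OF split(2) i1' i2'] l1 l2 lc by simp
    moreover have "set_integrable lborel {a<..b'} (\<lambda>s. \<phi> (v s))"
      unfolding split(1) by (rule set_integrable_Un[OF i1' i2']) auto
    ultimately show ?thesis using val[of \<phi>] insert by (simp add: b_def add.commute)
  qed
  moreover have "\<forall>s. v s \<in> D" using uD insert by (simp add: v_def)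
  ultimately show ?case using v unfolding b'_def by blast
qed

section \<open>Replacing a relaxed control by fast switching\<close>

lemma continuous_on_relaxed:
  fixes \<Phi> :: "'x::euclidean_space \<Rightarrow> 'c::euclidean_space \<Rightarrow> 'e::euclidean_space"
  assumes K: "compact K" and \<Phi>: "continuous_on (UNIV \<times> K) (\<lambda>(x, a). \<Phi> x a)" and \<mu>: "\<mu> \<in> radon_prob K"
  shows "continuous_on UNIV (\<lambda>x. LINT a|\<mu>. \<Phi> x a)"
proof (rule continuous_on_sequentiallyI)
  fix z :: "nat \<Rightarrow> 'x" and z0 assume z: "z \<longlonglongrightarrow> z0"
  have c: "continuous_on K (\<Phi> x)" for x by (rule continuous_on_slice(1)[OF \<Phi>])
  show "(\<lambda>n. LINT a|\<mu>. \<Phi> (z n) a) \<longlonglongrightarrow> (LINT a|\<mu>. \<Phi> z0 a)"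
  proof (rule LIMSEQ_I)
    fix e :: real assume e: "e > 0"
    then have "e / 2 > 0" by simp
    from uniform_in_control[OF K \<Phi> z this] obtain N where
      N: "\<And>n a. n \<ge> N \<Longrightarrow> a \<in> K \<Longrightarrow> norm (\<Phi> (z n) a - \<Phi> z0 a) < e / 2"
      unfolding eventually_sequentially by blast
    show "\<exists>N. \<forall>n\<ge>N. norm ((LINT a|\<mu>. \<Phi> (z n) a) - (LINT a|\<mu>. \<Phi> z0 a)) < e"
    proof (intro exI[of _ N] allI impI)
      fix n assume n: "n \<ge> N"
      have "(LINT a|\<mu>. \<Phi> (z n) a) - (LINT a|\<mu>. \<Phi> z0 a) = (LINT a|\<mu>. \<Phi> (z n) a - \<Phi> z0 a)"
        using radon_prob_integrable[OF \<mu> K c] by simp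
      also have "norm \<dots> \<le> e / 2"
        by (rule radon_prob_norm_integral_le[OF \<mu> K]) (use N[OF n] c in \<open>auto intro!: continuous_intros less_imp_le\<close>)
      finally show "norm ((LINT a|\<mu>. \<Phi> (z n) a) - (LINT a|\<mu>. \<Phi> z0 a)) < e" using e by simp
    qed
  qed
qed

lemma measurable_relaxed_comp:
  fixes \<Phi> :: "'x::euclidean_space \<Rightarrow> 'c::euclidean_space \<Rightarrow> 'e::euclidean_space"
  assumes K: "compact K" and \<Phi>: "continuous_on (UNIV \<times> K) (\<lambda>(x, a). \<Phi> x a)"
    and \<mu>: "\<mu> \<in> measurable borel (relaxed_space K)" and y: "y \<in> borel_measurable borel"
  shows "(\<lambda>t. LINT a|\<mu> t. \<Phi> (y t) a) \<in> borel_measurable borel"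
proof (rule measurable_caratheodory[OF _ _ y])
  show "(\<lambda>t. LINT a|\<mu> t. \<Phi> x a) \<in> borel_measurable borel" for x
    by (rule measurable_relaxed_integral_vec[OF \<mu> K continuous_on_slice(1)[OF \<Phi>]])
  show "continuous_on UNIV (\<lambda>x. LINT a|\<mu> t. \<Phi> x a)" for t
    by (rule continuous_on_relaxed[OF K \<Phi>]) (use relaxed_space_space[OF \<mu>] in simp)
qed

text \<open>The control stays at the nodes of an \<open>\<eta>\<close>-net, each for as long as \<open>\<mu>\<close> charges the corresponding
  member of a partition of unity.\<close>

lemma chattering_piece:
  fixes D K :: "'c::euclidean_space set" and \<mu> :: "real \<Rightarrow> 'c measure"
  assumes K: "compact K" and D: "D \<subseteq> K" "K \<subseteq> closure D" "D \<noteq> {}"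
    and \<mu>: "\<mu> \<in> measurable borel (relaxed_space K)" and \<eta>: "\<eta> > 0" and ab: "a \<le> b"
  obtains u where "u \<in> borel_measurable borel" "\<And>s. u s \<in> D"
    "\<And>(\<phi> :: 'c \<Rightarrow> 'e::euclidean_space) c. continuous_on K \<phi> \<Longrightarrow>
       (\<And>v w. v \<in> K \<Longrightarrow> w \<in> K \<Longrightarrow> dist v w < \<eta> \<Longrightarrow> norm (\<phi> v - \<phi> w) \<le> c) \<Longrightarrow>
       norm ((LINT s:{a..b}|lborel. \<phi> (u s)) - (LINT s:{a..b}|lborel. LINT v|\<mu> s. \<phi> v)) \<le> c * (b - a)"
proof -
  have r: "\<mu> t \<in> radon_prob K" for t using relaxed_space_space[OF \<mu>] by simp
  have Kb: "K \<in> sets borel" using K by (simp add: borel_compact)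
  have "K \<subseteq> (\<Union>d\<in>D. ball d \<eta>)"
  proof
    fix v assume "v \<in> K"
    then obtain d where "d \<in> D" "dist d v < \<eta>" using D(2) \<eta> by (meson closure_approachable subsetD)
    then show "v \<in> (\<Union>d\<in>D. ball d \<eta>)" by auto
  qed
  then obtain J where J: "J \<subseteq> D" "finite J" "K \<subseteq> (\<Union>d\<in>J. ball d \<eta>)"
    using compactE_image[OF K, of D "\<lambda>d. ball d \<eta>"] by auto
  \<comment> \<open>Hat functions of radius \<eta> around the nodes; the covering property makes
    their sum positive on \<open>K\<close>, and normalising gives the partition of unity
    \<open>\<beta>\<close>.\<close>
  define tot where "tot v = (\<Sum>d\<in>J. max 0 (\<eta> - dist v d))" for v
  define \<beta> where "\<beta> d v = max 0 (\<eta> - dist v d) / tot v" for d v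
  have tot_pos: "tot v > 0" if v: "v \<in> K" for v
  proof -
    obtain d where d: "d \<in> J" "dist d v < \<eta>" using J(3) v by auto
    then have "0 < max 0 (\<eta> - dist v d)" by (simp add: dist_commute)
    also have "\<dots> \<le> tot v" unfolding tot_def by (rule member_le_sum) (use d J in auto)
    finally show ?thesis .
  qed
  have tot_ne: "tot v \<noteq> 0" if "v \<in> K" for v using tot_pos[OF that] by simp
  have \<beta>_cont: "continuous_on K (\<beta> d)" for d
    unfolding \<beta>_def
    by (intro continuous_on_divide) (use tot_ne in \<open>auto simp: tot_def intro!: continuous_intros\<close>)
  have \<beta>_nonneg: "\<beta> d v \<ge> 0" if "v \<in> K" for d v
    using tot_pos[OF that] by (simp add: \<beta>_def)
  have \<beta>_sum: "(\<Sum>d\<in>J. \<beta> d v) = 1" if "v \<in> K" for v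
    using tot_pos[OF that] by (simp add: \<beta>_def sum_divide_distrib[symmetric] tot_def[symmetric])
  have \<beta>_le: "\<beta> d v \<le> 1" if "v \<in> K" "d \<in> J" for d v
    using \<beta>_sum[OF that(1)] member_le_sum[of d J "\<lambda>d. \<beta> d v"] that \<beta>_nonneg J(2) by simp
  define m where "m d s = (LINT v|\<mu> s. \<beta> d v)" for d s
  have m_meas: "m d \<in> borel_measurable borel" for d
    unfolding m_def by (rule measurable_relaxed_integral[OF \<mu> \<beta>_cont])
  have m_nonneg: "m d s \<ge> 0" for d s
  proof -
    have "(LINT v|\<mu> s. \<beta> d v) = (LINT v|\<mu> s. \<bar>\<beta> d v\<bar>)"
      by (rule integral_radon_cong[OF r]) (simp add: \<beta>_nonneg)
    also have "\<dots> \<ge> 0" by simp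
    finally show ?thesis by (simp add: m_def)
  qed
  have m_bound: "norm (m d s) \<le> 1" if "d \<in> J" for d s
    unfolding m_def by (rule radon_prob_norm_integral_le[OF r K \<beta>_cont]) (use \<beta>_nonneg \<beta>_le that in auto)
  have m_sum: "(\<Sum>d\<in>J. m d s) = 1" for s
  proof -
    interpret prob_space "\<mu> s" using r by (simp add: radon_prob_def)
    have "(\<Sum>d\<in>J. m d s) = (LINT v|\<mu> s. (\<Sum>d\<in>J. \<beta> d v))"
      unfolding m_def by (rule Bochner_Integration.integral_sum[symmetric]) (rule radon_prob_integrable[OF r K \<beta>_cont])
    also have "\<dots> = (LINT v|\<mu> s. 1)" by (rule integral_radon_cong[OF r]) (rule \<beta>_sum)
    finally show ?thesis by (simp add: prob_space)
  qed
  have m_int: "set_integrable lborel {a..b} (m d)" if "d \<in> J" for d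
    by (rule set_integrable_bounded_Icc[OF m_meas m_bound[OF that]])
  \<comment> \<open>The time to be spent at \<open>d\<close> is the total mass that
    \<open>\<mu>\<close> assigns to \<open>\<beta> d\<close> over the interval; these times add up
    to \<open>b - a\<close>.\<close>
  define len where "len d = (LINT s:{a..b}|lborel. m d s)" for d
  have len_nonneg: "len d \<ge> 0" for d
    unfolding len_def set_lebesgue_integral_def by (intro Bochner_Integration.integral_nonneg) (simp add: m_nonneg)
  have set_int_sum: "(LINT s:{a..b}|lborel. (\<Sum>d\<in>J. f d s)) = (\<Sum>d\<in>J. LINT s:{a..b}|lborel. f d s)"
    if "\<And>d. d \<in> J \<Longrightarrow> set_integrable lborel {a..b} (f d)" for f :: "'c \<Rightarrow> real \<Rightarrow> 'z::{banach, second_countable_topology}"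
    using that unfolding set_lebesgue_integral_def set_integrable_def
    by (simp add: scaleR_sum_right Bochner_Integration.integral_sum)
  have "sum len J = (LINT s:{a..b}|lborel. (\<Sum>d\<in>J. m d s))"
    unfolding len_def using set_int_sum[of m, OF m_int] by simp
  also have "\<dots> = b - a" using ab by (simp add: m_sum set_lebesgue_integral_def)
  finally have len_sum: "a + sum len J = b" by simp
  obtain u where u: "u \<in> borel_measurable borel" "\<And>s. u s \<in> D"
    and val: "\<And>\<phi> :: 'c \<Rightarrow> 'e. (LINT s:{a<..b}|lborel. \<phi> (u s)) = (\<Sum>d\<in>J. len d *\<^sub>R \<phi> d)"
    using switching_control[of J D len a, where ?'e='e, OF J(2,1) D(3) len_nonneg] unfolding len_sum by blast
  show thesis
  proof (rule that[OF u])
    fix \<phi> :: "'c \<Rightarrow> 'e" and c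
    assume \<phi>: "continuous_on K \<phi>"
      and osc: "\<And>v w. v \<in> K \<Longrightarrow> w \<in> K \<Longrightarrow> dist v w < \<eta> \<Longrightarrow> norm (\<phi> v - \<phi> w) \<le> c"
    have um: "(\<lambda>s. \<phi> (u s)) \<in> borel_measurable borel"
      by (rule measurable_continuous_on_comp[OF \<phi> Kb u(1)]) (use u(2) D(1) in auto)
    \<comment> \<open>The interpolation of \<open>\<phi>\<close> at the nodes. Switching reproduces
      the relaxed integral of \<open>\<psi>\<close> exactly, so the only error is that of replacing
      \<open>\<phi>\<close> by \<open>\<psi>\<close>.\<close>
    define \<psi> where "\<psi> v = (\<Sum>d\<in>J. \<beta> d v *\<^sub>R \<phi> d)" for v
    have \<psi>_cont: "continuous_on K \<psi>" unfolding \<psi>_def by (intro continuous_intros \<beta>_cont)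
    have int\<psi>: "(LINT v|\<mu> s. \<psi> v) = (\<Sum>d\<in>J. m d s *\<^sub>R \<phi> d)" for s
      unfolding \<psi>_def m_def
      by (subst Bochner_Integration.integral_sum)
        (auto intro!: integrable_scaleR_left simp: radon_prob_integrable[OF r K \<beta>_cont])
    have "(LINT s:{a..b}|lborel. \<phi> (u s)) = (\<Sum>d\<in>J. len d *\<^sub>R \<phi> d)"
      using set_integral_Ioc_eq_Icc[OF um, of a b] val[of \<phi>] by simp
    also have "\<dots> = (\<Sum>d\<in>J. LINT s:{a..b}|lborel. m d s *\<^sub>R \<phi> d)"
    proof (rule sum.cong[OF refl])
      fix d assume d: "d \<in> J"
      show "len d *\<^sub>R \<phi> d = (LINT s:{a..b}|lborel. m d s *\<^sub>R \<phi> d)"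
        using m_int[OF d] unfolding len_def set_lebesgue_integral_def set_integrable_def
        by (subst integral_scaleR_left[symmetric]) simp_all
    qed
    also have "\<dots> = (LINT s:{a..b}|lborel. (\<Sum>d\<in>J. m d s *\<^sub>R \<phi> d))"
      using m_int by (subst set_int_sum) (auto intro!: set_integrable_scaleR_left)
    finally have eq: "(LINT s:{a..b}|lborel. \<phi> (u s)) = (LINT s:{a..b}|lborel. LINT v|\<mu> s. \<psi> v)"
      by (simp add: int\<psi>)
    have bdd: "\<exists>B. \<forall>v\<in>K. norm (f v) \<le> B" if "continuous_on K f" for f :: "'c \<Rightarrow> 'e"
      using compact_imp_bounded[OF compact_continuous_image[OF that K]] by (auto simp: bounded_iff)
    have si: "set_integrable lborel {a..b} (\<lambda>s. LINT v|\<mu> s. f v)" if f: "continuous_on K f" for f :: "'c \<Rightarrow> 'e"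
    proof -
      obtain B where B: "\<And>v. v \<in> K \<Longrightarrow> norm (f v) \<le> B" using bdd[OF f] by blast
      show ?thesis
        by (rule set_integrable_bounded_Icc[OF measurable_relaxed_integral_vec[OF \<mu> K f]])
          (rule radon_prob_norm_integral_le[OF r K f B])
    qed
    \<comment> \<open>At \<open>v\<close> only nodes closer than \<eta> carry weight, and there
      \<open>\<phi>\<close> differs from \<open>\<phi> v\<close> by at most
      \<open>c\<close>.\<close>
    have pt: "norm (\<psi> v - \<phi> v) \<le> c" if v: "v \<in> K" for v
    proof -
      have "\<psi> v - \<phi> v = (\<Sum>d\<in>J. \<beta> d v *\<^sub>R (\<phi> d - \<phi> v))"
        using \<beta>_sum[OF v] by (simp add: \<psi>_def scaleR_diff_right sum_subtractf scaleR_sum_left[symmetric])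
      also have "norm \<dots> \<le> (\<Sum>d\<in>J. \<beta> d v * c)"
      proof (rule sum_norm_le)
        fix d assume d: "d \<in> J"
        show "norm (\<beta> d v *\<^sub>R (\<phi> d - \<phi> v)) \<le> \<beta> d v * c"
        proof (cases "dist v d < \<eta>")
          case True
          then show ?thesis
            using osc[of d v] v d J(1) D(1) \<beta>_nonneg[OF v, of d]
            by (auto simp: dist_commute intro!: mult_left_mono)
        next
          case False
          then show ?thesis by (simp add: \<beta>_def)
        qed
      qed
      also have "\<dots> = c" using \<beta>_sum[OF v] by (simp add: sum_distrib_right[symmetric])
      finally show ?thesis .
    qed
    have "(LINT s:{a..b}|lborel. LINT v|\<mu> s. \<psi> v) - (LINT s:{a..b}|lborel. LINT v|\<mu> s. \<phi> v)
        = (LINT s:{a..b}|lborel. (LINT v|\<mu> s. \<psi> v) - (LINT v|\<mu> s. \<phi> v))"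
      by (rule set_integral_diff(2)[OF si[OF \<psi>_cont] si[OF \<phi>], symmetric])
    also have "norm \<dots> \<le> c * (b - a)"
    proof (rule norm_set_integral_Icc_le[OF ab set_integral_diff(1)[OF si[OF \<psi>_cont] si[OF \<phi>]]])
      fix s
      have "(LINT v|\<mu> s. \<psi> v) - (LINT v|\<mu> s. \<phi> v) = (LINT v|\<mu> s. \<psi> v - \<phi> v)"
        using radon_prob_integrable[OF r[of s] K \<psi>_cont] radon_prob_integrable[OF r[of s] K \<phi>] by simp
      also have "norm \<dots> \<le> c"
        by (rule radon_prob_norm_integral_le[OF r K]) (use \<psi>_cont \<phi> pt in \<open>auto intro!: continuous_intros\<close>)
      finally show "norm ((LINT v|\<mu> s. \<psi> v) - (LINT v|\<mu> s. \<phi> v)) \<le> c" .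
    qed
    finally show "norm ((LINT s:{a..b}|lborel. \<phi> (u s)) - (LINT s:{a..b}|lborel. LINT v|\<mu> s. \<phi> v)) \<le> c * (b - a)"
      unfolding eq .
  qed
qed

text \<open>The interval is cut into cells so short that \<open>y\<close> is nearly constant on
  each. There the state is frozen at the left end and switching is exact up to the oscillation; at
  an intermediate time only one incomplete cell is uncontrolled.\<close>

lemma chattering_unit_interval:
  fixes \<Phi> :: "'x::euclidean_space \<Rightarrow> 'c::euclidean_space \<Rightarrow> 'e::euclidean_space"
    and \<mu> :: "real \<Rightarrow> 'c measure" and y :: "real \<Rightarrow> 'x"
  assumes K: "compact K" and \<Phi>: "continuous_on (UNIV \<times> K) (\<lambda>(x, a). \<Phi> x a)"
    and D: "D \<subseteq> K" "K \<subseteq> closure D" "D \<noteq> {}"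
    and \<mu>: "\<mu> \<in> measurable borel (relaxed_space K)" and y: "continuous_on UNIV y" and \<delta>: "\<delta> > 0"
  shows "\<exists>u. u \<in> borel_measurable borel \<and> (\<forall>s. u s \<in> D) \<and>
    (\<forall>t. b \<le> t \<and> t \<le> b + 1 \<longrightarrow>
      norm (LINT s:{b..t}|lborel. \<Phi> (y s) (u s) - (LINT a|\<mu> s. \<Phi> (y s) a)) \<le> \<delta>)"
proof -
  have r: "\<mu> t \<in> radon_prob K" for t using relaxed_space_space[OF \<mu>] by simp
  have Kb: "K \<in> sets borel" using K by (simp add: borel_compact)
  have ym: "y \<in> borel_measurable borel" by (rule borel_measurable_continuous_onI[OF y])
  let ?I = "{b..b+1} \<times> K"
  have \<Psi>c: "continuous_on ?I (\<lambda>(s, a). \<Phi> (y s) a)"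
  proof -
    have "continuous_on ?I (\<lambda>p. (y (fst p), snd p))"
      by (intro continuous_intros continuous_on_compose2[OF y]) auto
    then have "continuous_on ?I (\<lambda>p. case (y (fst p), snd p) of (x, a) \<Rightarrow> \<Phi> x a)"
      by (rule continuous_on_compose2[OF \<Phi>]) auto
    then show ?thesis by (simp add: case_prod_unfold)
  qed
  have cI: "compact ?I" by (intro compact_Times K compact_Icc)
  obtain B0 where B0: "\<And>s a. s \<in> {b..b+1} \<Longrightarrow> a \<in> K \<Longrightarrow> norm (\<Phi> (y s) a) \<le> B0"
    using compact_imp_bounded[OF compact_continuous_image[OF \<Psi>c cI]] by (force simp: bounded_iff)
  define B where "B = max B0 1"
  have B: "B > 0" "\<And>s a. s \<in> {b..b+1} \<Longrightarrow> a \<in> K \<Longrightarrow> norm (\<Phi> (y s) a) \<le> B"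
    using B0 by (force simp: B_def max_def)+
  have "uniformly_continuous_on ?I (\<lambda>(s, a). \<Phi> (y s) a)" by (rule compact_uniformly_continuous[OF \<Psi>c cI])
  then obtain d where d: "d > 0" "\<And>v w. v \<in> ?I \<Longrightarrow> w \<in> ?I \<Longrightarrow> dist w v < d \<Longrightarrow>
      dist (case w of (s, a) \<Rightarrow> \<Phi> (y s) a) (case v of (s, a) \<Rightarrow> \<Phi> (y s) a) < \<delta> / 6"
    using \<delta> unfolding uniformly_continuous_on_def by (metis divide_pos_pos zero_less_numeral)
  have osc: "norm (\<Phi> (y s) a - \<Phi> (y s') a') \<le> \<delta> / 6"
    if "s \<in> {b..b+1}" "s' \<in> {b..b+1}" "a \<in> K" "a' \<in> K" "dist (s, a) (s', a') < d" for s s' a a'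
    using d(2)[of "(s', a')" "(s, a)"] that by (simp add: dist_norm)
  \<comment> \<open>\<open>1 / N < d\<close> keeps the oscillation on a cell below
    \<open>\<delta> / 6\<close>. Switching then costs \<open>\<delta> / 6\<close> and freezing the
    state costs \<open>2 * (\<delta> / 6)\<close>, each times \<open>1 / N\<close>, so all cells
    together cost \<open>\<delta> / 2\<close>. The incomplete cell costs at most
    \<open>2 * B / N\<close>, the other half.\<close>
  obtain N :: nat where N: "N > 0" "1 / N < d" "2 * B / N \<le> \<delta> / 2"
  proof -
    obtain n :: nat where n: "real n > max (1 / d) (4 * B / \<delta>)" using reals_Archimedean2 by blast
    then have n1: "1 / d < n" "4 * B / \<delta> < n" by auto
    then have n0: "real n > 0" using d(1) by (meson divide_pos_pos less_trans zero_less_one)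
    have "1 / n < d" using n1(1) n0 d(1) by (simp add: field_simps)
    moreover have "2 * B / n \<le> \<delta> / 2" using n1(2) n0 \<delta> by (simp add: field_simps)
    ultimately show ?thesis using that[of n] n0 by simp
  qed
  define c where "c i = b + real i / N" for i :: nat
  have c_mono: "c i \<le> c (Suc i)" for i using N(1) by (simp add: c_def divide_right_mono)
  have c_diff: "c (Suc i) - c i = 1 / N" for i by (simp add: c_def add_divide_distrib)
  have c_le: "c i \<le> b + 1" if "i \<le> N" for i using that N(1) by (simp add: c_def)
  have c_ge: "b \<le> c i" for i by (simp add: c_def)
  have "\<exists>u. u \<in> borel_measurable borel \<and> (\<forall>s. u s \<in> D) \<and>
      (\<forall>\<phi> :: 'c \<Rightarrow> 'e. \<forall>e. continuous_on K \<phi> \<longrightarrow>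
       (\<forall>v\<in>K. \<forall>w\<in>K. dist v w < d \<longrightarrow> norm (\<phi> v - \<phi> w) \<le> e) \<longrightarrow>
       norm ((LINT s:{c i..c (Suc i)}|lborel. \<phi> (u s)) - (LINT s:{c i..c (Suc i)}|lborel. LINT v|\<mu> s. \<phi> v))
         \<le> e * (c (Suc i) - c i))" for i
    by (rule chattering_piece[OF K D \<mu> d(1) c_mono, where ?'e='e]) blast
  then obtain U where U: "\<And>i. U i \<in> borel_measurable borel" "\<And>i s. U i s \<in> D"
    and Ue: "\<And>i (\<phi> :: 'c \<Rightarrow> 'e) e. continuous_on K \<phi> \<Longrightarrow>
       (\<forall>v\<in>K. \<forall>w\<in>K. dist v w < d \<longrightarrow> norm (\<phi> v - \<phi> w) \<le> e) \<Longrightarrow>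
       norm ((LINT s:{c i..c (Suc i)}|lborel. \<phi> (U i s)) - (LINT s:{c i..c (Suc i)}|lborel. LINT v|\<mu> s. \<phi> v))
         \<le> e * (c (Suc i) - c i)"
    by metis
  \<comment> \<open>Selecting the cell by its integer index makes the glued control measurable as a
    countable composition.\<close>
  define u where "u s = U (nat \<lfloor>N * (s - b)\<rfloor>) s" for s
  have um: "u \<in> borel_measurable borel"
    unfolding u_def
  proof (rule measurable_compose_countable[OF U(1)])
    show "(\<lambda>s. nat \<lfloor>N * (s - b)\<rfloor>) \<in> measurable borel (count_space UNIV)" by measurable
  qed
  have uD: "u s \<in> D" for s by (simp add: u_def U(2))
  have u_piece: "u s = U i s" if "c i < s" "s < c (Suc i)" for i s
  proof -
    have "real i \<le> N * (s - b)" "N * (s - b) < real i + 1"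
      using that N(1) by (simp_all add: c_def field_simps)
    then have "\<lfloor>N * (s - b)\<rfloor> = int i" by (simp add: floor_eq_iff)
    then show ?thesis by (simp add: u_def)
  qed
  have mR: "(\<lambda>s. LINT a|\<mu> s. \<Phi> (y s) a) \<in> borel_measurable borel"
    by (rule measurable_relaxed_comp[OF K \<Phi> \<mu> ym])
  have mO: "(\<lambda>s. \<Phi> (y s) (w s)) \<in> borel_measurable borel"
    if "w \<in> borel_measurable borel" "\<And>s. w s \<in> D" for w
    by (rule measurable_ordinary_comp[OF K \<Phi> that(1) _ ym]) (use that(2) D(1) in auto)
  define E where "E w s = \<Phi> (y s) (w s) - (LINT a|\<mu> s. \<Phi> (y s) a)" for w s
  have Em: "E w \<in> borel_measurable borel" if "w \<in> borel_measurable borel" "\<And>s. w s \<in> D" for w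
    unfolding E_def using mO[OF that] mR by measurable
  have EB: "norm (E w s) \<le> 2 * B" if "\<And>s. w s \<in> D" "s \<in> {b..b+1}" for w s
  proof -
    have "norm (LINT a|\<mu> s. \<Phi> (y s) a) \<le> B"
      by (rule radon_prob_norm_integral_le[OF r K continuous_on_slice(1)[OF \<Phi>] B(2)[OF that(2)]])
    moreover have "norm (\<Phi> (y s) (w s)) \<le> B" using B(2)[OF that(2), of "w s"] that(1) D(1) by auto
    ultimately show ?thesis
      unfolding E_def using norm_triangle_ineq4[of "\<Phi> (y s) (w s)" "LINT a|\<mu> s. \<Phi> (y s) a"] by linarith
  qed
  have Eint: "set_integrable lborel {p..q} (E w)" if "w \<in> borel_measurable borel" "\<And>s. w s \<in> D" "b \<le> p" "q \<le> b+1" for w p q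
    by (rule set_integrable_bounded_Icc[OF Em[OF that(1,2)] EB[OF that(2)]]) (use that in auto)
  have piece: "norm (LINT s:{c i..c (Suc i)}|lborel. E u s) \<le> \<delta> / (2 * N)" if i: "i < N" for i
  proof -
    let ?J = "{c i..c (Suc i)}"
    have sub: "s \<in> {b..b+1}" if "s \<in> ?J" for s using that c_le[of "Suc i"] c_ge[of i] i by auto
    have ci: "c i \<in> {b..b+1}" using c_le[of i] c_ge i by auto
    have near: "dist s (c i) < d" if "s \<in> ?J" for s
      using that c_diff[of i] N(2) by (auto simp: dist_real_def)
    have cont_i: "continuous_on K (\<Phi> (y (c i)))" by (rule continuous_on_slice(1)[OF \<Phi>])
    \<comment> \<open>The error with the state frozen at the left end of the cell; to this the
      switching estimate applies.\<close>
    define F where "F s = \<Phi> (y (c i)) (U i s) - (LINT a|\<mu> s. \<Phi> (y (c i)) a)" for s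
    have Fm1: "(\<lambda>s. \<Phi> (y (c i)) (U i s)) \<in> borel_measurable borel"
      by (rule measurable_continuous_on_comp[OF cont_i Kb U(1)]) (use U(2) D(1) in auto)
    have Fm2: "(\<lambda>s. LINT a|\<mu> s. \<Phi> (y (c i)) a) \<in> borel_measurable borel"
      by (rule measurable_relaxed_integral_vec[OF \<mu> K cont_i])
    have F1: "set_integrable lborel ?J (\<lambda>s. \<Phi> (y (c i)) (U i s))"
      by (rule set_integrable_bounded_Icc[OF Fm1 B(2)[OF ci]]) (use U(2) D(1) in auto)
    have F2: "set_integrable lborel ?J (\<lambda>s. LINT a|\<mu> s. \<Phi> (y (c i)) a)"
      by (rule set_integrable_bounded_Icc[OF Fm2]) (rule radon_prob_norm_integral_le[OF r K cont_i B(2)[OF ci]])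
    have nF: "norm (LINT s:?J|lborel. F s) \<le> \<delta> / 6 * (1 / N)"
      unfolding F_def set_integral_diff(2)[OF F1 F2] c_diff[of i, symmetric]
      by (rule Ue[OF cont_i]) (use osc[OF ci ci] in \<open>auto simp: dist_Pair_Pair\<close>)
    have EF: "norm (E (U i) s - F s) \<le> \<delta> / 3" if s: "s \<in> ?J" for s
    proof -
      have o: "norm (\<Phi> (y s) a - \<Phi> (y (c i)) a) \<le> \<delta> / 6" if "a \<in> K" for a
        by (rule osc[OF sub[OF s] ci that that]) (use near[OF s] in \<open>simp add: dist_Pair_Pair\<close>)
      have "(LINT a|\<mu> s. \<Phi> (y s) a) - (LINT a|\<mu> s. \<Phi> (y (c i)) a) = (LINT a|\<mu> s. \<Phi> (y s) a - \<Phi> (y (c i)) a)"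
        using radon_prob_integrable[OF r K continuous_on_slice(1)[OF \<Phi>]] by simp
      also have "norm \<dots> \<le> \<delta> / 6"
        by (rule radon_prob_norm_integral_le[OF r K _ o])
          (use continuous_on_slice(1)[OF \<Phi>] in \<open>auto intro!: continuous_intros\<close>)
      finally have "norm ((LINT a|\<mu> s. \<Phi> (y s) a) - (LINT a|\<mu> s. \<Phi> (y (c i)) a)) \<le> \<delta> / 6" .
      moreover have "norm (\<Phi> (y s) (U i s) - \<Phi> (y (c i)) (U i s)) \<le> \<delta> / 6" using o U(2) D(1) by auto
      moreover have eq: "E (U i) s - F s = (\<Phi> (y s) (U i s) - \<Phi> (y (c i)) (U i s))
          - ((LINT a|\<mu> s. \<Phi> (y s) a) - (LINT a|\<mu> s. \<Phi> (y (c i)) a))"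
        by (simp add: E_def F_def)
      ultimately show ?thesis
        unfolding eq using norm_triangle_ineq4[of "\<Phi> (y s) (U i s) - \<Phi> (y (c i)) (U i s)"
            "(LINT a|\<mu> s. \<Phi> (y s) a) - (LINT a|\<mu> s. \<Phi> (y (c i)) a)"] by linarith
    qed
    have Eu: "(LINT s:?J|lborel. E u s) = (LINT s:?J|lborel. E (U i) s)"
      by (rule set_integral_Icc_cong_interior[OF Em[OF um uD] Em[OF U]]) (auto simp: E_def u_piece)
    have iE: "set_integrable lborel ?J (E (U i))"
      by (rule Eint[OF U]) (use c_le[of "Suc i"] c_ge i in auto)
    have iF: "set_integrable lborel ?J F" unfolding F_def by (rule set_integral_diff(1)[OF F1 F2])
    have "(LINT s:?J|lborel. E u s) = (LINT s:?J|lborel. F s) + (LINT s:?J|lborel. E (U i) s - F s)"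
      using set_integral_diff(2)[OF iE iF] Eu by simp
    also have "norm \<dots> \<le> norm (LINT s:?J|lborel. F s) + norm (LINT s:?J|lborel. E (U i) s - F s)"
      by (rule norm_triangle_ineq)
    also have "norm (LINT s:?J|lborel. E (U i) s - F s) \<le> \<delta> / 3 * (1 / N)"
      unfolding c_diff[of i, symmetric]
      by (rule norm_set_integral_Icc_le[OF c_mono set_integral_diff(1)[OF iE iF]]) (rule EF, simp)
    finally show ?thesis using nF by (simp add: field_simps)
  qed
  have partial: "norm (LINT s:{b..c i}|lborel. E u s) \<le> real i * (\<delta> / (2 * N))" if "i \<le> N" for i
    using that
  proof (induction i)
    case 0
    have "(LINT s:{b..b}|lborel. E u s) = (LINT s:{b..b}|lborel. 0)"
      by (rule set_integral_Icc_cong_interior[OF Em[OF um uD]]) auto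
    then show ?case by (simp add: c_def)
  next
    case (Suc i)
    have "(LINT s:{b..c (Suc i)}|lborel. E u s) = (LINT s:{b..c i}|lborel. E u s) + (LINT s:{c i..c (Suc i)}|lborel. E u s)"
      by (rule set_integral_Icc_combine[OF c_ge c_mono Eint[OF um uD], symmetric]) (use c_le Suc in auto)
    also have "norm \<dots> \<le> real i * (\<delta> / (2 * N)) + \<delta> / (2 * N)"
      by (rule order_trans[OF norm_triangle_ineq add_mono]) (use Suc piece in auto)
    finally show ?case by (simp add: algebra_simps add_divide_distrib)
  qed
  have "norm (LINT s:{b..t}|lborel. E u s) \<le> \<delta>" if t: "b \<le> t" "t \<le> b + 1" for t
  proof -
    define i where "i = nat \<lfloor>N * (t - b)\<rfloor>"
    have i1: "real i \<le> N * (t - b)" "N * (t - b) < real i + 1"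
      using t N(1) by (auto simp: i_def)
    have "real N * (t - b) \<le> real N * 1" using t N(1) by (intro mult_left_mono) auto
    then have "real i \<le> real N" using i1(1) by linarith
    then have iN: "i \<le> N" by simp
    have "t - b \<le> (real i + 1) / N" "real i / N \<le> t - b"
      using i1 N(1) by (simp_all add: pos_le_divide_eq pos_divide_le_eq mult.commute)
    then have ct: "c i \<le> t" "t - c i \<le> 1 / N" by (simp_all add: c_def add_divide_distrib)
    have "(LINT s:{b..t}|lborel. E u s) = (LINT s:{b..c i}|lborel. E u s) + (LINT s:{c i..t}|lborel. E u s)"
      by (rule set_integral_Icc_combine[OF c_ge ct(1) Eint[OF um uD], symmetric]) (use t in auto)
    also have "norm \<dots> \<le> norm (LINT s:{b..c i}|lborel. E u s) + norm (LINT s:{c i..t}|lborel. E u s)"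
      by (rule norm_triangle_ineq)
    also have "norm (LINT s:{b..c i}|lborel. E u s) \<le> real N * (\<delta> / (2 * N))"
      using partial[OF iN] iN \<delta> N(1) by (elim order_trans) (intro mult_right_mono, auto)
    also have "norm (LINT s:{c i..t}|lborel. E u s) \<le> 2 * B * (t - c i)"
      by (rule norm_set_integral_Icc_le[OF ct(1) Eint[OF um uD]]) (use t c_ge[of i] EB[OF uD] in auto)
    also have "2 * B * (t - c i) \<le> 2 * B * (1 / N)" using ct(2) B(1) by (intro mult_left_mono) auto
    finally have "norm (LINT s:{b..t}|lborel. E u s) \<le> real N * (\<delta> / (2 * N)) + 2 * B * (1 / N)" by simp
    moreover have "real N * (\<delta> / (2 * N)) = \<delta> / 2" "2 * B * (1 / N) = 2 * B / N" using N(1) by simp_all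
    ultimately show ?thesis using N(3) by linarith
  qed
  then show ?thesis using um uD unfolding E_def by blast
qed

text \<open>Unit intervals are treated separately, so the tolerance may be prescribed interval by
  interval; an exponentially decaying choice is what the infinite horizon requires.\<close>

theorem chattering:
  fixes \<Phi> :: "'x::euclidean_space \<Rightarrow> 'c::euclidean_space \<Rightarrow> 'e::euclidean_space"
    and \<mu> :: "real \<Rightarrow> 'c measure" and y :: "real \<Rightarrow> 'x"
  assumes K: "compact K" and \<Phi>: "continuous_on (UNIV \<times> K) (\<lambda>(x, a). \<Phi> x a)"
    and D: "D \<subseteq> K" "K \<subseteq> closure D" "D \<noteq> {}"
    and \<mu>: "\<mu> \<in> measurable borel (relaxed_space K)" and y: "continuous_on UNIV y"
    and \<delta>: "\<And>k :: nat. \<delta> k > 0"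
  obtains u where "u \<in> borel_measurable borel" "\<And>s. u s \<in> D"
    "\<And>k t. real k \<le> t \<Longrightarrow> t \<le> real k + 1 \<Longrightarrow>
      norm (LINT s:{real k..t}|lborel. \<Phi> (y s) (u s) - (LINT a|\<mu> s. \<Phi> (y s) a)) \<le> \<delta> k"
proof -
  have ym: "y \<in> borel_measurable borel" by (rule borel_measurable_continuous_onI[OF y])
  have "\<forall>k :: nat. \<exists>u. u \<in> borel_measurable borel \<and> (\<forall>s. u s \<in> D) \<and>
    (\<forall>t. real k \<le> t \<and> t \<le> real k + 1 \<longrightarrow>
      norm (LINT s:{real k..t}|lborel. \<Phi> (y s) (u s) - (LINT a|\<mu> s. \<Phi> (y s) a)) \<le> \<delta> k)"
    by (rule allI) (rule chattering_unit_interval[OF K \<Phi> D \<mu> y \<delta>])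
  from choice[OF this] obtain U where U: "\<And>k. U k \<in> borel_measurable borel" "\<And>k s. U k s \<in> D"
    and Ue: "\<And>k t. real k \<le> t \<Longrightarrow> t \<le> real k + 1 \<Longrightarrow>
      norm (LINT s:{real k..t}|lborel. \<Phi> (y s) (U k s) - (LINT a|\<mu> s. \<Phi> (y s) a)) \<le> \<delta> k"
    by blast
  define u where "u s = U (nat \<lfloor>s\<rfloor>) s" for s
  have um: "u \<in> borel_measurable borel"
    unfolding u_def by (rule measurable_compose_countable[OF U(1)]) measurable
  have uD: "u s \<in> D" for s by (simp add: u_def U(2))
  have m: "(\<lambda>s. \<Phi> (y s) (w s) - (LINT a|\<mu> s. \<Phi> (y s) a)) \<in> borel_measurable borel"
    if w: "w \<in> borel_measurable borel" "\<And>s. w s \<in> D" for w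
  proof -
    have "(\<lambda>s. \<Phi> (y s) (w s)) \<in> borel_measurable borel"
      by (rule measurable_ordinary_comp[OF K \<Phi> w(1) _ ym]) (use w(2) D(1) in auto)
    then show ?thesis using measurable_relaxed_comp[OF K \<Phi> \<mu> ym] by measurable
  qed
  show thesis
  proof (rule that[OF um uD])
    fix k t assume t: "real k \<le> t" "t \<le> real k + 1"
    have "u s = U k s" if "real k < s" "s < t" for s
    proof -
      have "\<lfloor>s\<rfloor> = int k" using that t by (simp add: floor_eq_iff)
      then show ?thesis by (simp add: u_def)
    qed
    then have "(LINT s:{real k..t}|lborel. \<Phi> (y s) (u s) - (LINT a|\<mu> s. \<Phi> (y s) a)) =
        (LINT s:{real k..t}|lborel. \<Phi> (y s) (U k s) - (LINT a|\<mu> s. \<Phi> (y s) a))"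
      by (intro set_integral_Icc_cong_interior m um uD U) auto
    then show "norm (LINT s:{real k..t}|lborel. \<Phi> (y s) (u s) - (LINT a|\<mu> s. \<Phi> (y s) a)) \<le> \<delta> k"
      using Ue[OF t] by simp
  qed
qed

section \<open>Trajectories determined from infinity\<close>

text \<open>With radii r(k) = \<epsilon> exp (- \<kappa> k), monotonicity bounds \<omega>(s) / s
  from below by \<omega>(r(k+1)) / r(k) on the block from r(k+1) to r(k), and
  \<open>\<kappa> \<ge> 1\<close> makes the block at least r(k) / 2 long. Each term is thus at most
  twice its share of the Dini integral; \<open>\<epsilon> \<le> 1\<close> and
  \<open>\<epsilon> < \<delta>\<close> keep the blocks in (0, 1] and in the range of
  monotonicity.\<close>

lemma dini_summable:
  assumes dini: "dini \<omega>" and nonneg: "\<And>r. 0 \<le> r \<Longrightarrow> \<omega> r \<ge> 0"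
    and mono: "mono_on {0..<\<delta>} \<omega>" and lam: "\<kappa> \<ge> (1::real)" and \<epsilon>: "0 < \<epsilon>" "\<epsilon> \<le> 1" "\<epsilon> < \<delta>"
  shows "summable (\<lambda>k. \<omega> (\<epsilon> * exp (- \<kappa> * real (Suc k))))"
proof -
  define r where "r k = \<epsilon> * exp (- \<kappa> * real k)" for k
  have r_pos: "r k > 0" for k using \<epsilon> by (simp add: r_def)
  have r_Suc: "r (Suc k) = r k * exp (- \<kappa>)" for k
    by (simp add: r_def algebra_simps exp_add[symmetric] exp_diff exp_minus field_simps)
  note e_half = exp_uminus_le_half[OF lam]
  have r_half: "r (Suc k) \<le> r k / 2" for k
    unfolding r_Suc using e_half r_pos[of k] mult_left_mono[of "exp (- \<kappa>)" "1/2" "r k"] by simp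
  have r_anti: "decseq r"
    by (rule decseq_SucI) (use r_half r_pos in \<open>smt (verit, best) field_sum_of_halves\<close>)
  have r_le: "r k \<le> \<epsilon>" for k using \<epsilon> lam by (simp add: r_def)
  define I where "I k = {r (Suc k)<..r k}" for k
  have I_disj: "disjoint_family I"
  proof -
    have "I i \<inter> I j = {}" if "i < j" for i j
    proof -
      have "r j \<le> r (Suc i)" using decseqD[OF r_anti, of "Suc i" j] that by simp
      then show ?thesis by (auto simp: I_def)
    qed
    then show ?thesis unfolding disjoint_family_on_def by (metis Int_commute linorder_neqE_nat)
  qed
  have I_sub: "I k \<subseteq> {0<..1}" for k
    using r_pos[of "Suc k"] r_le[of k] \<epsilon> by (auto simp: I_def)
  have block: "ennreal (\<omega> (r (Suc k)) / 2) \<le> (\<integral>\<^sup>+s\<in>I k. ennreal (\<omega> (r (Suc k)) / r k) \<partial>lborel)" for k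
  proof -
    have "(\<integral>\<^sup>+s\<in>I k. ennreal (\<omega> (r (Suc k)) / r k) \<partial>lborel) = ennreal (\<omega> (r (Suc k)) / r k) * emeasure lborel (I k)"
      by (simp add: nn_integral_cmult_indicator I_def)
    also have "\<dots> = ennreal (\<omega> (r (Suc k)) / r k * (r k - r (Suc k)))"
    proof (subst ennreal_mult)
      show "0 \<le> \<omega> (r (Suc k)) / r k" "0 \<le> r k - r (Suc k)"
        using decseq_SucD[OF r_anti, of k] nonneg[of "r (Suc k)"] r_pos[of k] r_pos[of "Suc k"] by auto
    qed (use decseq_SucD[OF r_anti, of k] in \<open>simp add: I_def\<close>)
    finally have eq: "(\<integral>\<^sup>+s\<in>I k. ennreal (\<omega> (r (Suc k)) / r k) \<partial>lborel) = ennreal (\<omega> (r (Suc k)) / r k * (r k - r (Suc k)))" .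
    have "\<omega> (r (Suc k)) / 2 = \<omega> (r (Suc k)) / r k * (r k / 2)" using r_pos[of k] by simp
    also have "\<dots> \<le> \<omega> (r (Suc k)) / r k * (r k - r (Suc k))"
      using r_half[of k] nonneg[of "r (Suc k)"] r_pos[of k] r_pos[of "Suc k"] by (intro mult_left_mono) auto
    finally show ?thesis unfolding eq by (rule ennreal_leI)
  qed
  have partial: "(\<Sum>k<n. ennreal (\<omega> (r (Suc k)) / 2)) \<le> (\<integral>\<^sup>+s\<in>{0<..1}. ennreal (\<omega> s / s) \<partial>lborel)" for n
  proof -
    have "(\<Sum>k<n. ennreal (\<omega> (r (Suc k)) / 2)) \<le> (\<Sum>k<n. \<integral>\<^sup>+s\<in>I k. ennreal (\<omega> (r (Suc k)) / r k) \<partial>lborel)"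
      by (intro sum_mono block)
    also have "\<dots> = (\<integral>\<^sup>+s. (\<Sum>k<n. ennreal (\<omega> (r (Suc k)) / r k) * indicator (I k) s) \<partial>lborel)"
      by (rule nn_integral_sum[symmetric]) (simp add: I_def)
    also have "\<dots> \<le> (\<integral>\<^sup>+s\<in>{0<..1}. ennreal (\<omega> s / s) \<partial>lborel)"
    proof (rule nn_integral_mono)
      fix s :: real
      show "(\<Sum>k<n. ennreal (\<omega> (r (Suc k)) / r k) * indicator (I k) s) \<le> ennreal (\<omega> s / s) * indicator {0<..1} s"
      proof (cases "\<exists>k<n. s \<in> I k")
        case False
        then have "(\<Sum>k<n. ennreal (\<omega> (r (Suc k)) / r k) * indicator (I k) s) = 0"
          by (intro sum.neutral) auto
        then show ?thesis by simp
      next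
        case True
        then obtain k where k: "k < n" "s \<in> I k" by blast
        have other: "s \<notin> I j" if "j \<noteq> k" for j
          using I_disj k(2) that unfolding disjoint_family_on_def by blast
        have "(\<Sum>k<n. ennreal (\<omega> (r (Suc k)) / r k) * indicator (I k) s) =
            (\<Sum>j<n. if j = k then ennreal (\<omega> (r (Suc k)) / r k) else 0)"
          by (rule sum.cong) (use k other in auto)
        also have "\<dots> = ennreal (\<omega> (r (Suc k)) / r k)" using k by simp
        also have "\<dots> \<le> ennreal (\<omega> s / s)"
        proof (rule ennreal_leI)
          have s: "r (Suc k) < s" "s \<le> r k" using k by (auto simp: I_def)
          have "\<omega> (r (Suc k)) \<le> \<omega> s"
            by (rule mono_onD[OF mono]) (use s r_pos[of "Suc k"] r_le[of k] r_le[of "Suc k"] \<epsilon> in auto)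
          then show "\<omega> (r (Suc k)) / r k \<le> \<omega> s / s"
            using s r_pos[of "Suc k"] nonneg[of "r (Suc k)"] by (intro frac_le) auto
        qed
        finally show ?thesis using k I_sub[of k] by auto
      qed
    qed
    finally show ?thesis .
  qed
  have fin: "(\<integral>\<^sup>+s\<in>{0<..1}. ennreal (\<omega> s / s) \<partial>lborel) < \<infinity>" using dini by (simp add: dini_def)
  have "summable (\<lambda>k. \<omega> (r (Suc k)) / 2)"
  proof (rule summableI_nonneg_bounded)
    show "0 \<le> \<omega> (r (Suc k)) / 2" for k using nonneg[of "r (Suc k)"] r_pos[of "Suc k"] by simp
    show "(\<Sum>k<n. \<omega> (r (Suc k)) / 2) \<le> enn2real (\<integral>\<^sup>+s\<in>{0<..1}. ennreal (\<omega> s / s) \<partial>lborel)" for n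
    proof -
      have "ennreal (\<Sum>k<n. \<omega> (r (Suc k)) / 2) = (\<Sum>k<n. ennreal (\<omega> (r (Suc k)) / 2))"
        using nonneg[OF less_imp_le[OF r_pos]] by (intro sum_ennreal[symmetric]) simp
      then have "ennreal (\<Sum>k<n. \<omega> (r (Suc k)) / 2) \<le> ennreal (enn2real (\<integral>\<^sup>+s\<in>{0<..1}. ennreal (\<omega> s / s) \<partial>lborel))"
        using partial[of n] fin by simp
      then show ?thesis by (subst (asm) ennreal_le_iff) auto
    qed
  qed
  then have "summable (\<lambda>k. 2 * (\<omega> (r (Suc k)) / 2))" by (rule summable_mult)
  then show ?thesis by (simp add: r_def)
qed

text \<open>Comparing with a geometric sequence instead of substituting \<open>r = \<epsilon> exp (- \<lambda> s)\<close> avoids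
  measurability questions: a modulus is monotone only near \<open>0\<close>.\<close>

lemma dini_exponential_small:
  assumes dini: "dini \<omega>" and nonneg: "\<And>r. 0 \<le> r \<Longrightarrow> \<omega> r \<ge> 0"
    and mono: "mono_on {0..<\<delta>} \<omega>" "\<delta> > 0" and lam: "\<kappa> \<ge> (1::real)" and \<eta>: "\<eta> > 0" and \<epsilon>0: "\<epsilon>\<^sub>0 > 0"
  obtains \<epsilon> where "0 < \<epsilon>" "\<epsilon> < \<epsilon>\<^sub>0" "\<epsilon> < \<delta>"
    "(\<integral>\<^sup>+s\<in>{0..}. ennreal (\<omega> (\<epsilon> * exp (- \<kappa> * s))) \<partial>lborel) \<le> ennreal \<eta>"
proof -
  define \<epsilon>1 where "\<epsilon>1 = min 1 (min \<epsilon>\<^sub>0 \<delta>) / 2"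
  have \<epsilon>1: "0 < \<epsilon>1" "\<epsilon>1 \<le> 1" "\<epsilon>1 < \<delta>" "\<epsilon>1 < \<epsilon>\<^sub>0" using mono(2) \<epsilon>0 by (auto simp: \<epsilon>1_def min_def)
  define w where "w k = \<omega> (\<epsilon>1 * exp (- \<kappa> * real (Suc k)))" for k
  have sm: "summable w" unfolding w_def by (rule dini_summable[OF dini nonneg mono(1) lam \<epsilon>1(1-3)])
  obtain m where m: "\<And>n. n \<ge> m \<Longrightarrow> norm (\<Sum>i. w (i + n)) < \<eta>"
    using suminf_exist_split[OF \<eta> sm] by blast
  \<comment> \<open>Shrinking the radius by this factor drops the first \<open>m\<close> terms of
    the convergent series, which leaves a tail below \<open>\<eta>\<close>.\<close>
  define \<epsilon> where "\<epsilon> = \<epsilon>1 * exp (- \<kappa> * real (Suc m))"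
  have \<epsilon>_le: "\<epsilon> \<le> \<epsilon>1" "\<epsilon> > 0" using \<epsilon>1 lam by (auto simp: \<epsilon>_def)
  have wk: "\<omega> (\<epsilon> * exp (- \<kappa> * real k)) = w (k + m)" for k
    by (simp add: \<epsilon>_def w_def mult.assoc exp_add[symmetric] algebra_simps)
  have w_nonneg: "w k \<ge> 0" for k unfolding w_def using \<epsilon>1 by (intro nonneg) auto
  have "(\<integral>\<^sup>+s\<in>{0..}. ennreal (\<omega> (\<epsilon> * exp (- \<kappa> * s))) \<partial>lborel)
      \<le> (\<integral>\<^sup>+s. (\<Sum>k. ennreal (w (k + m)) * indicator {real k..<real k + 1} s) \<partial>lborel)"
  proof (rule nn_integral_mono)
    fix s :: real
    show "ennreal (\<omega> (\<epsilon> * exp (- \<kappa> * s))) * indicator {0..} s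
        \<le> (\<Sum>k. ennreal (w (k + m)) * indicator {real k..<real k + 1} s)"
    proof (cases "s \<ge> 0")
      case True
      define k where "k = nat \<lfloor>s\<rfloor>"
      have k: "real k \<le> s" "s < real k + 1" using True by (auto simp: k_def)
      have "\<omega> (\<epsilon> * exp (- \<kappa> * s)) \<le> \<omega> (\<epsilon> * exp (- \<kappa> * real k))"
      proof (rule mono_onD[OF mono(1)])
        have *: "\<epsilon> * exp (- \<kappa> * t) < \<delta>" if "t \<ge> 0" for t
        proof -
          have "\<epsilon> * exp (- \<kappa> * t) \<le> \<epsilon> * 1" using that lam \<epsilon>_le by (intro mult_left_mono) auto
          then show ?thesis using \<epsilon>_le \<epsilon>1 by linarith
        qed
        show "\<epsilon> * exp (- \<kappa> * s) \<in> {0..<\<delta>}" "\<epsilon> * exp (- \<kappa> * real k) \<in> {0..<\<delta>}"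
          using *[OF True] *[of "real k"] \<epsilon>_le by auto
        show "\<epsilon> * exp (- \<kappa> * s) \<le> \<epsilon> * exp (- \<kappa> * real k)"
          using k \<epsilon>_le lam by (intro mult_left_mono) auto
      qed
      then have "ennreal (\<omega> (\<epsilon> * exp (- \<kappa> * s))) * indicator {0..} s \<le> ennreal (w (k + m)) * indicator {real k..<real k + 1} s"
        using True k by (simp add: wk[symmetric] ennreal_leI)
      also have "\<dots> \<le> (\<Sum>j. ennreal (w (j + m)) * indicator {real j..<real j + 1} s)"
        using sum_le_suminf[of "\<lambda>j. ennreal (w (j + m)) * indicator {real j..<real j + 1} s" "{k}"]
        by (simp del: sum_mult_indicator sum_indicator_mult)
      finally show ?thesis .
    qed simp
  qed
  also have "\<dots> = (\<Sum>k. \<integral>\<^sup>+s. ennreal (w (k + m)) * indicator {real k..<real k + 1} s \<partial>lborel)"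
    by (rule nn_integral_suminf) measurable
  also have "\<dots> = (\<Sum>k. ennreal (w (k + m)))"
    by (simp add: nn_integral_cmult_indicator)
  also have "\<dots> = ennreal (\<Sum>k. w (k + m))"
    by (rule suminf_ennreal2) (use w_nonneg sm in \<open>auto simp: summable_iff_shift\<close>)
  also have "\<dots> \<le> ennreal \<eta>" using m[of m] by (intro ennreal_leI) auto
  finally have "(\<integral>\<^sup>+s\<in>{0..}. ennreal (\<omega> (\<epsilon> * exp (- \<kappa> * s))) \<partial>lborel) \<le> ennreal \<eta>" .
  then show thesis using that[of \<epsilon>] \<epsilon>_le \<epsilon>1 by auto
qed

section \<open>Exponentially decaying tails\<close>

lemma set_integrable_exp_decay:
  fixes c :: real
  assumes "c > 0"
  shows "set_integrable lborel {t..} (\<lambda>s. exp (- c * s))"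
    and "(LINT s:{t..}|lborel. exp (- c * s)) = exp (- c * t) / c"
proof -
  have "((\<lambda>s. exp (- c * s)) \<longlongrightarrow> 0) at_top"
  proof (rule filterlim_compose[OF exp_at_bot])
    show "LIM s at_top. - c * s :> at_bot"
      using assms by (simp add: filterlim_uminus_at_bot filterlim_tendsto_pos_mult_at_top[OF tendsto_const _ filterlim_ident])
  qed
  then have "((\<lambda>s. - exp (- c * s) / c) \<longlongrightarrow> - 0 / c) at_top"
    using assms by (intro tendsto_intros) auto
  then have "((\<lambda>s. - exp (- c * s) / c) \<longlongrightarrow> 0) at_top" by simp
  then have nn: "(\<integral>\<^sup>+s. ennreal (exp (- c * s)) * indicator {t..} s \<partial>lborel) = ennreal (0 - (- exp (- c * t) / c))"
    by (rule nn_integral_FTC_atLeast[rotated 3]) (use assms in \<open>auto intro!: derivative_eq_intros\<close>)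
  then have nn': "(\<integral>\<^sup>+s. ennreal (indicat_real {t..} s *\<^sub>R exp (- c * s)) \<partial>lborel) = ennreal (exp (- c * t) / c)"
    by (subst (asm) nn_integral_cong[where v="\<lambda>s. ennreal (indicat_real {t..} s *\<^sub>R exp (- c * s))"]) (auto simp: indicator_def)
  show i: "set_integrable lborel {t..} (\<lambda>s. exp (- c * s))"
    unfolding set_integrable_def by (rule integrableI_nn_integral_finite[OF _ _ nn']) (use assms in auto)
  show "(LINT s:{t..}|lborel. exp (- c * s)) = exp (- c * t) / c"
    unfolding set_lebesgue_integral_def
    by (rule integral_eq_nn_integral[THEN trans]) (use assms nn' in \<open>auto simp: enn2real_ennreal\<close>)
qed

lemma set_integral_atLeast_split:
  fixes f :: "real \<Rightarrow> 'e::{banach, second_countable_topology}"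
  assumes f: "set_integrable lborel {0..} f" and t: "t \<ge> 0"
  shows "(LINT s:{0..}|lborel. f s) = (LINT s:{0..t}|lborel. f s) + (LINT s:{t..}|lborel. f s)"
proof -
  have eq: "{0..} = {0..t} \<union> {t..}" using t by auto
  have i: "set_integrable lborel {0..t} f" "set_integrable lborel {t..} f"
    by (rule set_integrable_subset[OF f]; use t in auto)+
  show ?thesis
    unfolding eq
  proof (rule set_integral_Un_AE[OF _ _ _ i])
    show "AE x in lborel. \<not> (x \<in> {0..t} \<and> x \<in> {t..})"
      using AE_lborel_singleton[of t] by eventually_elim auto
  qed auto
qed

text \<open>The errors of the unit intervals at least halve from one to the next, so their sum is
  controlled by the first. The factor \<open>exp \<kappa>\<close> pays for rounding \<open>s\<close>
  down to an integer, and the two incomplete intervals at the ends are absorbed in the factor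
  4.\<close>

lemma integral_exponential_decay:
  fixes F :: "real \<Rightarrow> 'e::euclidean_space"
  assumes int: "\<And>t. set_integrable lborel {0..t} F" and lam: "\<kappa> \<ge> (1::real)" and c: "c \<ge> 0"
    and bd: "\<And>k t. real k \<le> t \<Longrightarrow> t \<le> real k + 1 \<Longrightarrow> norm (LINT s:{real k..t}|lborel. F s) \<le> c * exp (- \<kappa> * real k)"
    and st: "0 \<le> s" "s \<le> t"
  shows "norm (LINT r:{s..t}|lborel. F r) \<le> 4 * c * exp \<kappa> * exp (- \<kappa> * s)"
proof -
  define e where "e k = exp (- \<kappa> * real k)" for k :: nat
  note e_half = exp_uminus_le_half[OF lam]
  have e_Suc: "2 * e (Suc k) \<le> e k" for k
  proof -
    have "e (Suc k) = e k * exp (- \<kappa>)" by (simp add: e_def exp_add[symmetric] algebra_simps)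
    then show ?thesis using e_half mult_left_mono[of "exp (- \<kappa>)" "1/2" "e k"] by (simp add: e_def)
  qed
  have e_pos: "e k > 0" for k by (simp add: e_def)
  have comb: "(LINT r:{a..b}|lborel. F r) + (LINT r:{b..d}|lborel. F r) = (LINT r:{a..d}|lborel. F r)"
    if "0 \<le> a" "a \<le> b" "b \<le> d" for a b d
    by (rule set_integral_Icc_combine[OF that(2,3) set_integrable_subset[OF int]]) (use that in auto)
  have zero: "(LINT r:{a..a}|lborel. F r) = 0" if "0 \<le> a" for a
    using comb[of a a a] that by simp
  \<comment> \<open>Stated with a difference so that the induction telescopes:
    \<open>c * e n\<close> is at most \<open>2 * c * (e n - e (Suc n))\<close>.\<close>
  have nat_bd: "norm (LINT r:{real k..real (k + j)}|lborel. F r) \<le> 2 * c * (e k - e (k + j))" for k j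
  proof (induction j)
    case 0
    show ?case using zero[of "real k"] by simp
  next
    case (Suc j)
    have "(LINT r:{real k..real (k + Suc j)}|lborel. F r) =
        (LINT r:{real k..real (k + j)}|lborel. F r) + (LINT r:{real (k + j)..real (k + Suc j)}|lborel. F r)"
      by (rule comb[symmetric]) auto
    also have "norm \<dots> \<le> 2 * c * (e k - e (k + j)) + c * e (k + j)"
      using bd[of "k + j" "real (k + Suc j)"]
      by (intro order_trans[OF norm_triangle_ineq add_mono] Suc) (simp add: e_def)
    also have "\<dots> \<le> 2 * c * (e k - e (k + Suc j))"
      using mult_left_mono[OF e_Suc[of "k + j"] c] by (simp add: algebra_simps)
    finally show ?case .
  qed
  define k where "k = nat \<lfloor>s\<rfloor>"
  define m where "m = nat \<lfloor>t\<rfloor>"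
  have k: "real k \<le> s" "s \<le> real k + 1" and m: "real m \<le> t" "t \<le> real m + 1"
    using st by (auto simp: k_def m_def intro: less_imp_le)
  have km: "k \<le> m" unfolding k_def m_def using st by (intro nat_mono floor_mono)
  have "(LINT r:{real k..s}|lborel. F r) + (LINT r:{s..t}|lborel. F r) =
      (LINT r:{real k..real m}|lborel. F r) + (LINT r:{real m..t}|lborel. F r)"
    using comb[of "real k" s t] comb[of "real k" "real m" t] k m km st by simp
  then have "(LINT r:{s..t}|lborel. F r) =
      (LINT r:{real k..real m}|lborel. F r) + (LINT r:{real m..t}|lborel. F r) - (LINT r:{real k..s}|lborel. F r)"
    by (simp add: algebra_simps)
  also have "norm \<dots> \<le> norm (LINT r:{real k..real m}|lborel. F r) + norm (LINT r:{real m..t}|lborel. F r)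
      + norm (LINT r:{real k..s}|lborel. F r)"
    by (meson add_right_mono norm_triangle_ineq norm_triangle_ineq4 order_trans)
  also have "\<dots> \<le> 2 * c * (e k - e m) + c * e m + c * e k"
    using nat_bd[of k "m - k"] km bd[OF m] bd[OF k] by (simp add: e_def)
  also have "\<dots> \<le> 4 * c * e k"
    using c e_pos[of m] e_pos[of k] by (simp add: algebra_simps add_increasing)
  also have "e k \<le> exp \<kappa> * exp (- \<kappa> * s)"
  proof -
    have "- \<kappa> * real k \<le> \<kappa> - \<kappa> * s" using k(2) lam mult_left_mono[of s "real k + 1" \<kappa>] by (simp add: algebra_simps)
    then show ?thesis by (simp add: e_def exp_add[symmetric])
  qed
  finally show ?thesis using c by (simp add: mult_left_mono mult.assoc)
qed

lemma measurable_tail_integral: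
  fixes q :: "real \<Rightarrow> 'e::euclidean_space"
  assumes q: "set_integrable lborel {0..} q"
  shows "(\<lambda>t. LINT s:{max 0 t..}|lborel. q s) \<in> borel_measurable borel"
proof -
  have i: "set_integrable lborel {0..t} q" for t by (rule set_integrable_subset[OF q]) auto
  have eq: "(LINT s:{max 0 t..}|lborel. q s) = (LINT s:{0..}|lborel. q s) - (LINT s:{0..max 0 t}|lborel. q s)" for t
    using set_integral_atLeast_split[OF q, of "max 0 t"] by simp
  have "continuous_on UNIV (\<lambda>t. LINT s:{0..max 0 t}|lborel. q s)"
    by (rule continuous_on_compose2[OF continuous_on_set_integral_Icc[OF i]]) (auto intro!: continuous_intros)
  then show ?thesis unfolding eq by (intro borel_measurable_continuous_onI continuous_intros)
qed

section \<open>The contraction backward from infinity\<close>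

context compact_control
begin

text \<open>If \<open>E\<close> is the tail of the averaging error, the equation says that
  \<open>Y + \<zeta>\<close> solves the ordinary equation and merges with \<open>Y\<close> at
  infinity. Of the allowed size \<open>\<epsilon> * exp (- (2 * \<Lambda>) * t)\<close> one half is
  spent on \<open>E\<close>; the other half is the tail integral of
  \<open>\<Lambda> * \<epsilon> * exp (- (2 * \<Lambda>) * s)\<close>. The same computation gives
  the contraction factor 1/2.\<close>

lemma backward_fixed_point:
  assumes u: "u \<in> borel_measurable borel" "\<And>t. u t \<in> K"
    and Y: "Y \<in> borel_measurable borel" and E: "E \<in> borel_measurable borel"
    and \<Lambda>: "\<Lambda> > 0" and \<epsilon>: "0 < \<epsilon>" "\<epsilon> \<le> 1"
    and E_bd: "\<And>t. t \<ge> 0 \<Longrightarrow> norm (E t) \<le> \<epsilon> / 2 * exp (- (2 * \<Lambda>) * t)"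
    and tube: "\<And>t a w w'. t \<ge> 0 \<Longrightarrow> a \<in> K \<Longrightarrow> norm (w - Y t) \<le> 1 \<Longrightarrow> norm (w' - Y t) \<le> 1 \<Longrightarrow>
                 norm (g w a - g w' a) \<le> \<Lambda> * norm (w - w')"
  obtains \<zeta> where "\<zeta> \<in> borel_measurable borel"
    "\<And>t. t \<ge> 0 \<Longrightarrow> norm (\<zeta> t) \<le> \<epsilon> * exp (- (2 * \<Lambda>) * t)"
    "set_integrable lborel {0..} (\<lambda>s. g (Y s + \<zeta> s) (u s) - g (Y s) (u s))"
    "\<And>t. t \<ge> 0 \<Longrightarrow> \<zeta> t = - E t - (LINT s:{t..}|lborel. g (Y s + \<zeta> s) (u s) - g (Y s) (u s))"
proof -
  interpret V: caratheodory_field "\<lambda>t x. g x (u t)" M L by (rule field_ordinary[OF u])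
  define Q where "Q \<zeta> s = g (Y s + \<zeta> s) (u s) - g (Y s) (u s)" for \<zeta> s
  define T where "T \<zeta> t = - E t - (LINT s:{max 0 t..}|lborel. Q \<zeta> s)" for \<zeta> t
  define e where "e t = exp (- (2 * \<Lambda>) * t)" for t
  \<comment> \<open>The set preserved by the fixed point map. As \<open>\<epsilon> \<le> 1\<close>,
    its members keep \<open>Y + \<zeta>\<close> in the unit tube where the Lipschitz constant
    \<open>\<Lambda>\<close> holds.\<close>
  define good :: "(real \<Rightarrow> 'x) \<Rightarrow> bool" where "good \<zeta> \<longleftrightarrow> \<zeta> \<in> borel_measurable borel \<and> (\<forall>t\<ge>0. norm (\<zeta> t) \<le> \<epsilon> * e t)" for \<zeta>
  have e_pos: "e t > 0" for t by (simp add: e_def)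
  have e_le: "e t \<le> 1" if "t \<ge> 0" for t using that \<Lambda> by (simp add: e_def)
  have e_int: "set_integrable lborel {t..} e" "(LINT s:{t..}|lborel. e s) = e t / (2 * \<Lambda>)" for t
    unfolding e_def[abs_def] using set_integrable_exp_decay[of "2 * \<Lambda>" t] \<Lambda> by auto
  have good_le1: "norm (\<zeta> t) \<le> 1" if "good \<zeta>" "t \<ge> 0" for \<zeta> t
  proof -
    have "norm (\<zeta> t) \<le> \<epsilon> * e t" using that by (simp add: good_def)
    also have "\<dots> \<le> 1 * 1" using \<epsilon> e_le[OF that(2)] e_pos[of t] by (intro mult_mono) auto
    finally show ?thesis by simp
  qed
  have Q_meas: "Q \<zeta> \<in> borel_measurable borel" if "good \<zeta>" for \<zeta>
  proof -
    have [measurable]: "\<zeta> \<in> borel_measurable borel" using that by (simp add: good_def)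
    have "(\<lambda>s. Y s + \<zeta> s) \<in> borel_measurable borel" using Y by measurable
    from V.measurable_comp[OF this] V.measurable_comp[OF Y] show ?thesis
      unfolding Q_def[abs_def] by measurable
  qed
  have Q_diff: "norm (Q \<zeta> s - Q \<zeta>' s) \<le> \<Lambda> * norm (\<zeta> s - \<zeta>' s)" if "good \<zeta>" "good \<zeta>'" "s \<ge> 0" for \<zeta> \<zeta>' s
    using tube[OF that(3) u(2), of "Y s + \<zeta> s" "Y s + \<zeta>' s" s] good_le1[OF that(1,3)] good_le1[OF that(2,3)]
    by (simp add: Q_def)
  have good0: "good (\<lambda>_. 0)" using \<epsilon> e_pos by (simp add: good_def less_imp_le)
  have Q0: "Q (\<lambda>_. 0) = (\<lambda>_. 0)" by (rule ext) (simp add: Q_def)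
  have Q_bd: "norm (Q \<zeta> s) \<le> \<Lambda> * \<epsilon> * e s" if "good \<zeta>" "s \<ge> 0" for \<zeta> s
  proof -
    have "norm (Q \<zeta> s) \<le> \<Lambda> * norm (\<zeta> s)" using Q_diff[OF that(1) good0 that(2)] by (simp add: Q0)
    also have "\<dots> \<le> \<Lambda> * (\<epsilon> * e s)" using that \<Lambda> by (intro mult_left_mono) (auto simp: good_def)
    finally show ?thesis by (simp add: mult.assoc)
  qed
  have Q_int: "set_integrable lborel {t..} (Q \<zeta>)" if "good \<zeta>" "t \<ge> 0" for \<zeta> t
  proof (rule set_integrable_bound)
    show "set_integrable lborel {t..} (\<lambda>s. \<Lambda> * \<epsilon> * e s)" by (intro set_integrable_mult_right e_int(1))
    show "set_borel_measurable lborel {t..} (Q \<zeta>)"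
      using Q_meas[OF that(1)] unfolding set_borel_measurable_def by measurable
    show "AE s in lborel. s \<in> {t..} \<longrightarrow> norm (Q \<zeta> s) \<le> norm (\<Lambda> * \<epsilon> * e s)"
      using Q_bd[OF that(1)] that(2) \<Lambda> \<epsilon> e_pos by (auto intro!: AE_I2 simp: abs_mult abs_of_pos[OF e_pos])
  qed
  have T_good: "good (T \<zeta>)" if "good \<zeta>" for \<zeta>
    unfolding good_def
  proof (intro conjI allI impI)
    show "T \<zeta> \<in> borel_measurable borel"
      unfolding T_def[abs_def] using measurable_tail_integral[OF Q_int[OF that order_refl]] E by measurable
    fix t :: real assume t: "t \<ge> 0"
    have "norm (LINT s:{t..}|lborel. Q \<zeta> s) \<le> (LINT s:{t..}|lborel. \<Lambda> * \<epsilon> * e s)"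
      by (rule norm_set_integral_le[OF Q_int[OF that t]])
        (use t in \<open>auto intro!: set_integrable_mult_right e_int(1) Q_bd[OF that]\<close>)
    also have "\<dots> = \<epsilon> / 2 * e t" using e_int(2)[of t] \<Lambda> by simp
    finally have "norm (T \<zeta> t) \<le> \<epsilon> / 2 * e t + \<epsilon> / 2 * e t"
      using E_bd[OF t] norm_triangle_ineq4[of "- E t" "LINT s:{t..}|lborel. Q \<zeta> s"] t
      unfolding T_def e_def by (simp add: max_def)
    then show "norm (T \<zeta> t) \<le> \<epsilon> * e t" by simp
  qed
  have T_contract: "norm (T \<zeta> t - T \<zeta>' t) \<le> C / 2 * e t"
    if g: "good \<zeta>" "good \<zeta>'" and d: "\<And>t. t \<ge> 0 \<Longrightarrow> norm (\<zeta> t - \<zeta>' t) \<le> C * e t" and t: "t \<ge> 0" for \<zeta> \<zeta>' C t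
  proof -
    have "T \<zeta> t - T \<zeta>' t = (LINT s:{t..}|lborel. Q \<zeta>' s) - (LINT s:{t..}|lborel. Q \<zeta> s)"
      using t by (simp add: T_def max_def)
    also have "\<dots> = (LINT s:{t..}|lborel. Q \<zeta>' s - Q \<zeta> s)"
      by (rule set_integral_diff(2)[OF Q_int[OF g(2) t] Q_int[OF g(1) t], symmetric])
    also have "norm \<dots> \<le> (LINT s:{t..}|lborel. \<Lambda> * C * e s)"
    proof (rule norm_set_integral_le[OF set_integral_diff(1)[OF Q_int[OF g(2) t] Q_int[OF g(1) t]]])
      fix s assume "s \<in> {t..}"
      then have s: "s \<ge> 0" using t by simp
      have "norm (Q \<zeta>' s - Q \<zeta> s) \<le> \<Lambda> * norm (\<zeta>' s - \<zeta> s)" by (rule Q_diff[OF g(2,1) s])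
      also have "\<dots> \<le> \<Lambda> * (C * e s)" using d[OF s] \<Lambda> by (intro mult_left_mono) (auto simp: norm_minus_commute)
      finally show "norm (Q \<zeta>' s - Q \<zeta> s) \<le> \<Lambda> * C * e s" by (simp add: mult.assoc)
    qed (auto intro!: set_integrable_mult_right e_int(1))
    also have "\<dots> = C / 2 * e t" using e_int(2)[of t] \<Lambda> by simp
    finally show ?thesis .
  qed
  define Z where "Z n = (T ^^ n) (\<lambda>_. 0)" for n
  have Z_good: "good (Z n)" for n
    unfolding Z_def by (induction n) (auto simp: good0 T_good)
  have Z_Suc: "Z (Suc n) = T (Z n)" for n by (simp add: Z_def)
  have Z_diff: "\<forall>t\<ge>0. norm (Z (Suc n) t - Z n t) \<le> \<epsilon> * (1/2) ^ n * e t" for n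
  proof (induction n)
    case 0
    have "Z 0 = (\<lambda>_. 0)" by (simp add: Z_def)
    then show ?case using Z_good[of "Suc 0"] by (simp add: good_def)
  next
    case (Suc n)
    show ?case
    proof (intro allI impI)
      fix t :: real assume t: "t \<ge> 0"
      have "norm (T (Z (Suc n)) t - T (Z n) t) \<le> (\<epsilon> * (1/2) ^ n) / 2 * e t"
        by (rule T_contract[OF Z_good Z_good _ t]) (use Suc in auto)
      then show "norm (Z (Suc (Suc n)) t - Z (Suc n) t) \<le> \<epsilon> * (1/2) ^ Suc n * e t"
        by (simp add: Z_Suc[of "Suc n"] Z_Suc[of n, symmetric])
    qed
  qed
  define \<zeta> where "\<zeta> t = lim (\<lambda>n. Z n (max 0 t))" for t
  have lim: "(\<lambda>n. Z n (max 0 t)) \<longlonglongrightarrow> \<zeta> t" for t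
  proof -
    have "norm (Z (Suc n) (max 0 t) - Z n (max 0 t)) \<le> \<epsilon> * e (max 0 t) * (1/2) ^ n" for n
      using Z_diff[of n] by (auto simp: mult_ac)
    then have "convergent (\<lambda>n. Z n (max 0 t))" by (rule convergent_geometric_steps)
    then show ?thesis by (simp add: \<zeta>_def convergent_LIMSEQ_iff)
  qed
  have lim': "(\<lambda>n. Z n t) \<longlonglongrightarrow> \<zeta> t" if "t \<ge> 0" for t using lim[of t] that by (simp add: max_def)
  have \<zeta>_good: "good \<zeta>"
    unfolding good_def
  proof (intro conjI allI impI)
    show "\<zeta> \<in> borel_measurable borel"
    proof (rule borel_measurable_LIMSEQ_metric[OF _ lim])
      have [measurable]: "Z n \<in> borel_measurable borel" for n using Z_good[of n] by (simp add: good_def)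
      show "(\<lambda>t. Z n (max 0 t)) \<in> borel_measurable borel" for n by measurable
    qed
    fix t :: real assume t: "t \<ge> 0"
    show "norm (\<zeta> t) \<le> \<epsilon> * e t"
      by (rule Lim_norm_ubound[OF trivial_limit_sequentially lim'[OF t]])
        (use Z_good t in \<open>auto simp: good_def\<close>)
  qed
  \<comment> \<open>The integrands of all iterates are dominated by
    \<open>\<Lambda> * \<epsilon> * e s\<close>, which is integrable up to infinity.\<close>
  have fix_eq: "\<zeta> t = - E t - (LINT s:{t..}|lborel. Q \<zeta> s)" if t: "t \<ge> 0" for t
  proof -
    let ?f = "\<lambda>n s. indicat_real {t..} s *\<^sub>R Q (Z n) s"
    let ?g = "\<lambda>s. indicat_real {t..} s *\<^sub>R Q \<zeta> s"
    let ?w = "\<lambda>s. indicat_real {t..} s *\<^sub>R (\<Lambda> * \<epsilon> * e s)"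
    have m1: "?f n \<in> borel_measurable lborel" for n using Q_meas[OF Z_good[of n]] by measurable
    have m2: "?g \<in> borel_measurable lborel" using Q_meas[OF \<zeta>_good] by measurable
    have w: "integrable lborel ?w"
      using set_integrable_mult_right[OF e_int(1)[of t], of "\<Lambda> * \<epsilon>"] by (simp add: set_integrable_def)
    have c: "AE s in lborel. (\<lambda>n. ?f n s) \<longlonglongrightarrow> ?g s"
    proof (rule AE_I2)
      fix s
      show "(\<lambda>n. ?f n s) \<longlonglongrightarrow> ?g s"
      proof (cases "s \<in> {t..}")
        case True
        then have s: "s \<ge> 0" using t by simp
        have "(\<lambda>n. g (Y s + Z n s) (u s)) \<longlonglongrightarrow> g (Y s + \<zeta> s) (u s)"
          by (rule continuous_on_tendsto_compose[OF V.continuous_field]) (auto intro!: tendsto_intros lim'[OF s])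
        then show ?thesis unfolding Q_def by (intro tendsto_intros)
      qed simp
    qed
    have dom: "AE s in lborel. norm (?f n s) \<le> ?w s" for n
      using Q_bd[OF Z_good[of n]] t by (intro AE_I2) (auto simp: indicator_def)
    have "(\<lambda>n. integral\<^sup>L lborel (?f n)) \<longlonglongrightarrow> integral\<^sup>L lborel ?g"
      by (rule integral_dominated_convergence[OF m2 m1 w c dom])
    then have "(\<lambda>n. T (Z n) t) \<longlonglongrightarrow> - E t - (LINT s:{t..}|lborel. Q \<zeta> s)"
      unfolding T_def using t by (intro tendsto_intros) (simp add: set_lebesgue_integral_def max_def)
    moreover have "(\<lambda>n. T (Z n) t) \<longlonglongrightarrow> \<zeta> t"
      using LIMSEQ_Suc[OF lim'[OF t]] by (simp add: Z_Suc)
    ultimately show ?thesis by (rule LIMSEQ_unique[symmetric])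
  qed
  show thesis
  proof (rule that[of \<zeta>])
    show "\<zeta> \<in> borel_measurable borel" using \<zeta>_good by (simp add: good_def)
    show "norm (\<zeta> t) \<le> \<epsilon> * exp (- (2 * \<Lambda>) * t)" if "t \<ge> 0" for t
      using \<zeta>_good that by (simp add: good_def e_def)
    show "set_integrable lborel {0..} (\<lambda>s. g (Y s + \<zeta> s) (u s) - g (Y s) (u s))"
      using Q_int[OF \<zeta>_good order_refl] by (simp add: Q_def[abs_def])
    show "\<zeta> t = - E t - (LINT s:{t..}|lborel. g (Y s + \<zeta> s) (u s) - g (Y s) (u s))" if "t \<ge> 0" for t
      using fix_eq[OF that] by (simp add: Q_def)
  qed
qed

end

text \<open>It allows costs to be compared on bounded intervals, where the averaging error of the
  cost enters as a signed integral; that integral is small although its integrand need not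
  be.\<close>

lemma nn_integral_atLeast_le:
  assumes f: "f \<in> borel_measurable borel" and le: "\<And>n :: nat. (\<integral>\<^sup>+t\<in>{0..real n}. f t \<partial>lborel) \<le> B"
  shows "(\<integral>\<^sup>+t\<in>{0..}. f t \<partial>lborel) \<le> B"
proof -
  have sup: "f t * indicator {0..} t = (SUP n. f t * indicator {0..real n} t)" for t :: real
  proof (cases "t \<ge> 0")
    case True
    obtain n :: nat where n: "t \<le> real n" using real_arch_simple by blast
    show ?thesis
    proof (rule antisym)
      have "f t * indicator {0..} t = f t * indicator {0..real n} t" using True n by simp
      also have "\<dots> \<le> (SUP n. f t * indicator {0..real n} t)" by (rule SUP_upper) simp
      finally show "f t * indicator {0..} t \<le> (SUP n. f t * indicator {0..real n} t)" .
      show "(SUP n. f t * indicator {0..real n} t) \<le> f t * indicator {0..} t"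
        using True by (intro SUP_least) (auto simp: indicator_def)
    qed
  qed (simp add: indicator_def)
  have "(\<integral>\<^sup>+t\<in>{0..}. f t \<partial>lborel) = (SUP n. \<integral>\<^sup>+t\<in>{0..real n}. f t \<partial>lborel)"
    unfolding sup
    by (rule nn_integral_monotone_convergence_SUP)
      (use f in \<open>auto simp: incseq_def le_fun_def indicator_def intro!: mult_left_mono\<close>)
  also have "\<dots> \<le> B" by (rule SUP_least) (rule le)
  finally show ?thesis .
qed

lemma nn_integral_Icc_eq_set_integral:
  assumes "set_integrable lborel {a..b} f" "\<And>t. a \<le> t \<Longrightarrow> t \<le> b \<Longrightarrow> 0 \<le> f t"
  shows "(\<integral>\<^sup>+t\<in>{a..b}. ennreal (f t) \<partial>lborel) = ennreal (LINT t:{a..b}|lborel. f t)"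
proof -
  have "(\<integral>\<^sup>+t\<in>{a..b}. ennreal (f t) \<partial>lborel) = (\<integral>\<^sup>+t. ennreal (indicat_real {a..b} t *\<^sub>R f t) \<partial>lborel)"
    by (intro nn_integral_cong) (auto simp: indicator_def)
  also have "\<dots> = ennreal (LINT t:{a..b}|lborel. f t)"
    unfolding set_lebesgue_integral_def
    by (rule nn_integral_eq_integral) (use assms in \<open>auto simp: set_integrable_def indicator_def\<close>)
  finally show ?thesis .
qed

lemma set_integrable_control:
  fixes \<Phi> :: "'x::euclidean_space \<Rightarrow> 'c::euclidean_space \<Rightarrow> 'e::euclidean_space" and y :: "real \<Rightarrow> 'x"
  assumes K: "compact K" and \<Phi>: "continuous_on (UNIV \<times> K) (\<lambda>(x, a). \<Phi> x a)" and y: "continuous_on UNIV y"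
  shows "u \<in> borel_measurable borel \<Longrightarrow> (\<And>t. u t \<in> K) \<Longrightarrow> set_integrable lborel {a..b} (\<lambda>s. \<Phi> (y s) (u s))"
    and "\<mu> \<in> measurable borel (relaxed_space K) \<Longrightarrow> set_integrable lborel {a..b} (\<lambda>s. LINT v|\<mu> s. \<Phi> (y s) v)"
proof -
  have ym: "y \<in> borel_measurable borel" by (rule borel_measurable_continuous_onI[OF y])
  have "compact (y ` {a..b} \<times> K)"
    by (intro compact_Times K compact_continuous_image continuous_on_subset[OF y]) auto
  then have "compact ((\<lambda>(x, a). \<Phi> x a) ` (y ` {a..b} \<times> K))"
    by (intro compact_continuous_image continuous_on_subset[OF \<Phi>]) auto
  then obtain B where B: "\<And>s v. s \<in> {a..b} \<Longrightarrow> v \<in> K \<Longrightarrow> norm (\<Phi> (y s) v) \<le> B"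
    by (force dest!: compact_imp_bounded simp: bounded_iff)
  show "set_integrable lborel {a..b} (\<lambda>s. \<Phi> (y s) (u s))" if u: "u \<in> borel_measurable borel" "\<And>t. u t \<in> K"
    by (rule set_integrable_bounded_Icc[OF measurable_ordinary_comp[OF K \<Phi> u ym]]) (use B u in auto)
  show "set_integrable lborel {a..b} (\<lambda>s. LINT v|\<mu> s. \<Phi> (y s) v)" if \<mu>: "\<mu> \<in> measurable borel (relaxed_space K)"
  proof (rule set_integrable_bounded_Icc[OF measurable_relaxed_comp[OF K \<Phi> \<mu> ym]])
    fix s assume "a \<le> s" "s \<le> b"
    then show "norm (LINT v|\<mu> s. \<Phi> (y s) v) \<le> B"
      by (intro radon_prob_norm_integral_le[OF relaxed_space_space[OF \<mu>] K continuous_on_slice(1)[OF \<Phi>]] B) auto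
  qed
qed

lemma norm_fst_le_norm: "norm (fst p) \<le> norm p"
  by (cases p) (simp add: norm_fst_le)

lemma norm_snd_le_norm: "norm (snd p) \<le> norm p"
  by (cases p) (simp add: norm_snd_le)

section \<open>Following a relaxed trajectory by an ordinary one\<close>

context compact_control
begin

text \<open>The initial point of the new trajectory is not prescribed but results from the backward
  problem; it absorbs the averaging error of all later times. The distance to \<open>y\<close> then
  decays exponentially, and the tube hypothesis on \<open>h\<close> with the Dini condition bounds
  the excess cost.\<close>

theorem ordinary_approximation:
  assumes D: "D \<subseteq> K" "K \<subseteq> closure D"
    and \<mu>: "\<mu> \<in> measurable borel (relaxed_space K)"
    and y: "caratheodory_solution (\<lambda>s z. LINT a|\<mu> s. g z a) x0 y"
    and tube_g: "\<And>t a w w'. t \<ge> 0 \<Longrightarrow> a \<in> K \<Longrightarrow> norm (w - y t) \<le> 1 \<Longrightarrow> norm (w' - y t) \<le> 1 \<Longrightarrow>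
                 norm (g w a - g w' a) \<le> \<Lambda> * norm (w - w')"
    and tube_h: "\<And>t a w. t \<ge> 0 \<Longrightarrow> a \<in> K \<Longrightarrow> norm (w - y t) \<le> 1 \<Longrightarrow>
                 \<bar>h w a - h (y t) a\<bar> \<le> C * \<omega> (norm (w - y t))"
    and C: "C > 0" and dini: "dini \<omega>" and \<omega>_nonneg: "\<And>r. 0 \<le> r \<Longrightarrow> \<omega> r \<ge> 0"
    and \<omega>_mono: "mono_on {0..<\<delta>} \<omega>" "\<delta> > 0" and \<eta>: "\<eta> > 0"
  obtains x' u z where "norm (x' - x0) < \<eta>" "u \<in> borel_measurable borel" "\<And>t. u t \<in> D"
    "caratheodory_solution (\<lambda>s w. g w (u s)) x' z"
    "(\<integral>\<^sup>+t\<in>{0..}. ennreal (h (z t) (u t)) \<partial>lborel)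
       \<le> (\<integral>\<^sup>+t\<in>{0..}. ennreal (LINT a|\<mu> t. h (y t) a) \<partial>lborel) + ennreal \<eta>"
proof -
  have r: "\<mu> t \<in> radon_prob K" for t using relaxed_space_space[OF \<mu>] by simp
  have D_ne: "D \<noteq> {}" using D(2) K_ne by auto
  \<comment> \<open>At least 1, so that \<open>\<kappa> \<ge> 1\<close>, as the Dini and the decay
    estimates require.\<close>
  define \<Lambda>' where "\<Lambda>' = max \<Lambda> 1"
  define \<kappa> where "\<kappa> = 2 * \<Lambda>'"
  have \<Lambda>': "\<Lambda>' > 0" "\<kappa> \<ge> 1" by (auto simp: \<Lambda>'_def \<kappa>_def)
  \<comment> \<open>After multiplication by \<open>C\<close> the modulus costs
    \<open>\<eta> / 2\<close>; the averaging error of the running cost takes the other half. The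
    bound \<open>min 1 \<eta>\<close> keeps the trajectory in the tube and its initial point
    close.\<close>
  have "\<eta> / (2 * C) > 0" "min 1 \<eta> > 0" using \<eta> C by auto
  then obtain \<epsilon> where \<epsilon>: "0 < \<epsilon>" "\<epsilon> < min 1 \<eta>" "\<epsilon> < \<delta>"
    and \<omega>_int: "(\<integral>\<^sup>+s\<in>{0..}. ennreal (\<omega> (\<epsilon> * exp (- \<kappa> * s))) \<partial>lborel) \<le> ennreal (\<eta> / (2 * C))"
    using dini_exponential_small[OF dini \<omega>_nonneg \<omega>_mono \<Lambda>'(2), of "\<eta> / (2 * C)" "min 1 \<eta>"] by metis
  have \<epsilon>': "\<epsilon> \<le> 1" "\<epsilon> < \<eta>" using \<epsilon> by auto
  define Y where "Y t = y (max 0 t)" for t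
  have Yy: "Y t = y t" if "t \<ge> 0" for t using that by (simp add: Y_def)
  have Yc: "continuous_on UNIV Y"
    unfolding Y_def
    by (rule continuous_on_compose2[OF caratheodory_solution_continuous[OF y]]) (auto intro!: continuous_intros)
  have Ym [measurable]: "Y \<in> borel_measurable borel" by (rule borel_measurable_continuous_onI[OF Yc])
  have Ysol: "caratheodory_solution (\<lambda>s z. LINT a|\<mu> s. g z a) x0 Y"
    using y by (subst caratheodory_solution_cong[of _ "\<lambda>s z. LINT a|\<mu> s. g z a" _ y]) (auto simp: Yy)
  \<comment> \<open>Drift and running cost are paired, so that one control averages both.\<close>
  define \<Phi> where "\<Phi> x a = (g x a, h x a)" for x a
  have \<Phi>: "continuous_on (UNIV \<times> K) (\<lambda>(x, a). \<Phi> x a)"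
    using continuous_on_Pair[OF cont_g cont_h] by (simp add: \<Phi>_def case_prod_unfold)
  \<comment> \<open>Chosen so that \<open>4 * c * exp \<kappa>\<close>, the constant in
    \<open>integral_exponential_decay\<close>, equals \<open>\<epsilon> / 2\<close>.\<close>
  define c where "c = \<epsilon> * exp (- \<kappa>) / 8"
  have c: "c > 0" using \<epsilon> by (simp add: c_def)
  have c4: "4 * c * exp \<kappa> = \<epsilon> / 2" by (simp add: c_def exp_minus field_simps)
  obtain u where u: "u \<in> borel_measurable borel" "\<And>s. u s \<in> D"
    and chat: "\<And>k t. real k \<le> t \<Longrightarrow> t \<le> real k + 1 \<Longrightarrow>
      norm (LINT s:{real k..t}|lborel. \<Phi> (Y s) (u s) - (LINT a|\<mu> s. \<Phi> (Y s) a)) \<le> c * exp (- \<kappa> * real k)"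
    by (rule chattering[OF compact_K \<Phi> D D_ne \<mu> Yc, of "\<lambda>k. c * exp (- \<kappa> * real k)"]) (use c in auto)
  have uK: "u s \<in> K" for s using u(2) D(1) by auto
  interpret V: caratheodory_field "\<lambda>t x. g x (u t)" M L by (rule field_ordinary[OF u(1) uK])
  define F where "F s = \<Phi> (Y s) (u s) - (LINT a|\<mu> s. \<Phi> (Y s) a)" for s
  have F_int: "set_integrable lborel {a..b} F" for a b
    unfolding F_def[abs_def]
    by (intro set_integral_diff(1) set_integrable_control[OF compact_K \<Phi> Yc] u(1) uK \<mu>)
  have F_bd: "norm (LINT r:{s..t}|lborel. F r) \<le> \<epsilon> / 2 * exp (- \<kappa> * s)" if "0 \<le> s" "s \<le> t" for s t
    using integral_exponential_decay[OF F_int \<Lambda>'(2) less_imp_le[OF c] _ that] chat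
    unfolding c4 F_def by blast
  have F_eq: "F s = (g (Y s) (u s) - (LINT a|\<mu> s. g (Y s) a), h (Y s) (u s) - (LINT a|\<mu> s. h (Y s) a))" for s
  proof -
    have i: "integrable (\<mu> s) (\<Phi> (Y s))"
      by (rule radon_prob_integrable[OF r compact_K continuous_on_slice(1)[OF \<Phi>]])
    have pr: "fst (\<Phi> x a) = g x a" "snd (\<Phi> x a) = h x a" for x a by (simp_all add: \<Phi>_def)
    have "fst (LINT a|\<mu> s. \<Phi> (Y s) a) = (LINT a|\<mu> s. g (Y s) a)"
      using integral_bounded_linear[OF bounded_linear_fst i] by (simp add: pr)
    moreover have "snd (LINT a|\<mu> s. \<Phi> (Y s) a) = (LINT a|\<mu> s. h (Y s) a)"
      using integral_bounded_linear[OF bounded_linear_snd i] by (simp add: pr)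
    ultimately show ?thesis by (simp add: F_def pr prod_eq_iff)
  qed
  have lin: "T (LINT r:{s..t}|lborel. F r) = (LINT r:{s..t}|lborel. T (F r))" if "bounded_linear T" for T :: "'x \<times> real \<Rightarrow> 'z::euclidean_space" and s t
    using integral_bounded_linear[OF that, of lborel "\<lambda>r. indicat_real {s..t} r *\<^sub>R F r"] F_int[of s t]
    by (simp add: set_lebesgue_integral_def set_integrable_def linear_simps[OF that])
  define Fg where "Fg s = g (Y s) (u s) - (LINT a|\<mu> s. g (Y s) a)" for s
  define Fh where "Fh s = h (Y s) (u s) - (LINT a|\<mu> s. h (Y s) a)" for s
  have gu_int: "set_integrable lborel {a..b} (\<lambda>s. g (Y s) (u s))" for a b
    by (rule set_integrable_control(1)[OF compact_K cont_g Yc u(1) uK])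
  have gr_int: "set_integrable lborel {a..b} (\<lambda>s. LINT v|\<mu> s. g (Y s) v)" for a b
    by (rule set_integrable_control(2)[OF compact_K cont_g Yc \<mu>])
  have hu_int: "set_integrable lborel {a..b} (\<lambda>s. h (Y s) (u s))" for a b
    by (rule set_integrable_control(1)[OF compact_K cont_h Yc u(1) uK])
  have hr_int: "set_integrable lborel {a..b} (\<lambda>s. LINT v|\<mu> s. h (Y s) v)" for a b
    by (rule set_integrable_control(2)[OF compact_K cont_h Yc \<mu>])
  have Fg_int: "set_integrable lborel {a..b} Fg" for a b
    unfolding Fg_def[abs_def] by (rule set_integral_diff(1)[OF gu_int gr_int])
  have Fg_bd: "norm (LINT r:{s..t}|lborel. Fg r) \<le> \<epsilon> / 2 * exp (- \<kappa> * s)" if "0 \<le> s" "s \<le> t" for s t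
  proof -
    have "(LINT r:{s..t}|lborel. Fg r) = fst (LINT r:{s..t}|lborel. F r)"
      unfolding lin[OF bounded_linear_fst] by (simp add: F_eq Fg_def)
    then have "norm (LINT r:{s..t}|lborel. Fg r) \<le> norm (LINT r:{s..t}|lborel. F r)"
      by (simp add: norm_fst_le_norm)
    then show ?thesis using F_bd[OF that] by linarith
  qed
  have Fh_bd: "\<bar>LINT r:{0..t}|lborel. Fh r\<bar> \<le> \<eta> / 2" if "0 \<le> t" for t
  proof -
    have "(LINT r:{0..t}|lborel. Fh r) = snd (LINT r:{0..t}|lborel. F r)"
      unfolding lin[OF bounded_linear_snd] by (simp add: F_eq Fh_def)
    then have "\<bar>LINT r:{0..t}|lborel. Fh r\<bar> \<le> norm (LINT r:{0..t}|lborel. F r)"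
      using norm_snd_le_norm[of "LINT r:{0..t}|lborel. F r"] by simp
    then show ?thesis using F_bd[OF order_refl that] \<epsilon>' by simp
  qed
  have comb: "(LINT r:{0..s}|lborel. Fg r) + (LINT r:{s..t}|lborel. Fg r) = (LINT r:{0..t}|lborel. Fg r)"
    if "0 \<le> s" "s \<le> t" for s t
    by (rule set_integral_Icc_combine[OF that Fg_int])
  have "convergent (\<lambda>n. LINT r:{0..real n}|lborel. Fg r)"
  proof -
    have "Cauchy (\<lambda>n. LINT r:{0..real n}|lborel. Fg r)"
    proof (rule CauchyI')
      fix e :: real assume e: "e > 0"
      have "((\<lambda>n. \<epsilon> / 2 * exp (- \<kappa>) ^ n) \<longlongrightarrow> \<epsilon> / 2 * 0) sequentially"
        using \<Lambda>'(2) by (intro tendsto_intros LIMSEQ_power_zero) auto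
      then have "\<forall>\<^sub>F n in sequentially. \<epsilon> / 2 * exp (- \<kappa>) ^ n < e"
        using e by (intro order_tendstoD(2)) auto
      then obtain N where N: "\<And>n. n \<ge> N \<Longrightarrow> \<epsilon> / 2 * exp (- \<kappa>) ^ n < e"
        unfolding eventually_sequentially by blast
      show "\<exists>N. \<forall>m\<ge>N. \<forall>n>m. dist (LINT r:{0..real m}|lborel. Fg r) (LINT r:{0..real n}|lborel. Fg r) < e"
        unfolding dist_norm
      proof (intro exI[of _ N] allI impI)
        fix m n :: nat assume mn: "m \<ge> N" "n > m"
        have "(LINT r:{0..real m}|lborel. Fg r) - (LINT r:{0..real n}|lborel. Fg r) = - (LINT r:{real m..real n}|lborel. Fg r)"
          using comb[of "real m" "real n"] mn by (simp add: algebra_simps)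
        then have "norm ((LINT r:{0..real m}|lborel. Fg r) - (LINT r:{0..real n}|lborel. Fg r)) \<le> \<epsilon> / 2 * exp (- \<kappa> * real m)"
          using Fg_bd[of "real m" "real n"] mn by simp
        also have "exp (- \<kappa> * real m) = exp (- \<kappa>) ^ m" using exp_of_nat2_mult[of "- \<kappa>" m] by simp
        finally show "norm ((LINT r:{0..real m}|lborel. Fg r) - (LINT r:{0..real n}|lborel. Fg r)) < e"
          using N[OF mn(1)] by simp
      qed
    qed
    then show ?thesis by (simp add: Cauchy_convergent_iff)
  qed
  then obtain e0 where e0: "(\<lambda>n. LINT r:{0..real n}|lborel. Fg r) \<longlonglongrightarrow> e0" by (auto simp: convergent_def)
  \<comment> \<open>The improper integral of \<open>Fg\<close> over [t, \<infinity>).\<close>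
  define E where "E t = e0 - (LINT r:{0..max 0 t}|lborel. Fg r)" for t
  have E_meas: "E \<in> borel_measurable borel"
  proof (rule borel_measurable_continuous_onI)
    show "continuous_on UNIV E"
      unfolding E_def
      by (intro continuous_intros continuous_on_compose2[OF continuous_on_set_integral_Icc[OF Fg_int]]) auto
  qed
  have E_bd: "norm (E t) \<le> \<epsilon> / 2 * exp (- (2 * \<Lambda>') * t)" if t: "t \<ge> 0" for t
  proof (rule Lim_norm_ubound[OF trivial_limit_sequentially])
    show "(\<lambda>n. (LINT r:{0..real n}|lborel. Fg r) - (LINT r:{0..max 0 t}|lborel. Fg r)) \<longlonglongrightarrow> E t"
      unfolding E_def by (intro tendsto_intros e0)
    obtain N :: nat where N: "t \<le> real N" using real_arch_simple by blast
    have "norm ((LINT r:{0..real n}|lborel. Fg r) - (LINT r:{0..max 0 t}|lborel. Fg r)) \<le> \<epsilon> / 2 * exp (- (2 * \<Lambda>') * t)" if "n \<ge> N" for n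
    proof -
      have tn: "t \<le> real n" using N that by linarith
      have "(LINT r:{0..real n}|lborel. Fg r) - (LINT r:{0..max 0 t}|lborel. Fg r) = (LINT r:{t..real n}|lborel. Fg r)"
        using comb[OF t tn] t by (simp add: algebra_simps max_def)
      then show ?thesis using Fg_bd[OF t tn] by (simp add: \<kappa>_def)
    qed
    then show "\<forall>\<^sub>F n in sequentially. norm ((LINT r:{0..real n}|lborel. Fg r) - (LINT r:{0..max 0 t}|lborel. Fg r)) \<le> \<epsilon> / 2 * exp (- (2 * \<Lambda>') * t)"
      unfolding eventually_sequentially by blast
  qed
  have tube_g': "norm (g w a - g w' a) \<le> \<Lambda>' * norm (w - w')"
    if "t \<ge> 0" "a \<in> K" "norm (w - Y t) \<le> 1" "norm (w' - Y t) \<le> 1" for t a w w'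
  proof -
    have "norm (g w a - g w' a) \<le> \<Lambda> * norm (w - w')" using tube_g[of t a w w'] that by (simp add: Yy)
    also have "\<dots> \<le> \<Lambda>' * norm (w - w')" by (intro mult_right_mono) (auto simp: \<Lambda>'_def)
    finally show ?thesis .
  qed
  have "\<exists>\<zeta>. \<zeta> \<in> borel_measurable borel \<and>
      (\<forall>t\<ge>0. norm (\<zeta> t) \<le> \<epsilon> * exp (- (2 * \<Lambda>') * t)) \<and>
      set_integrable lborel {0..} (\<lambda>s. g (Y s + \<zeta> s) (u s) - g (Y s) (u s)) \<and>
      (\<forall>t\<ge>0. \<zeta> t = - E t - (LINT s:{t..}|lborel. g (Y s + \<zeta> s) (u s) - g (Y s) (u s)))"
    by (rule backward_fixed_point[OF u(1) uK Ym E_meas \<Lambda>'(1) \<epsilon>(1) \<epsilon>'(1) E_bd tube_g']) blast+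
  then obtain \<zeta> where \<zeta>m [measurable]: "\<zeta> \<in> borel_measurable borel"
    and \<zeta>_bd: "\<And>t. t \<ge> 0 \<Longrightarrow> norm (\<zeta> t) \<le> \<epsilon> * exp (- (2 * \<Lambda>') * t)"
    and q_int: "set_integrable lborel {0..} (\<lambda>s. g (Y s + \<zeta> s) (u s) - g (Y s) (u s))"
    and \<zeta>_eq: "\<And>t. t \<ge> 0 \<Longrightarrow> \<zeta> t = - E t - (LINT s:{t..}|lborel. g (Y s + \<zeta> s) (u s) - g (Y s) (u s))"
    by blast
  define q where "q s = g (Y s + \<zeta> s) (u s) - g (Y s) (u s)" for s
  define z where "z t = Y t + \<zeta> t" for t
  have zm [measurable]: "z \<in> borel_measurable borel" unfolding z_def by measurable
  have q_int': "set_integrable lborel {0..t} q" for t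
    by (rule set_integrable_subset[OF q_int[folded q_def]]) auto
  have sol: "caratheodory_solution (\<lambda>s w. g w (u s)) (z 0) z"
    unfolding caratheodory_solution_def
  proof (intro allI impI)
    fix t :: real assume t: "t \<ge> 0"
    have gz: "(\<lambda>s. g (z s) (u s)) = (\<lambda>s. q s + g (Y s) (u s))" by (simp add: q_def z_def)
    have I: "set_integrable lborel {0..t} (\<lambda>s. g (z s) (u s))"
      unfolding gz by (rule set_integral_add(1)[OF q_int' gu_int])
    have E0: "E 0 - E t = (LINT r:{0..t}|lborel. Fg r)"
      using comb[of 0 0] t by (simp add: E_def max_def)
    \<comment> \<open>The increments of \<open>\<zeta>\<close> are those of \<open>Fg\<close> and
      \<open>q\<close>. Added to those of \<open>Y\<close> they cancel the relaxed drift and leave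
      the ordinary drift at \<open>z\<close>.\<close>
    have "\<zeta> t - \<zeta> 0 = (E 0 - E t) + (LINT s:{0..}|lborel. q s) - (LINT s:{t..}|lborel. q s)"
      using \<zeta>_eq[OF t] \<zeta>_eq[of 0] by (simp add: q_def[symmetric])
    also have "\<dots> = (LINT r:{0..t}|lborel. Fg r) + (LINT s:{0..t}|lborel. q s)"
      using set_integral_atLeast_split[OF q_int[folded q_def] t] by (simp add: E0)
    also have "(LINT r:{0..t}|lborel. Fg r) = (LINT s:{0..t}|lborel. g (Y s) (u s)) - (LINT s:{0..t}|lborel. LINT a|\<mu> s. g (Y s) a)"
      unfolding Fg_def by (rule set_integral_diff(2)[OF gu_int gr_int])
    also have "(LINT s:{0..t}|lborel. LINT a|\<mu> s. g (Y s) a) = Y t - Y 0"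
      using caratheodory_solutionD(2)[OF Ysol t] caratheodory_solution_0[OF Ysol] by simp
    finally have "z t = z 0 + ((LINT s:{0..t}|lborel. q s) + (LINT s:{0..t}|lborel. g (Y s) (u s)))"
      by (simp add: z_def algebra_simps)
    also have "(LINT s:{0..t}|lborel. q s) + (LINT s:{0..t}|lborel. g (Y s) (u s)) = (LINT s:{0..t}|lborel. g (z s) (u s))"
      unfolding gz by (rule set_integral_add(2)[OF q_int' gu_int, symmetric])
    finally show "set_integrable lborel {0..t} (\<lambda>s. g (z s) (u s)) \<and> z t = z 0 + (LINT s:{0..t}|lborel. g (z s) (u s))"
      using I by simp
  qed
  have \<zeta>_le: "norm (\<zeta> t) \<le> \<epsilon>" if "t \<ge> 0" for t
  proof -
    have "\<epsilon> * exp (- (2 * \<Lambda>') * t) \<le> \<epsilon> * 1" using that \<Lambda>' \<epsilon> by (intro mult_left_mono) auto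
    then show ?thesis using \<zeta>_bd[OF that] by simp
  qed
  \<comment> \<open>A majorant of \<open>\<omega> (norm (\<zeta> s))\<close> that is monotone on the
    whole line and hence Borel, whereas \<open>\<omega>\<close> itself is known to be monotone only
    near 0.\<close>
  define W where "W s = \<omega> (\<epsilon> * exp (- \<kappa> * max 0 s))" for s
  have exp_range: "\<epsilon> * exp (- \<kappa> * t) \<in> {0..<\<delta>}" if "t \<ge> 0" for t
  proof -
    have "\<epsilon> * exp (- \<kappa> * t) \<le> \<epsilon> * 1" using that \<Lambda>' \<epsilon> by (intro mult_left_mono) auto
    then have "\<epsilon> * exp (- \<kappa> * t) < \<delta>" using \<epsilon>(3) by linarith
    then show ?thesis using \<epsilon>(1) by simp
  qed
  have W_meas [measurable]: "W \<in> borel_measurable borel"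
  proof -
    have "mono (\<lambda>s. - W s)"
    proof (rule monoI)
      fix s t :: real assume st: "s \<le> t"
      have "\<omega> (\<epsilon> * exp (- \<kappa> * max 0 t)) \<le> \<omega> (\<epsilon> * exp (- \<kappa> * max 0 s))"
        by (rule mono_onD[OF \<omega>_mono(1)]) (use exp_range st \<Lambda>' \<epsilon> in auto)
      then show "- W s \<le> - W t" by (simp add: W_def)
    qed
    then have "(\<lambda>s. - W s) \<in> borel_measurable borel" by (rule borel_measurable_mono)
    then show ?thesis by simp
  qed
  have W_nonneg: "W s \<ge> 0" for s unfolding W_def using \<epsilon> by (intro \<omega>_nonneg) auto
  have hz: "h (z s) (u s) \<le> h (Y s) (u s) + C * W s" if s: "s \<ge> 0" for s
  proof -
    have n1: "norm (z s - y s) = norm (\<zeta> s)" by (simp add: z_def Yy[OF s])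
    have "\<bar>h (z s) (u s) - h (y s) (u s)\<bar> \<le> C * \<omega> (norm (\<zeta> s))"
      using tube_h[OF s uK, of "z s" s] n1 \<zeta>_le[OF s] \<epsilon>' by simp
    also have "\<dots> \<le> C * W s"
    proof (rule mult_left_mono)
      have "norm (\<zeta> s) \<le> \<epsilon> * exp (- \<kappa> * s)" using \<zeta>_bd[OF s] by (simp add: \<kappa>_def)
      then have "\<omega> (norm (\<zeta> s)) \<le> \<omega> (\<epsilon> * exp (- \<kappa> * s))"
        using exp_range[OF s] by (intro mono_onD[OF \<omega>_mono(1)]) auto
      then show "\<omega> (norm (\<zeta> s)) \<le> W s" using s by (simp add: W_def max_def)
    qed (use C in simp)
    finally show ?thesis by (simp add: Yy[OF s])
  qed
  have hz_meas [measurable]: "(\<lambda>t. h (z t) (u t)) \<in> borel_measurable borel"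
    by (rule measurable_ordinary_comp[OF compact_K cont_h u(1) uK zm])
  have hY_meas [measurable]: "(\<lambda>t. h (Y t) (u t)) \<in> borel_measurable borel"
    by (rule measurable_ordinary_comp[OF compact_K cont_h u(1) uK Ym])
  have hr_nonneg: "(LINT a|\<mu> s. h x a) \<ge> 0" for s x
  proof -
    have "(LINT a|\<mu> s. h x a) = (LINT a|\<mu> s. \<bar>h x a\<bar>)"
      by (rule integral_radon_cong[OF r]) (simp add: h_nonneg)
    also have "\<dots> \<ge> 0" by simp
    finally show ?thesis .
  qed
  let ?J = "\<integral>\<^sup>+t\<in>{0..}. ennreal (LINT a|\<mu> t. h (y t) a) \<partial>lborel"
  have "(\<integral>\<^sup>+t\<in>{0..}. ennreal (h (z t) (u t)) \<partial>lborel) \<le> ?J + ennreal \<eta>"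
  proof (rule nn_integral_atLeast_le)
    fix n :: nat
    have "(\<integral>\<^sup>+t\<in>{0..real n}. ennreal (h (z t) (u t)) \<partial>lborel)
        \<le> (\<integral>\<^sup>+t. ennreal (h (Y t) (u t)) * indicator {0..real n} t + ennreal C * (ennreal (W t) * indicator {0..} t) \<partial>lborel)"
    proof (rule nn_integral_mono)
      fix t :: real
      have "ennreal (h (z t) (u t)) \<le> ennreal (h (Y t) (u t)) + ennreal C * ennreal (W t)" if "t \<ge> 0"
      proof -
        have "ennreal (h (z t) (u t)) \<le> ennreal (h (Y t) (u t) + C * W t)" by (rule ennreal_leI[OF hz[OF that]])
        then show ?thesis using h_nonneg[OF uK] C W_nonneg by (simp add: ennreal_mult)
      qed
      then show "ennreal (h (z t) (u t)) * indicator {0..real n} t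
          \<le> ennreal (h (Y t) (u t)) * indicator {0..real n} t + ennreal C * (ennreal (W t) * indicator {0..} t)"
        by (auto simp: indicator_def)
    qed
    also have "\<dots> = (\<integral>\<^sup>+t\<in>{0..real n}. ennreal (h (Y t) (u t)) \<partial>lborel) + ennreal C * (\<integral>\<^sup>+t\<in>{0..}. ennreal (W t) \<partial>lborel)"
      by (subst nn_integral_add) (auto simp: nn_integral_cmult)
    also have "(\<integral>\<^sup>+t\<in>{0..}. ennreal (W t) \<partial>lborel) = (\<integral>\<^sup>+s\<in>{0..}. ennreal (\<omega> (\<epsilon> * exp (- \<kappa> * s))) \<partial>lborel)"
      by (intro nn_integral_cong) (auto simp: W_def indicator_def max_def)
    also have "ennreal C * \<dots> \<le> ennreal C * ennreal (\<eta> / (2 * C))" by (intro mult_left_mono \<omega>_int) simp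
    also have "ennreal C * ennreal (\<eta> / (2 * C)) = ennreal (\<eta> / 2)"
      using C \<eta> by (simp add: ennreal_mult[symmetric])
    also have "(\<integral>\<^sup>+t\<in>{0..real n}. ennreal (h (Y t) (u t)) \<partial>lborel) \<le> ?J + ennreal (\<eta> / 2)"
    proof -
      have "(LINT s:{0..real n}|lborel. h (Y s) (u s)) =
          (LINT s:{0..real n}|lborel. LINT a|\<mu> s. h (Y s) a) + (LINT s:{0..real n}|lborel. Fh s)"
        unfolding Fh_def using set_integral_diff(2)[OF hu_int hr_int, of 0 "real n"] by simp
      also have "\<dots> \<le> (LINT s:{0..real n}|lborel. LINT a|\<mu> s. h (Y s) a) + \<eta> / 2"
        using Fh_bd[of "real n"] by simp
      finally have "ennreal (LINT s:{0..real n}|lborel. h (Y s) (u s)) \<le>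
          ennreal ((LINT s:{0..real n}|lborel. LINT a|\<mu> s. h (Y s) a) + \<eta> / 2)" by (rule ennreal_leI)
      also have "\<dots> = ennreal (LINT s:{0..real n}|lborel. LINT a|\<mu> s. h (Y s) a) + ennreal (\<eta> / 2)"
      proof (rule ennreal_plus)
        show "0 \<le> (LINT s:{0..real n}|lborel. LINT a|\<mu> s. h (Y s) a)"
          unfolding set_lebesgue_integral_def by (intro Bochner_Integration.integral_nonneg) (simp add: hr_nonneg)
      qed (use \<eta> in simp)
      finally have "ennreal (LINT s:{0..real n}|lborel. h (Y s) (u s)) \<le>
          ennreal (LINT s:{0..real n}|lborel. LINT a|\<mu> s. h (Y s) a) + ennreal (\<eta> / 2)" .
      then have "(\<integral>\<^sup>+t\<in>{0..real n}. ennreal (h (Y t) (u t)) \<partial>lborel) \<le>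
          (\<integral>\<^sup>+t\<in>{0..real n}. ennreal (LINT a|\<mu> t. h (Y t) a) \<partial>lborel) + ennreal (\<eta> / 2)"
        by (simp add: nn_integral_Icc_eq_set_integral[OF hu_int] nn_integral_Icc_eq_set_integral[OF hr_int] h_nonneg uK hr_nonneg)
      also have "(\<integral>\<^sup>+t\<in>{0..real n}. ennreal (LINT a|\<mu> t. h (Y t) a) \<partial>lborel) \<le> ?J"
        by (intro nn_integral_mono) (auto simp: indicator_def Yy)
      finally show ?thesis by simp
    qed
    finally have "(\<integral>\<^sup>+t\<in>{0..real n}. ennreal (h (z t) (u t)) \<partial>lborel) \<le> ?J + ennreal (\<eta> / 2) + ennreal (\<eta> / 2)"
      by simp
    also have "\<dots> = ?J + ennreal \<eta>" using \<eta> by (simp add: add.assoc ennreal_plus[symmetric] del: ennreal_plus)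
    finally show "(\<integral>\<^sup>+t\<in>{0..real n}. ennreal (h (z t) (u t)) \<partial>lborel) \<le> ?J + ennreal \<eta>" .
  qed measurable
  moreover have "norm (z 0 - x0) < \<eta>"
    using \<zeta>_le[of 0] \<epsilon>' caratheodory_solution_0[OF Ysol] by (simp add: z_def)
  ultimately show thesis by (intro that[OF _ u sol])
qed

end

section \<open>Time changes\<close>

text \<open>\<open>k\<close> is the speed of the new time. Positivity makes the new time
  \<open>\<sigma>\<close> strictly increasing, and divergence of the integral makes it run through
  all of [0, \<infinity>), so that the inverse \<open>\<tau>\<close> is defined there.\<close>

locale time_change =
  fixes k :: "real \<Rightarrow> real"
  assumes k_meas [measurable]: "k \<in> borel_measurable borel" and k_pos: "\<And>t. k t > 0"
    and k_int: "\<And>t. set_integrable lborel {0..t} k"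
    and k_unbounded: "\<And>B. \<exists>t\<ge>0. B \<le> (LINT s:{0..t}|lborel. k s)"
begin

definition \<sigma> :: "real \<Rightarrow> real" where "\<sigma> t = (LINT s:{0..max 0 t}|lborel. k s)"

definition \<tau> :: "real \<Rightarrow> real" where "\<tau> s = (SOME t. t \<ge> 0 \<and> \<sigma> t = max 0 s)"

lemma \<sigma>_cont: "continuous_on S \<sigma>"
proof -
  have "continuous_on UNIV \<sigma>"
    unfolding \<sigma>_def
    by (rule continuous_on_compose2[OF continuous_on_set_integral_Icc[OF k_int]]) (auto intro!: continuous_intros)
  then show ?thesis by (rule continuous_on_subset) auto
qed

lemma \<sigma>_meas [measurable]: "\<sigma> \<in> borel_measurable borel"
  by (rule borel_measurable_continuous_onI[OF \<sigma>_cont])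

lemma \<sigma>_0: "\<sigma> 0 = 0"
proof -
  have "(LINT s:{0..0}|lborel. k s) + (LINT s:{0..0}|lborel. k s) = (LINT s:{0..0}|lborel. k s)"
    by (rule set_integral_Icc_combine[OF order_refl order_refl k_int])
  then show ?thesis by (simp add: \<sigma>_def)
qed

text \<open>The integral of a positive function vanishes only over a null set, and a nondegenerate
  interval is not null.\<close>

lemma \<sigma>_less: "0 \<le> s \<Longrightarrow> s < t \<Longrightarrow> \<sigma> s < \<sigma> t"
proof -
  assume st: "0 \<le> s" "s < t"
  have i: "set_integrable lborel {s..t} k" by (rule set_integrable_subset[OF k_int[of t]]) (use st in auto)
  have eq: "\<sigma> t - \<sigma> s = (LINT r:{s..t}|lborel. k r)"
    using set_integral_Icc_combine[of 0 s t, OF _ _ k_int] st by (simp add: \<sigma>_def max_def algebra_simps)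
  have "(LINT r:{s..t}|lborel. k r) \<ge> 0"
    unfolding set_lebesgue_integral_def by (intro Bochner_Integration.integral_nonneg) (simp add: less_imp_le[OF k_pos])
  moreover have "(LINT r:{s..t}|lborel. k r) \<noteq> 0"
  proof
    assume "(LINT r:{s..t}|lborel. k r) = 0"
    then have "AE r in lborel. indicat_real {s..t} r *\<^sub>R k r = 0"
      using i unfolding set_lebesgue_integral_def set_integrable_def
      by (subst (asm) integral_nonneg_eq_0_iff_AE) (auto simp: less_imp_le[OF k_pos])
    then have "AE r in lborel. r \<notin> {s..t}"
      by eventually_elim (use k_pos in \<open>auto simp: indicator_def less_le\<close>)
    moreover have "{x. s \<le> x \<and> x \<le> t} = {s..t}" by auto
    ultimately have "emeasure lborel {s..t} = 0"
      by (subst (asm) AE_iff_measurable[where N="{s..t}"]) auto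
    then show False using st by simp
  qed
  ultimately show ?thesis using eq by linarith
qed

lemma \<sigma>_mono: "0 \<le> s \<Longrightarrow> s \<le> t \<Longrightarrow> \<sigma> s \<le> \<sigma> t"
  using \<sigma>_less[of s t] by (cases "s = t") auto

lemma \<sigma>_nonneg: "\<sigma> t \<ge> 0"
  using \<sigma>_mono[of 0 "max 0 t"] \<sigma>_0 by (simp add: \<sigma>_def)

lemma \<tau>: "\<tau> s \<ge> 0" "\<sigma> (\<tau> s) = max 0 s"
proof -
  obtain t where t: "t \<ge> 0" "max 0 s \<le> \<sigma> t"
    using k_unbounded[of "max 0 s"] by (auto simp: \<sigma>_def max_def)
  have "\<exists>r\<ge>0. r \<le> t \<and> \<sigma> r = max 0 s"
    by (rule IVT') (use t \<sigma>_0 \<sigma>_cont in auto)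
  then have ex: "\<exists>r. r \<ge> 0 \<and> \<sigma> r = max 0 s" by blast
  have "\<tau> s \<ge> 0 \<and> \<sigma> (\<tau> s) = max 0 s"
    unfolding \<tau>_def by (rule someI_ex[OF ex])
  then show "\<tau> s \<ge> 0" "\<sigma> (\<tau> s) = max 0 s" by auto
qed

lemma \<sigma>_inj: "0 \<le> s \<Longrightarrow> 0 \<le> t \<Longrightarrow> \<sigma> s = \<sigma> t \<Longrightarrow> s = t"
proof (rule linorder_cases[of s t])
  assume "0 \<le> s" "\<sigma> s = \<sigma> t" "s < t" then show ?thesis using \<sigma>_less[of s t] by linarith
next
  assume "0 \<le> t" "\<sigma> s = \<sigma> t" "t < s" then show ?thesis using \<sigma>_less[of t s] by linarith
qed

lemma \<tau>_\<sigma>: "t \<ge> 0 \<Longrightarrow> \<tau> (\<sigma> t) = t"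
proof -
  assume t: "t \<ge> 0"
  have "\<sigma> (\<tau> (\<sigma> t)) = \<sigma> t" by (simp only: \<tau>(2) max_absorb2[OF \<sigma>_nonneg])
  then show ?thesis by (rule \<sigma>_inj[OF \<tau>(1) t])
qed

lemma \<sigma>_le_iff: "0 \<le> t \<Longrightarrow> 0 \<le> s \<Longrightarrow> \<sigma> t \<le> s \<longleftrightarrow> t \<le> \<tau> s"
proof -
  assume ts: "0 \<le> t" "0 \<le> s"
  have e: "\<sigma> (\<tau> s) = s" using \<tau>(2)[of s] ts by simp
  show ?thesis
  proof
    assume "\<sigma> t \<le> s"
    then have "\<not> \<tau> s < t" using \<sigma>_less[OF \<tau>(1)[of s], of t] e by linarith
    then show "t \<le> \<tau> s" by simp
  next
    assume "t \<le> \<tau> s"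
    then show "\<sigma> t \<le> s" using \<sigma>_mono[OF ts(1), of "\<tau> s"] e by simp
  qed
qed

lemma \<tau>_meas [measurable]: "\<tau> \<in> borel_measurable borel"
proof (rule borel_measurable_mono, rule monoI)
  fix s t :: real assume "s \<le> t"
  then have "\<sigma> (\<tau> s) \<le> max 0 t" by (simp add: \<tau>(2))
  then show "\<tau> s \<le> \<tau> t"
    using \<sigma>_less[of "\<tau> t" "\<tau> s"] \<tau>[of t] by (cases "\<tau> s \<le> \<tau> t") auto
qed

section \<open>Substitution in integrals, solutions and costs\<close>

abbreviation (input) "k0 t \<equiv> k t * indicat_real {0..} t"

text \<open>Both measures give the half-line up to \<open>a\<close> the mass \<open>max 0 a\<close>,
  and half-lines determine a measure. This yields the substitution rule without differentiating
  \<open>\<sigma>\<close>.\<close>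

lemma distr_time_change:
  "distr (density lborel (\<lambda>t. ennreal (k0 t))) borel \<sigma> = density lborel (indicator {0..})"
proof (rule measure_eqI_generator_eq[where E="range atMost" and \<Omega>=UNIV and A="\<lambda>i. {..real i}"])
  show "Int_stable (range (atMost :: real \<Rightarrow> _))"
    by (auto simp: Int_stable_def intro!: image_eqI[of _ _ "min _ _"])
  show "sets (distr (density lborel (\<lambda>t. ennreal (k0 t))) borel \<sigma>) = sigma_sets UNIV (range atMost)"
    "sets (density lborel (indicator {0..})) = sigma_sets UNIV (range (atMost :: real \<Rightarrow> _))"
    by (simp_all add: borel_eq_atMost)
  have L: "emeasure (distr (density lborel (\<lambda>t. ennreal (k0 t))) borel \<sigma>) {..a} = ennreal (max 0 a)" for a
  proof -
    have "emeasure (distr (density lborel (\<lambda>t. ennreal (k0 t))) borel \<sigma>) {..a}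
        = (\<integral>\<^sup>+t. ennreal (k0 t) * indicator (\<sigma> -` {..a}) t \<partial>lborel)"
      using measurable_sets[OF \<sigma>_meas, of "{..a}"] by (simp add: emeasure_distr emeasure_density)
    also have "\<dots> = ennreal (max 0 a)"
    proof (cases "a \<ge> 0")
      case True
      have "(\<integral>\<^sup>+t. ennreal (k0 t) * indicator (\<sigma> -` {..a}) t \<partial>lborel) = (\<integral>\<^sup>+t\<in>{0..\<tau> a}. ennreal (k t) \<partial>lborel)"
        by (intro nn_integral_cong) (use \<sigma>_le_iff True in \<open>auto simp: indicator_def\<close>)
      also have "\<dots> = ennreal (LINT t:{0..\<tau> a}|lborel. k t)"
        by (rule nn_integral_Icc_eq_set_integral[OF k_int]) (simp add: less_imp_le[OF k_pos])
      also have "(LINT t:{0..\<tau> a}|lborel. k t) = \<sigma> (\<tau> a)" using \<tau>(1)[of a] by (simp add: \<sigma>_def max_def)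
      finally show ?thesis by (simp add: \<tau>(2))
    next
      case False
      have "(\<integral>\<^sup>+t. ennreal (k0 t) * indicator (\<sigma> -` {..a}) t \<partial>lborel) = nn_integral lborel (\<lambda>t::real. 0)"
        by (intro nn_integral_cong) (use False \<sigma>_nonneg in \<open>auto simp: indicator_def dest: order_trans\<close>)
      then show ?thesis using False by simp
    qed
    finally show ?thesis .
  qed
  have R: "emeasure (density lborel (indicator {0..})) {..a} = ennreal (max 0 a)" for a :: real
  proof -
    have "emeasure (density lborel (indicator {0..})) {..a} =
        (\<integral>\<^sup>+t. indicator {0..} t * indicator {..a} t \<partial>lborel)" by (simp add: emeasure_density)
    also have "\<dots> = (\<integral>\<^sup>+t. indicator {0..a} t \<partial>lborel)"
      by (rule nn_integral_cong) (auto split: split_indicator)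
    also have "\<dots> = ennreal (max 0 a)" by (simp add: emeasure_lborel_Icc_eq max_def)
    finally show ?thesis .
  qed
  show "\<And>X. X \<in> range atMost \<Longrightarrow>
      emeasure (distr (density lborel (\<lambda>t. ennreal (k0 t))) borel \<sigma>) X = emeasure (density lborel (indicator {0..})) X"
    using L R by auto
  show "emeasure (distr (density lborel (\<lambda>t. ennreal (k0 t))) borel \<sigma>) {..real i} \<noteq> \<infinity>" for i
    unfolding L by simp
  show "(\<Union>i. {..real i}) = UNIV" using real_arch_simple by auto
qed auto

lemma nn_integral_time_change:
  assumes [measurable]: "q \<in> borel_measurable borel"
  shows "(\<integral>\<^sup>+s\<in>{0..}. q s \<partial>lborel) = (\<integral>\<^sup>+t\<in>{0..}. ennreal (k t) * q (\<sigma> t) \<partial>lborel)"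
proof -
  have "(\<integral>\<^sup>+s\<in>{0..}. q s \<partial>lborel) = (\<integral>\<^sup>+s. q s \<partial>density lborel (indicator {0..}))"
    by (subst nn_integral_density) (auto simp: mult.commute)
  also have "\<dots> = (\<integral>\<^sup>+t. ennreal (k0 t) * q (\<sigma> t) \<partial>lborel)"
    unfolding distr_time_change[symmetric] by (simp add: nn_integral_distr nn_integral_density)
  also have "\<dots> = (\<integral>\<^sup>+t\<in>{0..}. ennreal (k t) * q (\<sigma> t) \<partial>lborel)"
    by (intro nn_integral_cong) (auto simp: indicator_def)
  finally show ?thesis .
qed

text \<open>\<open>q\<close> is measurable on \<open>{0..\<sigma> T}\<close> only, because that is
  what integrability of a drift on bounded intervals provides.\<close>

lemma set_integral_time_change:
  fixes q :: "real \<Rightarrow> 'e::{banach, second_countable_topology}"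
  assumes q: "(\<lambda>s. indicat_real {0..\<sigma> T} s *\<^sub>R q s) \<in> borel_measurable borel" and T: "T \<ge> 0"
  shows "set_integrable lborel {0..\<sigma> T} q \<longleftrightarrow> set_integrable lborel {0..T} (\<lambda>t. k t *\<^sub>R q (\<sigma> t))"
    and "(LINT s:{0..\<sigma> T}|lborel. q s) = (LINT t:{0..T}|lborel. k t *\<^sub>R q (\<sigma> t))"
proof -
  let ?Q = "\<lambda>s. indicat_real {0..\<sigma> T} s *\<^sub>R q s"
  have eq1: "(\<lambda>s. indicat_real {0..} s *\<^sub>R ?Q s) = ?Q" by (auto simp: indicator_def)
  have eq2: "(\<lambda>t. k0 t *\<^sub>R ?Q (\<sigma> t)) = (\<lambda>t. indicat_real {0..T} t *\<^sub>R (k t *\<^sub>R q (\<sigma> t)))"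
  proof
    fix t
    show "k0 t *\<^sub>R ?Q (\<sigma> t) = indicat_real {0..T} t *\<^sub>R (k t *\<^sub>R q (\<sigma> t))"
      using \<sigma>_le_iff[of t "\<sigma> T"] \<tau>_\<sigma>[OF T] \<sigma>_nonneg[of T] \<sigma>_nonneg[of t]
      by (cases "t \<ge> 0") (auto simp: indicator_def)
  qed
  have dens: "density lborel (indicator {0..}) = density lborel (\<lambda>s. ennreal (indicat_real {0..} s))"
    by (simp add: ennreal_indicator)
  have Qm: "(\<lambda>t. ?Q (\<sigma> t)) \<in> borel_measurable borel"
    using measurable_compose[OF \<sigma>_meas q] .
  have k0: "(\<lambda>t. k0 t) \<in> borel_measurable lborel" by measurable
  have "set_integrable lborel {0..\<sigma> T} q \<longleftrightarrow> integrable (density lborel (indicator {0..})) ?Q"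
    unfolding set_integrable_def dens using q by (subst integrable_density) (simp_all add: eq1 del: scaleR_scaleR)
  also have "\<dots> \<longleftrightarrow> integrable (density lborel (\<lambda>t. ennreal (k0 t))) (\<lambda>t. ?Q (\<sigma> t))"
    unfolding distr_time_change[symmetric] using q by (subst integrable_distr_eq) auto
  also have "\<dots> \<longleftrightarrow> set_integrable lborel {0..T} (\<lambda>t. k t *\<^sub>R q (\<sigma> t))"
    unfolding set_integrable_def eq2[symmetric] using Qm k0 k_pos
    by (subst integrable_density) (auto intro!: AE_I2 mult_nonneg_nonneg simp: less_imp_le[OF k_pos])
  finally show "set_integrable lborel {0..\<sigma> T} q \<longleftrightarrow> set_integrable lborel {0..T} (\<lambda>t. k t *\<^sub>R q (\<sigma> t))" .
  have "(LINT s:{0..\<sigma> T}|lborel. q s) = (LINT s|density lborel (indicator {0..}). ?Q s)"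
    unfolding set_lebesgue_integral_def dens using q by (subst integral_density) (simp_all add: eq1 del: scaleR_scaleR)
  also have "\<dots> = (LINT t|density lborel (\<lambda>t. ennreal (k0 t)). ?Q (\<sigma> t))"
    unfolding distr_time_change[symmetric] using q by (subst integral_distr) auto
  also have "\<dots> = (LINT t:{0..T}|lborel. k t *\<^sub>R q (\<sigma> t))"
    unfolding set_lebesgue_integral_def eq2[symmetric] using Qm k0 k_pos
    by (subst integral_density) (auto intro!: AE_I2 mult_nonneg_nonneg simp: less_imp_le[OF k_pos])
  finally show "(LINT s:{0..\<sigma> T}|lborel. q s) = (LINT t:{0..T}|lborel. k t *\<^sub>R q (\<sigma> t))" .
qed

text \<open>One direction produces a solution in the other time; the opposite direction transfers
  uniqueness back.\<close>

lemma is_solution_time_change: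
  fixes g :: "'x::euclidean_space \<Rightarrow> 'c \<Rightarrow> 'x" and G :: "'x \<Rightarrow> 'd \<Rightarrow> 'x"
  assumes rel: "\<And>t x. t \<ge> 0 \<Longrightarrow> g x (u t) = k t *\<^sub>R G x (v (\<sigma> t))"
  shows "is_solution G x v \<xi> \<Longrightarrow> is_solution g x u (\<lambda>t. \<xi> (\<sigma> t))"
    and "is_solution g x u y \<Longrightarrow> is_solution G x v (\<lambda>s. y (\<tau> s))"
proof -
  show "is_solution g x u (\<lambda>t. \<xi> (\<sigma> t))" if \<xi>: "is_solution G x v \<xi>"
    unfolding is_solution_def
  proof (intro allI impI)
    fix T :: real assume T: "T \<ge> 0"
    let ?q = "\<lambda>s. G (\<xi> s) (v s)"
    have i: "set_integrable lborel {0..\<sigma> T} ?q" and e: "\<xi> (\<sigma> T) = x + (LINT s:{0..\<sigma> T}|lborel. ?q s)"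
      using \<xi> \<sigma>_nonneg[of T] by (auto simp: is_solution_def)
    have m: "(\<lambda>s. indicat_real {0..\<sigma> T} s *\<^sub>R ?q s) \<in> borel_measurable borel"
      using borel_measurable_integrable[OF i[unfolded set_integrable_def]] by simp
    have c1: "set_integrable lborel {0..T} (\<lambda>t. g (\<xi> (\<sigma> t)) (u t)) = set_integrable lborel {0..T} (\<lambda>t. k t *\<^sub>R ?q (\<sigma> t))"
      by (rule set_integrable_cong) (auto simp: rel)
    have c2: "(LINT t:{0..T}|lborel. g (\<xi> (\<sigma> t)) (u t)) = (LINT t:{0..T}|lborel. k t *\<^sub>R ?q (\<sigma> t))"
      by (rule set_lebesgue_integral_cong) (auto simp: rel)
    show "set_integrable lborel {0..T} (\<lambda>t. g (\<xi> (\<sigma> t)) (u t)) \<and>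
        \<xi> (\<sigma> T) = x + (LINT t:{0..T}|lborel. g (\<xi> (\<sigma> t)) (u t))"
      using set_integral_time_change[OF m T] i e by (simp add: c1 c2)
  qed
  show "is_solution G x v (\<lambda>s. y (\<tau> s))" if y: "is_solution g x u y"
    unfolding is_solution_def
  proof (intro allI impI)
    fix S :: real assume S: "S \<ge> 0"
    define T where "T = \<tau> S"
    have T: "T \<ge> 0" and \<sigma>T: "\<sigma> T = S" using \<tau>[of S] S by (auto simp: T_def)
    let ?q = "\<lambda>s. G (y (\<tau> s)) (v s)"
    have i: "set_integrable lborel {0..T} (\<lambda>t. g (y t) (u t))" and e: "y T = x + (LINT t:{0..T}|lborel. g (y t) (u t))"
      using y T by (auto simp: is_solution_def)
    have m0: "(\<lambda>t. indicat_real {0..T} t *\<^sub>R g (y t) (u t)) \<in> borel_measurable borel"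
      using borel_measurable_integrable[OF i[unfolded set_integrable_def]] by simp
    \<comment> \<open>Measurability of the new integrand comes from the old one: by the relation of
      the two fields it is the old integrand at \<open>\<tau> s\<close>, divided by the
      speed.\<close>
    have qe: "indicat_real {0..\<sigma> T} s *\<^sub>R ?q s =
        indicat_real {0..} s *\<^sub>R ((1 / k (\<tau> s)) *\<^sub>R (indicat_real {0..T} (\<tau> s) *\<^sub>R g (y (\<tau> s)) (u (\<tau> s))))" for s
    proof (cases "s \<ge> 0")
      case True
      have st: "\<sigma> (\<tau> s) = s" using \<tau>[of s] True by simp
      have "\<tau> s \<le> T \<longleftrightarrow> s \<le> \<sigma> T"
        using \<sigma>_le_iff[OF \<tau>(1)[of s], of S] S st by (simp add: T_def[symmetric] \<sigma>T)
      then show ?thesis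
        using True \<tau>(1)[of s] k_pos[of "\<tau> s"] rel[OF \<tau>(1)[of s], of "y (\<tau> s)"] st
        by (auto simp: indicator_def)
    qed (auto simp: indicator_def)
    have m1: "(\<lambda>s. indicat_real {0..T} (\<tau> s) *\<^sub>R g (y (\<tau> s)) (u (\<tau> s))) \<in> borel_measurable borel"
      using measurable_compose[OF \<tau>_meas m0] .
    have m: "(\<lambda>s. indicat_real {0..\<sigma> T} s *\<^sub>R ?q s) \<in> borel_measurable borel"
      unfolding qe using m1 by measurable
    have r: "g (y t) (u t) = k t *\<^sub>R ?q (\<sigma> t)" if "t \<in> {0..T}" for t
      using that rel[of t "y t"] \<tau>_\<sigma>[of t] by simp
    have c1: "set_integrable lborel {0..T} (\<lambda>t. g (y t) (u t)) = set_integrable lborel {0..T} (\<lambda>t. k t *\<^sub>R ?q (\<sigma> t))"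
      by (rule set_integrable_cong) (auto simp: r)
    have c2: "(LINT t:{0..T}|lborel. g (y t) (u t)) = (LINT t:{0..T}|lborel. k t *\<^sub>R ?q (\<sigma> t))"
      by (rule set_lebesgue_integral_cong) (auto simp: r)
    show "set_integrable lborel {0..S} ?q \<and> y (\<tau> S) = x + (LINT s:{0..S}|lborel. ?q s)"
      using set_integral_time_change[OF m T] i e by (simp add: c1 c2 \<sigma>T T_def[symmetric])
  qed
qed

text \<open>\<open>q\<close> is a Borel extension of the running cost to negative times, where
  nothing is known about \<open>\<xi>\<close> and \<open>v\<close>.\<close>

lemma cost_time_change:
  fixes h :: "'x \<Rightarrow> 'c \<Rightarrow> real" and H :: "'x \<Rightarrow> 'd \<Rightarrow> real"
  assumes rel: "\<And>t x. t \<ge> 0 \<Longrightarrow> h x (u t) = k t * H x (v (\<sigma> t))"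
    and q: "q \<in> borel_measurable borel" "\<And>s. s \<ge> 0 \<Longrightarrow> q s = H (\<xi> s) (v s)"
    and H: "\<And>s. s \<ge> 0 \<Longrightarrow> H (\<xi> s) (v s) \<ge> 0"
  shows "(\<integral>\<^sup>+t\<in>{0..}. ennreal (h (\<xi> (\<sigma> t)) (u t)) \<partial>lborel) = (\<integral>\<^sup>+s\<in>{0..}. ennreal (H (\<xi> s) (v s)) \<partial>lborel)"
proof -
  have "(\<integral>\<^sup>+s\<in>{0..}. ennreal (H (\<xi> s) (v s)) \<partial>lborel) = (\<integral>\<^sup>+s\<in>{0..}. ennreal (q s) \<partial>lborel)"
    by (intro nn_integral_cong) (auto simp: q(2) indicator_def)
  also have "\<dots> = (\<integral>\<^sup>+t\<in>{0..}. ennreal (k t) * ennreal (q (\<sigma> t)) \<partial>lborel)"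
    by (rule nn_integral_time_change) (use q(1) in measurable)
  also have "\<dots> = (\<integral>\<^sup>+t\<in>{0..}. ennreal (h (\<xi> (\<sigma> t)) (u t)) \<partial>lborel)"
  proof (intro nn_integral_cong)
    fix t
    show "ennreal (k t) * ennreal (q (\<sigma> t)) * indicator {0..} t = ennreal (h (\<xi> (\<sigma> t)) (u t)) * indicator {0..} t"
      using rel[of t "\<xi> (\<sigma> t)"] q(2)[OF \<sigma>_nonneg[of t]] H[OF \<sigma>_nonneg[of t]] k_pos[of t]
      by (auto simp: indicator_def ennreal_mult)
  qed
  finally show ?thesis by simp
qed

end

section \<open>Value functions on a compact control set\<close>

definition ordinary_controls :: "'c::euclidean_space set \<Rightarrow> (real \<Rightarrow> 'c) set" where
  "ordinary_controls D = {u. u \<in> borel_measurable (restrict_space borel {0..}) \<and> (\<forall>t\<ge>0. u t \<in> D)}"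

text \<open>Extension by the value at 0 keeps the set of values, so it turns ordinary and relaxed
  controls on the half-line into controls at all real times.\<close>

lemma measurable_extend_constant:
  assumes "u \<in> measurable (restrict_space borel {0::real..}) N"
  shows "(\<lambda>t. u (max 0 t)) \<in> measurable borel N"
proof -
  have "(\<lambda>t. max 0 t) \<in> measurable borel (restrict_space borel {0::real..})"
    by (rule measurable_restrict_space2) auto
  from measurable_compose[OF this assms] show ?thesis .
qed

lemma is_solution_cong_control:
  assumes "\<And>t. t \<ge> 0 \<Longrightarrow> u t = u' t"
  shows "is_solution g x u = is_solution g x u'"
proof
  fix y
  show "is_solution g x u y = is_solution g x u' y"
    unfolding is_solution_eq_caratheodory
    by (rule caratheodory_solution_cong) (simp_all add: assms)
qed

lemma trajectory_is_solution:
  assumes "is_solution g x u y"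
  shows "is_solution g x u (trajectory g x u)"
  unfolding trajectory_def by (rule someI[of _ y]) (rule assms)

text \<open>By uniqueness the trajectory picked by the choice operator agrees with \<open>y\<close>
  at all times that enter the cost.\<close>

lemma total_cost_eq:
  assumes y: "is_solution g x u y" and uniq: "\<And>y' t. is_solution g x u y' \<Longrightarrow> t \<ge> 0 \<Longrightarrow> y' t = y t"
  shows "total_cost g h x u = (\<integral>\<^sup>+t\<in>{0..}. ennreal (h (y t) (u t)) \<partial>lborel)"
  unfolding total_cost_def
  by (intro nn_integral_cong) (auto simp: indicator_def uniq[OF trajectory_is_solution[OF y]])

lemma lsc_envelope_mono:
  assumes "\<And>x. u x \<le> v x"
  shows "lsc_envelope u x \<le> lsc_envelope v x"
  unfolding lsc_envelope_def by (intro Liminf_mono always_eventually allI assms)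

section \<open>The two inequalities between envelope and relaxed value\<close>

context compact_control
begin

lemma ordinary_solution:
  assumes u: "u \<in> ordinary_controls K"
  shows "is_solution g x u (trajectory g x u)"
    and "is_solution g x u y \<Longrightarrow> is_solution g x u y' \<Longrightarrow> t \<ge> 0 \<Longrightarrow> y t = y' t"
proof -
  define v where "v t = u (max 0 t)" for t
  have v: "v \<in> borel_measurable borel" "v t \<in> K" for t
    using u measurable_extend_constant[of u borel] unfolding ordinary_controls_def v_def[abs_def] by auto
  interpret V: caratheodory_field "\<lambda>t x. g x (v t)" M L by (rule field_ordinary[OF v])
  have eq: "is_solution g x u = caratheodory_solution (\<lambda>s z. g z (v s)) x" for x
    unfolding is_solution_eq_caratheodory[abs_def, symmetric]
    using is_solution_cong_control[of u v g x] by (simp add: v_def is_solution_eq_caratheodory[abs_def])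
  obtain y0 where "is_solution g x u y0" using V.solution_exists[of x] unfolding eq by blast
  then show "is_solution g x u (trajectory g x u)" by (rule trajectory_is_solution)
  show "is_solution g x u y \<Longrightarrow> is_solution g x u y' \<Longrightarrow> t \<ge> 0 \<Longrightarrow> y t = y' t"
    unfolding eq by (rule V.solution_unique)
qed

lemma ordinary_cost:
  assumes "u \<in> ordinary_controls K" "is_solution g x u y"
  shows "total_cost g h x u = (\<integral>\<^sup>+t\<in>{0..}. ennreal (h (y t) (u t)) \<partial>lborel)"
  by (rule total_cost_eq[OF assms(2)]) (rule ordinary_solution(2)[OF assms(1) _ assms(2)])

abbreviation g_rel :: "'x \<Rightarrow> 'c measure \<Rightarrow> 'x" where "g_rel x \<mu> \<equiv> LINT a|\<mu>. g x a"
abbreviation h_rel :: "'x \<Rightarrow> 'c measure \<Rightarrow> real" where "h_rel x \<mu> \<equiv> LINT a|\<mu>. h x a"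

lemma relaxed_solution:
  assumes \<mu>: "\<mu> \<in> relaxed_controls_on K"
  shows "is_solution g_rel x \<mu> (trajectory g_rel x \<mu>)"
    and "is_solution g_rel x \<mu> y \<Longrightarrow> is_solution g_rel x \<mu> y' \<Longrightarrow> t \<ge> 0 \<Longrightarrow> y t = y' t"
proof -
  define \<nu> where "\<nu> t = \<mu> (max 0 t)" for t
  have \<nu>: "\<nu> \<in> measurable borel (relaxed_space K)"
    using \<mu> measurable_extend_constant[of \<mu> "relaxed_space K"]
    unfolding relaxed_controls_on_def \<nu>_def[abs_def] by auto
  interpret V: caratheodory_field "\<lambda>t x. g_rel x (\<nu> t)" M L by (rule field_relaxed[OF \<nu>])
  have eq: "is_solution g_rel x \<mu> = caratheodory_solution (\<lambda>s z. g_rel z (\<nu> s)) x" for x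
    using is_solution_cong_control[of \<mu> \<nu> g_rel x] by (simp add: \<nu>_def is_solution_eq_caratheodory[abs_def])
  obtain y0 where "is_solution g_rel x \<mu> y0" using V.solution_exists[of x] unfolding eq by blast
  then show "is_solution g_rel x \<mu> (trajectory g_rel x \<mu>)" by (rule trajectory_is_solution)
  show "is_solution g_rel x \<mu> y \<Longrightarrow> is_solution g_rel x \<mu> y' \<Longrightarrow> t \<ge> 0 \<Longrightarrow> y t = y' t"
    unfolding eq by (rule V.solution_unique)
qed

lemma relaxed_cost:
  assumes "\<mu> \<in> relaxed_controls_on K" "is_solution g_rel x \<mu> y"
  shows "total_cost g_rel h_rel x \<mu> = (\<integral>\<^sup>+t\<in>{0..}. ennreal (h_rel (y t) (\<mu> t)) \<partial>lborel)"
  by (rule total_cost_eq[OF assms(2)]) (rule relaxed_solution(2)[OF assms(1) _ assms(2)])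

text \<open>If values near \<open>x0\<close> failed to exceed \<open>c\<close>, there would be
  initial points tending to \<open>x0\<close> with controls cheaper than \<open>c'\<close>. A
  relaxed limit of these controls would cost at most \<open>c'\<close>, which is below the
  infimum.\<close>

theorem relaxed_value_le_lsc_envelope:
  "value_function (relaxed_controls_on K) g_rel h_rel x0
     \<le> lsc_envelope (value_function (ordinary_controls K) g h) x0"
  unfolding lsc_envelope_def le_Liminf_iff
proof (intro allI impI)
  let ?V = "value_function (ordinary_controls K) g h"
  fix c assume c: "c < value_function (relaxed_controls_on K) g_rel h_rel x0"
  \<comment> \<open>The gap between \<open>c\<close> and \<open>c'\<close> turns a value of at most
    \<open>c\<close> into a control of cost below \<open>c'\<close>, although the infimum need not
    be attained.\<close>
  then obtain c' where c': "c < c'" "c' < value_function (relaxed_controls_on K) g_rel h_rel x0"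
    using dense by blast
  show "\<forall>\<^sub>F x in nhds x0. c < ?V x"
  proof (unfold eventually_nhds_iff_sequentially, intro allI impI, rule ccontr)
    fix X assume X: "X \<longlonglongrightarrow> x0" and "\<not> (\<forall>\<^sub>F n in sequentially. c < ?V (X n))"
    then obtain r where r: "strict_mono r" "\<And>n :: nat. \<not> c < ?V (X (r n))"
      using not_eventually_sequentiallyD by blast
    have "\<exists>u\<in>ordinary_controls K. total_cost g h (X (r n)) u < c'" for n
    proof -
      have "?V (X (r n)) < c'" using r(2)[of n] c'(1) by auto
      then show ?thesis by (simp add: value_function_def INF_less_iff)
    qed
    then obtain u where u: "\<And>n. u n \<in> ordinary_controls K" "\<And>n. total_cost g h (X (r n)) (u n) < c'" by metis
    define v where "v n t = u n (max 0 t)" for n t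
    have v: "v n \<in> borel_measurable borel" "v n t \<in> K" for n t
      using u(1)[of n] measurable_extend_constant[of "u n" borel]
      unfolding ordinary_controls_def v_def[abs_def] by auto
    define y where "y n = trajectory g (X (r n)) (u n)" for n
    have ysol: "is_solution g (X (r n)) (u n) (y n)" for n
      unfolding y_def by (rule ordinary_solution(1)[OF u(1)])
    have y: "caratheodory_solution (\<lambda>s z. g z (v n s)) (X (r n)) (y n)" for n
      using ysol[of n] is_solution_cong_control[of "u n" "v n" g "X (r n)"]
      by (simp add: v_def is_solution_eq_caratheodory)
    have cost: "(\<integral>\<^sup>+t\<in>{0..}. ennreal (h (y n t) (v n t)) \<partial>lborel) \<le> c'" for n
    proof -
      have "(\<integral>\<^sup>+t\<in>{0..}. ennreal (h (y n t) (v n t)) \<partial>lborel) = total_cost g h (X (r n)) (u n)"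
        unfolding ordinary_cost[OF u(1) ysol]
        by (intro nn_integral_cong) (auto simp: indicator_def v_def)
      then show ?thesis using u(2)[of n] by simp
    qed
    have Xr: "(\<lambda>n. X (r n)) \<longlonglongrightarrow> x0" using LIMSEQ_subseq_LIMSEQ[OF X r(1)] by (simp add: o_def)
    obtain \<mu> z where \<mu>: "\<mu> \<in> measurable borel (relaxed_space K)"
      and z: "caratheodory_solution (\<lambda>s z. g_rel z (\<mu> s)) x0 z"
      and le: "(\<integral>\<^sup>+t\<in>{0..}. ennreal (h_rel (z t) (\<mu> t)) \<partial>lborel) \<le> c'"
      by (rule relaxed_trajectory_limit[of "\<lambda>n. X (r n)" x0 v y c', OF Xr v y cost])
    have \<mu>': "\<mu> \<in> relaxed_controls_on K"
      unfolding relaxed_controls_on_def by (rule measurable_restrict_space1[OF \<mu>])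
    have "value_function (relaxed_controls_on K) g_rel h_rel x0 \<le> total_cost g_rel h_rel x0 \<mu>"
      unfolding value_function_def by (rule INF_lower[OF \<mu>'])
    also have "\<dots> = (\<integral>\<^sup>+t\<in>{0..}. ennreal (h_rel (z t) (\<mu> t)) \<partial>lborel)"
      by (rule relaxed_cost[OF \<mu>']) (simp add: is_solution_eq_caratheodory z)
    finally show False using le c'(2) by auto
  qed
qed

text \<open>What both alternatives of (H0) supply along a relaxed trajectory: a Lipschitz constant
  and a Dini modulus, uniform in time and control, in the tube of radius 1.\<close>

definition tubular :: "'x \<Rightarrow> (real \<Rightarrow> 'c measure) \<Rightarrow> bool" where
  "tubular x \<mu> \<longleftrightarrow> (\<exists>\<Lambda> C \<omega> \<delta>. C > 0 \<and> \<delta> > 0 \<and> dini \<omega> \<and> (\<forall>r\<ge>0. \<omega> r \<ge> 0) \<and> mono_on {0..<\<delta>} \<omega> \<and>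
     (\<forall>t\<ge>0. \<forall>a\<in>K. \<forall>w w'. norm (w - trajectory g_rel x \<mu> t) \<le> 1 \<longrightarrow>
        norm (w' - trajectory g_rel x \<mu> t) \<le> 1 \<longrightarrow>
          norm (g w a - g w' a) \<le> \<Lambda> * norm (w - w') \<and>
          \<bar>h w a - h w' a\<bar> \<le> C * \<omega> (norm (w - w'))))"

text \<open>The approximating trajectory starts near \<open>x0\<close> but not at it. This is enough
  to refute that the value over \<open>D\<close> exceeds some \<open>c\<close> above the relaxed
  value on a whole neighbourhood of \<open>x0\<close>.\<close>

theorem lsc_envelope_le_relaxed_value:
  assumes D: "D \<subseteq> K" "K \<subseteq> closure D"
    and near: "\<And>\<eta>. \<eta> > 0 \<Longrightarrow> value_function (relaxed_controls_on K) g_rel h_rel x0 < \<infinity> \<Longrightarrow>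
      \<exists>\<mu>\<in>relaxed_controls_on K. tubular x0 \<mu> \<and>
        total_cost g_rel h_rel x0 \<mu> \<le> value_function (relaxed_controls_on K) g_rel h_rel x0 + ennreal \<eta>"
  shows "lsc_envelope (value_function (ordinary_controls D) g h) x0
     \<le> value_function (relaxed_controls_on K) g_rel h_rel x0"
proof (rule ccontr)
  let ?V = "value_function (ordinary_controls D) g h"
  let ?R = "value_function (relaxed_controls_on K) g_rel h_rel x0"
  assume "\<not> ?thesis"
  then have "?R < lsc_envelope ?V x0" by simp
  then obtain c where c: "?R < c" "c < lsc_envelope ?V x0" using dense by blast
  have fin: "?R < \<infinity>" using c(1) by (auto intro: less_le_trans)
  have "\<forall>\<^sub>F x in nhds x0. c < ?V x"
    using c(2) unfolding lsc_envelope_def by (rule less_LiminfD)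
  then obtain d where d: "d > 0" "\<And>x. dist x x0 < d \<Longrightarrow> c < ?V x"
    unfolding eventually_nhds_metric by blast
  \<comment> \<open>\<open>c\<close> may be infinite, so the room above \<open>?R\<close> is
    measured up to a finite \<open>b\<close> below \<open>c\<close>.\<close>
  obtain e where e: "e > 0" "?R + ennreal e \<le> c"
  proof -
    obtain b where b: "?R < b" "b < c" using c(1) dense by blast
    have bf: "b < \<infinity>" using b(2) by (auto intro: less_le_trans)
    define e where "e = enn2real (b - ?R)"
    have "b - ?R > 0" using b(1) by (simp add: diff_gt_0_iff_gt_ennreal)
    moreover have bR: "b - ?R < \<infinity>" using bf by (auto intro: le_less_trans[OF diff_le_self_ennreal])
    ultimately have "e > 0" by (simp add: e_def enn2real_positive_iff)
    moreover have "?R + ennreal e \<le> c"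
      using bR b by (simp add: e_def add_diff_inverse_ennreal less_imp_le)
    ultimately show ?thesis using that by blast
  qed
  \<comment> \<open>\<open>\<eta> \<le> d\<close> puts the new initial point into the neighbourhood;
    the choice of a nearly optimal \<open>\<mu>\<close> and its approximation cost
    \<open>\<eta>\<close> each, together at most \<open>e\<close>.\<close>
  define \<eta> where "\<eta> = min d (e / 2)"
  have \<eta>: "\<eta> > 0" "\<eta> \<le> d" "\<eta> + \<eta> \<le> e" using d(1) e(1) by (auto simp: \<eta>_def min_def)
  obtain \<mu> where \<mu>: "\<mu> \<in> relaxed_controls_on K" and tub: "tubular x0 \<mu>"
    and cost: "total_cost g_rel h_rel x0 \<mu> \<le> ?R + ennreal \<eta>"
    using near[OF \<eta>(1) fin] by blast
  define y where "y = trajectory g_rel x0 \<mu>"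
  have ysol: "is_solution g_rel x0 \<mu> y" unfolding y_def by (rule relaxed_solution(1)[OF \<mu>])
  define \<nu> where "\<nu> t = \<mu> (max 0 t)" for t
  have \<nu>: "\<nu> \<in> measurable borel (relaxed_space K)"
    using \<mu> measurable_extend_constant[of \<mu> "relaxed_space K"]
    unfolding relaxed_controls_on_def \<nu>_def[abs_def] by auto
  have ysol': "caratheodory_solution (\<lambda>s z. g_rel z (\<nu> s)) x0 y"
    using ysol is_solution_cong_control[of \<mu> \<nu> g_rel x0] by (simp add: \<nu>_def is_solution_eq_caratheodory)
  from tub[unfolded tubular_def, folded y_def] obtain \<Lambda> C \<omega> \<delta> where T: "C > 0 \<and> \<delta> > 0 \<and> dini \<omega> \<and> (\<forall>r\<ge>0. \<omega> r \<ge> 0) \<and> mono_on {0..<\<delta>} \<omega> \<and>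
     (\<forall>t\<ge>0. \<forall>a\<in>K. \<forall>w w'. norm (w - y t) \<le> 1 \<longrightarrow> norm (w' - y t) \<le> 1 \<longrightarrow>
          norm (g w a - g w' a) \<le> \<Lambda> * norm (w - w') \<and>
          \<bar>h w a - h w' a\<bar> \<le> C * \<omega> (norm (w - w')))"
    by (elim exE) (rule that)
  have tube: "C > 0" "\<delta> > 0" "dini \<omega>" "\<And>r. r \<ge> 0 \<Longrightarrow> \<omega> r \<ge> 0" "mono_on {0..<\<delta>} \<omega>"
    and tg: "\<And>t a w w'. t \<ge> 0 \<Longrightarrow> a \<in> K \<Longrightarrow> norm (w - y t) \<le> 1 \<Longrightarrow> norm (w' - y t) \<le> 1 \<Longrightarrow>
          norm (g w a - g w' a) \<le> \<Lambda> * norm (w - w')"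
    and th: "\<And>t a w w'. t \<ge> 0 \<Longrightarrow> a \<in> K \<Longrightarrow> norm (w - y t) \<le> 1 \<Longrightarrow> norm (w' - y t) \<le> 1 \<Longrightarrow>
          \<bar>h w a - h w' a\<bar> \<le> C * \<omega> (norm (w - w'))"
    using T by auto
  have th': "\<bar>h w a - h (y t) a\<bar> \<le> C * \<omega> (norm (w - y t))" if "t \<ge> 0" "a \<in> K" "norm (w - y t) \<le> 1" for t a w
    by (rule th[OF that(1,2,3)]) simp
  have "\<exists>x' u z. norm (x' - x0) < \<eta> \<and> u \<in> borel_measurable borel \<and> (\<forall>t. u t \<in> D) \<and>
    caratheodory_solution (\<lambda>s w. g w (u s)) x' z \<and>
    (\<integral>\<^sup>+t\<in>{0..}. ennreal (h (z t) (u t)) \<partial>lborel)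
       \<le> (\<integral>\<^sup>+t\<in>{0..}. ennreal (h_rel (y t) (\<nu> t)) \<partial>lborel) + ennreal \<eta>"
    by (rule ordinary_approximation[OF D \<nu> ysol' tg th' tube(1,3,4,5,2) \<eta>(1)]) blast+
  then obtain x' u z where x': "norm (x' - x0) < \<eta>" and u: "u \<in> borel_measurable borel" "\<And>t. u t \<in> D"
    and z: "caratheodory_solution (\<lambda>s w. g w (u s)) x' z"
    and le: "(\<integral>\<^sup>+t\<in>{0..}. ennreal (h (z t) (u t)) \<partial>lborel)
       \<le> (\<integral>\<^sup>+t\<in>{0..}. ennreal (h_rel (y t) (\<nu> t)) \<partial>lborel) + ennreal \<eta>" by blast
  have uD: "u \<in> ordinary_controls D"
    using u by (simp add: ordinary_controls_def measurable_restrict_space1)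
  have uK: "u \<in> ordinary_controls K" using uD D(1) by (auto simp: ordinary_controls_def)
  have "?V x' \<le> total_cost g h x' u" unfolding value_function_def by (rule INF_lower[OF uD])
  also have "\<dots> = (\<integral>\<^sup>+t\<in>{0..}. ennreal (h (z t) (u t)) \<partial>lborel)"
    by (rule ordinary_cost[OF uK]) (simp add: is_solution_eq_caratheodory z)
  also note le
  also have "(\<integral>\<^sup>+t\<in>{0..}. ennreal (h_rel (y t) (\<nu> t)) \<partial>lborel) = total_cost g_rel h_rel x0 \<mu>"
    unfolding relaxed_cost[OF \<mu> ysol] by (intro nn_integral_cong) (auto simp: indicator_def \<nu>_def)
  also have "\<dots> + ennreal \<eta> \<le> (?R + ennreal \<eta>) + ennreal \<eta>" by (intro add_right_mono cost)
  also have "\<dots> = ?R + ennreal (\<eta> + \<eta>)" using \<eta>(1) by (simp add: add.assoc ennreal_plus[symmetric] del: ennreal_plus)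
  also have "\<dots> \<le> ?R + ennreal e" by (intro add_left_mono ennreal_leI \<eta>(3))
  also note e(2)
  finally have "?V x' \<le> c" .
  moreover have "c < ?V x'" by (rule d(2)) (use x' \<eta>(2) in \<open>simp add: dist_norm\<close>)
  ultimately show False by simp
qed

end

section \<open>Reduction to a compact control set\<close>

text \<open>The constraint \<open>w0 ^ q + norm w ^ q = 1\<close> eliminates \<open>w0\<close>, so
  the control is \<open>w\<close> alone. For compact \<open>A\<close> the data are left as they are,
  and one family of lemmas covers both cases.\<close>

definition reduced ::
  "(real^'m) set \<Rightarrow> nat \<Rightarrow> (real^'n \<Rightarrow> real^'m \<Rightarrow> 'b::real_vector) \<Rightarrow> (real^'n \<Rightarrow> real^'m \<Rightarrow> 'b) \<Rightarrow>
   real^'n \<Rightarrow> real^'m \<Rightarrow> 'b" where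
  "reduced A q \<Phi> \<Phi>inf x w =
     (if compact A then \<Phi> x w else extension q \<Phi> \<Phi>inf x (root q (1 - norm w ^ q), w))"

text \<open>If \<open>A\<close> is unbounded, these are the extended controls with \<open>w\<^sub>0 > 0\<close>.\<close>

definition regular_base :: "(real^'m) set \<Rightarrow> (real^'m) set" where
  "regular_base A = (if compact A then A else {w \<in> A. norm w < 1})"

lemma relaxation_eq_reduced: "relaxation A q \<Phi> \<Phi>inf = (\<lambda>x \<mu>. LINT a|\<mu>. reduced A q \<Phi> \<Phi>inf x a)"
  by (auto simp: relaxation_def reduced_def fun_eq_iff)

text \<open>For \<open>w0 > 0\<close> this is a composition, as the cone contains \<open>w\<close>
  divided by \<open>w0\<close>. Across \<open>w0 = 0\<close> the recession limit is uniform on a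
  compact neighbourhood of the point, and the limit function is continuous there.\<close>

lemma extension_continuous:
  fixes \<Phi> \<Phi>inf :: "real^'n \<Rightarrow> real^'m \<Rightarrow> 'b::real_normed_vector"
  assumes A: "closed A" "cone A" and \<Phi>: "continuous_on (UNIV \<times> A) (\<lambda>(x, a). \<Phi> x a)"
    and rec: "recession A q \<Phi> \<Phi>inf" and q: "q > 0"
  shows "continuous_on (UNIV \<times> ({0..} \<times> A)) (\<lambda>(x, v). extension q \<Phi> \<Phi>inf x v)"
  unfolding continuous_on_eq_continuous_within
proof (safe)
  fix x0 r0 w0 assume r0: "(0::real) \<le> r0" and w0: "w0 \<in> A"
  let ?S = "UNIV \<times> ({0..} \<times> A) :: ((real^'n) \<times> real \<times> (real^'m)) set"
  let ?E = "\<lambda>(x :: real^'n, v). extension q \<Phi> \<Phi>inf x v"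
  show "continuous (at (x0, r0, w0) within ?S) ?E"
  proof (cases "r0 = 0")
    case False
    then have r0': "r0 > 0" using r0 by simp
    let ?P = "UNIV \<times> ({0<..} \<times> A) :: ((real^'n) \<times> real \<times> (real^'m)) set"
    have "continuous_on ?P (\<lambda>p. \<Phi> (fst p) (inverse (fst (snd p)) *\<^sub>R snd (snd p)))"
    proof -
      have "continuous_on ?P (\<lambda>p. (fst p, inverse (fst (snd p)) *\<^sub>R snd (snd p)))"
        by (intro continuous_intros) auto
      moreover have "(\<lambda>p. (fst p, inverse (fst (snd p)) *\<^sub>R snd (snd p))) ` ?P \<subseteq> UNIV \<times> A"
        using A(2) by (auto simp: cone_def)
      ultimately have "continuous_on ?P (\<lambda>p. case (fst p, inverse (fst (snd p)) *\<^sub>R snd (snd p)) of (x, a) \<Rightarrow> \<Phi> x a)"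
        by (rule continuous_on_compose2[OF \<Phi>])
      then show ?thesis by simp
    qed
    then have "continuous_on ?P (\<lambda>p. fst (snd p) ^ q *\<^sub>R \<Phi> (fst p) (inverse (fst (snd p)) *\<^sub>R snd (snd p)))"
      by (intro continuous_intros)
    then have "continuous_on ?P ?E"
      by (rule continuous_on_eq) (auto simp: extension_def)
    then have "continuous (at (x0, r0, w0) within ?P) ?E"
      using r0' w0 by (auto simp: continuous_on_eq_continuous_within)
    moreover have "at (x0, r0, w0) within ?P = at (x0, r0, w0) within ?S"
    proof (rule at_within_nhd[of _ "UNIV \<times> ({0<..} \<times> UNIV)"])
      show "open (UNIV \<times> ({0<..} \<times> UNIV) :: ((real^'n) \<times> real \<times> (real^'m)) set)"
        by (intro open_Times) auto
    qed (use r0' in auto)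
    ultimately show ?thesis by simp
  next
    case True
    show ?thesis
      unfolding continuous_within_eps_delta
    proof (intro allI impI)
      fix e :: real assume e: "e > 0"
      let ?C = "cball x0 1 \<times> (A \<inter> cball w0 1)"
      have "compact ?C" by (intro compact_Times compact_cball closed_Int_compact A(1))
      then have "uniform_limit ?C (\<lambda>\<rho> (x, a). \<rho> ^ q *\<^sub>R \<Phi> x (inverse \<rho> *\<^sub>R a)) (\<lambda>(x, a). \<Phi>inf x a) (at_right 0)"
        using rec unfolding recession_def by blast
      then have "\<forall>\<^sub>F \<rho> in at_right 0. \<forall>p\<in>?C. dist (case p of (x, a) \<Rightarrow> \<rho> ^ q *\<^sub>R \<Phi> x (inverse \<rho> *\<^sub>R a))
          (case p of (x, a) \<Rightarrow> \<Phi>inf x a) < e / 2"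
        using e by (intro uniform_limitD) auto
      then obtain b where b: "b > 0" "\<And>\<rho> p. 0 < \<rho> \<Longrightarrow> \<rho> < b \<Longrightarrow> p \<in> ?C \<Longrightarrow>
          dist (case p of (x, a) \<Rightarrow> \<rho> ^ q *\<^sub>R \<Phi> x (inverse \<rho> *\<^sub>R a)) (case p of (x, a) \<Rightarrow> \<Phi>inf x a) < e / 2"
        unfolding eventually_at_right_field by auto
      have "continuous (at (x0, w0) within UNIV \<times> A) (\<lambda>(x, a). \<Phi>inf x a)"
        using rec w0 unfolding recession_def by (auto simp: continuous_on_eq_continuous_within)
      then obtain d where d: "d > 0" "\<And>p. p \<in> UNIV \<times> A \<Longrightarrow> dist p (x0, w0) < d \<Longrightarrow>
          dist (case p of (x, a) \<Rightarrow> \<Phi>inf x a) (\<Phi>inf x0 w0) < e / 2"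
        using e unfolding continuous_within_eps_delta by (metis (mono_tags, lifting) case_prod_conv half_gt_zero)
      show "\<exists>d>0. \<forall>p\<in>?S. dist p (x0, r0, w0) < d \<longrightarrow> dist (?E p) (?E (x0, r0, w0)) < e"
      proof (intro exI[of _ "min (min b d) 1"] conjI ballI impI)
        show "0 < min (min b d) 1" using b d by simp
        fix p assume p: "p \<in> ?S" "dist p (x0, r0, w0) < min (min b d) 1"
        obtain x r w where pe: "p = (x, r, w)" by (cases p) auto
        have rw: "r \<ge> 0" "w \<in> A" using p(1) pe by auto
        have dx: "dist x x0 < 1" and dr: "r < b" and dw: "dist w w0 < 1" and dxw: "dist (x, w) (x0, w0) < d"
        proof -
          have "dist x x0 \<le> dist p (x0, r0, w0)" unfolding pe using dist_fst_le[of "(x, r, w)" "(x0, r0, w0)"] by simp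
          then show "dist x x0 < 1" using p(2) by simp
          have 1: "dist (r, w) (r0, w0) \<le> dist p (x0, r0, w0)" unfolding pe using dist_snd_le[of "(x, r, w)" "(x0, r0, w0)"] by simp
          have "dist r r0 \<le> dist (r, w) (r0, w0)" using dist_fst_le[of "(r, w)" "(r0, w0)"] by simp
          then have "dist r r0 < b" using 1 p(2) by simp
          then show "r < b" using True by (simp add: dist_real_def)
          have 2: "dist w w0 \<le> dist (r, w) (r0, w0)" using dist_snd_le[of "(r, w)" "(r0, w0)"] by simp
          then show "dist w w0 < 1" using 1 p(2) by simp
          have "dist (x, w) (x0, w0) \<le> dist p (x0, r0, w0)"
            unfolding pe dist_Pair_Pair using 2 by (intro real_sqrt_le_mono add_left_mono power_mono) (auto simp: dist_Pair_Pair)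
          then show "dist (x, w) (x0, w0) < d" using p(2) by simp
        qed
        have C: "(x, w) \<in> ?C" using dx dw rw by (simp add: dist_commute less_imp_le)
        have "dist (extension q \<Phi> \<Phi>inf x (r, w)) (\<Phi>inf x w) < e / 2"
          using b(2)[of r "(x, w)", OF _ dr C] rw e by (cases "r = 0") (auto simp: extension_def)
        moreover have "dist (\<Phi>inf x w) (\<Phi>inf x0 w0) < e / 2" using d(2)[of "(x, w)"] dxw rw by simp
        ultimately show "dist (?E p) (?E (x0, r0, w0)) < e"
          using dist_triangle_half_l[of "extension q \<Phi> \<Phi>inf x (r, w)" "\<Phi>inf x w" e "\<Phi>inf x0 w0"]
            dist_triangle[of "extension q \<Phi> \<Phi>inf x (r, w)" "\<Phi>inf x0 w0" "\<Phi>inf x w"]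
          by (simp add: pe True extension_def)
      qed
    qed
  qed
qed

lemma reduced_continuous:
  fixes \<Phi> \<Phi>inf :: "real^'n \<Rightarrow> real^'m \<Rightarrow> 'b::real_normed_vector"
  assumes A: "control_set A" and \<Phi>: "continuous_on (UNIV \<times> A) (\<lambda>(x, a). \<Phi> x a)"
    and rec: "\<not> bounded A \<Longrightarrow> recession A q \<Phi> \<Phi>inf" and q: "q > 0"
  shows "continuous_on (UNIV \<times> relaxed_base A) (\<lambda>(x, a). reduced A q \<Phi> \<Phi>inf x a)"
proof (cases "compact A")
  case True
  then show ?thesis using \<Phi> by (simp add: relaxed_base_def reduced_def)
next
  case False
  then have A': "\<not> bounded A" "closed A" "cone A" using A by (auto simp: control_set_def)
  have "continuous_on (UNIV \<times> (cball 0 1 \<inter> A)) (\<lambda>p :: (real^'n) \<times> (real^'m). (fst p, root q (1 - norm (snd p) ^ q), snd p))"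
    by (intro continuous_intros)
  moreover have "(\<lambda>p :: (real^'n) \<times> (real^'m). (fst p, root q (1 - norm (snd p) ^ q), snd p)) `
      (UNIV \<times> (cball 0 1 \<inter> A)) \<subseteq> UNIV \<times> ({0..} \<times> A)"
    by (auto simp: power_le_one real_root_ge_zero)
  ultimately have "continuous_on (UNIV \<times> (cball 0 1 \<inter> A))
      (\<lambda>p :: (real^'n) \<times> (real^'m). case (fst p, root q (1 - norm (snd p) ^ q), snd p) of (x, v) \<Rightarrow> extension q \<Phi> \<Phi>inf x v)"
    by (rule continuous_on_compose2[OF extension_continuous[OF A'(2,3) \<Phi> rec[OF A'(1)] q]])
  then show ?thesis using False by (simp add: relaxed_base_def reduced_def case_prod_unfold)
qed

lemma root_weight:
  fixes w :: "'a::real_normed_vector"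
  assumes "q > 0" "norm w < 1"
  shows "root q (1 - norm w ^ q) > 0" "root q (1 - norm w ^ q) ^ q = 1 - norm w ^ q"
proof -
  have "norm w ^ q < 1" using assms power_strict_mono[of "norm w" 1 q] by simp
  then show "root q (1 - norm w ^ q) > 0" "root q (1 - norm w ^ q) ^ q = 1 - norm w ^ q"
    using assms by (auto simp: real_root_pow_pos2)
qed

lemma reduced_regular:
  fixes \<Phi> \<Phi>inf :: "real^'n \<Rightarrow> real^'m \<Rightarrow> 'b::real_vector"
  assumes "\<not> compact A" "q > 0" "norm w < 1"
  shows "reduced A q \<Phi> \<Phi>inf x w = (1 - norm w ^ q) *\<^sub>R \<Phi> x (inverse (root q (1 - norm w ^ q)) *\<^sub>R w)"
  using root_weight[OF assms(2,3)] assms(1) by (simp add: reduced_def extension_def)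

text \<open>With r = w0 the first product is r^q + r^(q-p) |w|^p; since p \<le> q, both terms are at
  most 1. This is why growth of order p in the original control becomes a bound uniform in the
  reduced one.\<close>

lemma weight_bound:
  fixes w :: "'a::real_normed_vector"
  assumes p: "1 \<le> p" "p \<le> q" and w: "norm w < 1"
  shows "(1 - norm w ^ q) * (1 + norm (inverse (root q (1 - norm w ^ q)) *\<^sub>R w) ^ p) \<le> 2"
    and "(1 - norm w ^ q) * norm (inverse (root q (1 - norm w ^ q)) *\<^sub>R w) ^ q = norm w ^ q"
proof -
  define r where "r = root q (1 - norm w ^ q)"
  have q: "q > 0" using p by simp
  have r: "r > 0" "r ^ q = 1 - norm w ^ q" using root_weight[OF q w] by (auto simp: r_def)
  have r1: "r \<le> 1" unfolding r_def using q by (simp add: real_root_le_1_iff)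
  have np: "norm (inverse r *\<^sub>R w) ^ j = norm w ^ j / r ^ j" for j
    using r(1) by (simp add: power_mult_distrib power_inverse divide_inverse mult.commute)
  have "r ^ q * (1 + norm w ^ p / r ^ p) = r ^ q + r ^ (q - p) * norm w ^ p"
    using r(1) p by (simp add: power_diff field_simps)
  also have "\<dots> \<le> 1 + 1 * 1"
    using r r1 w by (intro add_mono mult_mono) (auto simp: power_le_one)
  finally show "(1 - norm w ^ q) * (1 + norm (inverse (root q (1 - norm w ^ q)) *\<^sub>R w) ^ p) \<le> 2"
    unfolding r_def[symmetric] np by (simp only: r(2))
  show "(1 - norm w ^ q) * norm (inverse (root q (1 - norm w ^ q)) *\<^sub>R w) ^ q = norm w ^ q"
    unfolding r_def[symmetric] np by (simp only: r(2)[symmetric]) (use r(1) in simp)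
qed

text \<open>Shrinking towards the origin stays in the cone and brings the norm below 1.\<close>

lemma regular_base_dense:
  assumes "control_set A"
  shows "regular_base A \<subseteq> relaxed_base A" "relaxed_base A \<subseteq> closure (regular_base A)"
proof -
  show "regular_base A \<subseteq> relaxed_base A" by (auto simp: regular_base_def relaxed_base_def)
  show "relaxed_base A \<subseteq> closure (regular_base A)"
  proof (cases "compact A")
    case True
    then show ?thesis by (simp add: regular_base_def relaxed_base_def closure_subset)
  next
    case False
    then have cone: "cone A" using assms by (auto simp: control_set_def)
    show ?thesis
    proof
      fix w assume w: "w \<in> relaxed_base A"
      then have w': "w \<in> A" "norm w \<le> 1" using False by (auto simp: relaxed_base_def)
      define s where "s n = (1 - inverse (real (Suc n))) *\<^sub>R w" for n
      have s_in: "s n \<in> regular_base A" for n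
      proof -
        have c: "0 \<le> 1 - inverse (real (Suc n))" "1 - inverse (real (Suc n)) < 1" by (auto simp: field_simps)
        have "norm (s n) < 1"
        proof (cases "norm w = 0")
          case False
          have "norm (s n) = (1 - inverse (real (Suc n))) * norm w" unfolding s_def norm_scaleR using c(1) by simp
          also have "\<dots> < 1 * norm w" using c(2) False by (intro mult_strict_right_mono) auto
          finally show ?thesis using w'(2) by simp
        qed (simp add: s_def)
        moreover have "s n \<in> A" using cone w'(1) c(1) by (auto simp: s_def cone_def)
        ultimately show ?thesis using False by (simp add: regular_base_def)
      qed
      have "s \<longlonglongrightarrow> (1 - 0) *\<^sub>R w"
        unfolding s_def by (intro tendsto_intros LIMSEQ_inverse_real_of_nat)
      then show "w \<in> closure (regular_base A)"
        unfolding closure_sequential using s_in by auto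
    qed
  qed
qed

lemma compact_relaxed_base:
  assumes "control_set A"
  shows "compact (relaxed_base A)"
  using assms by (auto simp: relaxed_base_def control_set_def intro: compact_Int_closed)

lemma closure_regular_base:
  assumes "control_set A"
  shows "closure (regular_base A) = relaxed_base A"
  using regular_base_dense[OF assms] compact_relaxed_base[OF assms]
  by (meson closure_minimal compact_imp_closed subset_antisym)

text \<open>At regular points the reduced data are a weight times the original data at a point of
  \<open>A\<close>, so the structural bounds hold there with a common factor \<open>c\<close>;
  continuity in the control extends them to the closure, which is all of \<open>K\<close>.\<close>

theorem reduced_compact_control:
  fixes A :: "(real^'m) set" and f finf :: "real^'n \<Rightarrow> real^'m \<Rightarrow> real^'n"
    and l linf :: "real^'n \<Rightarrow> real^'m \<Rightarrow> real"
  assumes std: "standing_assumptions A f l finf linf p q M L N \<omega>" and ne: "A \<noteq> {}"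
  obtains c where "c > 0"
    "compact_control (relaxed_base A) (reduced A q f finf) (reduced A q l linf) (c * M) (\<lambda>R. c * L R)"
    "\<And>R a x y. R > 0 \<Longrightarrow> a \<in> relaxed_base A \<Longrightarrow> norm x \<le> R \<Longrightarrow> norm y \<le> R \<Longrightarrow>
       \<bar>reduced A q l linf x a - reduced A q l linf y a\<bar> \<le> c * \<omega> (norm (x - y)) R"
proof -
  have cs: "control_set A" and fc: "continuous_on (UNIV \<times> A) (\<lambda>(x, a). f x a)"
    and lc: "continuous_on (UNIV \<times> A) (\<lambda>(x, a). l x a)" and sb: "structural_bounds A f l p q M L N \<omega>"
    and rec: "\<not> bounded A \<Longrightarrow> recession A q f finf" "\<not> bounded A \<Longrightarrow> recession A q l linf"
    using std by (auto simp: standing_assumptions_def)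
  have pq: "1 \<le> p" "p \<le> q" and M: "M > 0" and mod: "modulus \<omega>"
    and Lpos: "\<And>R. R > 0 \<Longrightarrow> L R > 0"
    and flip: "\<And>R a x y. R > 0 \<Longrightarrow> a \<in> A \<Longrightarrow> norm x \<le> R \<Longrightarrow> norm y \<le> R \<Longrightarrow>
        norm (f x a - f y a) \<le> L R * (1 + norm a ^ p) * norm (x - y)"
    and llip: "\<And>R a x y. R > 0 \<Longrightarrow> a \<in> A \<Longrightarrow> norm x \<le> R \<Longrightarrow> norm y \<le> R \<Longrightarrow>
        \<bar>l x a - l y a\<bar> \<le> (1 + norm a ^ q) * \<omega> (norm (x - y)) R"
    and lnn: "\<And>R a x. R > 0 \<Longrightarrow> a \<in> A \<Longrightarrow> norm x \<le> R \<Longrightarrow> 0 \<le> l x a"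
    and fgr: "\<And>x a. a \<in> A \<Longrightarrow> norm (f x a) \<le> M * (1 + norm a ^ p) * (1 + norm x)"
    using sb unfolding structural_bounds_def by (auto simp: Ball_def)
  have lnn': "0 \<le> l x a" if "a \<in> A" for x a
    using lnn[of "norm x + 1" a x] that by (simp add: add_nonneg_pos)
  have q: "q > 0" using pq by simp
  have \<omega>nn: "\<omega> r R \<ge> 0" if "r \<ge> 0" "R > 0" for r R using mod that by (simp add: modulus_def)
  let ?K = "relaxed_base A" and ?g = "reduced A q f finf" and ?h = "reduced A q l linf"
  have gc: "continuous_on (UNIV \<times> ?K) (\<lambda>(x, a). ?g x a)"
    by (rule reduced_continuous[OF cs fc rec(1) q])
  have hc: "continuous_on (UNIV \<times> ?K) (\<lambda>(x, a). ?h x a)"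
    by (rule reduced_continuous[OF cs lc rec(2) q])
  have K_ne: "?K \<noteq> {}"
  proof (cases "compact A")
    case False
    then have "0 \<in> cball 0 1 \<inter> A" using cs by (auto simp: control_set_def)
    then show ?thesis unfolding relaxed_base_def using False by (simp only: if_False) blast
  qed (use ne in \<open>simp add: relaxed_base_def\<close>)
  obtain c where c: "c > 0"
    and cg: "\<And>x a. a \<in> regular_base A \<Longrightarrow> norm (?g x a) \<le> c * M * (1 + norm x)"
    and clip: "\<And>R a x y. R > 0 \<Longrightarrow> a \<in> regular_base A \<Longrightarrow> norm x \<le> R \<Longrightarrow> norm y \<le> R \<Longrightarrow>
       norm (?g x a - ?g y a) \<le> c * L R * norm (x - y)"
    and chnn: "\<And>x a. a \<in> regular_base A \<Longrightarrow> 0 \<le> ?h x a"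
    and chl: "\<And>R a x y. R > 0 \<Longrightarrow> a \<in> regular_base A \<Longrightarrow> norm x \<le> R \<Longrightarrow> norm y \<le> R \<Longrightarrow>
       \<bar>?h x a - ?h y a\<bar> \<le> c * \<omega> (norm (x - y)) R"
  proof (cases "compact A")
    case True
    obtain B where B: "B > 0" "\<And>a. a \<in> A \<Longrightarrow> norm a \<le> B"
      using compact_imp_bounded[OF True] by (auto simp: bounded_pos)
    \<comment> \<open>As \<open>B\<close> bounds the norms in \<open>A\<close>, this dominates both
      growth factors.\<close>
    define c where "c = 1 + B ^ p + B ^ q"
    have c: "c > 0" using B(1) by (simp add: c_def add_pos_nonneg)
    have cp: "1 + norm a ^ p \<le> c" "1 + norm a ^ q \<le> c" if "a \<in> A" for a
      using power_mono[OF B(2)[OF that] norm_ge_zero, of p] power_mono[OF B(2)[OF that] norm_ge_zero, of q]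
        zero_less_power[OF B(1), of p] zero_less_power[OF B(1), of q] unfolding c_def by linarith+
    show ?thesis
    proof (rule that[OF c])
      show "norm (?g x a) \<le> c * M * (1 + norm x)" if "a \<in> regular_base A" for x a
      proof -
        have a: "a \<in> A" using that True by (simp add: regular_base_def)
        have "norm (f x a) \<le> M * (1 + norm a ^ p) * (1 + norm x)" by (rule fgr[OF a])
        also have "\<dots> \<le> M * c * (1 + norm x)" using cp[OF a] M by (intro mult_right_mono mult_left_mono) auto
        finally show ?thesis using True by (simp add: reduced_def mult.commute)
      qed
      show "norm (?g x a - ?g y a) \<le> c * L R * norm (x - y)"
        if "R > 0" "a \<in> regular_base A" "norm x \<le> R" "norm y \<le> R" for R a x y
      proof -
        have a: "a \<in> A" using that True by (simp add: regular_base_def)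
        have "norm (f x a - f y a) \<le> L R * (1 + norm a ^ p) * norm (x - y)" by (rule flip[OF that(1) a that(3,4)])
        also have "\<dots> \<le> L R * c * norm (x - y)" using cp[OF a] Lpos[OF that(1)] by (intro mult_right_mono mult_left_mono) auto
        finally show ?thesis using True by (simp add: reduced_def mult.commute)
      qed
      show "0 \<le> ?h x a" if "a \<in> regular_base A" for x a
        using that True lnn' by (simp add: regular_base_def reduced_def)
      show "\<bar>?h x a - ?h y a\<bar> \<le> c * \<omega> (norm (x - y)) R"
        if "R > 0" "a \<in> regular_base A" "norm x \<le> R" "norm y \<le> R" for R a x y
      proof -
        have a: "a \<in> A" using that True by (simp add: regular_base_def)
        have "\<bar>l x a - l y a\<bar> \<le> (1 + norm a ^ q) * \<omega> (norm (x - y)) R" by (rule llip[OF that(1) a that(3,4)])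
        also have "\<dots> \<le> c * \<omega> (norm (x - y)) R" using cp[OF a] \<omega>nn[OF _ that(1)] by (intro mult_right_mono) auto
        finally show ?thesis using True by (simp add: reduced_def)
      qed
    qed
  next
    case False
    then have cone: "cone A" using cs by (auto simp: control_set_def)
    define b where "b w = inverse (root q (1 - norm w ^ q)) *\<^sub>R w" for w :: "real^'m"
    have reg: "w \<in> A \<and> norm w < 1" if "w \<in> regular_base A" for w using that False by (simp add: regular_base_def)
    have bA: "b w \<in> A" if "w \<in> regular_base A" for w
      using cone reg[OF that] root_weight(1)[OF q, of w] by (auto simp: b_def cone_def)
    have wt: "0 \<le> 1 - norm w ^ q" if "w \<in> regular_base A" for w
      using reg[OF that] by (simp add: power_le_one)
    have w2: "(1 - norm w ^ q) * (1 + norm (b w) ^ p) \<le> 2" if "w \<in> regular_base A" for w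
      unfolding b_def by (rule weight_bound(1)[OF pq]) (use reg[OF that] in simp)
    have w1: "(1 - norm w ^ q) * (1 + norm (b w) ^ q) \<le> 2" if "w \<in> regular_base A" for w
      unfolding b_def by (rule weight_bound(1)[of q q]) (use reg[OF that] pq in auto)
    have red: "reduced A q \<Phi> \<Phi>inf x w = (1 - norm w ^ q) *\<^sub>R \<Phi> x (b w)" if "w \<in> regular_base A"
      for \<Phi> \<Phi>inf :: "real^'n \<Rightarrow> real^'m \<Rightarrow> 'z::real_vector" and x w
      unfolding b_def by (rule reduced_regular[OF False q]) (use reg[OF that] in simp)
    show ?thesis
    \<comment> \<open>The constant of \<open>weight_bound\<close>, used with exponent
      \<open>p\<close> for the drift and with \<open>q\<close> in place of \<open>p\<close> for the
      cost.\<close>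
    proof (rule that[of 2])
      show "norm (?g x a) \<le> 2 * M * (1 + norm x)" if a: "a \<in> regular_base A" for x a
      proof -
        have "norm (?g x a) = (1 - norm a ^ q) * norm (f x (b a))" using wt[OF a] by (simp add: red[OF a])
        also have "\<dots> \<le> (1 - norm a ^ q) * (M * (1 + norm (b a) ^ p) * (1 + norm x))"
          by (intro mult_left_mono fgr bA a wt)
        also have "\<dots> = ((1 - norm a ^ q) * (1 + norm (b a) ^ p)) * (M * (1 + norm x))" by (simp add: mult_ac)
        also have "\<dots> \<le> 2 * (M * (1 + norm x))" using w2[OF a] M by (intro mult_right_mono) auto
        finally show ?thesis by (simp add: mult.assoc)
      qed
      show "norm (?g x a - ?g y a) \<le> 2 * L R * norm (x - y)"
        if R: "R > 0" "norm x \<le> R" "norm y \<le> R" and a: "a \<in> regular_base A" for R a x y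
      proof -
        have "norm (?g x a - ?g y a) = (1 - norm a ^ q) * norm (f x (b a) - f y (b a))"
          using wt[OF a] by (simp add: red[OF a] scaleR_diff_right[symmetric])
        also have "\<dots> \<le> (1 - norm a ^ q) * (L R * (1 + norm (b a) ^ p) * norm (x - y))"
          by (intro mult_left_mono flip bA a wt R)
        also have "\<dots> = ((1 - norm a ^ q) * (1 + norm (b a) ^ p)) * (L R * norm (x - y))" by (simp add: mult_ac)
        also have "\<dots> \<le> 2 * (L R * norm (x - y))" using w2[OF a] Lpos[OF R(1)] by (intro mult_right_mono) auto
        finally show ?thesis by (simp add: mult.assoc)
      qed
      show "0 \<le> ?h x a" if a: "a \<in> regular_base A" for x a
        using wt[OF a] lnn'[OF bA[OF a]] by (simp add: red[OF a])
      show "\<bar>?h x a - ?h y a\<bar> \<le> 2 * \<omega> (norm (x - y)) R"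
        if R: "R > 0" "norm x \<le> R" "norm y \<le> R" and a: "a \<in> regular_base A" for R a x y
      proof -
        have "\<bar>?h x a - ?h y a\<bar> = (1 - norm a ^ q) * \<bar>l x (b a) - l y (b a)\<bar>"
          using wt[OF a] by (simp add: red[OF a] right_diff_distrib[symmetric] abs_mult)
        also have "\<dots> \<le> (1 - norm a ^ q) * ((1 + norm (b a) ^ q) * \<omega> (norm (x - y)) R)"
          by (intro mult_left_mono llip bA a wt R)
        also have "\<dots> = ((1 - norm a ^ q) * (1 + norm (b a) ^ q)) * \<omega> (norm (x - y)) R" by (simp add: mult_ac)
        also have "\<dots> \<le> 2 * \<omega> (norm (x - y)) R" using w1[OF a] \<omega>nn[OF _ R(1)] by (intro mult_right_mono) auto
        finally show ?thesis .
      qed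
    qed simp
  qed
  note cl = closure_regular_base[OF cs]
  note g1 = continuous_on_slice(1)[OF gc] and h1 = continuous_on_slice(1)[OF hc]
  have "compact_control ?K ?g ?h (c * M) (\<lambda>R. c * L R)"
  proof
    show "norm (?g x a) \<le> c * M * (1 + norm x)" if "a \<in> ?K" for x a
      by (rule continuous_le_on_closure[of "regular_base A" "\<lambda>a. norm (?g x a)"])
        (use that cg cl in \<open>auto intro!: continuous_intros g1\<close>)
    show "norm (?g x a - ?g y a) \<le> c * L R * norm (x - y)"
      if "R > 0" "a \<in> ?K" "norm x \<le> R" "norm y \<le> R" for R a x y
      by (rule continuous_le_on_closure[of "regular_base A" "\<lambda>a. norm (?g x a - ?g y a)"])
        (use that clip cl in \<open>auto intro!: continuous_intros g1\<close>)
    show "0 \<le> ?h x a" if "a \<in> ?K" for x a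
      by (rule continuous_ge_on_closure[of "regular_base A" "\<lambda>a. ?h x a"])
        (use that chnn cl in \<open>auto intro!: h1\<close>)
  qed (use c M Lpos gc hc K_ne compact_relaxed_base[OF cs] in auto)
  moreover have "\<bar>?h x a - ?h y a\<bar> \<le> c * \<omega> (norm (x - y)) R"
    if "R > 0" "a \<in> ?K" "norm x \<le> R" "norm y \<le> R" for R a x y
    by (rule continuous_le_on_closure[of "regular_base A" "\<lambda>a. \<bar>?h x a - ?h y a\<bar>"])
      (use that chl cl in \<open>auto intro!: continuous_intros h1\<close>)
  ultimately show thesis using that[OF c] by blast
qed

section \<open>Comparison of the original, extended and reduced values\<close>

lemma total_cost_cong:
  assumes g: "\<And>t x. t \<ge> 0 \<Longrightarrow> g x (u t) = g' x (u' t)" and h: "\<And>t x. t \<ge> 0 \<Longrightarrow> h x (u t) = h' x (u' t)"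
  shows "total_cost g h x u = total_cost g' h' x u'"
proof -
  have "is_solution g x u = is_solution g' x u'"
  proof
    fix y
    show "is_solution g x u y = is_solution g' x u' y"
      unfolding is_solution_eq_caratheodory
      by (rule caratheodory_solution_cong) (simp_all add: g)
  qed
  then have "trajectory g x u = trajectory g' x u'" by (simp add: trajectory_def)
  then show ?thesis
    unfolding total_cost_def by (intro nn_integral_cong) (auto simp: indicator_def h)
qed

lemma value_function_le:
  assumes "\<And>u. u \<in> U \<Longrightarrow> \<exists>u'\<in>U'. total_cost g' h' x u' \<le> total_cost g h x u"
  shows "value_function U' g' h' x \<le> value_function U g h x"
  unfolding value_function_def by (rule INF_mono) (use assms in blast)

lemma V_orig_compact:
  assumes "compact A"
  shows "V_orig A q f l = value_function (ordinary_controls (regular_base A)) (reduced A q f finf) (reduced A q l linf)"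
proof -
  have "controls A q = ordinary_controls (regular_base A)"
    using assms by (auto simp: controls_def ordinary_controls_def regular_base_def compact_imp_bounded)
  moreover have "reduced A q f finf = f" "reduced A q l linf = l"
    using assms by (auto simp: reduced_def fun_eq_iff)
  ultimately show ?thesis by (simp add: V_orig_def)
qed

text \<open>On the set of extended controls \<open>w\<close> determines \<open>w0\<close>, so
  dropping \<open>w0\<close> loses neither dynamics nor cost.\<close>

lemma value_reduced_le_V_ext:
  assumes A: "\<not> compact A" and q: "q > 0"
  shows "value_function (ordinary_controls (relaxed_base A)) (reduced A q f finf) (reduced A q l linf) x
      \<le> V_ext A q f finf l linf x"
  unfolding V_ext_def
proof (rule value_function_le)
  fix v assume v: "v \<in> extended_controls A q"
  define u where "u t = snd (v t)" for t
  have vt: "fst (v t) \<ge> 0 \<and> u t \<in> A \<and> fst (v t) ^ q + norm (u t) ^ q = 1" if "t \<ge> 0" for t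
  proof -
    have "v t \<in> extended_set A q" using v that by (simp add: extended_controls_def)
    then show ?thesis by (cases "v t") (simp add: extended_set_def u_def)
  qed
  have nu: "norm (u t) \<le> 1" if "t \<ge> 0" for t
  proof -
    have "0 \<le> fst (v t) ^ q" using vt[OF that] by simp
    then have "norm (u t) ^ q \<le> 1 ^ q" unfolding power_one using vt[OF that] by linarith
    then show ?thesis using power_mono_iff[of "norm (u t)" 1 q] q by simp
  qed
  have "v \<in> borel_measurable (restrict_space borel {0..})" using v by (simp add: extended_controls_def)
  then have "u \<in> borel_measurable (restrict_space borel {0..})"
    unfolding u_def[abs_def]
    by (rule measurable_compose[OF _ borel_measurable_continuous_onI[OF continuous_on_snd[OF continuous_on_id]]])
  then have u: "u \<in> ordinary_controls (relaxed_base A)"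
    using A nu vt by (auto simp: ordinary_controls_def relaxed_base_def)
  have fv: "v t = (root q (1 - norm (u t) ^ q), u t)" if "t \<ge> 0" for t
  proof -
    have e: "1 - norm (u t) ^ q = fst (v t) ^ q" using vt[OF that] by linarith
    have "root q (1 - norm (u t) ^ q) = fst (v t)"
      unfolding e by (rule real_root_power_cancel[OF q]) (use vt[OF that] in simp)
    then show ?thesis by (simp add: u_def)
  qed
  have "total_cost (reduced A q f finf) (reduced A q l linf) x u =
      total_cost (extension q f finf) (extension q l linf) x v"
  proof (rule total_cost_cong)
    show "reduced A q f finf y (u t) = extension q f finf y (v t)"
      "reduced A q l linf y (u t) = extension q l linf y (v t)" if "t \<ge> 0" for t y
      using A by (simp_all add: reduced_def fv[OF that])
  qed
  then show "\<exists>u\<in>ordinary_controls (relaxed_base A). total_cost (reduced A q f finf) (reduced A q l linf) x u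
      \<le> total_cost (extension q f finf) (extension q l linf) x v"
    using u by (intro bexI[of _ u]) auto
qed

lemma V_ext_le_value_reduced:
  assumes A: "\<not> compact A" and q: "q > 0"
  shows "V_ext A q f finf l linf x \<le>
    value_function (ordinary_controls (regular_base A)) (reduced A q f finf) (reduced A q l linf) x"
  unfolding V_ext_def
proof (rule value_function_le)
  fix u assume u: "u \<in> ordinary_controls (regular_base A)"
  define v where "v t = (root q (1 - norm (u t) ^ q), u t)" for t
  have um: "u \<in> borel_measurable (restrict_space borel {0..})" using u by (simp add: ordinary_controls_def)
  have rm: "root q \<in> borel_measurable borel"
    by (intro borel_measurable_continuous_onI continuous_intros)
  have "(\<lambda>t. root q (1 - norm (u t) ^ q)) \<in> borel_measurable (restrict_space borel {0..})"
    by (rule measurable_compose[OF _ rm]) (use um in measurable)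
  then have vm: "v \<in> borel_measurable (restrict_space borel {0..})"
    unfolding v_def[abs_def] using um by (rule borel_measurable_Pair)
  have "v t \<in> extended_set A q" if "t \<ge> 0" for t
  proof -
    have ut: "u t \<in> A" "norm (u t) < 1" using u that A by (auto simp: ordinary_controls_def regular_base_def)
    then show ?thesis using root_weight[OF q ut(2)] by (auto simp: extended_set_def v_def)
  qed
  then have v: "v \<in> extended_controls A q" using vm by (simp add: extended_controls_def)
  have "total_cost (extension q f finf) (extension q l linf) x v =
      total_cost (reduced A q f finf) (reduced A q l linf) x u"
    by (rule total_cost_cong) (use A in \<open>simp_all add: reduced_def v_def\<close>)
  then show "\<exists>v\<in>extended_controls A q. total_cost (extension q f finf) (extension q l linf) x v
      \<le> total_cost (reduced A q f finf) (reduced A q l linf) x u"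
    using v by (intro bexI[of _ v]) auto
qed

text \<open>The time change \<open>ds = (1 + |\<alpha>|\<^sup>q) dt\<close> turns an original control into an extended one.\<close>

lemma value_reduced_le_V_orig:
  fixes A :: "(real^'m) set" and f finf :: "real^'n \<Rightarrow> real^'m \<Rightarrow> real^'n"
    and l linf :: "real^'n \<Rightarrow> real^'m \<Rightarrow> real"
  assumes A: "\<not> compact A" "\<not> bounded A" "cone A" and q: "q > 0"
    and cc: "compact_control (relaxed_base A) (reduced A q f finf) (reduced A q l linf) M L"
  shows "value_function (ordinary_controls (relaxed_base A)) (reduced A q f finf) (reduced A q l linf) x
      \<le> V_orig A q f l x"
  unfolding V_orig_def
proof (rule value_function_le)
  let ?K = "relaxed_base A" and ?g = "reduced A q f finf" and ?h = "reduced A q l linf"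
  interpret compact_control ?K ?g ?h M L by (rule cc)
  fix \<alpha> assume \<alpha>: "\<alpha> \<in> controls A q"
  define a where "a t = \<alpha> (max 0 t)" for t
  have am [measurable]: "a \<in> borel_measurable borel"
    unfolding a_def[abs_def] by (rule measurable_extend_constant) (use \<alpha> in \<open>simp add: controls_def\<close>)
  have aA: "a t \<in> A" for t using \<alpha> by (simp add: controls_def a_def)
  have a\<alpha>: "a t = \<alpha> t" if "t \<ge> 0" for t using that by (simp add: a_def)
  define k where "k t = 1 + norm (a t) ^ q" for t
  have k1: "k t \<ge> 1" for t by (simp add: k_def)
  have kint: "set_integrable lborel {0..t} k" for t
  proof (cases "t \<ge> 0")
    case True
    have "set_integrable lborel {0..t} (\<lambda>s. norm (\<alpha> s) ^ q)"
      using \<alpha> A(2) True by (simp add: controls_def)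
    then have "set_integrable lborel {0..t} (\<lambda>s. norm (a s) ^ q)"
      by (subst set_integrable_cong[of lborel lborel "{0..t}" "{0..t}" _ "\<lambda>s. norm (\<alpha> s) ^ q"]) (auto simp: a\<alpha>)
    moreover have "set_integrable lborel {0..t} (\<lambda>s. 1 :: real)"
      by (intro borel_integrable_atLeastAtMost' continuous_intros)
    ultimately show ?thesis unfolding k_def[abs_def] by (intro set_integral_add(1))
  qed (simp add: set_integrable_def)
  have kunb: "\<exists>t\<ge>0. B \<le> (LINT s:{0..t}|lborel. k s)" for B
  proof (intro exI[of _ "max 0 B"] conjI)
    have "(LINT s:{0..max 0 B}|lborel. 1) \<le> (LINT s:{0..max 0 B}|lborel. k s)"
      by (rule set_integral_mono[OF _ kint]) (auto intro!: borel_integrable_atLeastAtMost' simp: k1)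
    then show "B \<le> (LINT s:{0..max 0 B}|lborel. k s)" by (simp add: set_lebesgue_integral_def)
  qed simp
  interpret time_change k
  proof
    show "k \<in> borel_measurable borel" unfolding k_def[abs_def] by measurable
    show "k t > 0" for t using k1[of t] by simp
  qed (rule kint kunb)+
  define w where "w s = inverse (root q (k (\<tau> s))) *\<^sub>R a (\<tau> s)" for s
  have kr: "root q (k t) > 0" "root q (k t) ^ q = k t" for t
    using q k1[of t] by (auto simp: real_root_pow_pos2)
  have nw: "norm (w s) ^ q = 1 - 1 / k (\<tau> s)" for s
  proof -
    have "norm (w s) ^ q = norm (a (\<tau> s)) ^ q / k (\<tau> s)"
      using kr[of "\<tau> s"] by (simp add: w_def power_mult_distrib power_inverse divide_inverse mult.commute)
    also have "norm (a (\<tau> s)) ^ q = k (\<tau> s) - 1" by (simp add: k_def)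
    finally show ?thesis using k_pos[of "\<tau> s"] by (simp add: diff_divide_distrib)
  qed
  have nw1: "norm (w s) < 1" for s
  proof -
    have "norm (w s) ^ q < 1 ^ q" using nw[of s] k_pos[of "\<tau> s"] by simp
    then show ?thesis by (rule power_less_imp_less_base) simp
  qed
  have wA: "w s \<in> A" for s
    using A(3) aA[of "\<tau> s"] kr(1)[of "\<tau> s"] by (auto simp: w_def cone_def)
  have wm: "w \<in> borel_measurable borel"
  proof -
    have [measurable]: "root q \<in> borel_measurable borel"
      by (intro borel_measurable_continuous_onI continuous_intros)
    show ?thesis unfolding w_def[abs_def] by measurable
  qed
  have w: "w \<in> ordinary_controls ?K"
    using wm wA nw1 A(1) by (auto simp: ordinary_controls_def relaxed_base_def less_imp_le intro!: measurable_restrict_space1)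
  have red: "k t *\<^sub>R reduced A q \<Phi> \<Phi>inf y (w (\<sigma> t)) = \<Phi> y (\<alpha> t)" if t: "t \<ge> 0"
    for \<Phi> \<Phi>inf :: "real^'n \<Rightarrow> real^'m \<Rightarrow> 'z::real_vector" and t y
  proof -
    have n: "1 - norm (w (\<sigma> t)) ^ q = 1 / k t" using nw[of "\<sigma> t"] by (simp add: \<tau>_\<sigma>[OF t])
    have "inverse (root q (1 / k t)) *\<^sub>R w (\<sigma> t) = \<alpha> t"
      using kr(1)[of t] by (simp add: w_def \<tau>_\<sigma>[OF t] a\<alpha>[OF t] real_root_divide q)
    then show ?thesis
      using k_pos[of t] unfolding reduced_regular[OF A(1) q nw1] n by simp
  qed
  define \<xi> where "\<xi> = trajectory ?g x w"
  have \<xi>: "is_solution ?g x w \<xi>" unfolding \<xi>_def by (rule ordinary_solution(1)[OF w])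
  have rel_f: "f y (\<alpha> t) = k t *\<^sub>R ?g y (w (\<sigma> t))" if "t \<ge> 0" for t y by (simp add: red[OF that])
  have rel_l: "l y (\<alpha> t) = k t * ?h y (w (\<sigma> t))" if "t \<ge> 0" for t y using red[OF that, of l linf y] by simp
  have sol: "is_solution f x \<alpha> (\<lambda>t. \<xi> (\<sigma> t))" by (rule is_solution_time_change(1)[of f \<alpha> ?g w, OF rel_f \<xi>])
  \<comment> \<open>With an unbounded control the original field has no growth constant uniform in
    time, so uniqueness is imported from the reduced equation.\<close>
  have uniq: "y t = \<xi> (\<sigma> t)" if y: "is_solution f x \<alpha> y" and t: "t \<ge> 0" for y t
  proof -
    have "is_solution ?g x w (\<lambda>s. y (\<tau> s))" by (rule is_solution_time_change(2)[of f \<alpha> ?g w, OF rel_f y])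
    from ordinary_solution(2)[OF w this \<xi> \<sigma>_nonneg[of t]] show ?thesis by (simp add: \<tau>_\<sigma>[OF t])
  qed
  have wK: "w s \<in> ?K" for s using wA[of s] nw1[of s] A(1) by (simp add: relaxed_base_def less_imp_le)
  have "total_cost f l x \<alpha> = (\<integral>\<^sup>+t\<in>{0..}. ennreal (l (\<xi> (\<sigma> t)) (\<alpha> t)) \<partial>lborel)"
    by (rule total_cost_eq[of f x \<alpha> "\<lambda>t. \<xi> (\<sigma> t)", OF sol]) (rule uniq)
  also have "\<dots> = (\<integral>\<^sup>+s\<in>{0..}. ennreal (?h (\<xi> s) (w s)) \<partial>lborel)"
  proof (rule cost_time_change[of l \<alpha> ?h w, OF rel_l])
    have "continuous_on UNIV (\<lambda>s. \<xi> (max 0 s))"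
      by (rule continuous_on_compose2[OF caratheodory_solution_continuous[OF \<xi>[unfolded is_solution_eq_caratheodory]]])
        (auto intro!: continuous_intros)
    then show "(\<lambda>s. ?h (\<xi> (max 0 s)) (w s)) \<in> borel_measurable borel"
      by (intro measurable_ordinary_comp[OF compact_K cont_h wm wK] borel_measurable_continuous_onI)
  qed (auto simp: h_nonneg wK)
  also have "\<dots> = total_cost ?g ?h x w" by (rule ordinary_cost[OF w \<xi>, symmetric])
  finally show "\<exists>w\<in>ordinary_controls ?K. total_cost ?g ?h x w \<le> total_cost f l x \<alpha>"
    using w by (intro bexI[of _ w]) auto
qed

text \<open>Conversely \<open>dt = w\<^sub>0\<^sup>q ds\<close>. By coercivity an extended trajectory of finite cost takes infinite
  original time, so the resulting control is defined on all of \<open>[0,\<infinity>)\<close>.\<close>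

lemma V_orig_le_value_reduced:
  fixes A :: "(real^'m) set" and f finf :: "real^'n \<Rightarrow> real^'m \<Rightarrow> real^'n"
    and l linf :: "real^'n \<Rightarrow> real^'m \<Rightarrow> real"
  assumes A: "\<not> compact A" "\<not> bounded A" "cone A" and pq: "1 \<le> p" "p \<le> q"
    and coer: "coercive A l q"
    and cc: "compact_control (relaxed_base A) (reduced A q f finf) (reduced A q l linf) M L"
    and D: "regular_base A \<subseteq> relaxed_base A" "regular_base A \<noteq> {}"
  shows "V_orig A q f l x \<le>
     value_function (ordinary_controls (regular_base A)) (reduced A q f finf) (reduced A q l linf) x"
  unfolding V_orig_def
proof (rule value_function_le)
  let ?K = "relaxed_base A" and ?g = "reduced A q f finf" and ?h = "reduced A q l linf"
  interpret compact_control ?K ?g ?h M L by (rule cc)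
  have q: "q > 0" using pq by simp
  fix u0 assume u0: "u0 \<in> ordinary_controls (regular_base A)"
  show "\<exists>\<alpha>\<in>controls A q. total_cost f l x \<alpha> \<le> total_cost ?g ?h x u0"
  proof (cases "total_cost ?g ?h x u0 = \<infinity>")
    case True
    \<comment> \<open>At infinite cost any original control will do; a constant one is locally
      integrable.\<close>
    obtain a0 where "a0 \<in> regular_base A" using D(2) by blast
    then have "a0 \<in> A" using A(1) by (simp add: regular_base_def)
    then have "(\<lambda>_. a0) \<in> controls A q"
      by (auto simp: controls_def intro!: borel_integrable_atLeastAtMost')
    then show ?thesis using True by (intro bexI[of _ "\<lambda>_. a0"]) auto
  next
    case False
    define u where "u t = u0 (max 0 t)" for t
    have um [measurable]: "u \<in> borel_measurable borel"
      unfolding u_def[abs_def] by (rule measurable_extend_constant) (use u0 in \<open>simp add: ordinary_controls_def\<close>)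
    have uu0: "u t = u0 t" if "t \<ge> 0" for t using that by (simp add: u_def)
    have ureg: "u t \<in> regular_base A" for t using u0 by (simp add: ordinary_controls_def u_def)
    have uA: "u t \<in> A" and un: "norm (u t) < 1" for t using ureg[of t] A(1) by (auto simp: regular_base_def)
    have uK: "u t \<in> ?K" for t using ureg D(1) by auto
    have u: "u \<in> ordinary_controls ?K" using um uK by (simp add: ordinary_controls_def measurable_restrict_space1)
    have cost_u: "total_cost ?g ?h x u0 = total_cost ?g ?h x u"
      by (rule total_cost_cong) (simp_all add: uu0)
    define k where "k s = 1 - norm (u s) ^ q" for s
    define r where "r s = root q (k s)" for s
    have r: "r s > 0" "r s ^ q = k s" for s
      using root_weight[OF q un[of s]] by (auto simp: r_def k_def)
    have kpos: "k s > 0" for s using r[of s] by (metis zero_less_power)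
    have k1: "k s \<le> 1" for s by (simp add: k_def)
    have km [measurable]: "k \<in> borel_measurable borel" unfolding k_def[abs_def] by measurable
    have kint: "set_integrable lborel {0..t} k" for t
      by (rule set_integrable_bounded_Icc[OF km, of _ _ 1]) (use k1 kpos in \<open>auto simp: abs_of_pos\<close>)
    define b where "b s = inverse (r s) *\<^sub>R u s" for s
    have bA: "b s \<in> A" for s using A(3) uA[of s] r(1)[of s] by (auto simp: b_def cone_def)
    have red: "reduced A q \<Phi> \<Phi>inf y (u s) = k s *\<^sub>R \<Phi> y (b s)"
      for \<Phi> \<Phi>inf :: "real^'n \<Rightarrow> real^'m \<Rightarrow> 'z::real_vector" and s y
      by (simp add: reduced_regular[OF A(1) q un] k_def b_def r_def)
    have nb: "k s * norm (b s) ^ q = norm (u s) ^ q" for s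
      using weight_bound(2)[OF pq un[of s]] by (simp add: k_def b_def r_def)
    define y where "y = trajectory ?g x u"
    have ysol: "is_solution ?g x u y" unfolding y_def by (rule ordinary_solution(1)[OF u])
    define Y where "Y s = y (max 0 s)" for s
    have Yc: "continuous_on UNIV Y"
      unfolding Y_def
      by (rule continuous_on_compose2[OF caratheodory_solution_continuous[OF ysol[unfolded is_solution_eq_caratheodory]]])
        (auto intro!: continuous_intros)
    have Ym: "Y \<in> borel_measurable borel" by (rule borel_measurable_continuous_onI[OF Yc])
    define hs where "hs s = ?h (Y s) (u s)" for s
    have hsm [measurable]: "hs \<in> borel_measurable borel"
      unfolding hs_def[abs_def] by (rule measurable_ordinary_comp[OF compact_K cont_h um uK Ym])
    have hs0: "hs s \<ge> 0" for s by (simp add: hs_def h_nonneg uK)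
    have hsint: "set_integrable lborel {0..t} hs" for t
      unfolding hs_def[abs_def] by (rule set_integrable_control(1)[OF compact_K cont_h Yc um uK])
    define J where "J = enn2real (total_cost ?g ?h x u)"
    have cost_hs: "total_cost ?g ?h x u = (\<integral>\<^sup>+s\<in>{0..}. ennreal (hs s) \<partial>lborel)"
      unfolding ordinary_cost[OF u ysol] by (intro nn_integral_cong) (auto simp: indicator_def hs_def Y_def)
    have hsJ: "(LINT s:{0..t}|lborel. hs s) \<le> J" for t
    proof -
      have "ennreal (LINT s:{0..t}|lborel. hs s) = (\<integral>\<^sup>+s\<in>{0..t}. ennreal (hs s) \<partial>lborel)"
        by (rule nn_integral_Icc_eq_set_integral[OF hsint, symmetric]) (rule hs0)
      also have "\<dots> \<le> total_cost ?g ?h x u"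
        unfolding cost_hs by (intro nn_integral_mono) (auto simp: indicator_def)
      also have "\<dots> = ennreal J" using False cost_u by (simp add: J_def less_top)
      finally show ?thesis by (subst (asm) ennreal_le_iff) (auto simp: J_def)
    qed
    have kunb: "\<exists>t\<ge>0. B \<le> (LINT s:{0..t}|lborel. k s)" for B
    proof -
      obtain C1 C2 where C: "C1 \<ge> 0" "C2 > 0" "\<And>x a. a \<in> A \<Longrightarrow> l x a \<ge> C2 * norm a ^ q - C1"
        using coer unfolding coercive_def by blast
      \<comment> \<open>Integrating the pointwise bound \<open>pt\<close> gives C2 T - (C1 + C2)
        \<integral> k \<le> J over [0, T]; this \<open>T\<close> forces the elapsed original time to
        reach \<open>B\<close>.\<close>
      define T where "T = max 0 ((J + (C1 + C2) * B) / C2)"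
      have T: "T \<ge> 0" "C2 * T \<ge> J + (C1 + C2) * B"
        using C(2) by (auto simp: T_def max_def field_simps)
      \<comment> \<open>Coercivity multiplied by the weight \<open>k s\<close>, with k |b|^q = |u|^q
        = 1 - k.\<close>
      have pt: "C2 - (C1 + C2) * k s \<le> hs s" for s
      proof -
        have "k s * (C2 * norm (b s) ^ q - C1) \<le> k s * l (Y s) (b s)"
          using C(3)[OF bA] kpos[of s] by (intro mult_left_mono) auto
        also have "k s * l (Y s) (b s) = hs s" using red[of l linf "Y s" s] by (simp add: hs_def)
        finally have "C2 * (k s * norm (b s) ^ q) - C1 * k s \<le> hs s" by (simp add: algebra_simps)
        moreover have "k s * norm (b s) ^ q = 1 - k s" unfolding nb by (simp add: k_def)
        ultimately show ?thesis by (simp add: algebra_simps)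
      qed
      have i1: "set_integrable lborel {0..T} (\<lambda>s. C2 :: real)"
        by (intro borel_integrable_atLeastAtMost' continuous_intros)
      have i2: "set_integrable lborel {0..T} (\<lambda>s. (C1 + C2) * k s)" by (intro set_integrable_mult_right kint)
      have "C2 * T - (C1 + C2) * (LINT s:{0..T}|lborel. k s) = (LINT s:{0..T}|lborel. C2 - (C1 + C2) * k s)"
        using T(1) by (simp add: set_integral_diff(2)[OF i1 i2]) (simp add: set_lebesgue_integral_def)
      also have "\<dots> \<le> (LINT s:{0..T}|lborel. hs s)"
        by (rule set_integral_mono[OF set_integral_diff(1)[OF i1 i2] hsint]) (rule pt)
      also have "\<dots> \<le> J" by (rule hsJ)
      finally have "(C1 + C2) * B \<le> (C1 + C2) * (LINT s:{0..T}|lborel. k s)" using T(2) by linarith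
      then have "B \<le> (LINT s:{0..T}|lborel. k s)" using C(1,2) by simp
      then show ?thesis using T(1) by blast
    qed
    interpret time_change k by unfold_locales (rule km kpos kint kunb)+
    define \<alpha> where "\<alpha> t = b (\<tau> t)" for t
    have [measurable]: "root q \<in> borel_measurable borel"
      by (intro borel_measurable_continuous_onI continuous_intros)
    have bm [measurable]: "b \<in> borel_measurable borel" unfolding b_def[abs_def] r_def[abs_def] by measurable
    have \<alpha>m [measurable]: "\<alpha> \<in> borel_measurable borel" unfolding \<alpha>_def[abs_def] by measurable
    have \<alpha>\<sigma>: "\<alpha> (\<sigma> s) = b s" if "s \<ge> 0" for s using that by (simp add: \<alpha>_def \<tau>_\<sigma>)
    \<comment> \<open>In the extended time the integrand becomes \<open>norm (u s) ^ q\<close>,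
      which is at most 1, over a bounded interval.\<close>
    have \<alpha>_int: "set_integrable lborel {0..T} (\<lambda>t. norm (\<alpha> t) ^ q)" if T: "T \<ge> 0" for T
    proof -
      have "set_integrable lborel {0..\<tau> T} (\<lambda>s. k s *\<^sub>R norm (\<alpha> (\<sigma> s)) ^ q) =
          set_integrable lborel {0..\<tau> T} (\<lambda>s. norm (u s) ^ q)"
        by (rule set_integrable_cong) (auto simp: \<alpha>\<sigma> nb)
      moreover have "set_integrable lborel {0..\<tau> T} (\<lambda>s. norm (u s) ^ q)"
        by (rule set_integrable_bounded_Icc[of _ _ _ 1]) (use un in \<open>auto simp: power_le_one less_imp_le\<close>)
      ultimately have "set_integrable lborel {0..\<sigma> (\<tau> T)} (\<lambda>t. norm (\<alpha> t) ^ q)"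
        by (subst set_integral_time_change(1)) (auto intro: \<tau>(1))
      then show ?thesis using T by (simp add: \<tau>(2))
    qed
    have \<alpha>: "\<alpha> \<in> controls A q"
      using bA \<alpha>_int by (auto simp: controls_def \<alpha>_def intro!: measurable_restrict_space1)
    have rel_f: "?g z (u s) = k s *\<^sub>R f z (\<alpha> (\<sigma> s))" if "s \<ge> 0" for s z by (simp add: red \<alpha>\<sigma>[OF that])
    have rel_l: "?h z (u s) = k s * l z (\<alpha> (\<sigma> s))" if "s \<ge> 0" for s z by (simp add: red \<alpha>\<sigma>[OF that])
    have sol: "is_solution f x \<alpha> (\<lambda>t. y (\<tau> t))" by (rule is_solution_time_change(2)[of ?g u f \<alpha>, OF rel_f ysol])
    have uniq: "z t = y (\<tau> t)" if z: "is_solution f x \<alpha> z" and t: "t \<ge> 0" for z t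
    proof -
      have "is_solution ?g x u (\<lambda>s. z (\<sigma> s))" by (rule is_solution_time_change(1)[of ?g u f \<alpha>, OF rel_f z])
      from ordinary_solution(2)[OF u this ysol \<tau>(1)[of t]] show ?thesis using t by (simp add: \<tau>(2))
    qed
    have l_eq: "l (y (\<tau> t)) (\<alpha> t) = hs (\<tau> t) / k (\<tau> t)" for t
      using red[of l linf "Y (\<tau> t)" "\<tau> t"] kpos[of "\<tau> t"] \<tau>(1)[of t]
      by (simp add: hs_def \<alpha>_def Y_def max_def)
    have "total_cost f l x \<alpha> = (\<integral>\<^sup>+t\<in>{0..}. ennreal (l (y (\<tau> t)) (\<alpha> t)) \<partial>lborel)"
      by (rule total_cost_eq[of f x \<alpha> "\<lambda>t. y (\<tau> t)", OF sol]) (rule uniq)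
    also have "\<dots> = (\<integral>\<^sup>+s\<in>{0..}. ennreal (?h (y (\<tau> (\<sigma> s))) (u s)) \<partial>lborel)"
    proof (rule cost_time_change[of ?h u l \<alpha>, OF rel_l, symmetric])
      show "(\<lambda>t. hs (\<tau> t) / k (\<tau> t)) \<in> borel_measurable borel" by measurable
      show "0 \<le> l (y (\<tau> s)) (\<alpha> s)" for s unfolding l_eq using hs0 kpos by (simp add: less_imp_le)
    qed (simp_all add: l_eq)
    also have "\<dots> = total_cost ?g ?h x u"
      unfolding cost_hs by (intro nn_integral_cong) (auto simp: indicator_def hs_def Y_def \<tau>_\<sigma>)
    finally show ?thesis using \<alpha> cost_u by (intro bexI[of _ \<alpha>]) auto
  qed
qed

text \<open>The constants do not depend on the radius, so any two points may be placed in a ball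
  large enough for both; the estimate then holds everywhere, along every trajectory.\<close>

lemma tubular_of_H0_1:
  fixes A :: "(real^'m) set" and f finf :: "real^'n \<Rightarrow> real^'m \<Rightarrow> real^'n"
    and l linf :: "real^'n \<Rightarrow> real^'m \<Rightarrow> real"
  assumes cc: "compact_control (relaxed_base A) (reduced A q f finf) (reduced A q l linf) M (\<lambda>R. c * L R)"
    and hl: "\<And>R a x y. R > 0 \<Longrightarrow> a \<in> relaxed_base A \<Longrightarrow> norm x \<le> R \<Longrightarrow> norm y \<le> R \<Longrightarrow>
       \<bar>reduced A q l linf x a - reduced A q l linf y a\<bar> \<le> c * \<omega> (norm (x - y)) R"
    and c: "c > 0" and mod: "modulus \<omega>" and H: "H0_1 A f p M' L N \<omega>"
  shows "compact_control.tubular (relaxed_base A) (reduced A q f finf) (reduced A q l linf) x \<mu>"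
proof -
  let ?K = "relaxed_base A" and ?g = "reduced A q f finf" and ?h = "reduced A q l linf"
  interpret compact_control ?K ?g ?h M "\<lambda>R. c * L R" by (rule cc)
  obtain \<delta> where \<delta>: "\<delta> > 0" "mono_on {0..<\<delta>} (\<lambda>r. \<omega> r 1)" using mod unfolding modulus_def by (meson zero_less_one)
  have "\<forall>R>0. \<forall>R'>0. L R = L R' \<and> N R = N R' \<and> (\<forall>s\<ge>0. \<omega> s R = \<omega> s R')"
    using H unfolding H0_1_def by (rule conjunct1)
  then have const: "L R = L 1" "\<And>s. s \<ge> 0 \<Longrightarrow> \<omega> s R = \<omega> s 1" if "R > 0" for R
    using that zero_less_one by blast+
  have "norm (?g w a - ?g w' a) \<le> (c * L 1) * norm (w - w') \<and> \<bar>?h w a - ?h w' a\<bar> \<le> c * \<omega> (norm (w - w')) 1"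
    if a: "a \<in> ?K" for w w' a
  proof -
    define R where "R = norm w + norm w' + 1"
    have R: "R > 0" "norm w \<le> R" "norm w' \<le> R" by (auto simp: R_def add_nonneg_pos)
    show ?thesis using lip_g[OF R(1) a R(2,3)] hl[OF R(1) a R(2,3)]
      unfolding const(1)[OF R(1)] const(2)[OF R(1) norm_ge_zero] by simp
  qed
  moreover have "dini (\<lambda>s. \<omega> s 1)" using H unfolding H0_1_def by blast
  moreover have "\<omega> r 1 \<ge> 0" if "r \<ge> 0" for r using mod that by (simp add: modulus_def)
  ultimately show ?thesis
    unfolding tubular_def
    by (intro exI[of _ "c * L 1"] exI[of _ c] exI[of _ "\<lambda>s. \<omega> s 1"] exI[of _ \<delta>])
      (simp add: c \<delta>)
qed

text \<open>The unit tube around a trajectory in the ball of radius \<open>R\<close> lies in the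
  ball of radius \<open>R + 3\<close>, where the Dini modulus is available.\<close>

lemma tubular_of_bounded:
  fixes A :: "(real^'m) set" and f finf :: "real^'n \<Rightarrow> real^'m \<Rightarrow> real^'n"
    and l linf :: "real^'n \<Rightarrow> real^'m \<Rightarrow> real"
  assumes cc: "compact_control (relaxed_base A) (reduced A q f finf) (reduced A q l linf) M (\<lambda>R. c * L R)"
    and hl: "\<And>R a x y. R > 0 \<Longrightarrow> a \<in> relaxed_base A \<Longrightarrow> norm x \<le> R \<Longrightarrow> norm y \<le> R \<Longrightarrow>
       \<bar>reduced A q l linf x a - reduced A q l linf y a\<bar> \<le> c * \<omega> (norm (x - y)) R"
    and c: "c > 0" and mod: "modulus \<omega>" and R: "R > 0" and dini: "dini (\<lambda>s. \<omega> s (R + 3))"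
    and bd: "\<And>s. s \<ge> 0 \<Longrightarrow> norm (trajectory (\<lambda>x \<mu>. LINT a|\<mu>. reduced A q f finf x a) x \<mu> s) \<le> R"
  shows "compact_control.tubular (relaxed_base A) (reduced A q f finf) (reduced A q l linf) x \<mu>"
proof -
  let ?K = "relaxed_base A" and ?g = "reduced A q f finf" and ?h = "reduced A q l linf"
  interpret compact_control ?K ?g ?h M "\<lambda>R. c * L R" by (rule cc)
  have R3: "R + 3 > 0" using R by simp
  obtain \<delta> where \<delta>: "\<delta> > 0" "mono_on {0..<\<delta>} (\<lambda>r. \<omega> r (R + 3))" using mod R3 unfolding modulus_def by meson
  have "norm (?g w a - ?g w' a) \<le> (c * L (R + 3)) * norm (w - w') \<and>
      \<bar>?h w a - ?h w' a\<bar> \<le> c * \<omega> (norm (w - w')) (R + 3)"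
    if t: "t \<ge> 0" and a: "a \<in> ?K" and w: "norm (w - trajectory g_rel x \<mu> t) \<le> 1"
      "norm (w' - trajectory g_rel x \<mu> t) \<le> 1" for t w w' a
  proof -
    have "norm w \<le> R + 3" "norm w' \<le> R + 3"
      using bd[OF t] w norm_triangle_sub[of w "trajectory g_rel x \<mu> t"]
        norm_triangle_sub[of w' "trajectory g_rel x \<mu> t"] by linarith+
    then show ?thesis using lip_g[OF R3 a] hl[OF R3 a] by simp
  qed
  moreover have "\<omega> r (R + 3) \<ge> 0" if "r \<ge> 0" for r using mod that R3 by (simp add: modulus_def)
  ultimately show ?thesis
    unfolding tubular_def
    by (intro exI[of _ "c * L (R + 3)"] exI[of _ c] exI[of _ "\<lambda>s. \<omega> s (R + 3)"] exI[of _ \<delta>])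
      (simp add: c \<delta> dini)
qed

text \<open>The empty set carries no probability measure, so neither problem has a control and both
  infima are infinite.\<close>

lemma V_empty:
  assumes "A = {}"
  shows "V_orig A q f l x = \<top>" "V_rel A q f finf l linf x = \<top>"
proof -
  have "controls A q = {}" using assms by (auto simp: controls_def)
  then show "V_orig A q f l x = \<top>" by (simp add: V_orig_def value_function_def)
  have "relaxed_controls A = {}"
  proof (rule ccontr)
    assume "relaxed_controls A \<noteq> {}"
    then obtain \<mu> where "\<mu> \<in> measurable (restrict_space borel {0::real..}) (relaxed_space (relaxed_base A))"
      unfolding relaxed_controls_def relaxed_controls_on_def by blast
    then have "\<mu> 0 \<in> radon_prob (relaxed_base A)" by (rule relaxed_space_space) simp
    then have 1: "sets (\<mu> 0) = sets (restrict_space borel (relaxed_base A))" and 2: "prob_space (\<mu> 0)"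
      by (auto simp: radon_prob_def)
    have "space (\<mu> 0) = {}" using sets_eq_imp_space_eq[OF 1] assms by (simp add: relaxed_base_def space_restrict_space)
    then show False using prob_space.not_empty[OF 2] by simp
  qed
  then show "V_rel A q f finf l linf x = \<top>" by (simp add: V_rel_def value_function_def)
qed

section \<open>The envelopes of the original and the extended value\<close>

theorem lsc_envelope_values:
  fixes A :: "(real^'m) set" and f finf :: "real^'n \<Rightarrow> real^'m \<Rightarrow> real^'n"
    and l linf :: "real^'n \<Rightarrow> real^'m \<Rightarrow> real"
  assumes std: "standing_assumptions A f l finf linf p q M L N \<omega>" and ne: "A \<noteq> {}"
    and H0: "H0_1 A f p M L N \<omega> \<or> H0_2 A q f finf l linf \<omega>"
  shows "lsc_envelope (V_orig A q f l) x = V_rel A q f finf l linf x"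
    and "\<not> bounded A \<Longrightarrow> lsc_envelope (V_ext A q f finf l linf) x = V_rel A q f finf l linf x"
proof -
  let ?K = "relaxed_base A" and ?D = "regular_base A"
  let ?g = "reduced A q f finf" and ?h = "reduced A q l linf"
  have cs: "control_set A" and sb: "structural_bounds A f l p q M L N \<omega>"
    and coer: "\<not> bounded A \<Longrightarrow> coercive A l q"
    using std by (auto simp: standing_assumptions_def)
  have pq: "1 \<le> p" "p \<le> q" and mod: "modulus \<omega>" using sb by (auto simp: structural_bounds_def)
  have q: "q > 0" using pq by simp
  obtain c where c: "c > 0" and cc: "compact_control ?K ?g ?h (c * M) (\<lambda>R. c * L R)"
    and hl: "\<And>R a x y. R > 0 \<Longrightarrow> a \<in> ?K \<Longrightarrow> norm x \<le> R \<Longrightarrow> norm y \<le> R \<Longrightarrow>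
       \<bar>?h x a - ?h y a\<bar> \<le> c * \<omega> (norm (x - y)) R"
    using reduced_compact_control[OF std ne] by metis
  interpret compact_control ?K ?g ?h "c * M" "\<lambda>R. c * L R" by (rule cc)
  let ?VK = "value_function (ordinary_controls ?K) ?g ?h" and ?VD = "value_function (ordinary_controls ?D) ?g ?h"
  have Vr: "V_rel A q f finf l linf = value_function (relaxed_controls_on ?K) g_rel h_rel"
    by (simp add: V_rel_def relaxation_eq_reduced relaxed_controls_def)
  note D = regular_base_dense[OF cs]
  have D_ne: "?D \<noteq> {}" using D(2) K_ne by auto
  have lower: "V_rel A q f finf l linf x \<le> lsc_envelope ?VK x"
    unfolding Vr by (rule relaxed_value_le_lsc_envelope)
  have upper: "lsc_envelope ?VD x \<le> V_rel A q f finf l linf x"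
    unfolding Vr
  proof (rule lsc_envelope_le_relaxed_value[OF D])
    fix \<eta> :: real assume \<eta>: "\<eta> > 0" and fin: "value_function (relaxed_controls_on ?K) g_rel h_rel x < \<infinity>"
    show "\<exists>\<mu>\<in>relaxed_controls_on ?K. tubular x \<mu> \<and>
        total_cost g_rel h_rel x \<mu> \<le> value_function (relaxed_controls_on ?K) g_rel h_rel x + ennreal \<eta>"
      using H0
    proof
      assume H: "H0_1 A f p M L N \<omega>"
      \<comment> \<open>Under the first alternative every relaxed control is tubular, so a nearly
        optimal one serves; finiteness of the value makes the inequality strict.\<close>
      have "value_function (relaxed_controls_on ?K) g_rel h_rel x <
          value_function (relaxed_controls_on ?K) g_rel h_rel x + ennreal \<eta>"
        using fin \<eta> by (simp add: ennreal_add_left_cancel_less less_top[symmetric])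
      then obtain \<mu> where "\<mu> \<in> relaxed_controls_on ?K" "total_cost g_rel h_rel x \<mu> <
          value_function (relaxed_controls_on ?K) g_rel h_rel x + ennreal \<eta>"
        unfolding value_function_def INF_less_iff by blast
      then show ?thesis using tubular_of_H0_1[OF cc hl c mod H] by (intro bexI[of _ \<mu>]) auto
    next
      assume H: "H0_2 A q f finf l linf \<omega>"
      have "V_rel A q f finf l linf x < \<infinity>" using fin unfolding Vr .
      then obtain \<mu> R where \<mu>: "\<mu> \<in> relaxed_controls A" and R: "R > 0"
        and opt: "total_cost (relaxation A q f finf) (relaxation A q l linf) x \<mu> = V_rel A q f finf l linf x"
        and bd: "\<And>s. s \<ge> 0 \<Longrightarrow> norm (trajectory (relaxation A q f finf) x \<mu> s) \<le> R"
        and dini: "dini (\<lambda>s. \<omega> s (R + 3))"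
        using H unfolding H0_2_def by blast
      have "tubular x \<mu>"
        by (rule tubular_of_bounded[OF cc hl c mod R dini]) (use bd in \<open>simp_all add: relaxation_eq_reduced\<close>)
      moreover have "\<mu> \<in> relaxed_controls_on ?K" using \<mu> by (simp add: relaxed_controls_def)
      moreover have "total_cost g_rel h_rel x \<mu> = value_function (relaxed_controls_on ?K) g_rel h_rel x"
        using opt unfolding Vr relaxation_eq_reduced .
      ultimately show ?thesis by (intro bexI[of _ \<mu>]) auto
    qed
  qed
  \<comment> \<open>The envelope is monotone, the one of the smaller value \<open>?VK\<close> is at
    least the relaxed value, and the one of the larger value \<open>?VD\<close> is at most the
    relaxed value.\<close>
  have sandwich: "lsc_envelope W x = V_rel A q f finf l linf x"
    if "\<And>x. ?VK x \<le> W x" "\<And>x. W x \<le> ?VD x" for W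
    using lsc_envelope_mono[of ?VK W x, OF that(1)] lsc_envelope_mono[of W ?VD x, OF that(2)] lower upper
    by (meson order_trans antisym)
  show "lsc_envelope (V_orig A q f l) x = V_rel A q f finf l linf x"
  proof (cases "compact A")
    case True
    then have "?K = ?D" by (simp add: relaxed_base_def regular_base_def)
    then show ?thesis using V_orig_compact[OF True, of q f l finf linf] by (intro sandwich) auto
  next
    case False
    then have A: "\<not> bounded A" "cone A" using cs by (auto simp: control_set_def)
    show ?thesis
      by (rule sandwich)
        (rule value_reduced_le_V_orig[OF False A q cc] V_orig_le_value_reduced[OF False A pq coer[OF A(1)] cc D(1) D_ne])+
  qed
  show "lsc_envelope (V_ext A q f finf l linf) x = V_rel A q f finf l linf x" if "\<not> bounded A"
  proof -
    have A: "\<not> compact A" using that compact_imp_bounded by blast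
    show ?thesis by (rule sandwich) (rule value_reduced_le_V_ext[OF A q] V_ext_le_value_reduced[OF A q])+
  qed
qed

theorem theorem4p2:
  fixes A :: "(real^'m) set"
    and f finf :: "real^'n \<Rightarrow> real^'m \<Rightarrow> real^'n"
    and l linf :: "real^'n \<Rightarrow> real^'m \<Rightarrow> real"
    and p q :: nat
    and M :: real
    and L N :: "real \<Rightarrow> real"
    and \<omega> :: "real \<Rightarrow> real \<Rightarrow> real"
  assumes "standing_assumptions A f l finf linf p q M L N \<omega>"
    and "H0_1 A f p M L N \<omega> \<or> H0_2 A q f finf l linf \<omega>"
  shows "(compact A \<or> q > p \<longrightarrow>
            (\<forall>x. lsc_envelope (V_orig A q f l) x = V_rel A q f finf l linf x)) \<and>
         (\<not> bounded A \<and> q = p \<longrightarrow>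
            (\<forall>x. lsc_envelope (V_ext A q f finf l linf) x = V_rel A q f finf l linf x) \<and>
            (\<forall>T. H2 A q f l T \<and> H3 A q f finf l linf T \<longrightarrow>
               (\<forall>x. lsc_envelope (V_orig A q f l) x = V_rel A q f finf l linf x)))"
proof (cases "A = {}")
  \<comment> \<open>The standing assumptions admit the empty set as a compact \<open>A\<close>; then
    both sides are constantly infinite.\<close>
  case True
  have "V_orig A q f l = (\<lambda>_. \<top>)" by (rule ext) (rule V_empty(1)[OF True])
  then have "lsc_envelope (V_orig A q f l) x = V_rel A q f finf l linf x" for x
    by (simp add: V_empty(2)[OF True] lsc_envelope_def Liminf_const)
  then show ?thesis using True by simp
next
  case False
  then show ?thesis using lsc_envelope_values[OF assms(1) False assms(2)] by blast
qed

end
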